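(* Let $K$ be an algebraically closed field, let $A$ be a twisted generalized Weyl construction with data $(R,\boldsymbol{\sigma},\boldsymbol{t},\boldsymbol{\mu})$ over $K$, and let $\mathfrak{m}$ be a maximal ideal of $R$ such that the inclusion $K\hookrightarrow R/\mathfrak{m}$ is onto. Let $k=\mathrm{rank}\,G_\mathfrak{m}$, let $s_1,\ldots,s_k$ be a $\mathbb{Z}$-basis of $G_\mathfrak{m}$, let $b_i=\varphi_\mathfrak{m}(a_{s_i})$, and let $\lambda_{ij}\in K^*$ be the scalars with $b_ib_j=\lambda_{ij}b_jb_i$ for $1\le i,j\le k$. If all the $\lambda_{ij}$ are roots of unity, then there is a root of unity $\lambda$, an integer $r$ with $0\le r\le\lfloor k/2\rfloor$ and positive integers $p_i$, $i=1,\ldots,r$, with $1=p_1\,|\,p_2\,|\cdots|\,p_r$ such that $$B_\mathfrak{m}^{(1)}\simeq T_{\lambda^{p_1}}\otimes T_{\lambda^{p_2}}\otimes\cdots\otimes T_{\lambda^{p_r}}\otimes L$$ as $K$-algebras, where $L$ is a Laurent polynomial algebra over $K$ in $k-2r$ variables.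
   Context: Twisted generalized Weyl construction (TGWC). Let $n\ge 1$, $K$ a field, $R$ a commutative unital $K$-algebra, $\boldsymbol{\sigma}=(\sigma_1,\ldots,\sigma_n)$ pairwise commuting $K$-automorphisms of $R$, $\boldsymbol{\mu}=(\mu_{ij})_{1\le i,j\le n}$ a matrix with entries in $K^*=K\setminus\{0\}$, $\boldsymbol{t}=(t_1,\ldots,t_n)$ nonzero elements of $R$. The TGWC $A$ is the unital $K$-algebra generated over $R$ by $X_i,Y_i$ ($1\le i\le n$) with relations $X_ir=\sigma_i(r)X_i$, $Y_ir=\sigma_i^{-1}(r)Y_i$ ($r\in R$), $Y_iX_i=t_i$, $X_iY_i=\sigma_i(t_i)$, and $X_iY_j=\mu_{ij}Y_jX_i$ for $i\ne j$. It is $\mathbb{Z}^n$-graded, $A=\bigoplus_g A_g$, by $\deg X_i=e_i$, $\deg Y_i=-e_i$, $\deg r=0$ for $r\in R$. $R$ is identified with $A_0$ (so the canonical map $R\to A$ is taken to be injective). Action. $g\in\mathbb{Z}^n$ acts on $R$ by $g(r)=\sigma_1^{g_1}\cdots\sigma_n^{g_n}(r)$ and on maximal ideals by $g(\mathfrak{m})=\{g(r)\mid r\in\mathfrak{m}\}$. For $\omega$ the orbit of $\mathfrak{m}$, $\mathbb{Z}^n_\omega=\{g\in\mathbb{Z}^n\mid g(\mathfrak{m})=\mathfrak{m}\}$. Words. A word is an element $a=Z_1\cdots Z_k$ ($k\ge0$, the empty word being $1$) with each $Z_j\in\{X_i,Y_i\}_i$, together with this representation; $X_i^*=Y_i$,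 $Y_i^*=X_i$, $a^*=Z_k^*\cdots Z_1^*$; then $a^*a\in R$. Subalgebra. $B(\omega)=\bigoplus_{g\in\mathbb{Z}^n_\omega}A_g$; $B_\mathfrak{m}=B(\omega)/(\mathfrak{m})$, where $(\mathfrak{m})$ is the two-sided ideal of $B(\omega)$ generated by $\mathfrak{m}$; $\varphi_\mathfrak{m}:B(\omega)\to B_\mathfrak{m}$ is the projection. Put $\tilde G_\mathfrak{m}=\{g\in\mathbb{Z}^n\mid a^*a\notin\mathfrak{m}\text{ for some word }a\in A_g\}$ and $G_\mathfrak{m}=\tilde G_\mathfrak{m}\cap\mathbb{Z}^n_\omega$, which is a subgroup of $\mathbb{Z}^n$, hence free abelian of finite rank. For each $g\in\tilde G_\mathfrak{m}$ a word $a_g\in A_g$ with $a_g^*a_g\notin\mathfrak{m}$ is fixed, with $a_0=1$. $B_\mathfrak{m}^{(1)}=\bigoplus_{g\in G_\mathfrak{m}}\varphi_\mathfrak{m}(A_g)$. Under the hypotheses, the elements $b_i$ are invertible in $B_\mathfrak{m}^{(1)}$ and $b_ib_j=\lambda_{ij}b_jb_i$ for uniquely determined $\lambda_{ij}\in K^*$. Noncommutative torus. For $\lambda\in K^*$, $T_\lambda$ denotes the $K$-algebra with two invertible generators $a,b$ satisfying $ab=\lambda ba$. Tensor products are over $K$. If $r=0$ there are no factors $T$ and no integers $p_i$. *)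

theory Defs
  imports "HOL-Algebra.Algebra" "HOL-Algebra.Product_Groups"
begin

section \<open>Algebras over a field, not necessarily commutative\<close>

text \<open>
  The locale \<open>algebra\<close> of the library is for commutative algebras. A general \<open>K\<close>-algebra is
  here a ring that carries a scalar multiplication, i.e. a record of type \<open>('k, 'a) module\<close>.
\<close>

definition alg_iso :: "('k, 'x) ring_scheme \<Rightarrow> ('k, 'a, 'y) module_scheme \<Rightarrow>
    ('k, 'b, 'z) module_scheme \<Rightarrow> ('a \<Rightarrow> 'b) set"
  where "alg_iso K A B = {f \<in> ring_iso A B.
           \<forall>c \<in> carrier K. \<forall>x \<in> carrier A. f (c \<odot>\<^bsub>A\<^esub> x) = c \<odot>\<^bsub>B\<^esub> f x}"

definition alg_isomorphic :: "('k, 'x) ring_scheme \<Rightarrow> ('k, 'a, 'y) module_scheme \<Rightarrow>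
    ('k, 'b, 'z) module_scheme \<Rightarrow> bool"
  where "alg_isomorphic K A B \<longleftrightarrow> alg_iso K A B \<noteq> {}"

definition quot_alg :: "('k, 'a, 'x) module_scheme \<Rightarrow> 'a set \<Rightarrow> ('k, 'a set) module"
  where "quot_alg A I =
    \<lparr>carrier = carrier (A Quot I), monoid.mult = monoid.mult (A Quot I), one = one (A Quot I),
     ring.zero = ring.zero (A Quot I), ring.add = ring.add (A Quot I),
     smult = (\<lambda>c C. \<Union>x\<in>C. I +>\<^bsub>A\<^esub> (c \<odot>\<^bsub>A\<^esub> x))\<rparr>"

text \<open>The two-sided ideal generated by relations \<open>u = v\<close>.\<close>

definition rel_ideal :: "('a, 'x) ring_scheme \<Rightarrow> ('a \<times> 'a) set \<Rightarrow> 'a set"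
  where "rel_ideal A rels = genideal A {u \<ominus>\<^bsub>A\<^esub> v | u v. (u, v) \<in> rels}"

text \<open>The sum of a family of additive subgroups (or subsets) \<open>S g\<close>, \<open>g \<in> G\<close>, of a ring.\<close>

definition sum_of :: "('a, 'x) ring_scheme \<Rightarrow> 'g set \<Rightarrow> ('g \<Rightarrow> 'a set) \<Rightarrow> 'a set"
  where "sum_of A G S = generate (add_monoid A) (\<Union>g\<in>G. S g)"

text \<open>
  The monoid algebra \<open>K[M]\<close>: the free \<open>K\<close>-module on \<open>M\<close>, realized by finitely supported
  functions, with the multiplication extended bilinearly from \<open>M\<close>.
\<close>

definition monoid_alg :: "('k, 'x) ring_scheme \<Rightarrow> ('m, 'y) monoid_scheme \<Rightarrow> ('k, 'm \<Rightarrow> 'k) module"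
  where "monoid_alg K M =
    \<lparr>carrier = {f. (\<forall>x. f x \<in> carrier K) \<and> (\<forall>x. x \<notin> carrier M \<longrightarrow> f x = \<zero>\<^bsub>K\<^esub>) \<and>
                   finite {x. f x \<noteq> \<zero>\<^bsub>K\<^esub>}},
     monoid.mult = (\<lambda>f h x. finsum K (\<lambda>(u, v). f u \<otimes>\<^bsub>K\<^esub> h v)
               {(u, v). f u \<noteq> \<zero>\<^bsub>K\<^esub> \<and> h v \<noteq> \<zero>\<^bsub>K\<^esub> \<and> u \<otimes>\<^bsub>M\<^esub> v = x}),
     one = (\<lambda>x. if x = \<one>\<^bsub>M\<^esub> then \<one>\<^bsub>K\<^esub> else \<zero>\<^bsub>K\<^esub>),
     ring.zero = (\<lambda>x. \<zero>\<^bsub>K\<^esub>),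
     ring.add = (\<lambda>f h x. f x \<oplus>\<^bsub>K\<^esub> h x),
     smult = (\<lambda>c f x. c \<otimes>\<^bsub>K\<^esub> f x)\<rparr>"

definition basis_elt :: "('k, 'x) ring_scheme \<Rightarrow> 'm \<Rightarrow> 'm \<Rightarrow> 'k"
  where "basis_elt K x = (\<lambda>y. if y = x then \<one>\<^bsub>K\<^esub> else \<zero>\<^bsub>K\<^esub>)"

definition free_monoid :: "'g set \<Rightarrow> 'g list monoid"
  where "free_monoid S = \<lparr>carrier = lists S, monoid.mult = (@), one = []\<rparr>"

abbreviation free_alg :: "('k, 'x) ring_scheme \<Rightarrow> 'g set \<Rightarrow> ('k, 'g list \<Rightarrow> 'k) module"
  where "free_alg K S \<equiv> monoid_alg K (free_monoid S)"

abbreviation var :: "('k, 'x) ring_scheme \<Rightarrow> 'g \<Rightarrow> 'g list \<Rightarrow> 'k"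
  where "var K z \<equiv> basis_elt K [z]"

text \<open>
  The tensor product over \<open>K\<close> of a family of \<open>K\<close>-algebras: the free module on the product of
  the carriers modulo the multilinearity relations, with componentwise multiplication of pure
  tensors. The multilinearity relations are stable under multiplication by pure tensors, so the
  ideal they generate is the submodule they generate.
\<close>

definition tensor_alg :: "('k, 'x) ring_scheme \<Rightarrow> 'i set \<Rightarrow> ('i \<Rightarrow> ('k, 'a) module) \<Rightarrow>
    ('k, (('i \<Rightarrow> 'a) \<Rightarrow> 'k) set) module"
  where "tensor_alg K I F =
    (let P = monoid_alg K (product_group I F); e = basis_elt K;
         rels =
           {(e (x(i := u \<oplus>\<^bsub>F i\<^esub> v)), e (x(i := u)) \<oplus>\<^bsub>P\<^esub> e (x(i := v))) | x i u v.
             x \<in> (\<Pi>\<^sub>E j\<in>I. carrier (F j)) \<and> i \<in> I \<and> u \<in> carrier (F i) \<and> v \<in> carrier (F i)} \<union>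
           {(e (x(i := c \<odot>\<^bsub>F i\<^esub> u)), c \<odot>\<^bsub>P\<^esub> e (x(i := u))) | x i c u.
             x \<in> (\<Pi>\<^sub>E j\<in>I. carrier (F j)) \<and> i \<in> I \<and> c \<in> carrier K \<and> u \<in> carrier (F i)}
     in quot_alg P (rel_ideal P rels))"


section \<open>Noncommutative tori and Laurent polynomial algebras\<close>

datatype torus_gen = Pos nat | Neg nat

text \<open>
  The \<open>K\<close>-algebra with invertible generators \<open>x\<^sub>1, \<dots>, x\<^sub>m\<close> (\<open>Pos i\<close> is \<open>x\<^sub>i\<close> and \<open>Neg i\<close> its
  inverse) satisfying \<open>x\<^sub>i x\<^sub>j = q x\<^sub>j x\<^sub>i\<close> for \<open>i < j\<close>.
\<close>

definition torus_alg ::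
    "('k, 'x) ring_scheme \<Rightarrow> nat \<Rightarrow> 'k \<Rightarrow> ('k, (torus_gen list \<Rightarrow> 'k) set) module"
  where "torus_alg K m q =
    (let F = free_alg K (Pos ` {1..m} \<union> Neg ` {1..m});
         rels =
           {(var K (Pos i) \<otimes>\<^bsub>F\<^esub> var K (Neg i), \<one>\<^bsub>F\<^esub>) | i. i \<in> {1..m}} \<union>
           {(var K (Neg i) \<otimes>\<^bsub>F\<^esub> var K (Pos i), \<one>\<^bsub>F\<^esub>) | i. i \<in> {1..m}} \<union>
           {(var K (Pos i) \<otimes>\<^bsub>F\<^esub> var K (Pos j), q \<odot>\<^bsub>F\<^esub> (var K (Pos j) \<otimes>\<^bsub>F\<^esub> var K (Pos i))) | i j.
             i \<in> {1..m} \<and> j \<in> {1..m} \<and> i < j}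
     in quot_alg F (rel_ideal F rels))"

definition T_alg :: "('k, 'x) ring_scheme \<Rightarrow> 'k \<Rightarrow> ('k, (torus_gen list \<Rightarrow> 'k) set) module"
  where "T_alg K q = torus_alg K 2 q"

definition laurent_alg :: "('k, 'x) ring_scheme \<Rightarrow> nat \<Rightarrow> ('k, (torus_gen list \<Rightarrow> 'k) set) module"
  where "laurent_alg K m = torus_alg K m \<one>\<^bsub>K\<^esub>"

definition root_of_unity :: "('k, 'x) ring_scheme \<Rightarrow> 'k \<Rightarrow> bool"
  where "root_of_unity K z \<longleftrightarrow> z \<in> carrier K \<and> (\<exists>N::nat. N > 0 \<and> z [^]\<^bsub>K\<^esub> N = \<one>\<^bsub>K\<^esub>)"


section \<open>Twisted generalized Weyl constructions\<close>

text \<open>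
  The data \<open>K\<close>, \<open>R\<close>, \<open>n\<close>, \<open>\<sigma>\<close> (\<open>aut\<close>), \<open>t\<close> (\<open>elt\<close>), \<open>\<mu>\<close> (\<open>par\<close>). Families are indexed by \<open>{1..n}\<close>.
\<close>

record ('k, 'r) tgw_data =
  ground :: "'k ring"
  base :: "('k, 'r) module"
  nvars :: nat
  aut :: "nat \<Rightarrow> 'r \<Rightarrow> 'r"
  elt :: "nat \<Rightarrow> 'r"
  par :: "nat \<Rightarrow> nat \<Rightarrow> 'k"

definition is_tgw_data :: "('k, 'r) tgw_data \<Rightarrow> bool"
  where "is_tgw_data D \<longleftrightarrow>
    field (ground D) \<and> algebra (ground D) (base D) \<and> nvars D \<ge> 1 \<and>
    (\<forall>i \<in> {1..nvars D}. aut D i \<in> alg_iso (ground D) (base D) (base D)) \<and>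
    (\<forall>i \<in> {1..nvars D}. \<forall>j \<in> {1..nvars D}. \<forall>r \<in> carrier (base D).
       aut D i (aut D j r) = aut D j (aut D i r)) \<and>
    (\<forall>i \<in> {1..nvars D}. elt D i \<in> carrier (base D) - {\<zero>\<^bsub>base D\<^esub>}) \<and>
    (\<forall>i \<in> {1..nvars D}. \<forall>j \<in> {1..nvars D}. par D i j \<in> carrier (ground D) - {\<zero>\<^bsub>ground D\<^esub>})"

abbreviation aut_inv :: "('k, 'r) tgw_data \<Rightarrow> nat \<Rightarrow> 'r \<Rightarrow> 'r"
  where "aut_inv D i \<equiv> inv_into (carrier (base D)) (aut D i)"

datatype letter = LX nat | LY nat

fun star_letter :: "letter \<Rightarrow> letter" where
  "star_letter (LX i) = LY i"
| "star_letter (LY i) = LX i"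

definition letters :: "nat \<Rightarrow> letter set"
  where "letters n = LX ` {1..n} \<union> LY ` {1..n}"

datatype 'r tgw_gen = Coef 'r | Letter letter

definition tgw_free :: "('k, 'r) tgw_data \<Rightarrow> ('k, 'r tgw_gen list \<Rightarrow> 'k) module"
  where "tgw_free D = free_alg (ground D) (Coef ` carrier (base D) \<union> Letter ` letters (nvars D))"

text \<open>
  The first four families of relations say that \<open>Coef\<close> is a homomorphism of unital \<open>K\<close>-algebras,
  so that the algebra presented is generated over \<open>R\<close> by the letters.
\<close>

definition tgw_rels ::
    "('k, 'r) tgw_data \<Rightarrow> (('r tgw_gen list \<Rightarrow> 'k) \<times> ('r tgw_gen list \<Rightarrow> 'k)) set"
  where "tgw_rels D =
    (let K = ground D; R = base D; F = tgw_free D;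
         c = (\<lambda>r. var K (Coef r)); x = (\<lambda>i. var K (Letter (LX i))); y = (\<lambda>i. var K (Letter (LY i)))
     in
       {(c (r \<oplus>\<^bsub>R\<^esub> r'), c r \<oplus>\<^bsub>F\<^esub> c r') | r r'. r \<in> carrier R \<and> r' \<in> carrier R} \<union>
       {(c (r \<otimes>\<^bsub>R\<^esub> r'), c r \<otimes>\<^bsub>F\<^esub> c r') | r r'. r \<in> carrier R \<and> r' \<in> carrier R} \<union>
       {(c (a \<odot>\<^bsub>R\<^esub> r), a \<odot>\<^bsub>F\<^esub> c r) | a r. a \<in> carrier K \<and> r \<in> carrier R} \<union>
       {(c \<one>\<^bsub>R\<^esub>, \<one>\<^bsub>F\<^esub>)} \<union>
       {(x i \<otimes>\<^bsub>F\<^esub> c r, c (aut D i r) \<otimes>\<^bsub>F\<^esub> x i) | i r. i \<in> {1..nvars D} \<and> r \<in> carrier R} \<union>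
       {(y i \<otimes>\<^bsub>F\<^esub> c r, c (aut_inv D i r) \<otimes>\<^bsub>F\<^esub> y i) | i r. i \<in> {1..nvars D} \<and> r \<in> carrier R} \<union>
       {(y i \<otimes>\<^bsub>F\<^esub> x i, c (elt D i)) | i. i \<in> {1..nvars D}} \<union>
       {(x i \<otimes>\<^bsub>F\<^esub> y i, c (aut D i (elt D i))) | i. i \<in> {1..nvars D}} \<union>
       {(x i \<otimes>\<^bsub>F\<^esub> y j, par D i j \<odot>\<^bsub>F\<^esub> (y j \<otimes>\<^bsub>F\<^esub> x i)) | i j.
         i \<in> {1..nvars D} \<and> j \<in> {1..nvars D} \<and> i \<noteq> j})"

definition tgw_ideal :: "('k, 'r) tgw_data \<Rightarrow> ('r tgw_gen list \<Rightarrow> 'k) set"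
  where "tgw_ideal D = rel_ideal (tgw_free D) (tgw_rels D)"

definition tgwc :: "('k, 'r) tgw_data \<Rightarrow> ('k, ('r tgw_gen list \<Rightarrow> 'k) set) module"
  where "tgwc D = quot_alg (tgw_free D) (tgw_ideal D)"

definition tgw_class ::
    "('k, 'r) tgw_data \<Rightarrow> ('r tgw_gen list \<Rightarrow> 'k) \<Rightarrow> ('r tgw_gen list \<Rightarrow> 'k) set"
  where "tgw_class D f = tgw_ideal D +>\<^bsub>tgw_free D\<^esub> f"

text \<open>The canonical map from \<open>R\<close>; the identification of \<open>R\<close> with \<open>A\<^sub>0\<close> presupposes that it is injective.\<close>

definition coef_map :: "('k, 'r) tgw_data \<Rightarrow> 'r \<Rightarrow> ('r tgw_gen list \<Rightarrow> 'k) set"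
  where "coef_map D r = tgw_class D (var (ground D) (Coef r))"

text \<open>
  Elements of \<open>\<int>\<^sup>n\<close> are integer functions on \<open>\<nat>\<close> that vanish outside \<open>{1..n}\<close>. A component
  \<open>A\<^sub>g\<close> is the image of the span of the monomials of degree \<open>g\<close> in the free algebra.
\<close>

definition Zn :: "nat \<Rightarrow> (nat \<Rightarrow> int) set"
  where "Zn n = {g. \<forall>i. i \<notin> {1..n} \<longrightarrow> g i = 0}"

fun gen_degree :: "'r tgw_gen \<Rightarrow> nat \<Rightarrow> int" where
  "gen_degree (Coef r) i = 0"
| "gen_degree (Letter (LX j)) i = (if i = j then 1 else 0)"
| "gen_degree (Letter (LY j)) i = (if i = j then -1 else 0)"

definition mon_degree :: "'r tgw_gen list \<Rightarrow> nat \<Rightarrow> int"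
  where "mon_degree w = (\<lambda>i. \<Sum>z\<leftarrow>w. gen_degree z i)"

definition component :: "('k, 'r) tgw_data \<Rightarrow> (nat \<Rightarrow> int) \<Rightarrow> ('r tgw_gen list \<Rightarrow> 'k) set set"
  where "component D g = tgw_class D `
    {f \<in> carrier (tgw_free D). \<forall>w. f w \<noteq> \<zero>\<^bsub>ground D\<^esub> \<longrightarrow> mon_degree w = g}"

definition words :: "('k, 'r) tgw_data \<Rightarrow> letter list set"
  where "words D = lists (letters (nvars D))"

definition star :: "letter list \<Rightarrow> letter list"
  where "star w = rev (map star_letter w)"

definition word_elt :: "('k, 'r) tgw_data \<Rightarrow> letter list \<Rightarrow> ('r tgw_gen list \<Rightarrow> 'k) set"
  where "word_elt D w =
    foldr (\<lambda>z b. tgw_class D (var (ground D) (Letter z)) \<otimes>\<^bsub>tgwc D\<^esub> b) w \<one>\<^bsub>tgwc D\<^esub>"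

text \<open>\<open>a\<^sup>*a \<notin> \<mm>\<close>, where \<open>R\<close> is identified with its image in the construction.\<close>

definition nonvanishing :: "('k, 'r) tgw_data \<Rightarrow> 'r set \<Rightarrow> letter list \<Rightarrow> bool"
  where "nonvanishing D \<mm> w \<longleftrightarrow>
    word_elt D (star w) \<otimes>\<^bsub>tgwc D\<^esub> word_elt D w \<notin> coef_map D ` \<mm>"


section \<open>The subalgebra attached to a maximal ideal\<close>

definition aut_pow :: "('k, 'r) tgw_data \<Rightarrow> nat \<Rightarrow> int \<Rightarrow> 'r \<Rightarrow> 'r"
  where "aut_pow D i z = (if 0 \<le> z then aut D i ^^ nat z else aut_inv D i ^^ nat (- z))"

definition act :: "('k, 'r) tgw_data \<Rightarrow> (nat \<Rightarrow> int) \<Rightarrow> 'r \<Rightarrow> 'r"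
  where "act D g r = foldr (\<lambda>i. aut_pow D i (g i)) [1..<Suc (nvars D)] r"

text \<open>
  \<open>\<int>\<^sup>n\<^sub>\<omega>\<close> for the orbit \<open>\<omega>\<close> of \<open>\<mm>\<close>; since \<open>\<int>\<^sup>n\<close> is abelian it depends on the orbit only.
\<close>

definition stab :: "('k, 'r) tgw_data \<Rightarrow> 'r set \<Rightarrow> (nat \<Rightarrow> int) set"
  where "stab D \<mm> = {g \<in> Zn (nvars D). act D g ` \<mm> = \<mm>}"

definition G_tilde :: "('k, 'r) tgw_data \<Rightarrow> 'r set \<Rightarrow> (nat \<Rightarrow> int) set"
  where "G_tilde D \<mm> =
    {g \<in> Zn (nvars D). \<exists>w \<in> words D. word_elt D w \<in> component D g \<and> nonvanishing D \<mm> w}"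

definition G_grp :: "('k, 'r) tgw_data \<Rightarrow> 'r set \<Rightarrow> (nat \<Rightarrow> int) set"
  where "G_grp D \<mm> = G_tilde D \<mm> \<inter> stab D \<mm>"

definition B_omega :: "('k, 'r) tgw_data \<Rightarrow> 'r set \<Rightarrow> ('k, ('r tgw_gen list \<Rightarrow> 'k) set) module"
  where "B_omega D \<mm> = (tgwc D)\<lparr>carrier := sum_of (tgwc D) (stab D \<mm>) (component D)\<rparr>"

definition B_ideal :: "('k, 'r) tgw_data \<Rightarrow> 'r set \<Rightarrow> ('r tgw_gen list \<Rightarrow> 'k) set set"
  where "B_ideal D \<mm> = genideal (B_omega D \<mm>) (coef_map D ` \<mm>)"

definition B_alg :: "('k, 'r) tgw_data \<Rightarrow> 'r set \<Rightarrow> ('k, ('r tgw_gen list \<Rightarrow> 'k) set set) module"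
  where "B_alg D \<mm> = quot_alg (B_omega D \<mm>) (B_ideal D \<mm>)"

definition B_proj :: "('k, 'r) tgw_data \<Rightarrow> 'r set \<Rightarrow> ('r tgw_gen list \<Rightarrow> 'k) set \<Rightarrow>
    ('r tgw_gen list \<Rightarrow> 'k) set set"
  where "B_proj D \<mm> x = B_ideal D \<mm> +>\<^bsub>B_omega D \<mm>\<^esub> x"

definition B1_alg :: "('k, 'r) tgw_data \<Rightarrow> 'r set \<Rightarrow> ('k, ('r tgw_gen list \<Rightarrow> 'k) set set) module"
  where "B1_alg D \<mm> = (B_alg D \<mm>)
    \<lparr>carrier := sum_of (B_alg D \<mm>) (G_grp D \<mm>) (\<lambda>g. B_proj D \<mm> ` component D g)\<rparr>"

text \<open>
  \<open>s 1, \<dots>, s k\<close> is a \<open>\<int>\<close>-basis of \<open>G\<close>: every element of \<open>G\<close> is an integer combination of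
  the \<open>s j\<close> in exactly one way, and all such combinations lie in \<open>G\<close>. In particular, \<open>G\<close> is then
  free abelian of rank \<open>k\<close>.
\<close>

definition Z_basis :: "nat \<Rightarrow> (nat \<Rightarrow> nat \<Rightarrow> int) \<Rightarrow> (nat \<Rightarrow> int) set \<Rightarrow> bool"
  where "Z_basis k s G \<longleftrightarrow> bij_betw (\<lambda>c i. \<Sum>j = 1..k. c j * s j i) (Zn k) G"

end

theory Submission
  imports Defs
begin

text \<open>
  Write \<open>G\<close> for the group \<open>G_grp D \<mm>\<close> and \<open>V g\<close> for the image of the chosen word \<open>a g\<close> in \<open>B1_alg D \<mm>\<close>. The
  theorem holds because \<open>B1_alg D \<mm>\<close> is a group algebra of the lattice \<open>G\<close>, twisted by a cocycle: the
  elements \<open>V g\<close> with \<open>g \<in> G\<close> form a basis of it, and \<open>V g \<cdot> V h\<close> is a nonzero multiple of \<open>V (g + h)\<close>.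

  Let \<open>u\<close> be the value of \<open>a g\<close> and \<open>v\<close> that of the reversed word, so that \<open>v u \<notin> \<mm>\<close>. The degree zero component
  of the construction is \<open>R\<close>, since letters \<open>X\<close> and \<open>Y\<close> can be brought into normal order and then cancel
  (\<open>component_zero\<close>). For \<open>x\<close> of degree \<open>g\<close> both \<open>x v\<close> and \<open>v u\<close> therefore lie in \<open>R\<close>, they are scalars modulo
  \<open>\<mm>\<close>, and as \<open>g\<close> stabilizes \<open>\<mm>\<close>, the equation \<open>(x v) u = x (v u)\<close> shows that \<open>x\<close> is a
  multiple of \<open>u\<close> modulo \<open>\<mm>\<close>. This gives the spanning property and, up to a scalar that could vanish, the
  product rule. That nothing vanishes or becomes dependent is seen from the largest graded ideal with degree zero part in \<open>\<mm>\<close>, which contains the ideal generated by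
  \<open>\<mm>\<close>. The lemmas \<open>kspan_V\<close>, \<open>V_mult\<close> and \<open>V_independent\<close> of the locale \<open>weight_basis\<close> state the result.

  The commutation factor \<open>\<kappa>\<close>, given by \<open>V g \<cdot> V h = \<kappa> g h \<cdot> V h \<cdot> V g\<close>, is multiplicative in both arguments, and \<open>\<kappa> g g = 1\<close>.
  Its values on the given basis are roots of unity, hence powers of one root of unity \<open>z\<close>
  (\<open>root_of_unity_common\<close>), and the exponents define an alternating integral form on \<open>\<int>\<^sup>k\<close>. In a suitable
  basis this form consists of two by two blocks with entries \<open>d\<^sub>1 | d\<^sub>2 | \<dots> | d\<^sub>r\<close> and of zeros (\<open>normal_form\<close>). The
  root of unity and the exponents of the theorem are \<open>z\<close> to the power \<open>d\<^sub>1\<close> and the quotients \<open>d\<^sub>i / d\<^sub>1\<close>.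

  In the new basis every block generates a torus, different blocks commute, and the other basis
  vectors generate commuting invertible elements. The universal properties of tori and tensor products
  give a homomorphism from the tensor product, and it is bijective because it maps a spanning set of
  monomials to nonzero multiples of the elements of a basis (\<open>torus_tensor_iso\<close>).
\<close>

section \<open>Algebras over a field and monoid algebras\<close>

text \<open>Unital associative \<open>K\<close>-algebras, not necessarily commutative: a ring that is a \<open>K\<close>-module with a
  bilinear product. The primed axioms are found without prime among the facts of the locale \<open>module\<close>.\<close>

locale kalg = K?: field K + A?: ring A
  for K :: "('k, 'x) ring_scheme" (structure) and A :: "('k, 'a, 'y) module_scheme" (structure) +
  assumes smult_closed' [simp, intro]:
      "\<lbrakk>c \<in> carrier K; x \<in> carrier A\<rbrakk> \<Longrightarrow> c \<odot>\<^bsub>A\<^esub> x \<in> carrier A"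
    and smult_l_distr':
      "\<lbrakk>c \<in> carrier K; d \<in> carrier K; x \<in> carrier A\<rbrakk> \<Longrightarrow>
          (c \<oplus> d) \<odot>\<^bsub>A\<^esub> x = c \<odot>\<^bsub>A\<^esub> x \<oplus>\<^bsub>A\<^esub> d \<odot>\<^bsub>A\<^esub> x"
    and smult_r_distr':
      "\<lbrakk>c \<in> carrier K; x \<in> carrier A; y \<in> carrier A\<rbrakk> \<Longrightarrow>
          c \<odot>\<^bsub>A\<^esub> (x \<oplus>\<^bsub>A\<^esub> y) = c \<odot>\<^bsub>A\<^esub> x \<oplus>\<^bsub>A\<^esub> c \<odot>\<^bsub>A\<^esub> y"
    and smult_assoc':
      "\<lbrakk>c \<in> carrier K; d \<in> carrier K; x \<in> carrier A\<rbrakk> \<Longrightarrow>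
          (c \<otimes> d) \<odot>\<^bsub>A\<^esub> x = c \<odot>\<^bsub>A\<^esub> (d \<odot>\<^bsub>A\<^esub> x)"
    and smult_one' [simp]: "x \<in> carrier A \<Longrightarrow> \<one> \<odot>\<^bsub>A\<^esub> x = x"
    and smult_mult_left:
      "\<lbrakk>c \<in> carrier K; x \<in> carrier A; y \<in> carrier A\<rbrakk> \<Longrightarrow> (c \<odot>\<^bsub>A\<^esub> x) \<otimes>\<^bsub>A\<^esub> y = c \<odot>\<^bsub>A\<^esub> (x \<otimes>\<^bsub>A\<^esub> y)"
    and smult_mult_right:
      "\<lbrakk>c \<in> carrier K; x \<in> carrier A; y \<in> carrier A\<rbrakk> \<Longrightarrow> x \<otimes>\<^bsub>A\<^esub> (c \<odot>\<^bsub>A\<^esub> y) = c \<odot>\<^bsub>A\<^esub> (x \<otimes>\<^bsub>A\<^esub> y)"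

sublocale kalg \<subseteq> module K A
  by (intro module.intro module_axioms.intro K.cring_axioms A.abelian_group_axioms)
    (auto simp: smult_l_distr' smult_r_distr' smult_assoc')

lemmas kalgI = kalg.intro[OF _ _ kalg_axioms.intro]

text \<open>Homomorphisms of unital \<open>K\<close>-algebras, as functions that matter on the carrier only.\<close>

definition alg_hom :: "('k, 'x) ring_scheme \<Rightarrow> ('k, 'a, 'y) module_scheme \<Rightarrow>
    ('k, 'b, 'z) module_scheme \<Rightarrow> ('a \<Rightarrow> 'b) set"
  where "alg_hom K A B = {f \<in> ring_hom A B.
           \<forall>c \<in> carrier K. \<forall>x \<in> carrier A. f (c \<odot>\<^bsub>A\<^esub> x) = c \<odot>\<^bsub>B\<^esub> f x}"

lemma alg_homD:
  assumes "f \<in> alg_hom K A B"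
  shows "x \<in> carrier A \<Longrightarrow> f x \<in> carrier B"
    and "x \<in> carrier A \<Longrightarrow> y \<in> carrier A \<Longrightarrow> f (x \<otimes>\<^bsub>A\<^esub> y) = f x \<otimes>\<^bsub>B\<^esub> f y"
    and "x \<in> carrier A \<Longrightarrow> y \<in> carrier A \<Longrightarrow> f (x \<oplus>\<^bsub>A\<^esub> y) = f x \<oplus>\<^bsub>B\<^esub> f y"
    and "f \<one>\<^bsub>A\<^esub> = \<one>\<^bsub>B\<^esub>"
    and "c \<in> carrier K \<Longrightarrow> x \<in> carrier A \<Longrightarrow> f (c \<odot>\<^bsub>A\<^esub> x) = c \<odot>\<^bsub>B\<^esub> f x"
  using assms by (auto simp: alg_hom_def ring_hom_def)

lemma alg_hom_zero:
  assumes "f \<in> alg_hom K A B" "ring A" "ring B"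
  shows "f \<zero>\<^bsub>A\<^esub> = \<zero>\<^bsub>B\<^esub>"
  using assms by (auto simp: alg_hom_def intro: ring_hom_zero)

subsection \<open>Finitely supported functions and linear combinations\<close>

text \<open>Finitely supported functions on \<open>S\<close>, extended by zero outside of \<open>S\<close>.\<close>

definition fs :: "('k, 'x) ring_scheme \<Rightarrow> 'm set \<Rightarrow> ('m \<Rightarrow> 'k) set"
  where "fs K S = {f. (\<forall>x. f x \<in> carrier K) \<and> (\<forall>x. x \<notin> S \<longrightarrow> f x = \<zero>\<^bsub>K\<^esub>) \<and> finite {x. f x \<noteq> \<zero>\<^bsub>K\<^esub>}}"

text \<open>The function with the value \<open>c\<close> at \<open>x\<close> and zero elsewhere.\<close>

definition single :: "('k, 'x) ring_scheme \<Rightarrow> 'm \<Rightarrow> 'k \<Rightarrow> 'm \<Rightarrow> 'k"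
  where "single K x c = (\<lambda>y. if y = x then c else \<zero>\<^bsub>K\<^esub>)"

text \<open>The linear combination of the elements \<open>h x\<close> with the coefficients \<open>f x\<close>.\<close>

definition lin :: "('k, 'x) ring_scheme \<Rightarrow> ('k, 'a, 'y) module_scheme \<Rightarrow> ('m \<Rightarrow> 'a) \<Rightarrow> ('m \<Rightarrow> 'k) \<Rightarrow> 'a"
  where "lin K A h f = finsum A (\<lambda>x. f x \<odot>\<^bsub>A\<^esub> h x) {x. f x \<noteq> \<zero>\<^bsub>K\<^esub>}"

lemma basis_elt_single: "basis_elt K x = single K x \<one>\<^bsub>K\<^esub>"
  by (simp add: basis_elt_def single_def)

context field begin

lemma fsD: "f \<in> fs R S \<Longrightarrow> f x \<in> carrier R" "f \<in> fs R S \<Longrightarrow> finite {x. f x \<noteq> \<zero>}"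
  "f \<in> fs R S \<Longrightarrow> {x. f x \<noteq> \<zero>} \<subseteq> S"
  by (auto simp: fs_def)

lemma fs_zero: "(\<lambda>_. \<zero>) \<in> fs R S" by (simp add: fs_def)

lemma fs_single: "x \<in> S \<Longrightarrow> c \<in> carrier R \<Longrightarrow> single R x c \<in> fs R S"
  by (auto simp: fs_def single_def)

lemma fs_add: "f \<in> fs R S \<Longrightarrow> g \<in> fs R S \<Longrightarrow> (\<lambda>x. f x \<oplus> g x) \<in> fs R S"
proof -
  assume *: "f \<in> fs R S" "g \<in> fs R S"
  have "{x. f x \<oplus> g x \<noteq> \<zero>} \<subseteq> {x. f x \<noteq> \<zero>} \<union> {x. g x \<noteq> \<zero>}" by auto
  then have "finite {x. f x \<oplus> g x \<noteq> \<zero>}"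
    using * by (auto simp: fs_def intro: finite_subset)
  with * show ?thesis by (auto simp: fs_def)
qed

lemma fs_smult: "f \<in> fs R S \<Longrightarrow> c \<in> carrier R \<Longrightarrow> (\<lambda>x. c \<otimes> f x) \<in> fs R S"
proof -
  assume *: "f \<in> fs R S" "c \<in> carrier R"
  have "{x. c \<otimes> f x \<noteq> \<zero>} \<subseteq> {x. f x \<noteq> \<zero>}" using *(2) by auto
  then have "finite {x. c \<otimes> f x \<noteq> \<zero>}"
    using * by (auto simp: fs_def intro: finite_subset)
  with * show ?thesis by (auto simp: fs_def)
qed

lemma fs_uminus: "f \<in> fs R S \<Longrightarrow> (\<lambda>x. \<ominus> f x) \<in> fs R S"
proof -
  assume *: "f \<in> fs R S"
  have "{x. \<ominus> f x \<noteq> \<zero>} \<subseteq> {x. f x \<noteq> \<zero>}" by auto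
  then have "finite {x. \<ominus> f x \<noteq> \<zero>}"
    using * by (auto simp: fs_def intro: finite_subset)
  with * show ?thesis by (auto simp: fs_def)
qed

lemma fs_induct [consumes 1, case_names zero add]:
  assumes "f \<in> fs R S"
    and "P (\<lambda>_. \<zero>)"
    and "\<And>f x c. \<lbrakk>f \<in> fs R S; P f; x \<in> S; c \<in> carrier R\<rbrakk> \<Longrightarrow> P (\<lambda>y. f y \<oplus> single R x c y)"
  shows "P f"
proof -
  have "finite {x. f x \<noteq> \<zero>}" using assms(1) by (rule fsD)
  then have "f \<in> fs R S \<Longrightarrow> P f"
  proof (induction "{x. f x \<noteq> \<zero>}" arbitrary: f rule: finite_induct)
    case empty
    then have "f = (\<lambda>_. \<zero>)" by auto
    with assms(2) show ?case by simp
  next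
    case (insert x F)
    define g where "g = f(x := \<zero>)"
    have g: "{y. g y \<noteq> \<zero>} = F" using insert.hyps by (auto simp: g_def)
    have "g \<in> fs R S"
      using insert.prems insert.hyps(1) unfolding fs_def g[symmetric] by (auto simp: g_def)
    moreover have "x \<in> S" using insert.hyps insert.prems by (auto simp: fs_def)
    ultimately have "P (\<lambda>y. g y \<oplus> single R x (f x) y)"
      using insert.hyps(3)[of g] g insert.prems by (intro assms(3)) (auto simp: fs_def)
    moreover have "(\<lambda>y. g y \<oplus> single R x (f x) y) = f"
      using insert.prems by (auto simp: g_def single_def fs_def)
    ultimately show ?case by simp
  qed
  with assms(1) show ?thesis by simp
qed

end

context kalg begin

lemma smult_comm:
  "\<lbrakk>c \<in> carrier K; d \<in> carrier K; x \<in> carrier A\<rbrakk> \<Longrightarrow> c \<odot>\<^bsub>A\<^esub> (d \<odot>\<^bsub>A\<^esub> x) = d \<odot>\<^bsub>A\<^esub> (c \<odot>\<^bsub>A\<^esub> x)"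
  using K.m_comm by (simp flip: smult_assoc1)

lemma lin_eq:
  assumes "f \<in> fs K S" "\<And>x. x \<in> S \<Longrightarrow> h x \<in> carrier A" "finite T" "{x. f x \<noteq> \<zero>} \<subseteq> T" "T \<subseteq> S"
  shows "lin K A h f = finsum A (\<lambda>x. f x \<odot>\<^bsub>A\<^esub> h x) T"
  unfolding lin_def
proof (rule A.add.finprod_mono_neutral_cong_left)
  have h: "h x \<in> carrier A" if "x \<in> T" for x using assms that by auto
  show "f i \<odot>\<^bsub>A\<^esub> h i = \<zero>\<^bsub>A\<^esub>" if "i \<in> T - {x. f x \<noteq> \<zero>}" for i
    using that h by auto
  show "(\<lambda>x. f x \<odot>\<^bsub>A\<^esub> h x) \<in> T \<rightarrow> carrier A" using fsD(1)[OF assms(1)] h by auto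
qed (use assms in auto)

lemma lin_closed:
  assumes "f \<in> fs K S" "\<And>x. x \<in> S \<Longrightarrow> h x \<in> carrier A"
  shows "lin K A h f \<in> carrier A"
  unfolding lin_def using assms by (intro A.finsum_closed) (auto simp: fs_def Pi_iff)

lemma lin_zero: "lin K A h (\<lambda>_. \<zero>) = \<zero>\<^bsub>A\<^esub>"
  by (simp add: lin_def)

lemma lin_add:
  assumes "f \<in> fs K S" "g \<in> fs K S" "\<And>x. x \<in> S \<Longrightarrow> h x \<in> carrier A"
  shows "lin K A h (\<lambda>x. f x \<oplus> g x) = lin K A h f \<oplus>\<^bsub>A\<^esub> lin K A h g"
proof -
  define T where "T = {x. f x \<noteq> \<zero>} \<union> {x. g x \<noteq> \<zero>}"
  have T: "finite T" "T \<subseteq> S" "{x. f x \<noteq> \<zero>} \<subseteq> T" "{x. g x \<noteq> \<zero>} \<subseteq> T"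
    "{x. f x \<oplus> g x \<noteq> \<zero>} \<subseteq> T"
    using assms(1,2) by (auto simp: T_def fs_def)
  have h: "h x \<in> carrier A" if "x \<in> T" for x using assms T that by auto
  note f = fsD(1)[OF assms(1)] and g = fsD(1)[OF assms(2)]
  have fh: "(\<lambda>x. f x \<odot>\<^bsub>A\<^esub> h x) \<in> T \<rightarrow> carrier A" "(\<lambda>x. g x \<odot>\<^bsub>A\<^esub> h x) \<in> T \<rightarrow> carrier A"
    using h f g by (intro Pi_I smult_closed; simp)+
  have "finsum A (\<lambda>x. (f x \<oplus> g x) \<odot>\<^bsub>A\<^esub> h x) T =
      finsum A (\<lambda>x. f x \<odot>\<^bsub>A\<^esub> h x \<oplus>\<^bsub>A\<^esub> g x \<odot>\<^bsub>A\<^esub> h x) T"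
    by (rule A.add.finprod_cong') (use h f g in \<open>auto simp: smult_l_distr\<close>)
  also have "\<dots> = finsum A (\<lambda>x. f x \<odot>\<^bsub>A\<^esub> h x) T \<oplus>\<^bsub>A\<^esub> finsum A (\<lambda>x. g x \<odot>\<^bsub>A\<^esub> h x) T"
    by (rule A.finsum_addf) (use fh in auto)
  finally show ?thesis
    using assms T by (simp add: lin_eq[where T = T and S = S] fs_add)
qed

lemma lin_single:
  assumes "x \<in> S" "c \<in> carrier K" "\<And>x. x \<in> S \<Longrightarrow> h x \<in> carrier A"
  shows "lin K A h (single K x c) = c \<odot>\<^bsub>A\<^esub> h x"
proof -
  have "lin K A h (single K x c) = finsum A (\<lambda>y. single K x c y \<odot>\<^bsub>A\<^esub> h y) {x}"
    by (rule lin_eq[where S = S]) (use assms in \<open>auto simp: fs_single\<close>, simp add: single_def split: if_splits)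
  also have "\<dots> = c \<odot>\<^bsub>A\<^esub> h x"
    using assms by (subst A.finsum_insert) (auto simp: single_def)
  finally show ?thesis .
qed

lemma lin_cong:
  assumes "f \<in> fs K S" "\<And>x. x \<in> S \<Longrightarrow> h x = h' x" "\<And>x. x \<in> S \<Longrightarrow> h x \<in> carrier A"
  shows "lin K A h f = lin K A h' f"
proof -
  have "x \<in> S" if "f x \<noteq> \<zero>" for x using fsD(3)[OF assms(1)] that by auto
  then show ?thesis
    unfolding lin_def using fsD(1)[OF assms(1)] assms(2,3)
    by (intro A.add.finprod_cong') auto
qed

end

lemma linear_map_lin:
  assumes A: "kalg K A" and B: "kalg K B" and f: "f \<in> fs K S" and h: "\<And>x. x \<in> S \<Longrightarrow> h x \<in> carrier A"
    and map: "\<And>x. x \<in> carrier A \<Longrightarrow> g x \<in> carrier B"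
    and add: "\<And>x y. x \<in> carrier A \<Longrightarrow> y \<in> carrier A \<Longrightarrow> g (x \<oplus>\<^bsub>A\<^esub> y) = g x \<oplus>\<^bsub>B\<^esub> g y"
    and sm: "\<And>c x. c \<in> carrier K \<Longrightarrow> x \<in> carrier A \<Longrightarrow> g (c \<odot>\<^bsub>A\<^esub> x) = c \<odot>\<^bsub>B\<^esub> g x"
  shows "g (lin K A h f) = lin K B (g \<circ> h) f"
proof -
  interpret A: kalg K A by fact
  interpret B: kalg K B by fact
  have gh: "\<And>x. x \<in> S \<Longrightarrow> (g \<circ> h) x \<in> carrier B" using h map by simp
  have g0: "g \<zero>\<^bsub>A\<^esub> = \<zero>\<^bsub>B\<^esub>"
    using sm[of "\<zero>\<^bsub>K\<^esub>" "\<zero>\<^bsub>A\<^esub>"] map by simp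
  from f show ?thesis
  proof (induction rule: A.fs_induct)
    case zero
    then show ?case by (simp add: A.lin_zero B.lin_zero g0)
  next
    case (add f x c)
    then have "single K x c \<in> fs K S" by (simp add: A.fs_single)
    moreover have "h x \<in> carrier A" "lin K A h f \<in> carrier A" using h add by (auto simp: A.lin_closed)
    ultimately show ?case
      using add h gh map assms(6-)
      by (simp add: A.lin_add[where S = S] B.lin_add[where S = S] A.lin_single[where S = S]
          B.lin_single[where S = S] A.lin_closed[where S = S])
  qed
qed

subsection \<open>Monoid algebras\<close>

lemma carrier_monoid_alg: "carrier (monoid_alg K M) = fs K (carrier M)"
  by (auto simp: monoid_alg_def fs_def)

lemma monoid_alg_simps:
  "f \<oplus>\<^bsub>monoid_alg K M\<^esub> g = (\<lambda>x. f x \<oplus>\<^bsub>K\<^esub> g x)"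
  "\<zero>\<^bsub>monoid_alg K M\<^esub> = (\<lambda>x. \<zero>\<^bsub>K\<^esub>)"
  "\<one>\<^bsub>monoid_alg K M\<^esub> = single K \<one>\<^bsub>M\<^esub> \<one>\<^bsub>K\<^esub>"
  "c \<odot>\<^bsub>monoid_alg K M\<^esub> f = (\<lambda>x. c \<otimes>\<^bsub>K\<^esub> f x)"
  by (auto simp: monoid_alg_def single_def)

text \<open>A field and a monoid, not necessarily commutative; \<open>KM\<close> is the monoid algebra.\<close>

locale monoid_algebra = K?: field K + M?: monoid M for K (structure) and M (structure)
begin

abbreviation "KM \<equiv> monoid_alg K M"

text \<open>The sum that defines the product, extended from the pairs of support elements with product \<open>x\<close> to a
  rectangle that does not depend on \<open>x\<close>.\<close>

lemma mult_eq:
  assumes "f \<in> fs K (carrier M)" "g \<in> fs K (carrier M)" "finite S" "finite T"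
    "{x. f x \<noteq> \<zero>} \<subseteq> S" "{x. g x \<noteq> \<zero>} \<subseteq> T"
  shows "(f \<otimes>\<^bsub>KM\<^esub> g) x =
    finsum K (\<lambda>(u, v). if u \<otimes>\<^bsub>M\<^esub> v = x then f u \<otimes> g v else \<zero>) (S \<times> T)"
proof -
  have "finsum K (\<lambda>(u, v). f u \<otimes> g v) {(u, v). f u \<noteq> \<zero> \<and> g v \<noteq> \<zero> \<and> u \<otimes>\<^bsub>M\<^esub> v = x} =
    finsum K (\<lambda>(u, v). if u \<otimes>\<^bsub>M\<^esub> v = x then f u \<otimes> g v else \<zero>) (S \<times> T)"
  proof (rule K.add.finprod_mono_neutral_cong_left)
    show "(case p of (u, v) \<Rightarrow> if u \<otimes>\<^bsub>M\<^esub> v = x then f u \<otimes> g v else \<zero>) = \<zero>"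
      if "p \<in> S \<times> T - {(u, v). f u \<noteq> \<zero> \<and> g v \<noteq> \<zero> \<and> u \<otimes>\<^bsub>M\<^esub> v = x}" for p
      using that fsD(1)[OF assms(1)] fsD(1)[OF assms(2)] by (auto split: if_splits)
    show "(\<lambda>(u, v). if u \<otimes>\<^bsub>M\<^esub> v = x then f u \<otimes> g v else \<zero>) \<in> S \<times> T \<rightarrow> carrier K"
      using fsD(1)[OF assms(1)] fsD(1)[OF assms(2)] by auto
  qed (use assms in auto)
  then show ?thesis by (simp add: monoid_alg_def)
qed

lemma mult_closed:
  assumes f: "f \<in> fs K (carrier M)" and g: "g \<in> fs K (carrier M)"
  shows "f \<otimes>\<^bsub>KM\<^esub> g \<in> fs K (carrier M)"
proof -
  let ?S = "{x. f x \<noteq> \<zero>}" and ?T = "{x. g x \<noteq> \<zero>}"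
  have e: "(f \<otimes>\<^bsub>KM\<^esub> g) x =
    finsum K (\<lambda>(u, v). if u \<otimes>\<^bsub>M\<^esub> v = x then f u \<otimes> g v else \<zero>) (?S \<times> ?T)" for x
    by (rule mult_eq) (use f g in \<open>auto simp: fs_def\<close>)
  have z: "(f \<otimes>\<^bsub>KM\<^esub> g) x = \<zero>" if "x \<notin> (\<lambda>(u, v). u \<otimes>\<^bsub>M\<^esub> v) ` (?S \<times> ?T)" for x
    unfolding e by (rule K.add.finprod_one_eqI) (use that in auto)
  have "finite ((\<lambda>(u, v). u \<otimes>\<^bsub>M\<^esub> v) ` (?S \<times> ?T))" using f g by (auto simp: fs_def)
  moreover have "{x. (f \<otimes>\<^bsub>KM\<^esub> g) x \<noteq> \<zero>} \<subseteq> (\<lambda>(u, v). u \<otimes>\<^bsub>M\<^esub> v) ` (?S \<times> ?T)"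
    using z by blast
  moreover have "(\<lambda>(u, v). u \<otimes>\<^bsub>M\<^esub> v) ` (?S \<times> ?T) \<subseteq> carrier M"
    using fsD(3)[OF f] fsD(3)[OF g] by auto
  moreover have "(f \<otimes>\<^bsub>KM\<^esub> g) x \<in> carrier K" for x
    unfolding e by (rule K.finsum_closed) (use f g in \<open>auto simp: fs_def\<close>)
  ultimately show ?thesis unfolding fs_def by (blast intro: finite_subset)
qed

lemma mult_add_left:
  assumes f: "f \<in> fs K (carrier M)" and f': "f' \<in> fs K (carrier M)" and g: "g \<in> fs K (carrier M)"
  shows "(\<lambda>x. f x \<oplus> f' x) \<otimes>\<^bsub>KM\<^esub> g = (\<lambda>x. (f \<otimes>\<^bsub>KM\<^esub> g) x \<oplus> (f' \<otimes>\<^bsub>KM\<^esub> g) x)"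
proof
  fix x
  let ?S = "{x. f x \<noteq> \<zero>} \<union> {x. f' x \<noteq> \<zero>}" and ?T = "{x. g x \<noteq> \<zero>}"
  have fin: "finite ?S" "finite ?T" using f f' g by (auto simp: fs_def)
  have "((\<lambda>x. f x \<oplus> f' x) \<otimes>\<^bsub>KM\<^esub> g) x =
     finsum K (\<lambda>(u, v). if u \<otimes>\<^bsub>M\<^esub> v = x then (f u \<oplus> f' u) \<otimes> g v else \<zero>) (?S \<times> ?T)"
    by (rule mult_eq) (use f f' g fin in \<open>auto simp: fs_add\<close>)
  also have "\<dots> = finsum K (\<lambda>p. (case p of (u, v) \<Rightarrow> if u \<otimes>\<^bsub>M\<^esub> v = x then f u \<otimes> g v else \<zero>) \<oplus>
      (case p of (u, v) \<Rightarrow> if u \<otimes>\<^bsub>M\<^esub> v = x then f' u \<otimes> g v else \<zero>)) (?S \<times> ?T)"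
    by (rule K.finsum_cong') (use f f' g in \<open>auto simp: fs_def K.l_distr\<close>)
  also have "\<dots> = finsum K (\<lambda>(u, v). if u \<otimes>\<^bsub>M\<^esub> v = x then f u \<otimes> g v else \<zero>) (?S \<times> ?T) \<oplus>
      finsum K (\<lambda>(u, v). if u \<otimes>\<^bsub>M\<^esub> v = x then f' u \<otimes> g v else \<zero>) (?S \<times> ?T)"
    by (rule K.finsum_addf) (use f f' g in \<open>auto simp: fs_def\<close>)
  also have "finsum K (\<lambda>(u, v). if u \<otimes>\<^bsub>M\<^esub> v = x then f u \<otimes> g v else \<zero>) (?S \<times> ?T) = (f \<otimes>\<^bsub>KM\<^esub> g) x"
    by (rule mult_eq[symmetric]) (use f g fin in auto)
  also have "finsum K (\<lambda>(u, v). if u \<otimes>\<^bsub>M\<^esub> v = x then f' u \<otimes> g v else \<zero>) (?S \<times> ?T) = (f' \<otimes>\<^bsub>KM\<^esub> g) x"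
    by (rule mult_eq[symmetric]) (use f' g fin in auto)
  finally show "((\<lambda>x. f x \<oplus> f' x) \<otimes>\<^bsub>KM\<^esub> g) x = (f \<otimes>\<^bsub>KM\<^esub> g) x \<oplus> (f' \<otimes>\<^bsub>KM\<^esub> g) x" .
qed

lemma mult_add_right:
  assumes f: "f \<in> fs K (carrier M)" and g: "g \<in> fs K (carrier M)" and g': "g' \<in> fs K (carrier M)"
  shows "f \<otimes>\<^bsub>KM\<^esub> (\<lambda>x. g x \<oplus> g' x) = (\<lambda>x. (f \<otimes>\<^bsub>KM\<^esub> g) x \<oplus> (f \<otimes>\<^bsub>KM\<^esub> g') x)"
proof
  fix x
  let ?S = "{x. f x \<noteq> \<zero>}" and ?T = "{x. g x \<noteq> \<zero>} \<union> {x. g' x \<noteq> \<zero>}"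
  have fin: "finite ?S" "finite ?T" using f g g' by (auto simp: fs_def)
  have "(f \<otimes>\<^bsub>KM\<^esub> (\<lambda>x. g x \<oplus> g' x)) x =
     finsum K (\<lambda>(u, v). if u \<otimes>\<^bsub>M\<^esub> v = x then f u \<otimes> (g v \<oplus> g' v) else \<zero>) (?S \<times> ?T)"
    by (rule mult_eq) (use f g g' fin in \<open>auto simp: fs_add\<close>)
  also have "\<dots> = finsum K (\<lambda>p. (case p of (u, v) \<Rightarrow> if u \<otimes>\<^bsub>M\<^esub> v = x then f u \<otimes> g v else \<zero>) \<oplus>
      (case p of (u, v) \<Rightarrow> if u \<otimes>\<^bsub>M\<^esub> v = x then f u \<otimes> g' v else \<zero>)) (?S \<times> ?T)"
    by (rule K.finsum_cong') (use f g g' in \<open>auto simp: fs_def K.r_distr\<close>)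
  also have "\<dots> = finsum K (\<lambda>(u, v). if u \<otimes>\<^bsub>M\<^esub> v = x then f u \<otimes> g v else \<zero>) (?S \<times> ?T) \<oplus>
      finsum K (\<lambda>(u, v). if u \<otimes>\<^bsub>M\<^esub> v = x then f u \<otimes> g' v else \<zero>) (?S \<times> ?T)"
    by (rule K.finsum_addf) (use f g g' in \<open>auto simp: fs_def\<close>)
  also have "finsum K (\<lambda>(u, v). if u \<otimes>\<^bsub>M\<^esub> v = x then f u \<otimes> g v else \<zero>) (?S \<times> ?T) = (f \<otimes>\<^bsub>KM\<^esub> g) x"
    by (rule mult_eq[symmetric]) (use f g fin in auto)
  also have "finsum K (\<lambda>(u, v). if u \<otimes>\<^bsub>M\<^esub> v = x then f u \<otimes> g' v else \<zero>) (?S \<times> ?T) = (f \<otimes>\<^bsub>KM\<^esub> g') x"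
    by (rule mult_eq[symmetric]) (use f g' fin in auto)
  finally show "(f \<otimes>\<^bsub>KM\<^esub> (\<lambda>x. g x \<oplus> g' x)) x = (f \<otimes>\<^bsub>KM\<^esub> g) x \<oplus> (f \<otimes>\<^bsub>KM\<^esub> g') x" .
qed

lemma mult_single:
  assumes "u \<in> carrier M" "v \<in> carrier M" "c \<in> carrier K" "d \<in> carrier K"
  shows "single K u c \<otimes>\<^bsub>KM\<^esub> single K v d = single K (u \<otimes>\<^bsub>M\<^esub> v) (c \<otimes> d)"
proof
  fix x
  have "(single K u c \<otimes>\<^bsub>KM\<^esub> single K v d) x =
    finsum K (\<lambda>(u', v'). if u' \<otimes>\<^bsub>M\<^esub> v' = x then single K u c u' \<otimes> single K v d v' else \<zero>) ({u} \<times> {v})"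
    by (rule mult_eq) (use assms in \<open>auto simp: fs_single\<close>, simp_all add: single_def split: if_splits)
  also have "\<dots> = single K (u \<otimes>\<^bsub>M\<^esub> v) (c \<otimes> d) x"
    using assms by (simp add: K.finsum_insert single_def)
  finally show "(single K u c \<otimes>\<^bsub>KM\<^esub> single K v d) x = single K (u \<otimes>\<^bsub>M\<^esub> v) (c \<otimes> d) x" .
qed

lemma mult_zero:
  "(\<lambda>_. \<zero>) \<otimes>\<^bsub>KM\<^esub> f = (\<lambda>_. \<zero>)" "f \<otimes>\<^bsub>KM\<^esub> (\<lambda>_. \<zero>) = (\<lambda>_. \<zero>)"
  by (simp_all add: monoid_alg_def)

lemma mult_assoc_single:
  assumes "f \<in> fs K (carrier M)" "v \<in> carrier M" "w \<in> carrier M" "c \<in> carrier K" "d \<in> carrier K"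
  shows "(f \<otimes>\<^bsub>KM\<^esub> single K v c) \<otimes>\<^bsub>KM\<^esub> single K w d = f \<otimes>\<^bsub>KM\<^esub> (single K v c \<otimes>\<^bsub>KM\<^esub> single K w d)"
  using assms(1)
  by (induction rule: fs_induct)
    (use assms(2-) in \<open>simp_all add: mult_zero mult_add_left mult_single mult_closed fs_single
       M.m_assoc K.m_assoc\<close>)

lemma mult_assoc_single2:
  assumes "f \<in> fs K (carrier M)" "g \<in> fs K (carrier M)" "w \<in> carrier M" "d \<in> carrier K"
  shows "(f \<otimes>\<^bsub>KM\<^esub> g) \<otimes>\<^bsub>KM\<^esub> single K w d = f \<otimes>\<^bsub>KM\<^esub> (g \<otimes>\<^bsub>KM\<^esub> single K w d)"
  using assms(2)
  by (induction rule: fs_induct)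
    (use assms in \<open>simp_all add: mult_zero mult_add_left mult_add_right mult_closed fs_single
       mult_assoc_single\<close>)

lemma mult_assoc:
  assumes "f \<in> fs K (carrier M)" "g \<in> fs K (carrier M)" "h \<in> fs K (carrier M)"
  shows "(f \<otimes>\<^bsub>KM\<^esub> g) \<otimes>\<^bsub>KM\<^esub> h = f \<otimes>\<^bsub>KM\<^esub> (g \<otimes>\<^bsub>KM\<^esub> h)"
  using assms(3)
  by (induction rule: fs_induct)
    (use assms in \<open>simp_all add: mult_zero mult_add_right mult_closed fs_single mult_assoc_single2\<close>)

lemma mult_one:
  assumes "f \<in> fs K (carrier M)"
  shows "single K \<one>\<^bsub>M\<^esub> \<one> \<otimes>\<^bsub>KM\<^esub> f = f" "f \<otimes>\<^bsub>KM\<^esub> single K \<one>\<^bsub>M\<^esub> \<one> = f"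
  using assms
  by (induction rule: fs_induct; simp add: mult_zero mult_add_right mult_add_left fs_single mult_single)+

lemma monoid_alg_ring: "ring KM"
proof (rule ringI)
  show "abelian_group KM"
  proof (rule abelian_groupI; unfold monoid_alg_simps carrier_monoid_alg)
    fix f assume "f \<in> fs K (carrier M)"
    then show "\<exists>g\<in>fs K (carrier M). (\<lambda>x. g x \<oplus> f x) = (\<lambda>x. \<zero>)"
      by (intro bexI[of _ "\<lambda>x. \<ominus> f x"]) (auto simp: fs_uminus K.l_neg fsD)
  next
    fix f g assume "f \<in> fs K (carrier M)" "g \<in> fs K (carrier M)"
    then show "(\<lambda>x. f x \<oplus> g x) = (\<lambda>x. g x \<oplus> f x)" using K.a_comm by (auto simp: fsD)
  qed (auto simp: fs_add fs_zero fsD K.a_assoc)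
  show "monoid KM"
    by (rule monoidI; unfold monoid_alg_simps carrier_monoid_alg)
      (auto simp: mult_closed mult_assoc mult_one fs_single)
qed (auto simp: monoid_alg_simps carrier_monoid_alg mult_add_left mult_add_right)

lemma smult_eq_mult:
  assumes c: "c \<in> carrier K" and f: "f \<in> fs K (carrier M)"
  shows "(\<lambda>x. c \<otimes> f x) = single K \<one>\<^bsub>M\<^esub> c \<otimes>\<^bsub>KM\<^esub> f" (is ?L)
    and "(\<lambda>x. c \<otimes> f x) = f \<otimes>\<^bsub>KM\<^esub> single K \<one>\<^bsub>M\<^esub> c" (is ?R)
proof -
  have *: "(\<lambda>y. c \<otimes> (f y \<oplus> single K x d y)) = (\<lambda>y. c \<otimes> f y \<oplus> single K x (c \<otimes> d) y)"
    if "f \<in> fs K (carrier M)" "d \<in> carrier K" for f x d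
    using that c by (auto simp: single_def K.r_distr fsD(1))
  from f show ?L
  proof (induction rule: fs_induct)
    case zero
    then show ?case using c by (simp add: mult_zero)
  next
    case (add f x d)
    have e: "(\<lambda>y. c \<otimes> f y \<oplus> z y) = (\<lambda>y. (single K \<one>\<^bsub>M\<^esub> c \<otimes>\<^bsub>KM\<^esub> f) y \<oplus> z y)" for z
      using fun_cong[OF add.IH] by (simp only:)
    show ?case unfolding *[OF add.hyps(1,3)] e
      using add.hyps c by (simp add: mult_add_right fs_single mult_single)
  qed
  from f show ?R
  proof (induction rule: fs_induct)
    case zero
    then show ?case using c by (simp add: mult_zero)
  next
    case (add f x d)
    have e: "(\<lambda>y. c \<otimes> f y \<oplus> z y) = (\<lambda>y. (f \<otimes>\<^bsub>KM\<^esub> single K \<one>\<^bsub>M\<^esub> c) y \<oplus> z y)" for z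
      using fun_cong[OF add.IH] by (simp only:)
    show ?case unfolding *[OF add.hyps(1,3)] e
      using add.hyps c K.m_comm[of c d] by (simp add: mult_add_left fs_single mult_single)
  qed
qed

lemma monoid_alg_kalg: "kalg K KM"
proof (rule kalgI)
  show "field K" by (rule K.field_axioms)
  show "ring KM" by (rule monoid_alg_ring)
  fix c f g assume "c \<in> carrier K" "f \<in> carrier KM" "g \<in> carrier KM"
  then have *: "c \<in> carrier K" "f \<in> fs K (carrier M)" "g \<in> fs K (carrier M)"
    by (auto simp: carrier_monoid_alg)
  then have s: "single K \<one>\<^bsub>M\<^esub> c \<in> fs K (carrier M)" by (simp add: fs_single)
  show "(c \<odot>\<^bsub>KM\<^esub> f) \<otimes>\<^bsub>KM\<^esub> g = c \<odot>\<^bsub>KM\<^esub> (f \<otimes>\<^bsub>KM\<^esub> g)"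
    unfolding monoid_alg_simps using * s by (simp add: smult_eq_mult(1) mult_assoc mult_closed)
  have "f \<otimes>\<^bsub>KM\<^esub> (\<lambda>x. c \<otimes> g x) = (f \<otimes>\<^bsub>KM\<^esub> single K \<one>\<^bsub>M\<^esub> c) \<otimes>\<^bsub>KM\<^esub> g"
    using * s by (simp add: smult_eq_mult(1) mult_assoc)
  also have "\<dots> = single K \<one>\<^bsub>M\<^esub> c \<otimes>\<^bsub>KM\<^esub> f \<otimes>\<^bsub>KM\<^esub> g"
    using * by (simp flip: smult_eq_mult)
  also have "\<dots> = (\<lambda>x. c \<otimes> (f \<otimes>\<^bsub>KM\<^esub> g) x)"
    using * s by (simp add: smult_eq_mult(1) mult_assoc mult_closed)
  finally show "f \<otimes>\<^bsub>KM\<^esub> (c \<odot>\<^bsub>KM\<^esub> g) = c \<odot>\<^bsub>KM\<^esub> (f \<otimes>\<^bsub>KM\<^esub> g)"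
    unfolding monoid_alg_simps .
qed (auto simp: carrier_monoid_alg monoid_alg_simps fs_smult fsD K.l_distr K.r_distr K.m_assoc)

end

text \<open>The universal property of the monoid algebra.\<close>

lemma (in monoid_algebra) lin_alg_hom:
  assumes "kalg K B" and h: "\<And>u. u \<in> carrier M \<Longrightarrow> h u \<in> carrier B"
    and h1: "h \<one>\<^bsub>M\<^esub> = \<one>\<^bsub>B\<^esub>"
    and hm: "\<And>u v. u \<in> carrier M \<Longrightarrow> v \<in> carrier M \<Longrightarrow> h (u \<otimes>\<^bsub>M\<^esub> v) = h u \<otimes>\<^bsub>B\<^esub> h v"
  shows "lin K B h \<in> alg_hom K KM B"
proof -
  interpret B: kalg K B by fact
  let ?C = "carrier M"
  have sm: "lin K B h (\<lambda>x. c \<otimes> f x) = c \<odot>\<^bsub>B\<^esub> lin K B h f" if f: "f \<in> fs K ?C" and c: "c \<in> carrier K" for c f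
    using f
  proof (induction rule: fs_induct)
    case zero
    then show ?case using c by (simp add: B.lin_zero)
  next
    case (add f x d)
    then have "lin K B h (\<lambda>x'. c \<otimes> (f x' \<oplus> single K x d x')) =
       lin K B h (\<lambda>x'. c \<otimes> f x' \<oplus> single K x (c \<otimes> d) x')"
      using c by (intro arg_cong[where f = "lin K B h"]) (auto simp: K.r_distr fsD single_def)
    then show ?case using add c h
      by (simp add: B.lin_add[where S = ?C] fs_smult fs_single B.lin_single[where S = ?C]
         B.lin_closed[where S = ?C] B.smult_r_distr B.smult_assoc1)
  qed
  have m1: "lin K B h (f \<otimes>\<^bsub>KM\<^esub> single K v d) = lin K B h f \<otimes>\<^bsub>B\<^esub> lin K B h (single K v d)"
    if f: "f \<in> fs K ?C" and v: "v \<in> ?C" "d \<in> carrier K" for f v d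
    using f
  proof (induction rule: fs_induct)
    case zero
    then show ?case using v h by (simp add: mult_zero B.lin_zero B.lin_single[where S = ?C])
  next
    case (add f x c)
    then show ?case using v h
      by (simp add: mult_add_left B.lin_add[where S = ?C] fs_single mult_closed mult_single
          B.lin_closed[where S = ?C] B.l_distr B.lin_single[where S = ?C] hm B.smult_mult_left
          B.smult_mult_right B.smult_r_distr B.smult_comm[of c d] B.smult_assoc1)
  qed
  have m: "lin K B h (f \<otimes>\<^bsub>KM\<^esub> g) = lin K B h f \<otimes>\<^bsub>B\<^esub> lin K B h g"
    if f: "f \<in> fs K ?C" and g: "g \<in> fs K ?C" for f g
    using g
  proof (induction rule: fs_induct)
    case zero
    then show ?case using h f by (simp add: mult_zero B.lin_zero B.lin_closed[where S = ?C])
  next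
    case (add g x c)
    then show ?case using f h
      by (simp add: mult_add_right B.lin_add[where S = ?C] fs_single mult_closed m1
          B.lin_closed[where S = ?C] B.r_distr)
  qed
  show ?thesis
    unfolding alg_hom_def
    by (auto intro!: ring_hom_memI simp: carrier_monoid_alg monoid_alg_simps sm m h h1 
        B.lin_add[where S = ?C] B.lin_closed[where S = ?C] B.lin_single[where S = ?C])
qed

section \<open>Presented algebras and linear spans\<close>

subsection \<open>Quotient algebras\<close>

lemma ring_transfer:
  assumes "ring R" "carrier S = carrier R" "monoid.mult S = monoid.mult R" "one S = one R"
    "ring.zero S = ring.zero R" "ring.add S = ring.add R"
  shows "ring S"
proof -
  interpret R: ring R by fact
  show ?thesis
  proof (rule ringI)
    show "abelian_group S"
      by (rule abelian_groupI) (use R.l_neg in \<open>auto simp: assms R.a_assoc intro: R.a_comm\<close>)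
    show "monoid S" by (rule monoidI) (auto simp: assms R.m_assoc)
  qed (auto simp: assms R.l_distr R.r_distr)
qed

lemma quot_alg_simps:
  "carrier (quot_alg A I) = carrier (A Quot I)" "monoid.mult (quot_alg A I) = monoid.mult (A Quot I)"
  "one (quot_alg A I) = one (A Quot I)" "ring.zero (quot_alg A I) = ring.zero (A Quot I)"
  "ring.add (quot_alg A I) = ring.add (A Quot I)"
  "c \<odot>\<^bsub>quot_alg A I\<^esub> C = (\<Union>x\<in>C. I +>\<^bsub>A\<^esub> (c \<odot>\<^bsub>A\<^esub> x))"
  by (simp_all add: quot_alg_def)

text \<open>A two-sided ideal of a \<open>K\<close>-algebra, with the quotient algebra \<open>Q\<close> and the projection \<open>cls\<close>.\<close>

locale kalg_ideal = kalg K A + I?: ideal I A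
  for K :: "('k, 'x) ring_scheme" (structure) and A :: "('k, 'a, 'y) module_scheme" (structure) and I
begin

abbreviation "Q \<equiv> quot_alg A I"
abbreviation cls :: "'a \<Rightarrow> 'a set" where "cls x \<equiv> I +>\<^bsub>A\<^esub> x"

lemma cls_eq_iff: "x \<in> carrier A \<Longrightarrow> y \<in> carrier A \<Longrightarrow> cls x = cls y \<longleftrightarrow> x \<ominus>\<^bsub>A\<^esub> y \<in> I"
  using A.quotient_eq_iff_same_a_r_cos[OF I.is_ideal] by simp

lemma cls_carrier: "carrier Q = cls ` carrier A"
  by (auto simp: quot_alg_simps FactRing_def A_RCOSETS_def')

lemma cls_closed: "x \<in> carrier A \<Longrightarrow> cls x \<in> carrier Q"
  by (simp add: cls_carrier)

lemma ideal_smult: "x \<in> I \<Longrightarrow> c \<in> carrier K \<Longrightarrow> c \<odot>\<^bsub>A\<^esub> x \<in> I"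
  using smult_mult_left[of c "\<one>\<^bsub>A\<^esub>" x] I.I_l_closed[of x "c \<odot>\<^bsub>A\<^esub> \<one>\<^bsub>A\<^esub>"] I.a_Hcarr[of x] by simp

lemma cls_mult: "x \<in> carrier A \<Longrightarrow> y \<in> carrier A \<Longrightarrow> cls (x \<otimes>\<^bsub>A\<^esub> y) = cls x \<otimes>\<^bsub>Q\<^esub> cls y"
  using ring_hom_mult[OF I.rcos_ring_hom] by (simp add: quot_alg_simps)

lemma cls_add: "x \<in> carrier A \<Longrightarrow> y \<in> carrier A \<Longrightarrow> cls (x \<oplus>\<^bsub>A\<^esub> y) = cls x \<oplus>\<^bsub>Q\<^esub> cls y"
  using ring_hom_add[OF I.rcos_ring_hom] by (simp add: quot_alg_simps)

lemma cls_one: "cls \<one>\<^bsub>A\<^esub> = \<one>\<^bsub>Q\<^esub>"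
  using ring_hom_one[OF I.rcos_ring_hom] by (simp add: quot_alg_simps)

lemma cls_smult:
  assumes "c \<in> carrier K" "x \<in> carrier A"
  shows "cls (c \<odot>\<^bsub>A\<^esub> x) = c \<odot>\<^bsub>Q\<^esub> cls x"
proof -
  have "cls (c \<odot>\<^bsub>A\<^esub> y) = cls (c \<odot>\<^bsub>A\<^esub> x)" if y: "y \<in> cls x" for y
  proof -
    obtain h where h: "h \<in> I" "y = h \<oplus>\<^bsub>A\<^esub> x"
      using y by (auto simp: a_r_coset_def')
    then have hc: "h \<in> carrier A" using I.a_Hcarr by auto
    have "c \<odot>\<^bsub>A\<^esub> y \<ominus>\<^bsub>A\<^esub> c \<odot>\<^bsub>A\<^esub> x = c \<odot>\<^bsub>A\<^esub> h"
      using h(2) assms hc by (simp add: smult_r_distr A.minus_eq A.a_assoc A.r_neg)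
    also have "\<dots> \<in> I" using h assms by (simp add: ideal_smult)
    finally show ?thesis using assms h hc by (simp add: cls_eq_iff)
  qed
  moreover have "x \<in> cls x" using I.a_rcos_self[of x] assms by simp
  ultimately show ?thesis unfolding quot_alg_simps by blast
qed

lemma quot_ring: "ring Q"
  by (rule ring_transfer[OF I.quotient_is_ring]) (simp_all add: quot_alg_simps)

lemma quot_kalg: "kalg K Q"
proof -
  interpret Q: ring Q by (rule quot_ring)
  show ?thesis
  proof (rule kalgI)
    show "field K" by (rule K.field_axioms)
    show "ring Q" by (rule quot_ring)
  qed (auto simp: cls_carrier smult_assoc1 smult_l_distr smult_r_distr smult_mult_left smult_mult_right
        simp flip: cls_mult cls_add cls_smult)
qed

lemma cls_hom: "cls \<in> alg_hom K A Q"
  unfolding alg_hom_def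
  by (auto intro!: ring_hom_memI simp: cls_closed cls_mult cls_add cls_one cls_smult)

lemma cls_zero: "cls \<zero>\<^bsub>A\<^esub> = \<zero>\<^bsub>Q\<^esub>"
  using alg_hom_zero[OF cls_hom A.ring_axioms quot_ring] .

lemma cls_zero_iff: "x \<in> carrier A \<Longrightarrow> cls x = \<zero>\<^bsub>Q\<^esub> \<longleftrightarrow> x \<in> I"
  using cls_eq_iff[of x "\<zero>\<^bsub>A\<^esub>"] by (simp add: cls_zero A.minus_eq)

text \<open>The universal property of the quotient by a two-sided ideal.\<close>

lemma quot_hom_ex:
  assumes B: "kalg K B" and f: "f \<in> alg_hom K A B" and f0: "\<And>x. x \<in> I \<Longrightarrow> f x = \<zero>\<^bsub>B\<^esub>"
  shows "\<exists>g \<in> alg_hom K Q B. \<forall>x \<in> carrier A. g (cls x) = f x"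
proof -
  interpret B: kalg K B by fact
  note fD = alg_homD[OF f]
  define g where "g = (\<lambda>C. f (SOME x. x \<in> carrier A \<and> cls x = C))"
  have g: "g (cls x) = f x" if x: "x \<in> carrier A" for x
  proof -
    define y where "y = (SOME y. y \<in> carrier A \<and> cls y = cls x)"
    have "y \<in> carrier A \<and> cls y = cls x" unfolding y_def by (rule someI[of _ x]) (use x in simp)
    then have y: "y \<in> carrier A" "y \<ominus>\<^bsub>A\<^esub> x \<in> I" using x by (auto simp: cls_eq_iff)
    have "f y = f ((y \<ominus>\<^bsub>A\<^esub> x) \<oplus>\<^bsub>A\<^esub> x)"
      using x y by (simp add: A.minus_eq A.a_assoc A.l_neg)
    also have "\<dots> = f x" using x y f0[OF y(2)] by (simp add: fD)
    finally show ?thesis by (simp add: g_def y_def)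
  qed
  have "g \<in> alg_hom K Q B"
    unfolding alg_hom_def
    by (auto intro!: ring_hom_memI simp: cls_carrier g fD simp flip: cls_mult cls_add cls_smult cls_one)
  with g show ?thesis by blast
qed

end

lemma rel_ideal_ideal:
  assumes "ring A" "rels \<subseteq> carrier A \<times> carrier A"
  shows "ideal (rel_ideal A rels) A"
proof -
  interpret ring A by fact
  show ?thesis unfolding rel_ideal_def by (rule genideal_ideal) (use assms in auto)
qed

lemma rel_ideal_rel:
  assumes "ring A" "rels \<subseteq> carrier A \<times> carrier A" "(u, v) \<in> rels"
  shows "u \<ominus>\<^bsub>A\<^esub> v \<in> rel_ideal A rels"
proof -
  interpret ring A by fact
  have "{u \<ominus>\<^bsub>A\<^esub> v |u v. (u, v) \<in> rels} \<subseteq> rel_ideal A rels"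
    unfolding rel_ideal_def by (rule genideal_self) (use assms in auto)
  with assms(3) show ?thesis by blast
qed

lemma alg_hom_rel_ideal:
  assumes "ring A" "ring B" "f \<in> alg_hom K A B" "rels \<subseteq> carrier A \<times> carrier A"
    "\<And>u v. (u, v) \<in> rels \<Longrightarrow> f u = f v" "x \<in> rel_ideal A rels"
  shows "f x = \<zero>\<^bsub>B\<^esub>"
proof -
  interpret A: ring A by fact
  interpret B: ring B by fact
  interpret f: ring_hom_ring A B f
    by (rule ring_hom_ringI2) (use assms in \<open>auto simp: alg_hom_def\<close>)
  have "{u \<ominus>\<^bsub>A\<^esub> v |u v. (u, v) \<in> rels} \<subseteq> a_kernel A B f"
  proof clarify
    fix u v assume uv: "(u, v) \<in> rels"
    then have c: "u \<in> carrier A" "v \<in> carrier A" using assms(4) by auto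
    have "f (u \<ominus>\<^bsub>A\<^esub> v) = f u \<oplus>\<^bsub>B\<^esub> \<ominus>\<^bsub>B\<^esub> f v"
      unfolding A.minus_eq using c by (simp only: f.hom_add f.hom_a_inv A.a_inv_closed)
    also have "\<dots> = \<zero>\<^bsub>B\<^esub>" unfolding assms(5)[OF uv] by (rule B.r_neg) (rule f.hom_closed[OF c(2)])
    finally show "u \<ominus>\<^bsub>A\<^esub> v \<in> a_kernel A B f"
      unfolding a_kernel_def' using c by blast
  qed
  then have "rel_ideal A rels \<subseteq> a_kernel A B f"
    unfolding rel_ideal_def by (intro A.genideal_minimal f.kernel_is_ideal)
  with assms(6) have "x \<in> a_kernel A B f" by blast
  then show ?thesis unfolding a_kernel_def' by blast
qed

text \<open>The universal property of an algebra that is presented as a quotient of a monoid algebra.\<close>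

lemma (in monoid_algebra) presented_hom_ex:
  assumes B: "kalg K B" and h: "\<And>u. u \<in> carrier M \<Longrightarrow> h u \<in> carrier B"
    and h1: "h \<one>\<^bsub>M\<^esub> = \<one>\<^bsub>B\<^esub>"
    and hm: "\<And>u v. u \<in> carrier M \<Longrightarrow> v \<in> carrier M \<Longrightarrow> h (u \<otimes>\<^bsub>M\<^esub> v) = h u \<otimes>\<^bsub>B\<^esub> h v"
    and rels: "rels \<subseteq> carrier KM \<times> carrier KM"
      "\<And>u v. (u, v) \<in> rels \<Longrightarrow> lin K B h u = lin K B h v"
  shows "\<exists>f \<in> alg_hom K (quot_alg KM (rel_ideal KM rels)) B.
    \<forall>x \<in> carrier M. f (rel_ideal KM rels +>\<^bsub>KM\<^esub> basis_elt K x) = h x"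
proof -
  interpret B: kalg K B by fact
  interpret KM: kalg K KM by (rule monoid_alg_kalg)
  interpret kalg_ideal K KM "rel_ideal KM rels"
    by (intro kalg_ideal.intro rel_ideal_ideal KM.ring_axioms rels KM.kalg_axioms)
  have f: "lin K B h \<in> alg_hom K KM B" by (rule lin_alg_hom[OF B h h1 hm])
  then obtain g where g: "g \<in> alg_hom K (quot_alg KM (rel_ideal KM rels)) B"
    "\<forall>x \<in> carrier KM. g (rel_ideal KM rels +>\<^bsub>KM\<^esub> x) = lin K B h x"
    using quot_hom_ex[OF B f] alg_hom_rel_ideal[OF KM.ring_axioms B.ring_axioms f rels] by blast
  have "g (rel_ideal KM rels +>\<^bsub>KM\<^esub> basis_elt K x) = h x" if "x \<in> carrier M" for x
    using g(2) that h
    by (simp add: carrier_monoid_alg basis_elt_single fs_single B.lin_single[where S = "carrier M"])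
  with g show ?thesis by blast
qed

subsection \<open>Linear span\<close>

text \<open>The linear span of \<open>S\<close>, built by adding one multiple of an element of \<open>S\<close> at a time, which gives an
  induction on the number of terms.\<close>

inductive_set kspan :: "('k, 'x) ring_scheme \<Rightarrow> ('k, 'a, 'y) module_scheme \<Rightarrow> 'a set \<Rightarrow> 'a set"
  for K A S where
  kspan_zero: "\<zero>\<^bsub>A\<^esub> \<in> kspan K A S"
| kspan_step: "\<lbrakk>x \<in> kspan K A S; c \<in> carrier K; s \<in> S\<rbrakk> \<Longrightarrow> x \<oplus>\<^bsub>A\<^esub> c \<odot>\<^bsub>A\<^esub> s \<in> kspan K A S"

context kalg begin

lemma kspan_carrier: "S \<subseteq> carrier A \<Longrightarrow> x \<in> kspan K A S \<Longrightarrow> x \<in> carrier A"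
  by (rotate_tac, induction rule: kspan.induct) auto

lemma kspan_base: "S \<subseteq> carrier A \<Longrightarrow> s \<in> S \<Longrightarrow> s \<in> kspan K A S"
  using kspan_step[of "\<zero>\<^bsub>A\<^esub>" K A S "\<one>" s] kspan_zero[of A K S] by auto

lemma kspan_add: "S \<subseteq> carrier A \<Longrightarrow> x \<in> kspan K A S \<Longrightarrow> y \<in> kspan K A S \<Longrightarrow> x \<oplus>\<^bsub>A\<^esub> y \<in> kspan K A S"
proof (rotate_tac 2, induction rule: kspan.induct)
  case kspan_zero
  then show ?case using kspan_carrier by simp
next
  case (kspan_step y c s)
  then have "x \<oplus>\<^bsub>A\<^esub> (y \<oplus>\<^bsub>A\<^esub> c \<odot>\<^bsub>A\<^esub> s) = (x \<oplus>\<^bsub>A\<^esub> y) \<oplus>\<^bsub>A\<^esub> c \<odot>\<^bsub>A\<^esub> s"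
    using kspan_carrier by (subst A.a_assoc) auto
  then show ?case using kspan_step by (auto intro: kspan.kspan_step)
qed

lemma kspan_smult: "S \<subseteq> carrier A \<Longrightarrow> c \<in> carrier K \<Longrightarrow> x \<in> kspan K A S \<Longrightarrow> c \<odot>\<^bsub>A\<^esub> x \<in> kspan K A S"
proof (rotate_tac 2, induction rule: kspan.induct)
  case kspan_zero
  then show ?case using kspan.kspan_zero by simp
next
  case (kspan_step y d s)
  then have "c \<odot>\<^bsub>A\<^esub> (y \<oplus>\<^bsub>A\<^esub> d \<odot>\<^bsub>A\<^esub> s) = c \<odot>\<^bsub>A\<^esub> y \<oplus>\<^bsub>A\<^esub> (c \<otimes> d) \<odot>\<^bsub>A\<^esub> s"
    using kspan_carrier[of S y] by (auto simp: smult_r_distr smult_assoc1)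
  then show ?case using kspan_step by (auto intro: kspan.kspan_step)
qed

lemma kspan_subset:
  assumes "T \<subseteq> carrier A" "S \<subseteq> kspan K A T"
  shows "kspan K A S \<subseteq> kspan K A T"
proof
  fix x assume "x \<in> kspan K A S"
  then show "x \<in> kspan K A T"
    by induction (use assms in \<open>auto intro: kspan.kspan_zero kspan_add kspan_smult\<close>)
qed

lemma lin_image_kspan:
  assumes h: "\<And>x. x \<in> S \<Longrightarrow> h x \<in> carrier A"
  shows "lin K A h ` fs K S = kspan K A (h ` S)"
proof (intro equalityI subsetI)
  fix x assume "x \<in> lin K A h ` fs K S"
  then obtain f where f: "f \<in> fs K S" "x = lin K A h f" by auto
  from f(1) have "lin K A h f \<in> kspan K A (h ` S)"
  proof (induction rule: fs_induct)
    case (add f y c)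
    then show ?case using h
      by (auto simp: lin_add[where S = S] fs_single lin_single[where S = S] intro: kspan.kspan_step)
  qed (simp add: lin_zero kspan.kspan_zero)
  with f show "x \<in> kspan K A (h ` S)" by simp
next
  fix x assume "x \<in> kspan K A (h ` S)"
  then show "x \<in> lin K A h ` fs K S"
  proof induction
    case kspan_zero
    then show ?case using lin_zero[of h] fs_zero by force
  next
    case (kspan_step x c s)
    then obtain f y where f: "f \<in> fs K S" "x = lin K A h f" "y \<in> S" "s = h y" by auto
    then have "x \<oplus>\<^bsub>A\<^esub> c \<odot>\<^bsub>A\<^esub> s = lin K A h (\<lambda>z. f z \<oplus> single K y c z)"
      using h kspan_step by (simp add: lin_add[where S = S] fs_single lin_single[where S = S])
    moreover have "(\<lambda>z. f z \<oplus> single K y c z) \<in> fs K S"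
      using f kspan_step by (simp add: fs_add fs_single)
    ultimately show ?case by blast
  qed
qed

end

lemma kspan_map:
  assumes "kalg K A" "kalg K B" "S \<subseteq> carrier A" "x \<in> kspan K A S"
    and map: "\<And>x. x \<in> carrier A \<Longrightarrow> g x \<in> carrier B"
    and add: "\<And>x y. x \<in> carrier A \<Longrightarrow> y \<in> carrier A \<Longrightarrow> g (x \<oplus>\<^bsub>A\<^esub> y) = g x \<oplus>\<^bsub>B\<^esub> g y"
    and sm: "\<And>c x. c \<in> carrier K \<Longrightarrow> x \<in> carrier A \<Longrightarrow> g (c \<odot>\<^bsub>A\<^esub> x) = c \<odot>\<^bsub>B\<^esub> g x"
  shows "g x \<in> kspan K B (g ` S)"
proof -
  interpret A: kalg K A by fact
  interpret B: kalg K B by fact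
  have g0: "g \<zero>\<^bsub>A\<^esub> = \<zero>\<^bsub>B\<^esub>"
    using sm[of "\<zero>\<^bsub>K\<^esub>" "\<zero>\<^bsub>A\<^esub>"] map by simp
  from assms(4) show ?thesis
  proof induction
    case kspan_zero
    then show ?case by (simp add: g0 kspan.kspan_zero)
  next
    case (kspan_step x c s)
    then have "x \<in> carrier A" "s \<in> carrier A" using A.kspan_carrier assms(3) by auto
    then show ?case using kspan_step by (auto simp: add sm intro: kspan.kspan_step)
  qed
qed

lemma (in monoid_algebra) monoid_alg_kspan: "carrier KM = kspan K KM (basis_elt K ` carrier M)"
proof -
  interpret KM: kalg K KM by (rule monoid_alg_kalg)
  have "f \<in> kspan K KM (basis_elt K ` carrier M)" if "f \<in> fs K (carrier M)" for f
    using that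
  proof (induction rule: fs_induct)
    case zero
    then show ?case using kspan.kspan_zero[of KM K] by (simp add: monoid_alg_simps)
  next
    case (add f x c)
    have "(\<lambda>y. f y \<oplus> single K x c y) = f \<oplus>\<^bsub>KM\<^esub> c \<odot>\<^bsub>KM\<^esub> basis_elt K x"
      using add by (auto simp: monoid_alg_simps basis_elt_single single_def)
    then show ?case using add by (auto intro: kspan.kspan_step)
  qed
  moreover have "basis_elt K ` carrier M \<subseteq> carrier KM"
    by (auto simp: carrier_monoid_alg basis_elt_single fs_single)
  ultimately show ?thesis using KM.kspan_carrier by (auto simp: carrier_monoid_alg)
qed

lemma (in monoid_algebra) presented_kspan:
  assumes "ideal I KM"
  shows "carrier (quot_alg KM I) = kspan K (quot_alg KM I) ((\<lambda>x. I +>\<^bsub>KM\<^esub> basis_elt K x) ` carrier M)"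
proof -
  interpret KM: kalg K KM by (rule monoid_alg_kalg)
  interpret kalg_ideal K KM I by (intro kalg_ideal.intro KM.kalg_axioms assms)
  have b: "basis_elt K ` carrier M \<subseteq> carrier KM"
    by (auto simp: carrier_monoid_alg basis_elt_single fs_single)
  have "cls f \<in> kspan K Q (cls ` basis_elt K ` carrier M)" if "f \<in> carrier KM" for f
    by (rule kspan_map[OF KM.kalg_axioms quot_kalg b])
      (use that monoid_alg_kspan in \<open>auto simp: cls_closed cls_add cls_smult\<close>)
  moreover have "cls ` basis_elt K ` carrier M \<subseteq> carrier Q" using b by (auto simp: cls_closed)
  ultimately show ?thesis using kalg.kspan_carrier[OF quot_kalg] cls_carrier
    by (auto simp: image_image)
qed

lemma (in monoid_algebra) basis_elt_closed: "x \<in> carrier M \<Longrightarrow> basis_elt K x \<in> carrier KM"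
  by (auto simp: carrier_monoid_alg basis_elt_single fs_single)

lemma (in monoid_algebra) basis_elt_mult:
  "x \<in> carrier M \<Longrightarrow> y \<in> carrier M \<Longrightarrow> basis_elt K x \<otimes>\<^bsub>KM\<^esub> basis_elt K y = basis_elt K (x \<otimes>\<^bsub>M\<^esub> y)"
  by (simp add: basis_elt_single mult_single)

lemma (in monoid_algebra) basis_elt_one: "basis_elt K \<one>\<^bsub>M\<^esub> = \<one>\<^bsub>KM\<^esub>"
  by (simp add: basis_elt_single monoid_alg_simps)

lemma free_monoid_simps [simp]:
  "carrier (free_monoid S) = lists S" "monoid.mult (free_monoid S) = (@)" "one (free_monoid S) = []"
  by (simp_all add: free_monoid_def)

lemma free_monoid_algebra: "field K \<Longrightarrow> monoid_algebra K (free_monoid S)"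
  by (intro monoid_algebra.intro monoidI) auto

text \<open>The value of a word when every letter \<open>z\<close> is replaced by \<open>y z\<close>; the empty word has the value \<open>1\<close>.\<close>

definition wprod :: "('a, 'y) monoid_scheme \<Rightarrow> ('g \<Rightarrow> 'a) \<Rightarrow> 'g list \<Rightarrow> 'a"
  where "wprod A y w = foldr (\<lambda>z b. y z \<otimes>\<^bsub>A\<^esub> b) w \<one>\<^bsub>A\<^esub>"

lemma wprod_simps [simp]: "wprod A y [] = \<one>\<^bsub>A\<^esub>" "wprod A y (z # w) = y z \<otimes>\<^bsub>A\<^esub> wprod A y w"
  by (simp_all add: wprod_def)

context monoid begin

lemma wprod_closed: "(\<And>z. z \<in> S \<Longrightarrow> y z \<in> carrier G) \<Longrightarrow> w \<in> lists S \<Longrightarrow> wprod G y w \<in> carrier G"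
  by (induction w) auto

lemma wprod_append:
  "(\<And>z. z \<in> S \<Longrightarrow> y z \<in> carrier G) \<Longrightarrow> v \<in> lists S \<Longrightarrow> w \<in> lists S \<Longrightarrow>
   wprod G y (v @ w) = wprod G y v \<otimes> wprod G y w"
  by (induction v) (simp_all add: m_assoc wprod_closed[where S = S])

end

section \<open>Noncommutative tori\<close>

subsection \<open>Words in invertible letters that commute up to scalars\<close>

text \<open>Proportionality: \<open>x\<close> is a nonzero scalar multiple of \<open>y\<close>.\<close>

definition (in kalg) prp where "prp x y \<longleftrightarrow> (\<exists>c \<in> carrier K - {\<zero>}. x = c \<odot>\<^bsub>A\<^esub> y)"

text \<open>The letter of the inverse generator.\<close>

fun tinv :: "torus_gen \<Rightarrow> torus_gen" where
  "tinv (Pos i) = Neg i"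
| "tinv (Neg i) = Pos i"

text \<open>The exponent of the \<open>i\<close>-th generator in a letter.\<close>

fun tdeg :: "torus_gen \<Rightarrow> nat \<Rightarrow> int" where
  "tdeg (Pos j) i = (if i = j then 1 else 0)"
| "tdeg (Neg j) i = (if i = j then -1 else 0)"

text \<open>The total exponent of the \<open>i\<close>-th generator in a word.\<close>

definition wdeg :: "torus_gen list \<Rightarrow> nat \<Rightarrow> int"
  where "wdeg w i = (\<Sum>z\<leftarrow>w. tdeg z i)"

text \<open>The letters of the torus in \<open>m\<close> generators.\<close>

definition tletters :: "nat \<Rightarrow> torus_gen set"
  where "tletters m = Pos ` {1..m} \<union> Neg ` {1..m}"

lemma tinv_tinv [simp]: "tinv (tinv z) = z" by (cases z) auto
lemma tdeg_tinv [simp]: "tdeg (tinv z) i = - tdeg z i" by (cases z) auto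
lemma tinv_letters: "z \<in> tletters m \<Longrightarrow> tinv z \<in> tletters m" by (auto simp: tletters_def)

lemma wdeg_simps [simp]: "wdeg [] i = 0" "wdeg (z # w) i = tdeg z i + wdeg w i"
  "wdeg (v @ w) i = wdeg v i + wdeg w i" "wdeg (rev w) i = wdeg w i"
  by (auto simp: wdeg_def rev_map[symmetric])

lemma wdeg_map_tinv [simp]: "wdeg (map tinv w) i = - wdeg w i"
  by (induction w) auto

lemma tinv_mem_of_wdeg_zero:
  assumes "\<And>i. wdeg (z # w) i = 0"
  shows "tinv z \<in> set w"
proof (rule ccontr)
  assume n: "tinv z \<notin> set w"
  obtain j where j: "z = Pos j \<or> z = Neg j" by (cases z) auto
  have "tdeg z' j * tdeg z j \<ge> 0" if "z' \<in> set w" for z'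
  proof -
    have "z' \<noteq> tinv z" using that n by auto
    then show ?thesis using j by (cases z') auto
  qed
  then have "wdeg w j * tdeg z j \<ge> 0"
    by (induction w) (auto simp: distrib_right)
  moreover have "tdeg z j * tdeg z j = 1" using j by auto
  moreover have "(tdeg z j + wdeg w j) * tdeg z j = 0" using assms[of j] by simp
  ultimately show False by (simp add: distrib_right)
qed

context kalg begin

lemma prp_refl: "x \<in> carrier A \<Longrightarrow> prp x x"
  unfolding prp_def by (rule bexI[of _ \<one>]) auto

lemma prp_sym: "prp x y \<Longrightarrow> y \<in> carrier A \<Longrightarrow> prp y x"
proof -
  assume "prp x y" and y: "y \<in> carrier A"
  then obtain c where c: "c \<in> carrier K" "c \<noteq> \<zero>" "x = c \<odot>\<^bsub>A\<^esub> y" by (auto simp: prp_def)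
  then have "y = inv c \<odot>\<^bsub>A\<^esub> x" using y by (simp flip: smult_assoc1 add: K.field_Units)
  moreover have "inv c \<in> carrier K - {\<zero>}"
    using c by (metis K.Units_inv_Units K.field_Units DiffI singletonD)
  ultimately show ?thesis by (auto simp: prp_def)
qed

lemma prp_trans: "prp x y \<Longrightarrow> prp y z \<Longrightarrow> z \<in> carrier A \<Longrightarrow> prp x z"
proof -
  assume "prp x y" "prp y z" and z: "z \<in> carrier A"
  then obtain c d where c: "c \<in> carrier K" "c \<noteq> \<zero>" "x = c \<odot>\<^bsub>A\<^esub> y"
    and d: "d \<in> carrier K" "d \<noteq> \<zero>" "y = d \<odot>\<^bsub>A\<^esub> z" by (auto simp: prp_def)
  then have "x = (c \<otimes> d) \<odot>\<^bsub>A\<^esub> z" using z by (simp add: smult_assoc1)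
  moreover have "c \<otimes> d \<in> carrier K - {\<zero>}" using c d K.integral by auto
  ultimately show ?thesis unfolding prp_def by blast
qed

lemma prp_mult: "prp x x' \<Longrightarrow> prp y y' \<Longrightarrow> x' \<in> carrier A \<Longrightarrow> y' \<in> carrier A \<Longrightarrow>
  prp (x \<otimes>\<^bsub>A\<^esub> y) (x' \<otimes>\<^bsub>A\<^esub> y')"
proof -
  assume "prp x x'" "prp y y'" and z: "x' \<in> carrier A" "y' \<in> carrier A"
  then obtain c d where c: "c \<in> carrier K" "c \<noteq> \<zero>" "x = c \<odot>\<^bsub>A\<^esub> x'"
    and d: "d \<in> carrier K" "d \<noteq> \<zero>" "y = d \<odot>\<^bsub>A\<^esub> y'" by (auto simp: prp_def)
  then have "x \<otimes>\<^bsub>A\<^esub> y = (c \<otimes> d) \<odot>\<^bsub>A\<^esub> (x' \<otimes>\<^bsub>A\<^esub> y')"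
    using z smult_comm[of c d] by (simp add: smult_assoc1 smult_mult_left smult_mult_right)
  moreover have "c \<otimes> d \<in> carrier K - {\<zero>}" using c d K.integral by auto
  ultimately show ?thesis unfolding prp_def by blast
qed

lemma prp_mult_left: "x \<in> carrier A \<Longrightarrow> prp y y' \<Longrightarrow> y' \<in> carrier A \<Longrightarrow> prp (x \<otimes>\<^bsub>A\<^esub> y) (x \<otimes>\<^bsub>A\<^esub> y')"
  by (rule prp_mult[OF prp_refl])

lemma prp_mult_right: "prp x x' \<Longrightarrow> x' \<in> carrier A \<Longrightarrow> y \<in> carrier A \<Longrightarrow> prp (x \<otimes>\<^bsub>A\<^esub> y) (x' \<otimes>\<^bsub>A\<^esub> y)"
  by (rule prp_mult[OF _ prp_refl])

lemma prp_commute_inverse: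
  assumes x: "x \<in> carrier A" and y: "y \<in> carrier A" "y' \<in> carrier A"
    "y \<otimes>\<^bsub>A\<^esub> y' = \<one>\<^bsub>A\<^esub>" "y' \<otimes>\<^bsub>A\<^esub> y = \<one>\<^bsub>A\<^esub>"
    and p: "prp (x \<otimes>\<^bsub>A\<^esub> y) (y \<otimes>\<^bsub>A\<^esub> x)"
  shows "prp (y' \<otimes>\<^bsub>A\<^esub> x) (x \<otimes>\<^bsub>A\<^esub> y')"
proof -
  have "prp (y' \<otimes>\<^bsub>A\<^esub> ((x \<otimes>\<^bsub>A\<^esub> y) \<otimes>\<^bsub>A\<^esub> y')) (y' \<otimes>\<^bsub>A\<^esub> ((y \<otimes>\<^bsub>A\<^esub> x) \<otimes>\<^bsub>A\<^esub> y'))"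
    using x y p by (intro prp_mult_left prp_mult_right) auto
  moreover have "y' \<otimes>\<^bsub>A\<^esub> ((x \<otimes>\<^bsub>A\<^esub> y) \<otimes>\<^bsub>A\<^esub> y') = y' \<otimes>\<^bsub>A\<^esub> x"
    using x y by (simp add: A.m_assoc)
  moreover have "y' \<otimes>\<^bsub>A\<^esub> ((y \<otimes>\<^bsub>A\<^esub> x) \<otimes>\<^bsub>A\<^esub> y') = (y' \<otimes>\<^bsub>A\<^esub> y) \<otimes>\<^bsub>A\<^esub> x \<otimes>\<^bsub>A\<^esub> y'"
    using x y(1,2) by (simp add: A.m_assoc)
  ultimately show ?thesis using x y by simp
qed

end

text \<open>Elements \<open>y z\<close>, one for each letter, such that inverse letters have inverse values and any two of the
  elements commute up to a nonzero scalar.\<close>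

locale scalar_commuting_letters = kalg K A
  for K :: "('k, 'x) ring_scheme" (structure) and A :: "('k, 'a, 'y) module_scheme" (structure) +
  fixes m :: nat and y :: "torus_gen \<Rightarrow> 'a"
  assumes y_closed: "z \<in> tletters m \<Longrightarrow> y z \<in> carrier A"
    and y_tinv: "z \<in> tletters m \<Longrightarrow> y z \<otimes>\<^bsub>A\<^esub> y (tinv z) = \<one>\<^bsub>A\<^esub>"
    and y_comm: "z \<in> tletters m \<Longrightarrow> z' \<in> tletters m \<Longrightarrow> prp (y z \<otimes>\<^bsub>A\<^esub> y z') (y z' \<otimes>\<^bsub>A\<^esub> y z)"
begin

lemma w_closed: "w \<in> lists (tletters m) \<Longrightarrow> wprod A y w \<in> carrier A"
  by (rule A.wprod_closed) (auto simp: y_closed)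

lemma w_append: "v \<in> lists (tletters m) \<Longrightarrow> w \<in> lists (tletters m) \<Longrightarrow>
    wprod A y (v @ w) = wprod A y v \<otimes>\<^bsub>A\<^esub> wprod A y w"
  by (rule A.wprod_append) (auto simp: y_closed)

lemma letter_word_comm:
  assumes z: "z \<in> tletters m" and w: "w \<in> lists (tletters m)"
  shows "prp (y z \<otimes>\<^bsub>A\<^esub> wprod A y w) (wprod A y w \<otimes>\<^bsub>A\<^esub> y z)"
  using w
proof (induction w)
  case Nil
  then show ?case using z by (simp add: prp_refl y_closed)
next
  case (Cons z' w)
  then have c: "y z \<in> carrier A" "y z' \<in> carrier A" "wprod A y w \<in> carrier A"
    using z by (auto simp: y_closed w_closed)
  have "prp ((y z \<otimes>\<^bsub>A\<^esub> y z') \<otimes>\<^bsub>A\<^esub> wprod A y w) ((y z' \<otimes>\<^bsub>A\<^esub> y z) \<otimes>\<^bsub>A\<^esub> wprod A y w)"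
    using c z Cons by (intro prp_mult_right y_comm) auto
  moreover have "prp (y z' \<otimes>\<^bsub>A\<^esub> (y z \<otimes>\<^bsub>A\<^esub> wprod A y w)) (y z' \<otimes>\<^bsub>A\<^esub> (wprod A y w \<otimes>\<^bsub>A\<^esub> y z))"
    using c Cons by (intro prp_mult_left) auto
  ultimately show ?case using c prp_trans by (simp add: A.m_assoc)
qed

text \<open>A word of degree zero contains the inverse of its first letter; moved next to it at the cost of a
  nonzero scalar, it cancels.\<close>

lemma wdeg_zero_scalar:
  "w \<in> lists (tletters m) \<Longrightarrow> (\<And>i. wdeg w i = 0) \<Longrightarrow> prp (wprod A y w) \<one>\<^bsub>A\<^esub>"
proof (induction w rule: length_induct)
  case (1 w)
  show ?case
  proof (cases w)
    case Nil
    then show ?thesis by (simp add: prp_refl)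
  next
    case (Cons z w1)
    then have "tinv z \<in> set w1" using 1 tinv_mem_of_wdeg_zero by blast
    then obtain p q where pq: "w1 = p @ tinv z # q" by (meson split_list)
    have l: "z \<in> tletters m" "tinv z \<in> tletters m" "p \<in> lists (tletters m)" "q \<in> lists (tletters m)"
      using 1(2) Cons pq by auto
    let ?P = "wprod A y p" and ?Q = "wprod A y q"
    have c: "y z \<in> carrier A" "y (tinv z) \<in> carrier A" "?P \<in> carrier A" "?Q \<in> carrier A"
      using l by (auto simp: y_closed w_closed)
    have "wprod A y w = (y z \<otimes>\<^bsub>A\<^esub> ?P) \<otimes>\<^bsub>A\<^esub> (y (tinv z) \<otimes>\<^bsub>A\<^esub> ?Q)"
      using Cons pq l c by (simp add: w_append A.m_assoc)
    moreover have "prp ((y z \<otimes>\<^bsub>A\<^esub> ?P) \<otimes>\<^bsub>A\<^esub> (y (tinv z) \<otimes>\<^bsub>A\<^esub> ?Q)) ((?P \<otimes>\<^bsub>A\<^esub> y z) \<otimes>\<^bsub>A\<^esub> (y (tinv z) \<otimes>\<^bsub>A\<^esub> ?Q))"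
      using l c by (intro prp_mult_right letter_word_comm) auto
    moreover have "(?P \<otimes>\<^bsub>A\<^esub> y z) \<otimes>\<^bsub>A\<^esub> (y (tinv z) \<otimes>\<^bsub>A\<^esub> ?Q) = ?P \<otimes>\<^bsub>A\<^esub> (y z \<otimes>\<^bsub>A\<^esub> y (tinv z)) \<otimes>\<^bsub>A\<^esub> ?Q"
      using c by (simp add: A.m_assoc)
    moreover have "\<dots> = wprod A y (p @ q)"
      using c l by (simp add: y_tinv w_append)
    moreover have "prp (wprod A y (p @ q)) \<one>\<^bsub>A\<^esub>"
    proof -
      have "wdeg (p @ q) i = 0" for i using 1(3)[of i] Cons pq by simp
      moreover have "length (p @ q) < length w" "p @ q \<in> lists (tletters m)" using Cons pq l by auto
      ultimately show ?thesis using 1(1) by blast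
    qed
    ultimately show ?thesis using prp_trans by simp
  qed
qed

lemma w_rev_tinv:
  "w \<in> lists (tletters m) \<Longrightarrow> wprod A y (rev (map tinv w)) \<otimes>\<^bsub>A\<^esub> wprod A y w = \<one>\<^bsub>A\<^esub>"
proof (induction w)
  case (Cons z w)
  let ?V = "wprod A y (rev (map tinv w))" and ?W = "wprod A y w"
  have l: "rev (map tinv w) \<in> lists (tletters m)" "tinv z \<in> tletters m" "z \<in> tletters m"
    using Cons by (auto simp: tinv_letters)
  have c: "?V \<in> carrier A" "?W \<in> carrier A" "y z \<in> carrier A" "y (tinv z) \<in> carrier A"
    using Cons l by (auto simp: w_closed y_closed)
  have "wprod A y (rev (map tinv (z # w))) \<otimes>\<^bsub>A\<^esub> wprod A y (z # w) =
     ?V \<otimes>\<^bsub>A\<^esub> (y (tinv z) \<otimes>\<^bsub>A\<^esub> y z) \<otimes>\<^bsub>A\<^esub> ?W"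
    using l c by (simp add: w_append A.m_assoc)
  also have "\<dots> = \<one>\<^bsub>A\<^esub>" using y_tinv[of "tinv z"] l c Cons by simp
  finally show ?case .
qed simp

lemma w_proportional:
  assumes v: "v \<in> lists (tletters m)" and w: "w \<in> lists (tletters m)" and d: "\<And>i. wdeg v i = wdeg w i"
  shows "prp (wprod A y v) (wprod A y w)"
proof -
  let ?w' = "rev (map tinv w)"
  have w': "?w' \<in> lists (tletters m)" using w by (auto simp: tinv_letters)
  have "prp (wprod A y (v @ ?w')) \<one>\<^bsub>A\<^esub>"
    using v w' d by (intro wdeg_zero_scalar) auto
  then have "prp (wprod A y (v @ ?w') \<otimes>\<^bsub>A\<^esub> wprod A y w) (\<one>\<^bsub>A\<^esub> \<otimes>\<^bsub>A\<^esub> wprod A y w)"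
    using w by (intro prp_mult_right) (auto simp: w_closed)
  moreover have "wprod A y (v @ ?w') \<otimes>\<^bsub>A\<^esub> wprod A y w = wprod A y v"
    using v w w' w_rev_tinv[OF w] by (simp add: w_append A.m_assoc w_closed)
  ultimately show ?thesis using w by (simp add: w_closed)
qed

end

lemma word_of_degree:
  assumes "c \<in> Zn m"
  shows "\<exists>w \<in> lists (tletters m). \<forall>i. wdeg w i = c i"
proof -
  have "\<exists>w \<in> lists (tletters m). \<forall>i. wdeg w i = (if i \<le> n then c i else 0)" if "n \<le> m" for n
    using that
  proof (induction n)
    case 0
    then show ?case using assms by (intro bexI[of _ "[]"]) (auto simp: Zn_def)
  next
    case (Suc n)
    then obtain w where w: "w \<in> lists (tletters m)" "\<forall>i. wdeg w i = (if i \<le> n then c i else 0)" by auto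
    define v where "v = (if c (Suc n) \<ge> 0 then replicate (nat (c (Suc n))) (Pos (Suc n))
       else replicate (nat (- c (Suc n))) (Neg (Suc n)))"
    have "wdeg (replicate a (Pos b)) i = (if i = b then int a else 0)"
      "wdeg (replicate a (Neg b)) i = (if i = b then - int a else 0)" for a b i
      by (induction a) auto
    then have "wdeg (w @ v) i = (if i \<le> Suc n then c i else 0)" for i
      using w(2) by (auto simp: v_def le_Suc_eq)
    moreover have "w @ v \<in> lists (tletters m)"
      using w(1) Suc by (auto simp: v_def tletters_def)
    ultimately show ?case by blast
  qed
  from this[of m] obtain w where w: "w \<in> lists (tletters m)" "\<forall>i. wdeg w i = (if i \<le> m then c i else 0)" by auto
  moreover have "(if i \<le> m then c i else 0) = c i" for i using assms by (auto simp: Zn_def)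
  ultimately show ?thesis by auto
qed

subsection \<open>The presented algebra\<close>

text \<open>The defining relations of the torus.\<close>

definition torus_rels :: "('k, 'x) ring_scheme \<Rightarrow> nat \<Rightarrow> 'k \<Rightarrow> ((torus_gen list \<Rightarrow> 'k) \<times> (torus_gen list \<Rightarrow> 'k)) set"
  where "torus_rels K m q = (let F = free_alg K (tletters m) in
           {(var K (Pos i) \<otimes>\<^bsub>F\<^esub> var K (Neg i), \<one>\<^bsub>F\<^esub>) | i. i \<in> {1..m}} \<union>
           {(var K (Neg i) \<otimes>\<^bsub>F\<^esub> var K (Pos i), \<one>\<^bsub>F\<^esub>) | i. i \<in> {1..m}} \<union>
           {(var K (Pos i) \<otimes>\<^bsub>F\<^esub> var K (Pos j), q \<odot>\<^bsub>F\<^esub> (var K (Pos j) \<otimes>\<^bsub>F\<^esub> var K (Pos i))) | i j.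
             i \<in> {1..m} \<and> j \<in> {1..m} \<and> i < j})"

text \<open>The class of a word in the torus.\<close>

definition tword :: "('k, 'x) ring_scheme \<Rightarrow> nat \<Rightarrow> 'k \<Rightarrow> torus_gen list \<Rightarrow> (torus_gen list \<Rightarrow> 'k) set"
  where "tword K m q w = (let F = free_alg K (tletters m) in rel_ideal F (torus_rels K m q) +>\<^bsub>F\<^esub> basis_elt K w)"

lemma torus_alg_eq: "torus_alg K m q =
    (let F = free_alg K (tletters m) in quot_alg F (rel_ideal F (torus_rels K m q)))"
  by (simp add: torus_alg_def torus_rels_def tletters_def Let_def)

text \<open>The torus \<open>Tm\<close> in \<open>m\<close> generators with the nonzero parameter \<open>q\<close>, as a quotient of the free algebra \<open>F\<close>.\<close>

locale torus = K?: field K for K :: "('k, 'x) ring_scheme" (structure) +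
  fixes m :: nat and q
  assumes q: "q \<in> carrier K" "q \<noteq> \<zero>"
begin

abbreviation "F \<equiv> free_alg K (tletters m)"
abbreviation "Tm \<equiv> torus_alg K m q"
abbreviation "J \<equiv> rel_ideal F (torus_rels K m q)"

sublocale M: monoid_algebra K "free_monoid (tletters m)"
  by (rule free_monoid_algebra) (rule K.field_axioms)

sublocale F: kalg K F by (rule M.monoid_alg_kalg)

lemma var_closed: "z \<in> tletters m \<Longrightarrow> var K z \<in> carrier F"
  using M.basis_elt_closed[of "[z]"] by simp

lemma letters_mem: "i \<in> {1..m} \<Longrightarrow> Pos i \<in> tletters m" "i \<in> {1..m} \<Longrightarrow> Neg i \<in> tletters m"
  by (auto simp: tletters_def)

lemma torus_rels_closed: "torus_rels K m q \<subseteq> carrier F \<times> carrier F"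
  using var_closed letters_mem q unfolding torus_rels_def Let_def
  by (auto intro!: F.m_closed F.smult_closed)

sublocale Q: kalg_ideal K F J
  by (intro kalg_ideal.intro rel_ideal_ideal F.ring_axioms F.kalg_axioms torus_rels_closed)

lemma Tm_eq: "Tm = quot_alg F J" by (simp add: torus_alg_eq Let_def)
lemma tword_eq: "tword K m q w = Q.cls (basis_elt K w)" by (simp add: tword_def Let_def)

sublocale T: kalg K Tm unfolding Tm_eq by (rule Q.quot_kalg)

lemma tword_closed: "w \<in> lists (tletters m) \<Longrightarrow> tword K m q w \<in> carrier Tm"
  unfolding Tm_eq tword_eq using M.basis_elt_closed[of w] by (simp add: Q.cls_closed)

lemma tword_append: "v \<in> lists (tletters m) \<Longrightarrow> w \<in> lists (tletters m) \<Longrightarrow>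
   tword K m q (v @ w) = tword K m q v \<otimes>\<^bsub>Tm\<^esub> tword K m q w"
  unfolding Tm_eq tword_eq using M.basis_elt_closed[of w] M.basis_elt_closed[of v] M.basis_elt_mult[of v w]
  by (simp flip: Q.cls_mult)

lemma tword_Nil: "tword K m q [] = \<one>\<^bsub>Tm\<^esub>"
  unfolding Tm_eq tword_eq using M.basis_elt_one by (simp add: Q.cls_one)

lemma tword_wprod: "w \<in> lists (tletters m) \<Longrightarrow> tword K m q w = wprod Tm (\<lambda>z. tword K m q [z]) w"
proof (induction w)
  case (Cons z w)
  then show ?case using tword_append[of "[z]" w] by simp
qed (simp add: tword_Nil)

lemma torus_kspan: "carrier Tm = kspan K Tm (tword K m q ` lists (tletters m))"
  unfolding Tm_eq tword_eq[abs_def]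
  using M.presented_kspan[OF Q.is_ideal] by simp

lemma cls_rel: "(u, v) \<in> torus_rels K m q \<Longrightarrow> Q.cls u = Q.cls v"
  using torus_rels_closed rel_ideal_rel[OF F.ring_axioms torus_rels_closed]
  by (subst Q.cls_eq_iff) auto

lemma tword_Pos_Neg:
  assumes i: "i \<in> {1..m}"
  shows "tword K m q [Pos i] \<otimes>\<^bsub>Tm\<^esub> tword K m q [Neg i] = \<one>\<^bsub>Tm\<^esub>"
    and "tword K m q [Neg i] \<otimes>\<^bsub>Tm\<^esub> tword K m q [Pos i] = \<one>\<^bsub>Tm\<^esub>"
proof -
  have "(var K (Pos i) \<otimes>\<^bsub>F\<^esub> var K (Neg i), \<one>\<^bsub>F\<^esub>) \<in> torus_rels K m q"
    "(var K (Neg i) \<otimes>\<^bsub>F\<^esub> var K (Pos i), \<one>\<^bsub>F\<^esub>) \<in> torus_rels K m q"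
    using i by (auto simp: torus_rels_def Let_def)
  from this[THEN cls_rel] show "tword K m q [Pos i] \<otimes>\<^bsub>Tm\<^esub> tword K m q [Neg i] = \<one>\<^bsub>Tm\<^esub>"
    "tword K m q [Neg i] \<otimes>\<^bsub>Tm\<^esub> tword K m q [Pos i] = \<one>\<^bsub>Tm\<^esub>"
    using i letters_mem[OF i, THEN var_closed] unfolding Tm_eq tword_eq
    by (simp_all flip: Q.cls_mult Q.cls_one)
qed

lemma tword_Pos_Pos:
  assumes i: "i \<in> {1..m}" "j \<in> {1..m}" "i < j"
  shows "tword K m q [Pos i] \<otimes>\<^bsub>Tm\<^esub> tword K m q [Pos j] =
     q \<odot>\<^bsub>Tm\<^esub> (tword K m q [Pos j] \<otimes>\<^bsub>Tm\<^esub> tword K m q [Pos i])"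
proof -
  have "(var K (Pos i) \<otimes>\<^bsub>F\<^esub> var K (Pos j), q \<odot>\<^bsub>F\<^esub> (var K (Pos j) \<otimes>\<^bsub>F\<^esub> var K (Pos i))) \<in> torus_rels K m q"
    unfolding torus_rels_def Let_def by (rule UnI2) (use i in blast)
  from this[THEN cls_rel] show ?thesis
    using i letters_mem[THEN var_closed] q unfolding Tm_eq tword_eq
    by (simp flip: Q.cls_mult Q.cls_smult)
qed

text \<open>The relations concern pairs of generators with increasing indices; proportionality passes to
  inverses by conjugation.\<close>

sublocale S: scalar_commuting_letters K Tm m "\<lambda>z. tword K m q [z]"
proof
  let ?y = "\<lambda>z. tword K m q [z]"
  show c: "?y z \<in> carrier Tm" if "z \<in> tletters m" for z
    using that tword_closed[of "[z]"] by simp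
  show inv: "?y z \<otimes>\<^bsub>Tm\<^esub> ?y (tinv z) = \<one>\<^bsub>Tm\<^esub>" if "z \<in> tletters m" for z
    using that tword_Pos_Neg by (auto simp: tletters_def)
  have inv': "?y (tinv z) \<otimes>\<^bsub>Tm\<^esub> ?y z = \<one>\<^bsub>Tm\<^esub>" if "z \<in> tletters m" for z
    using inv[OF tinv_letters[OF that]] by simp
  have pp: "T.prp (?y (Pos i) \<otimes>\<^bsub>Tm\<^esub> ?y (Pos j)) (?y (Pos j) \<otimes>\<^bsub>Tm\<^esub> ?y (Pos i))"
    if ij: "i \<in> {1..m}" "j \<in> {1..m}" for i j
  proof -
    have lt: "T.prp (?y (Pos i) \<otimes>\<^bsub>Tm\<^esub> ?y (Pos j)) (?y (Pos j) \<otimes>\<^bsub>Tm\<^esub> ?y (Pos i))"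
      if "i \<in> {1..m}" "j \<in> {1..m}" "i < j" for i j
      using tword_Pos_Pos[OF that] q by (auto simp: T.prp_def)
    have cl: "?y (Pos i) \<in> carrier Tm" "?y (Pos j) \<in> carrier Tm" using ij letters_mem c by auto
    consider "i < j" | "j < i" | "i = j" by linarith
    then show ?thesis
      proof cases
      case 1
      then show ?thesis using lt ij by blast
    next
      case 2
      show ?thesis
        by (rule T.prp_sym[OF lt[OF ij(2,1) 2] T.A.m_closed[OF cl]])
    next
      case 3
      then show ?thesis using T.prp_refl[OF T.A.m_closed[OF cl]] by simp
    qed
  qed
  have ext: "T.prp (?y z \<otimes>\<^bsub>Tm\<^esub> x) (x \<otimes>\<^bsub>Tm\<^esub> ?y z)"
    if x: "x \<in> carrier Tm" and z: "z \<in> tletters m"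
      and h: "\<And>i. i \<in> {1..m} \<Longrightarrow> T.prp (?y (Pos i) \<otimes>\<^bsub>Tm\<^esub> x) (x \<otimes>\<^bsub>Tm\<^esub> ?y (Pos i))" for x z
  proof (cases z)
    case (Pos i)
    then show ?thesis using h z by (auto simp: tletters_def)
  next
    case (Neg i)
    then have i: "i \<in> {1..m}" using z by (auto simp: tletters_def)
    note l = letters_mem[OF i]
    have "T.prp (x \<otimes>\<^bsub>Tm\<^esub> ?y (Pos i)) (?y (Pos i) \<otimes>\<^bsub>Tm\<^esub> x)"
      by (rule T.prp_sym[OF h[OF i] T.A.m_closed[OF x c[OF l(1)]]])
    then show ?thesis
      unfolding Neg
      by (rule T.prp_commute_inverse[OF x c[OF l(1)] c[OF l(2)] tword_Pos_Neg[OF i]])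
  qed
  show "T.prp (?y z \<otimes>\<^bsub>Tm\<^esub> ?y z') (?y z' \<otimes>\<^bsub>Tm\<^esub> ?y z)"
    if z: "z \<in> tletters m" "z' \<in> tletters m" for z z'
  proof (rule ext[OF c[OF z(2)] z(1)])
    fix i assume i: "i \<in> {1..m}"
    have "T.prp (?y z' \<otimes>\<^bsub>Tm\<^esub> ?y (Pos i)) (?y (Pos i) \<otimes>\<^bsub>Tm\<^esub> ?y z')"
      by (rule ext[OF c[OF letters_mem(1)[OF i]] z(2)]) (rule pp[OF _ i])
    then show "T.prp (?y (Pos i) \<otimes>\<^bsub>Tm\<^esub> ?y z') (?y z' \<otimes>\<^bsub>Tm\<^esub> ?y (Pos i))"
      by (rule T.prp_sym[OF _ T.A.m_closed[OF c[OF letters_mem(1)[OF i]] c[OF z(2)]]])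
  qed
qed

lemma tword_proportional:
  "v \<in> lists (tletters m) \<Longrightarrow> w \<in> lists (tletters m) \<Longrightarrow> (\<And>i. wdeg v i = wdeg w i) \<Longrightarrow>
   T.prp (tword K m q v) (tword K m q w)"
  using S.w_proportional by (simp flip: tword_wprod)

text \<open>The universal property of the torus.\<close>

lemma torus_hom_ex:
  assumes B: "kalg K B" and y: "\<And>z. z \<in> tletters m \<Longrightarrow> y z \<in> carrier B"
    and inv: "\<And>z. z \<in> tletters m \<Longrightarrow> y z \<otimes>\<^bsub>B\<^esub> y (tinv z) = \<one>\<^bsub>B\<^esub>"
    and comm: "\<And>i j. i \<in> {1..m} \<Longrightarrow> j \<in> {1..m} \<Longrightarrow> i < j \<Longrightarrow>
       y (Pos i) \<otimes>\<^bsub>B\<^esub> y (Pos j) = q \<odot>\<^bsub>B\<^esub> (y (Pos j) \<otimes>\<^bsub>B\<^esub> y (Pos i))"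
  shows "\<exists>f \<in> alg_hom K Tm B. \<forall>w \<in> lists (tletters m). f (tword K m q w) = wprod B y w"
proof -
  interpret B: kalg K B by fact
  have h: "\<And>u. u \<in> carrier (free_monoid (tletters m)) \<Longrightarrow> wprod B y u \<in> carrier B"
    using B.A.wprod_closed[of "tletters m" y] y by auto
  have hm: "\<And>u v. u \<in> carrier (free_monoid (tletters m)) \<Longrightarrow> v \<in> carrier (free_monoid (tletters m)) \<Longrightarrow>
     wprod B y (u \<otimes>\<^bsub>free_monoid (tletters m)\<^esub> v) = wprod B y u \<otimes>\<^bsub>B\<^esub> wprod B y v"
    using B.A.wprod_append[of "tletters m" y] y by auto
  have h1: "wprod B y \<one>\<^bsub>free_monoid (tletters m)\<^esub> = \<one>\<^bsub>B\<^esub>" by simp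
  note L = M.lin_alg_hom[OF B h h1 hm]
  note LD = alg_homD[OF L]
  have Lv: "lin K B (wprod B y) (var K z) = y z" if "z \<in> tletters m" for z
    unfolding basis_elt_single using that y h
    by (subst B.lin_single[where S = "carrier (free_monoid (tletters m))"]) auto
  have r: "lin K B (wprod B y) u = lin K B (wprod B y) v" if uv: "(u, v) \<in> torus_rels K m q" for u v
  proof -
    have inv': "y (Pos i) \<otimes>\<^bsub>B\<^esub> y (Neg i) = \<one>\<^bsub>B\<^esub>" "y (Neg i) \<otimes>\<^bsub>B\<^esub> y (Pos i) = \<one>\<^bsub>B\<^esub>" if "i \<in> {1..m}" for i
      using inv[of "Pos i"] inv[of "Neg i"] letters_mem[OF that] by simp_all
    note simps = LD Lv letters_mem var_closed inv'
      comm F.m_closed q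
    from uv show ?thesis unfolding torus_rels_def Let_def
      by (elim UnE CollectE exE conjE) (simp_all only: prod.inject simps)
  qed
  show ?thesis
    using M.presented_hom_ex[OF B h h1 hm torus_rels_closed r]
    unfolding Tm_eq tword_eq by simp
qed

end

section \<open>Tensor products of algebras\<close>

text \<open>The multilinearity relations of the tensor product.\<close>

definition tensor_rels :: "('k, 'x) ring_scheme \<Rightarrow> 'i set \<Rightarrow> ('i \<Rightarrow> ('k, 'a) module) \<Rightarrow>
    ((('i \<Rightarrow> 'a) \<Rightarrow> 'k) \<times> (('i \<Rightarrow> 'a) \<Rightarrow> 'k)) set"
  where "tensor_rels K I F = (let P = monoid_alg K (product_group I F); e = basis_elt K in
           {(e (x(i := u \<oplus>\<^bsub>F i\<^esub> v)), e (x(i := u)) \<oplus>\<^bsub>P\<^esub> e (x(i := v))) | x i u v.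
             x \<in> (\<Pi>\<^sub>E j\<in>I. carrier (F j)) \<and> i \<in> I \<and> u \<in> carrier (F i) \<and> v \<in> carrier (F i)} \<union>
           {(e (x(i := c \<odot>\<^bsub>F i\<^esub> u)), c \<odot>\<^bsub>P\<^esub> e (x(i := u))) | x i c u.
             x \<in> (\<Pi>\<^sub>E j\<in>I. carrier (F j)) \<and> i \<in> I \<and> c \<in> carrier K \<and> u \<in> carrier (F i)})"

text \<open>The class of a pure tensor.\<close>

definition tpure :: "('k, 'x) ring_scheme \<Rightarrow> 'i set \<Rightarrow> ('i \<Rightarrow> ('k, 'a) module) \<Rightarrow> ('i \<Rightarrow> 'a) \<Rightarrow>
    (('i \<Rightarrow> 'a) \<Rightarrow> 'k) set"
  where "tpure K I F x = (let P = monoid_alg K (product_group I F) in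
     rel_ideal P (tensor_rels K I F) +>\<^bsub>P\<^esub> basis_elt K x)"

lemma tensor_alg_eq: "tensor_alg K I F = (let P = monoid_alg K (product_group I F) in
    quot_alg P (rel_ideal P (tensor_rels K I F)))"
  by (simp add: tensor_alg_def tensor_rels_def Let_def)

lemma product_group_monoid:
  assumes "\<And>i. i \<in> I \<Longrightarrow> monoid (F i)"
  shows "monoid (product_group I F)"
proof (rule monoidI)
  fix x y z assume "x \<in> carrier (product_group I F)" "y \<in> carrier (product_group I F)"
    "z \<in> carrier (product_group I F)"
  then show "x \<otimes>\<^bsub>product_group I F\<^esub> y \<otimes>\<^bsub>product_group I F\<^esub> z =
      x \<otimes>\<^bsub>product_group I F\<^esub> (y \<otimes>\<^bsub>product_group I F\<^esub> z)"
    using assms by (auto simp: fun_eq_iff restrict_def PiE_iff monoid.m_assoc)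
next
  fix x assume x: "x \<in> carrier (product_group I F)"
  then show "\<one>\<^bsub>product_group I F\<^esub> \<otimes>\<^bsub>product_group I F\<^esub> x = x"
    "x \<otimes>\<^bsub>product_group I F\<^esub> \<one>\<^bsub>product_group I F\<^esub> = x"
    using assms by (auto simp: fun_eq_iff restrict_def PiE_iff monoid.l_one monoid.r_one extensional_def)
qed (use assms in \<open>auto simp: monoid.m_closed monoid.one_closed PiE_iff\<close>)

text \<open>A finite family of \<open>K\<close>-algebras and its tensor product \<open>T\<close>; \<open>C\<close> is the product of the carriers.\<close>

locale tensor = K?: field K for K :: "('k, 'x) ring_scheme" (structure) +
  fixes I :: "'i set" and F :: "'i \<Rightarrow> ('k, 'a) module"
  assumes F_kalg: "i \<in> I \<Longrightarrow> kalg K (F i)"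
    and finI: "finite I"
begin

abbreviation "P \<equiv> monoid_alg K (product_group I F)"
abbreviation "T \<equiv> tensor_alg K I F"
abbreviation "J \<equiv> rel_ideal P (tensor_rels K I F)"
abbreviation "C \<equiv> (\<Pi>\<^sub>E j\<in>I. carrier (F j))"

lemma F_ring: "i \<in> I \<Longrightarrow> ring (F i)"
  using F_kalg by (auto simp: kalg_def)

lemma F_monoid: "i \<in> I \<Longrightarrow> monoid (F i)"
  using F_ring by (simp add: ring_def)

sublocale M: monoid_algebra K "product_group I F"
  by (intro monoid_algebra.intro K.field_axioms product_group_monoid F_monoid)

sublocale P: kalg K P by (rule M.monoid_alg_kalg)

lemma pure_closed: "x \<in> C \<Longrightarrow> basis_elt K x \<in> carrier P"
  by (rule M.basis_elt_closed) simp

lemma upd_closed: "x \<in> C \<Longrightarrow> i \<in> I \<Longrightarrow> u \<in> carrier (F i) \<Longrightarrow> x(i := u) \<in> C"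
  by (auto simp: PiE_iff extensional_def)

lemma F_closed:
  "i \<in> I \<Longrightarrow> u \<in> carrier (F i) \<Longrightarrow> v \<in> carrier (F i) \<Longrightarrow> u \<oplus>\<^bsub>F i\<^esub> v \<in> carrier (F i)"
  "i \<in> I \<Longrightarrow> c \<in> carrier K \<Longrightarrow> u \<in> carrier (F i) \<Longrightarrow> c \<odot>\<^bsub>F i\<^esub> u \<in> carrier (F i)"
  using F_ring[of i] kalg.smult_closed'[OF F_kalg, of i] by (simp_all add: ring.ring_simprules)

lemma tensor_rels_closed: "tensor_rels K I F \<subseteq> carrier P \<times> carrier P"
  unfolding tensor_rels_def Let_def
  by (intro Un_least subsetI; elim CollectE exE conjE; simp only: mem_Sigma_iff;
      intro conjI P.A.a_closed P.smult_closed pure_closed upd_closed F_closed; assumption)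

sublocale Q: kalg_ideal K P J
  by (intro kalg_ideal.intro rel_ideal_ideal P.ring_axioms P.kalg_axioms tensor_rels_closed)

lemma T_eq: "T = quot_alg P J" by (simp add: tensor_alg_eq Let_def)
lemma tpure_eq: "tpure K I F x = Q.cls (basis_elt K x)" by (simp add: tpure_def Let_def)

sublocale T: kalg K T unfolding T_eq by (rule Q.quot_kalg)

lemma tpure_closed: "x \<in> C \<Longrightarrow> tpure K I F x \<in> carrier T"
  unfolding T_eq tpure_eq by (rule Q.cls_closed) (rule pure_closed)

lemma tensor_kspan_pure: "carrier T = kspan K T (tpure K I F ` C)"
  unfolding T_eq tpure_eq[abs_def]
  using M.presented_kspan[OF Q.is_ideal] by simp

lemma cls_rel: "(u, v) \<in> tensor_rels K I F \<Longrightarrow> Q.cls u = Q.cls v"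
  using tensor_rels_closed rel_ideal_rel[OF P.ring_axioms tensor_rels_closed]
  by (subst Q.cls_eq_iff) auto

lemma tpure_add:
  assumes "x \<in> C" "i \<in> I" "u \<in> carrier (F i)" "v \<in> carrier (F i)"
  shows "tpure K I F (x(i := u \<oplus>\<^bsub>F i\<^esub> v)) = tpure K I F (x(i := u)) \<oplus>\<^bsub>T\<^esub> tpure K I F (x(i := v))"
proof -
  have "(basis_elt K (x(i := u \<oplus>\<^bsub>F i\<^esub> v)), basis_elt K (x(i := u)) \<oplus>\<^bsub>P\<^esub> basis_elt K (x(i := v)))
      \<in> tensor_rels K I F"
    unfolding tensor_rels_def Let_def by (rule UnI1) (use assms in blast)
  from cls_rel[OF this] show ?thesis
    unfolding T_eq tpure_eq using assms by (simp only: Q.cls_add pure_closed upd_closed)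
qed

lemma tpure_smult:
  assumes "x \<in> C" "i \<in> I" "c \<in> carrier K" "u \<in> carrier (F i)"
  shows "tpure K I F (x(i := c \<odot>\<^bsub>F i\<^esub> u)) = c \<odot>\<^bsub>T\<^esub> tpure K I F (x(i := u))"
proof -
  have "(basis_elt K (x(i := c \<odot>\<^bsub>F i\<^esub> u)), c \<odot>\<^bsub>P\<^esub> basis_elt K (x(i := u))) \<in> tensor_rels K I F"
    unfolding tensor_rels_def Let_def by (rule UnI2) (use assms in blast)
  from cls_rel[OF this] show ?thesis
    unfolding T_eq tpure_eq using assms by (simp only: Q.cls_smult pure_closed upd_closed)
qed

lemma tensor_kspan:
  assumes S: "\<And>i. i \<in> I \<Longrightarrow> S i \<subseteq> carrier (F i)" "\<And>i. i \<in> I \<Longrightarrow> carrier (F i) = kspan K (F i) (S i)"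
  shows "carrier T = kspan K T (tpure K I F ` (\<Pi>\<^sub>E j\<in>I. S j))"
proof -
  let ?S = "tpure K I F ` (\<Pi>\<^sub>E j\<in>I. S j)"
  have SC: "(\<Pi>\<^sub>E j\<in>I. S j) \<subseteq> C" using S(1) by (auto simp: PiE_iff)
  then have Sc: "?S \<subseteq> carrier T" using tpure_closed by auto
  \<comment> \<open>The factors are expanded one at a time; \<open>N\<close> is the set of positions that are still arbitrary.\<close>
  have "tpure K I F x \<in> kspan K T ?S"
    if "finite N" "N \<subseteq> I" "x \<in> (\<Pi>\<^sub>E j\<in>I. if j \<in> N then carrier (F j) else S j)" for N x
    using that
  proof (induction N arbitrary: x rule: finite_induct)
    case empty
    then show ?case using T.kspan_base[OF Sc] by auto
  next
    case (insert i N)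
    interpret Fi: kalg K "F i" using F_kalg insert by auto
    have xC: "x \<in> C" using insert.prems S(1) by (auto simp: PiE_iff split: if_splits)
    have i: "i \<in> I" using insert by auto
    have U: "tpure K I F (x(i := u)) \<in> kspan K T ?S" if "u \<in> kspan K (F i) (S i)" for u
      using that
    proof induction
      case kspan_zero
      have "tpure K I F (x(i := \<zero>\<^bsub>K\<^esub> \<odot>\<^bsub>F i\<^esub> \<zero>\<^bsub>F i\<^esub>)) = \<zero>\<^bsub>T\<^esub>"
        using tpure_smult[OF xC i, of "\<zero>" "\<zero>\<^bsub>F i\<^esub>"] tpure_closed upd_closed[OF xC i] by simp
      then show ?case using kspan.kspan_zero[of T] by (simp del: fun_upd_apply)
    next
      case (kspan_step u c s)
      have s: "s \<in> carrier (F i)" using kspan_step S(1)[OF i] by auto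
      have u: "u \<in> carrier (F i)" using kspan_step S(2)[OF i] by auto
      have "x(i := s) \<in> (\<Pi>\<^sub>E j\<in>I. if j \<in> N then carrier (F j) else S j)"
        using insert.prems insert.hyps kspan_step i by (auto simp: PiE_iff extensional_def split: if_splits)
      then have "tpure K I F (x(i := s)) \<in> kspan K T ?S" using insert by auto
      then have "tpure K I F (x(i := u)) \<oplus>\<^bsub>T\<^esub> c \<odot>\<^bsub>T\<^esub> tpure K I F (x(i := s)) \<in> kspan K T ?S"
        using kspan_step Sc by (intro T.kspan_add T.kspan_smult)
      then show ?case
        using xC i u s kspan_step by (simp add: tpure_add tpure_smult del: fun_upd_apply)
    qed
    have "x i \<in> kspan K (F i) (S i)" using PiE_mem[OF xC i] S(2)[OF i] by simp
    from U[OF this] show ?case by simp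
  qed
  from this[OF finI order_refl] have "tpure K I F ` C \<subseteq> kspan K T ?S"
    by (auto cong: PiE_cong)
  then have "carrier T \<subseteq> kspan K T ?S"
    using T.kspan_subset[OF Sc] tensor_kspan_pure by blast
  then show ?thesis using T.kspan_carrier[OF Sc] by blast
qed

lemma tpure_prp:
  assumes x: "x \<in> C" and y: "y \<in> C" and p: "\<And>i. i \<in> I \<Longrightarrow> kalg.prp K (F i) (x i) (y i)"
  shows "T.prp (tpure K I F x) (tpure K I F y)"
proof -
  have "T.prp (tpure K I F (\<lambda>i. if i \<in> N then x i else y i)) (tpure K I F y)"
    if "finite N" "N \<subseteq> I" for N
    using that
  proof (induction N rule: finite_induct)
    case empty
    then show ?case using y by (simp add: T.prp_refl tpure_closed)
  next
    case (insert i N)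
    interpret Fi: kalg K "F i" using F_kalg insert by auto
    let ?z = "\<lambda>j. if j \<in> N then x j else y j"
    have i: "i \<in> I" "i \<notin> N" using insert by auto
    have z: "?z \<in> C" using x y by (auto simp: PiE_iff extensional_def)
    obtain c where c: "c \<in> carrier K - {\<zero>}" "x i = c \<odot>\<^bsub>F i\<^esub> y i"
      using p[OF i(1)] by (auto simp: Fi.prp_def)
    have yi: "y i \<in> carrier (F i)" using y i by auto
    have "(\<lambda>j. if j \<in> insert i N then x j else y j) = ?z(i := c \<odot>\<^bsub>F i\<^esub> y i)"
      using c by auto
    then have "tpure K I F (\<lambda>j. if j \<in> insert i N then x j else y j) = c \<odot>\<^bsub>T\<^esub> tpure K I F (?z(i := y i))"
      using tpure_smult[OF z i(1) _ yi, of c] c by simp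
    moreover have "?z(i := y i) = ?z" using i by auto
    ultimately have "T.prp (tpure K I F (\<lambda>j. if j \<in> insert i N then x j else y j)) (tpure K I F ?z)"
      using c unfolding T.prp_def by auto
    then show ?case using insert T.prp_trans tpure_closed[OF y] by blast
  qed
  from this[OF finI order_refl] have "T.prp (tpure K I F (\<lambda>i. if i \<in> I then x i else y i)) (tpure K I F y)" .
  moreover have "(\<lambda>i. if i \<in> I then x i else y i) = x"
    using x y by (auto simp: PiE_iff extensional_def)
  ultimately show ?thesis by simp
qed

end

context monoid begin

lemma wprod_cong: "(\<And>z. z \<in> set w \<Longrightarrow> y z = y' z) \<Longrightarrow> wprod G y w = wprod G y' w"
  by (induction w) auto

lemma wprod_commute:
  assumes "x \<in> carrier G" "\<And>i. i \<in> set L \<Longrightarrow> f i \<in> carrier G"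
    and "\<And>i. i \<in> set L \<Longrightarrow> f i \<otimes> x = x \<otimes> f i"
  shows "wprod G f L \<otimes> x = x \<otimes> wprod G f L"
  using assms(2,3)
proof (induction L)
  case Nil
  then show ?case using assms(1) by simp
next
  case (Cons j L)
  have j: "f j \<in> carrier G" "wprod G f L \<in> carrier G" "f j \<otimes> x = x \<otimes> f j"
    using Cons.prems by (auto intro!: wprod_closed[where S = "set L"])
  have "f j \<otimes> wprod G f L \<otimes> x = f j \<otimes> (x \<otimes> wprod G f L)"
    using j assms(1) Cons by (simp add: m_assoc)
  also have "\<dots> = x \<otimes> (f j \<otimes> wprod G f L)"
    using j assms(1) by (simp flip: m_assoc)
  finally show ?case by simp
qed

lemma wprod_mult:
  assumes "distinct L" "\<And>i. i \<in> set L \<Longrightarrow> f i \<in> carrier G" "\<And>i. i \<in> set L \<Longrightarrow> g i \<in> carrier G"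
    and "\<And>i j. i \<in> set L \<Longrightarrow> j \<in> set L \<Longrightarrow> i \<noteq> j \<Longrightarrow> f i \<otimes> g j = g j \<otimes> f i"
  shows "wprod G (\<lambda>i. f i \<otimes> g i) L = wprod G f L \<otimes> wprod G g L"
  using assms
proof (induction L)
  case (Cons i L)
  have c: "wprod G f L' \<in> carrier G" "wprod G g L' \<in> carrier G" if "set L' \<subseteq> set L" for L'
    using that Cons.prems by (auto intro!: wprod_closed[where S = "set L"])
  have comm: "wprod G f L \<otimes> g i = g i \<otimes> wprod G f L"
    by (rule wprod_commute) (use Cons.prems in auto)
  have fg: "f i \<in> carrier G" "g i \<in> carrier G" using Cons.prems by auto
  note c' = c[OF order_refl]
  have "wprod G (\<lambda>i. f i \<otimes> g i) (i # L) = f i \<otimes> (g i \<otimes> wprod G f L) \<otimes> wprod G g L"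
    using Cons fg c' by (simp add: m_assoc)
  also have "\<dots> = f i \<otimes> (wprod G f L \<otimes> g i) \<otimes> wprod G g L" using comm by simp
  also have "\<dots> = wprod G f (i # L) \<otimes> wprod G g (i # L)"
    using fg c' by (simp add: m_assoc)
  finally show ?case .
qed simp

end

context tensor begin

text \<open>The universal property of the tensor product: homomorphisms with pairwise commuting images induce
  a homomorphism on the tensor product. The list \<open>L\<close> fixes an order for the products in \<open>B\<close>.\<close>

lemma tensor_hom_ex:
  assumes B: "kalg K B" and f: "\<And>i. i \<in> I \<Longrightarrow> f i \<in> alg_hom K (F i) B"
    and comm: "\<And>i j u v. i \<in> I \<Longrightarrow> j \<in> I \<Longrightarrow> i \<noteq> j \<Longrightarrow> u \<in> carrier (F i) \<Longrightarrow> v \<in> carrier (F j) \<Longrightarrow>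
      f i u \<otimes>\<^bsub>B\<^esub> f j v = f j v \<otimes>\<^bsub>B\<^esub> f i u"
    and L: "distinct L" "set L = I"
  shows "\<exists>g \<in> alg_hom K T B. \<forall>x \<in> C. g (tpure K I F x) = wprod B (\<lambda>i. f i (x i)) L"
proof -
  interpret B: kalg K B by fact
  let ?h = "\<lambda>x. wprod B (\<lambda>i. f i (x i)) L"
  note fD = alg_homD[OF f]
  have fc: "f i (x i) \<in> carrier B" if "x \<in> C" "i \<in> I" for x i using that fD by auto
  have h: "?h x \<in> carrier B" if "x \<in> carrier (product_group I F)" for x
    by (rule B.A.wprod_closed[where S = I]) (use that fc L in auto)
  have h1: "?h \<one>\<^bsub>product_group I F\<^esub> = \<one>\<^bsub>B\<^esub>"
  proof -
    have "wprod B (\<lambda>i. f i (\<one>\<^bsub>product_group I F\<^esub> i)) M = \<one>\<^bsub>B\<^esub>" if "set M \<subseteq> I" for M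
      using that by (induction M) (auto simp: fD(4))
    then show ?thesis using L by simp
  qed
  have hm: "?h (x \<otimes>\<^bsub>product_group I F\<^esub> y) = ?h x \<otimes>\<^bsub>B\<^esub> ?h y"
    if "x \<in> carrier (product_group I F)" "y \<in> carrier (product_group I F)" for x y
  proof -
    have xy: "x \<in> C" "y \<in> C" using that by auto
    have "?h (x \<otimes>\<^bsub>product_group I F\<^esub> y) = wprod B (\<lambda>i. f i (x i) \<otimes>\<^bsub>B\<^esub> f i (y i)) L"
      by (rule B.A.wprod_cong) (use L fD(2) PiE_mem[OF xy(1)] PiE_mem[OF xy(2)] in auto)
    also have "\<dots> = ?h x \<otimes>\<^bsub>B\<^esub> ?h y"
      by (rule B.A.wprod_mult)
        (use L fc[OF xy(1)] fc[OF xy(2)] comm[OF _ _ _ PiE_mem[OF xy(1)] PiE_mem[OF xy(2)]] in auto)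
    finally show ?thesis .
  qed
  note LD = alg_homD[OF M.lin_alg_hom[OF B h h1 hm]]
  have Lp: "lin K B ?h (basis_elt K x) = ?h x" if "x \<in> C" for x
    unfolding basis_elt_single using that h
    by (subst B.lin_single[where S = "carrier (product_group I F)"]) auto
  \<comment> \<open>As a function of the factor at position \<open>i\<close> alone, \<open>?h\<close> is \<open>f i\<close> multiplied by constants from both sides.\<close>
  have upd: "\<exists>a b. a \<in> carrier B \<and> b \<in> carrier B \<and> (\<forall>u \<in> carrier (F i). ?h (x(i := u)) = a \<otimes>\<^bsub>B\<^esub> (f i u \<otimes>\<^bsub>B\<^esub> b))"
    if x: "x \<in> C" and i: "i \<in> I" for x i
  proof -
    obtain p q where pq: "L = p @ i # q" using i L by (meson split_list)
    then have n: "i \<notin> set p" "i \<notin> set q" "set p \<subseteq> I" "set q \<subseteq> I" using L by auto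
    let ?w = "wprod B (\<lambda>i. f i (x i))"
    have c: "?w p \<in> carrier B" "?w q \<in> carrier B"
      using n fc[OF x] by (auto intro!: B.A.wprod_closed[where S = I])
    have "?h (x(i := u)) = ?w p \<otimes>\<^bsub>B\<^esub> (f i u \<otimes>\<^bsub>B\<^esub> ?w q)" if u: "u \<in> carrier (F i)" for u
    proof -
      let ?g = "\<lambda>j. f j ((x(i := u)) j)"
      have g: "?g j \<in> carrier B" if "j \<in> I" for j using fc[OF upd_closed[OF x i u] that] .
      have "wprod B ?g L = wprod B ?g p \<otimes>\<^bsub>B\<^esub> wprod B ?g (i # q)"
        unfolding pq by (rule B.A.wprod_append[where S = I]) (use g n i in auto)
      also have "wprod B ?g p = ?w p" by (rule B.A.wprod_cong) (use n in auto)
      also have "wprod B ?g (i # q) = f i u \<otimes>\<^bsub>B\<^esub> wprod B ?g q" by simp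
      also have "wprod B ?g q = ?w q" by (rule B.A.wprod_cong) (use n in auto)
      finally show ?thesis .
    qed
    with c show ?thesis by blast
  qed
  have r: "lin K B ?h u = lin K B ?h v" if uv: "(u, v) \<in> tensor_rels K I F" for u v
    using uv unfolding tensor_rels_def Let_def
  proof (elim UnE CollectE exE conjE)
    fix x i u' v'
    assume e: "(u, v) = (basis_elt K (x(i := u' \<oplus>\<^bsub>F i\<^esub> v')), basis_elt K (x(i := u')) \<oplus>\<^bsub>P\<^esub> basis_elt K (x(i := v')))"
      and x: "x \<in> C" and i: "i \<in> I" and u': "u' \<in> carrier (F i)" "v' \<in> carrier (F i)"
    obtain a b where ab: "a \<in> carrier B" "b \<in> carrier B"
      "\<forall>u \<in> carrier (F i). ?h (x(i := u)) = a \<otimes>\<^bsub>B\<^esub> (f i u \<otimes>\<^bsub>B\<^esub> b)" using upd[OF x i] by blast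
    have "?h (x(i := u' \<oplus>\<^bsub>F i\<^esub> v')) = ?h (x(i := u')) \<oplus>\<^bsub>B\<^esub> ?h (x(i := v'))"
      using ab u' i F_closed fD by (simp add: B.A.l_distr B.A.r_distr del: fun_upd_apply)
    then show "lin K B ?h u = lin K B ?h v"
      using e x i u' by (simp only: prod.inject LD Lp pure_closed upd_closed F_closed)
  next
    fix x i c u'
    assume e: "(u, v) = (basis_elt K (x(i := c \<odot>\<^bsub>F i\<^esub> u')), c \<odot>\<^bsub>P\<^esub> basis_elt K (x(i := u')))"
      and x: "x \<in> C" and i: "i \<in> I" and u': "c \<in> carrier K" "u' \<in> carrier (F i)"
    obtain a b where ab: "a \<in> carrier B" "b \<in> carrier B"
      "\<forall>u \<in> carrier (F i). ?h (x(i := u)) = a \<otimes>\<^bsub>B\<^esub> (f i u \<otimes>\<^bsub>B\<^esub> b)" using upd[OF x i] by blast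
    have "?h (x(i := c \<odot>\<^bsub>F i\<^esub> u')) = c \<odot>\<^bsub>B\<^esub> ?h (x(i := u'))"
      using ab u' i F_closed fD by (simp add: B.smult_mult_left B.smult_mult_right del: fun_upd_apply)
    then show "lin K B ?h u = lin K B ?h v"
      using e x i u' by (simp only: prod.inject LD Lp pure_closed upd_closed F_closed)
  qed
  show ?thesis
    using M.presented_hom_ex[OF B h h1 hm tensor_rels_closed r]
    unfolding T_eq tpure_eq by simp
qed

end

section \<open>Roots of unity and alternating integral forms\<close>

subsection \<open>Roots of unity\<close>

lemma (in comm_group) ord_mult_coprime:
  assumes x: "x \<in> carrier G" and y: "y \<in> carrier G" and cop: "coprime (ord x) (ord y)"
  shows "ord (x \<otimes> y) = ord x * ord y"
proof (rule dvd_antisym)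
  show "ord (x \<otimes> y) dvd ord x * ord y" using abelian_ord_mul_divides[OF x y] .
  define k where "k = ord (x \<otimes> y)"
  have xy: "x [^] (k * n) \<otimes> y [^] (k * n) = \<one>" for n
  proof -
    have "x [^] (k * n) \<otimes> y [^] (k * n) = (x \<otimes> y) [^] (k * n)"
      using x y by (simp add: nat_pow_distrib)
    also have "\<dots> = \<one>" using x y by (subst pow_eq_id) (auto simp: k_def)
    finally show ?thesis .
  qed
  have "y [^] (k * ord y) = \<one>" using y by (subst pow_eq_id) auto
  then have "x [^] (k * ord y) = \<one>" using xy[of "ord y"] x by simp
  then have "ord x dvd k * ord y" using x by (simp add: pow_eq_id)
  then have 1: "ord x dvd k" using cop by (simp add: coprime_dvd_mult_left_iff)
  have "x [^] (k * ord x) = \<one>" using x by (subst pow_eq_id) auto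
  then have "y [^] (k * ord x) = \<one>" using xy[of "ord x"] y by simp
  then have "ord y dvd k * ord x" using y by (simp add: pow_eq_id)
  then have "ord y dvd k" using cop by (simp add: coprime_dvd_mult_left_iff coprime_commute)
  then show "ord x * ord y dvd ord (x \<otimes> y)" using 1 cop divides_mult k_def by blast
qed

lemma (in field) card_roots_of_unity:
  assumes "d > 0"
  shows "finite {x \<in> carrier R. x [^] (d::nat) = \<one>}" "card {x \<in> carrier R. x [^] d = \<one>} \<le> d"
proof -
  \<comment> \<open>The polynomial \<open>X\<^sup>d - 1\<close>, as the list of its coefficients with the leading one first.\<close>
  define p where "p = monom \<one> (d - 1) @ [\<ominus> \<one>]"
  have p: "p \<in> carrier (poly_ring R)"
    unfolding univ_poly_carrier[symmetric] polynomial_def by (auto simp: p_def monom_def)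
  have "{x \<in> carrier R. x [^] d = \<one>} \<subseteq> {x. is_root p x}"
  proof clarify
    fix x assume x: "x \<in> carrier R" "x [^] d = \<one>"
    have "eval p x = eval (monom \<one> (d - 1)) x \<otimes> x \<oplus> \<ominus> \<one>"
      unfolding p_def by (rule eval_append_aux) (use x in \<open>auto simp: monom_def\<close>)
    also have "\<dots> = x [^] Suc (d - 1) \<oplus> \<ominus> \<one>" using x by (simp add: eval_monom)
    also have "\<dots> = \<zero>" using x assms by (simp add: r_neg)
    finally show "is_root p x" using x by (simp add: is_root_def p_def)
  qed
  moreover have "{x. is_root p x} = set_mset (roots p)"
    using roots_mem_iff_is_root[OF p] by auto
  ultimately have sub: "{x \<in> carrier R. x [^] d = \<one>} \<subseteq> set_mset (roots p)" by simp
  then show "finite {x \<in> carrier R. x [^] d = \<one>}" by (rule finite_subset) simp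
  have "card {x \<in> carrier R. x [^] d = \<one>} \<le> card (set_mset (roots p))"
    by (rule card_mono) (use sub in auto)
  also have "\<dots> \<le> size (roots p)"
    by (metis mset_set_set_mset_msubset size_mset_mono size_mset_set)
  also have "\<dots> \<le> degree p" by (rule size_roots_le_degree[OF p])
  also have "\<dots> = d" using assms by (simp add: p_def monom_def)
  finally show "card {x \<in> carrier R. x [^] d = \<one>} \<le> d" .
qed

text \<open>
  A common exponent \<open>N\<close> of the given roots of unity defines a finite group \<open>H\<close> of roots of unity.
  The order of every element of \<open>H\<close> divides the maximal order \<open>e\<close>, and \<open>x\<^sup>e = 1\<close> has at most \<open>e\<close>
  solutions; hence the powers of an element \<open>z\<close> of order \<open>e\<close> exhaust \<open>H\<close>.
\<close>

lemma (in field) root_of_unity_common: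
  assumes "finite U" "\<And>x. x \<in> U \<Longrightarrow> root_of_unity R x"
  shows "\<exists>z. root_of_unity R z \<and> (\<forall>x \<in> U. \<exists>m::nat. x = z [^] m)"
proof -
  interpret G: comm_group "Multiplicative_Group.mult_of R"
    by (rule group.group_comm_groupI[OF field_mult_group]) (auto simp: m_comm)
  have "\<exists>N::nat. N > 0 \<and> (\<forall>x\<in>U. x [^] N = \<one>)"
    using assms
  proof (induction U rule: finite_induct)
    case (insert x U)
    then obtain N :: nat where N: "N > 0" "\<forall>x\<in>U. x [^] N = \<one>" by auto
    obtain M :: nat where M: "M > 0" "x [^] M = \<one>" "x \<in> carrier R"
      using insert.prems[of x] by (auto simp: root_of_unity_def)
    have "y [^] (N * M) = \<one>" if "y \<in> insert x U" for y
    proof (cases "y = x")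
      case True
      then show ?thesis using M nat_pow_pow[of x M N] by (simp add: mult.commute)
    next
      case False
      with that insert.prems[of y] N have "y \<in> carrier R" "y [^] N = \<one>" by (auto simp: root_of_unity_def)
      then show ?thesis using nat_pow_pow[of y N M] by simp
    qed
    moreover have "N * M > 0" using M N by simp
    ultimately show ?case by blast
  qed auto
  then obtain N :: nat where N: "N > 0" "\<forall>x\<in>U. x [^] N = \<one>" by blast
  define H where "H = {x \<in> carrier R. x [^] N = \<one>}"
  have finH: "finite H" and U: "U \<subseteq> H"
    using card_roots_of_unity[OF N(1)] N(2) assms(2) by (auto simp: H_def root_of_unity_def)
  have HG: "x \<in> carrier (Multiplicative_Group.mult_of R)" if "x \<in> H" for x
    using that N by (auto simp: H_def nat_pow_zero)
  have pw: "x [^]\<^bsub>Multiplicative_Group.mult_of R\<^esub> (n::nat) = x [^] n" for x n by (simp add: Multiplicative_Group.nat_pow_mult_of)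
  have Hord: "x \<in> H \<longleftrightarrow> G.ord x dvd N" if "x \<in> carrier (Multiplicative_Group.mult_of R)" for x
    using G.pow_eq_id[OF that, of N] that by (simp add: pw H_def)
  have one: "\<one> \<in> H" by (simp add: H_def)
  have "Max (G.ord ` H) \<in> G.ord ` H" using finH one by (intro Max_in) auto
  then obtain z where z: "z \<in> H" and M: "Max (G.ord ` H) = G.ord z" by blast
  have zmax: "G.ord x \<le> G.ord z" if "x \<in> H" for x
    unfolding M[symmetric] by (rule Max_ge) (use finH that in blast)+
  define e where "e = G.ord z"
  have ez: "e dvd N" unfolding e_def using Hord[OF HG[OF z]] z by blast
  have e0: "e > 0" using ez N(1) dvd_pos_nat by blast
  have dv: "G.ord x dvd e" if x: "x \<in> H" for x
  proof (rule ccontr)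
    \<comment> \<open>Otherwise some prime \<open>p\<close> has a larger exponent \<open>a\<close> in the order of \<open>x\<close> than its exponent \<open>b\<close> in \<open>e\<close>.
      A power \<open>x'\<close> of \<open>x\<close> has order \<open>p\<^sup>a\<close>, a power \<open>z'\<close> of \<open>z\<close> has the coprime order \<open>e / p\<^sup>b\<close>, and the order
      of \<open>x' z'\<close> exceeds \<open>e\<close>.\<close>
    assume nd: "\<not> G.ord x dvd e"
    have ox: "G.ord x dvd N" using Hord[OF HG[OF x]] x by blast
    then have ox0: "G.ord x \<noteq> 0" using N(1) by (metis dvd_0_left_iff less_irrefl)
    have "\<exists>p. Factorial_Ring.prime p \<and> multiplicity p e < multiplicity p (G.ord x)"
      using nd ox0 e0 by (metis multiplicity_le_imp_dvd not_less)
    then obtain p where p: "Factorial_Ring.prime p" "multiplicity p e < multiplicity p (G.ord x)" by blast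
    define a b where "a = multiplicity p (G.ord x)" and "b = multiplicity p e"
    have pa: "p ^ a dvd G.ord x" "p ^ b dvd e" by (auto simp: a_def b_def multiplicity_dvd)
    define x' where "x' = x [^]\<^bsub>Multiplicative_Group.mult_of R\<^esub> (G.ord x div p ^ a)"
    define z' where "z' = z [^]\<^bsub>Multiplicative_Group.mult_of R\<^esub> (p ^ b)"
    have p0: "p > 0" using p prime_gt_0_nat by blast
    have ox': "G.ord x' = p ^ a"
      unfolding x'_def using pa ox0 HG x p0
      by (subst G.ord_pow) (auto simp: div_div_eq_right dvd_div_eq_0_iff)
    have oz': "G.ord z' = e div p ^ b"
      unfolding z'_def e_def using pa HG z p0 by (subst G.ord_pow) (auto simp: e_def)
    have "\<not> p dvd e div p ^ b"
    proof
      assume "p dvd e div p ^ b"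
      then have "p ^ b * p dvd p ^ b * (e div p ^ b)" by (rule mult_dvd_mono[OF dvd_refl])
      then have "p ^ Suc b dvd e" using pa by (simp add: mult.commute)
      then have "Suc b \<le> multiplicity p e"
        using e0 p by (intro multiplicity_geI) (auto simp: not_prime_unit)
      then show False by (simp add: b_def)
    qed
    then have "coprime (p ^ a) (e div p ^ b)" using p by (simp add: prime_imp_coprime)
    have c: "x' \<in> carrier (Multiplicative_Group.mult_of R)" "z' \<in> carrier (Multiplicative_Group.mult_of R)"
      unfolding x'_def z'_def using HG x z G.nat_pow_closed by blast+
    have o: "G.ord (x' \<otimes>\<^bsub>Multiplicative_Group.mult_of R\<^esub> z') = p ^ a * (e div p ^ b)"
      using G.ord_mult_coprime[OF c] \<open>coprime (p ^ a) (e div p ^ b)\<close> unfolding ox' oz' by blast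
    have "e div p ^ b dvd e" using dvd_mult_div_cancel[OF pa(2)] by (metis dvd_triv_right)
    then have "p ^ a dvd N" "e div p ^ b dvd N"
      using pa ox ez dvd_trans by blast+
    then have "p ^ a * (e div p ^ b) dvd N"
      using \<open>coprime (p ^ a) (e div p ^ b)\<close> by (rule semiring_gcd_class.divides_mult)
    then have xz: "x' \<otimes>\<^bsub>Multiplicative_Group.mult_of R\<^esub> z' \<in> H" using Hord[of "x' \<otimes>\<^bsub>Multiplicative_Group.mult_of R\<^esub> z'"] o c G.m_closed by presburger
    have "p ^ a * (e div p ^ b) \<le> e" using zmax[OF xz] unfolding o e_def .
    moreover have "p ^ b * (e div p ^ b) = e" using pa by simp
    moreover have "p ^ b < p ^ a" using p prime_gt_1_nat by (auto simp: a_def b_def)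
    ultimately show False using e0
      by (metis linorder_not_less mult_less_cancel2 mult_is_0 neq0_conv)
  qed
  have zG: "z \<in> carrier (Multiplicative_Group.mult_of R)" using HG z by blast
  have inj: "inj_on (\<lambda>n. z [^] n) {0..e - 1}"
    using G.ord_inj[OF zG] by (simp add: pw e_def)
  have "(\<lambda>n. z [^] n) ` {0..e - 1} \<subseteq> {x \<in> carrier R. x [^] e = \<one>}"
  proof clarify
    fix n :: nat
    have "(z [^] n) [^] e = (z [^] e) [^] n" using zG by (simp add: nat_pow_pow mult.commute)
    also have "z [^] e = \<one>" using G.pow_ord_eq_1[OF zG] by (simp add: pw e_def)
    finally show "z [^] n \<in> carrier R \<and> (z [^] n) [^] e = \<one>" using zG by simp
  qed
  moreover have "card ((\<lambda>n. z [^] n) ` {0..e - 1}) = e"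
    using card_image[OF inj] e0 by simp
  ultimately have eq: "(\<lambda>n. z [^] n) ` {0..e - 1} = {x \<in> carrier R. x [^] e = \<one>}"
    using card_roots_of_unity[OF e0] by (intro card_seteq) auto
  have "\<exists>m::nat. x = z [^] m" if "x \<in> U" for x
  proof -
    have xH: "x \<in> H" using that U by blast
    then have "x [^] e = \<one>" using G.pow_eq_id[OF HG[OF xH], of e] dv[OF xH] by (simp add: pw)
    then have "x \<in> (\<lambda>n. z [^] n) ` {0..e - 1}" unfolding eq using xH by (auto simp: H_def)
    then show ?thesis by blast
  qed
  moreover have "root_of_unity R z" using z N by (auto simp: root_of_unity_def H_def)
  ultimately show ?thesis by blast
qed

subsection \<open>Bases of \<open>\<int>\<^sup>k\<close>\<close>

text \<open>The integer combination of \<open>s 1, \<dots>, s k\<close> with the coefficients \<open>c\<close>.\<close>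

definition lcomb :: "nat \<Rightarrow> (nat \<Rightarrow> nat \<Rightarrow> int) \<Rightarrow> (nat \<Rightarrow> int) \<Rightarrow> nat \<Rightarrow> int"
  where "lcomb k s c = (\<lambda>i. \<Sum>j = 1..k. c j * s j i)"

lemma Z_basis_lcomb: "Z_basis k s G \<longleftrightarrow> bij_betw (lcomb k s) (Zn k) G"
  by (simp add: Z_basis_def lcomb_def[abs_def])

lemma bij_betw_Zn_addmul:
  assumes "l \<in> {1..k}" "m \<in> {1..k}" "l \<noteq> m"
  shows "bij_betw (\<lambda>c. c(m := c m + q * c l)) (Zn k) (Zn k)"
  by (rule bij_betw_byWitness[where f' = "\<lambda>c. c(m := c m - q * c l)"])
    (use assms in \<open>auto simp: Zn_def\<close>)

lemma Z_basis_addmul: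
  assumes "Z_basis k s G" "l \<in> {1..k}" "m \<in> {1..k}" "l \<noteq> m"
  shows "Z_basis k (s(l := (\<lambda>i. s l i + q * s m i))) G"
proof -
  let ?s = "s(l := (\<lambda>i. s l i + q * s m i))" and ?f = "\<lambda>c. c(m := c m + q * c l)"
  have "lcomb k ?s c i = lcomb k s (?f c) i" for c i
  proof -
    have "(\<Sum>j = 1..k. c j * ?s j i) = (\<Sum>j = 1..k. c j * s j i + (if j = l then q * c l * s m i else 0))"
      by (rule sum.cong) (auto simp: algebra_simps)
    also have "\<dots> = (\<Sum>j = 1..k. c j * s j i) + q * c l * s m i"
      using assms by (simp add: sum.distrib)
    also have "\<dots> = (\<Sum>j = 1..k. c j * s j i + (if j = m then q * c l * s m i else 0))"
      using assms by (simp add: sum.distrib)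
    also have "\<dots> = (\<Sum>j = 1..k. ?f c j * s j i)"
      by (rule sum.cong) (auto simp: algebra_simps)
    finally show ?thesis by (simp add: lcomb_def)
  qed
  then have "lcomb k ?s = lcomb k s \<circ> ?f" by (auto simp: fun_eq_iff)
  then show ?thesis
    using bij_betw_trans[OF bij_betw_Zn_addmul[OF assms(2-4)]] assms(1)
    by (simp add: Z_basis_lcomb)
qed

lemma Z_basis_swap:
  assumes "Z_basis k s G" "l \<in> {1..k}" "m \<in> {1..k}"
  shows "Z_basis k (s \<circ> Transposition.transpose l m) G"
proof -
  let ?t = "Transposition.transpose l m"
  have t: "?t j \<in> {1..k} \<longleftrightarrow> j \<in> {1..k}" for j using assms(2,3) by (auto simp: Transposition.transpose_def)
  have b: "bij_betw (\<lambda>c. c \<circ> ?t) (Zn k) (Zn k)"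
  proof (rule bij_betw_byWitness[where f' = "\<lambda>c. c \<circ> ?t"])
    have "c \<circ> ?t \<in> Zn k" if "c \<in> Zn k" for c using that t by (auto simp: Zn_def)
    then show "(\<lambda>c. c \<circ> ?t) ` Zn k \<subseteq> Zn k" by blast
    then show "(\<lambda>c. c \<circ> ?t) ` Zn k \<subseteq> Zn k" .
  qed (auto simp: fun_eq_iff)
  have "lcomb k (s \<circ> ?t) c i = lcomb k s (c \<circ> ?t) i" for c i
    unfolding lcomb_def
    by (rule sum.reindex_bij_witness[where i = ?t and j = ?t]) (use t in auto)
  then have "lcomb k (s \<circ> ?t) = lcomb k s \<circ> (\<lambda>c. c \<circ> ?t)" by (auto simp: fun_eq_iff)
  then show ?thesis
    using bij_betw_trans[OF b] assms(1) by (simp add: Z_basis_lcomb)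
qed

subsection \<open>Normal form of an alternating form\<close>

text \<open>An alternating integral bilinear form. Additivity and homogeneity are combined into one axiom in
  each argument.\<close>

locale alternating_form =
  fixes w :: "(nat \<Rightarrow> int) \<Rightarrow> (nat \<Rightarrow> int) \<Rightarrow> int"
  assumes add_left: "w (\<lambda>i. x i + q * y i) z = w x z + q * w y z"
    and add_right: "w z (\<lambda>i. x i + q * y i) = w z x + q * w z y"
    and alternating: "w x x = 0"
begin

lemma antisym: "w x y = - w y x"
proof -
  have "w (\<lambda>i. x i + 1 * y i) (\<lambda>i. x i + 1 * y i) = 0" by (rule alternating)
  then show ?thesis unfolding add_left add_right by (simp add: alternating)
qed

text \<open>
  A basis whose first \<open>2 m\<close> vectors are in normal form, with blocks \<open>d 1, \<dots>, d m\<close>, and are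
  orthogonal to the remaining ones, such that \<open>d m\<close> divides all values on the remaining vectors.
  The last condition is what makes the next block divisible by \<open>d m\<close>.
\<close>

definition reduced :: "nat \<Rightarrow> (nat \<Rightarrow> int) set \<Rightarrow> nat \<Rightarrow> (nat \<Rightarrow> nat) \<Rightarrow> (nat \<Rightarrow> nat \<Rightarrow> int) \<Rightarrow> bool"
  where "reduced k G m d s \<longleftrightarrow> Z_basis k s G \<and> 2 * m \<le> k \<and>
    (\<forall>i\<in>{1..m}. d i > 0) \<and> (\<forall>i\<in>{1..<m}. d i dvd d (Suc i)) \<and>
    (\<forall>i j. 1 \<le> i \<longrightarrow> i < j \<longrightarrow> j \<le> k \<longrightarrow> i \<le> 2 * m \<longrightarrow>
      w (s i) (s j) = (if odd i \<and> j = Suc i then int (d (Suc i div 2)) else 0)) \<and>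
    (m \<ge> 1 \<longrightarrow> (\<forall>i\<in>{2*m<..k}. \<forall>j\<in>{2*m<..k}. int (d m) dvd w (s i) (s j)))"

lemma reduced_addmul:
  assumes s: "reduced k G m d s" and l: "l \<in> {2*m<..k}" and n: "n \<in> {2*m<..k}" and ln: "l \<noteq> n"
  shows "reduced k G m d (s(l := (\<lambda>i. s l i + q * s n i)))" (is "reduced k G m d ?s")
proof -
  have "Z_basis k ?s G" using s l n ln by (intro Z_basis_addmul) (auto simp: reduced_def)
  moreover have "w (?s i) (?s j) = (if odd i \<and> j = Suc i then int (d (Suc i div 2)) else 0)"
    if "1 \<le> i" "i < j" "j \<le> k" "i \<le> 2 * m" for i j
  proof -
    have i: "?s i = s i" using that l by auto
    have R: "w (s i) (s j) = (if odd i \<and> j = Suc i then int (d (Suc i div 2)) else 0)"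
      if "i < j" "j \<le> k" for j
      using s \<open>1 \<le> i\<close> \<open>i \<le> 2 * m\<close> that unfolding reduced_def by blast
    have z: "\<not> (odd i \<and> j = Suc i)" if "2 * m < j" for j
    proof
      assume "odd i \<and> j = Suc i"
      then have "i = 2 * m" using that \<open>i \<le> 2 * m\<close> by simp
      with \<open>odd i \<and> j = Suc i\<close> show False by simp
    qed
    show ?thesis
    proof (cases "j = l")
      case True
      have "w (s i) (s l) = 0" "w (s i) (s n) = 0"
        using R[of l] R[of n] z[of l] z[of n] l n that by auto
      then show ?thesis using True z[of l] l unfolding i by (auto simp: add_right)
    next
      case False
      then show ?thesis using R[of j] that i by simp
    qed
  qed
  moreover have "int (d m) dvd w (?s i) (?s j)" if "i \<in> {2*m<..k}" "j \<in> {2*m<..k}" "m \<ge> 1" for i j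
  proof -
    have "int (d m) dvd w (s i) (s j)" if "i \<in> {2*m<..k}" "j \<in> {2*m<..k}" for i j
      using s that \<open>m \<ge> 1\<close> unfolding reduced_def by blast
    then show ?thesis using that l n by (auto simp: add_right add_left)
  qed
  ultimately show ?thesis using s unfolding reduced_def by simp
qed

lemma reduced_swap:
  assumes s: "reduced k G m d s" and l: "l \<in> {2*m<..k}" and n: "n \<in> {2*m<..k}"
  shows "reduced k G m d (s \<circ> Transposition.transpose l n)" (is "reduced k G m d ?s")
proof -
  let ?t = "Transposition.transpose l n"
  have "Z_basis k ?s G" using s l n by (intro Z_basis_swap) (auto simp: reduced_def)
  moreover have "w (?s i) (?s j) = (if odd i \<and> j = Suc i then int (d (Suc i div 2)) else 0)"
    if "1 \<le> i" "i < j" "j \<le> k" "i \<le> 2 * m" for i j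
  proof -
    have i: "?s i = s i" using that l n by (auto simp: Transposition.transpose_def)
    have R: "w (s i) (s j) = (if odd i \<and> j = Suc i then int (d (Suc i div 2)) else 0)"
      if "i < j" "j \<le> k" for j
      using s \<open>1 \<le> i\<close> \<open>i \<le> 2 * m\<close> that unfolding reduced_def by blast
    show ?thesis
    proof (cases "j \<le> 2 * m")
      case True
      then have "?s j = s j" using l n by (auto simp: Transposition.transpose_def)
      then show ?thesis using R that i by simp
    next
      case False
      then have t: "2 * m < ?t j" "?t j \<le> k" using l n that by (auto simp: Transposition.transpose_def)
      have "\<not> (odd i \<and> j = Suc i)" if "2 * m < j" for j
      proof
        assume "odd i \<and> j = Suc i"
        then have "i = 2 * m" using that \<open>i \<le> 2 * m\<close> by simp
        with \<open>odd i \<and> j = Suc i\<close> show False by simp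
      qed
      then have "\<not> (odd i \<and> j = Suc i)" "\<not> (odd i \<and> ?t j = Suc i)" using t False by simp_all
      then have "w (s i) (s (?t j)) = 0" using R[of "?t j"] t \<open>i \<le> 2 * m\<close> by auto
      then show ?thesis using \<open>\<not> (odd i \<and> j = Suc i)\<close> unfolding i by auto
    qed
  qed
  moreover have "int (d m) dvd w (?s i) (?s j)" if "i \<in> {2*m<..k}" "j \<in> {2*m<..k}" "m \<ge> 1" for i j
  proof -
    have "?t i \<in> {2*m<..k}" "?t j \<in> {2*m<..k}" using that l n by (auto simp: Transposition.transpose_def)
    then show ?thesis using s that unfolding reduced_def by simp
  qed
  ultimately show ?thesis using s unfolding reduced_def by simp
qed

text \<open>Among all reduced bases with the same \<open>m\<close> and \<open>d\<close>, and all pairs of their remaining vectors, a pair with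
  the least positive value \<open>e\<close> of the form splits off a further block: by minimality of \<open>e\<close> all remainders
  of division by \<open>e\<close> vanish.\<close>

lemma reduced_step:
  assumes s0: "reduced k G m d s0" and ij: "i0 \<in> {2*m<..k}" "j0 \<in> {2*m<..k}" "w (s0 i0) (s0 j0) \<noteq> 0"
  shows "\<exists>d' s. reduced k G (Suc m) d' s"
proof -
  define P where "P = (\<lambda>v. \<exists>s i j. reduced k G m d s \<and> i \<in> {2*m<..k} \<and> j \<in> {2*m<..k} \<and>
     v = nat \<bar>w (s i) (s j)\<bar> \<and> v > 0)"
  define e where "e = (LEAST v. P v)"
  have "P (nat \<bar>w (s0 i0) (s0 j0)\<bar>)" unfolding P_def using s0 ij by (intro exI[of _ s0] exI[of _ i0] exI[of _ j0]) auto
  then have Pe: "P e" unfolding e_def by (rule LeastI)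
  have min: "e \<le> nat \<bar>w (s i) (s j)\<bar>"
    if "reduced k G m d s" "i \<in> {2*m<..k}" "j \<in> {2*m<..k}" "w (s i) (s j) \<noteq> 0" for s i j
    unfolding e_def by (rule Least_le) (use that in \<open>auto simp: P_def\<close>)
  have e0: "e > 0" using Pe by (auto simp: P_def)
  obtain s1 i1 j1 where s1: "reduced k G m d s1" "i1 \<in> {2*m<..k}" "j1 \<in> {2*m<..k}"
     "int e = \<bar>w (s1 i1) (s1 j1)\<bar>"
    using Pe unfolding P_def by auto
  define a b where "a = Suc (2 * m)" and "b = Suc (Suc (2 * m))"
  have ne: "i1 \<noteq> j1" using s1(4) e0 alternating by auto
  then have ab: "a \<in> {2*m<..k}" "b \<in> {2*m<..k}" "a \<noteq> b" using s1(2,3) by (auto simp: a_def b_def)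
  have "\<exists>s. reduced k G m d s \<and> \<bar>w (s a) (s b)\<bar> = int e"
  proof -
    define s2 where "s2 = s1 \<circ> Transposition.transpose i1 a"
    define j2 where "j2 = Transposition.transpose i1 a j1"
    have 2: "reduced k G m d s2" unfolding s2_def using s1 ab by (intro reduced_swap)
    have j2: "j2 \<in> {2*m<..k}" "j2 \<noteq> a" "s2 j2 = s1 j1" "s2 a = s1 i1"
      using s1 ab ne by (auto simp: j2_def s2_def Transposition.transpose_def)
    define s3 where "s3 = s2 \<circ> Transposition.transpose j2 b"
    have "reduced k G m d s3" unfolding s3_def using 2 j2 ab by (intro reduced_swap)
    moreover have "s3 a = s1 i1" "s3 b = s1 j1"
      using j2 ab by (auto simp: s3_def Transposition.transpose_def)
    ultimately show ?thesis using s1 by auto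
  qed
  then obtain s4 where s4: "reduced k G m d s4" "\<bar>w (s4 a) (s4 b)\<bar> = int e" by blast
  have "\<exists>s. reduced k G m d s \<and> w (s a) (s b) = int e"
  proof (cases "w (s4 a) (s4 b) \<ge> 0")
    case True
    then show ?thesis using s4 by auto
  next
    case False
    have "reduced k G m d (s4 \<circ> Transposition.transpose a b)" using s4 ab by (intro reduced_swap)
    moreover have "w (s4 b) (s4 a) = int e" using s4 False antisym[of "s4 b"] by simp
    ultimately show ?thesis by (intro exI[of _ "s4 \<circ> Transposition.transpose a b"]) simp
  qed
  then obtain s5 where s5: "reduced k G m d s5" "w (s5 a) (s5 b) = int e" by blast
  \<comment> \<open>Otherwise adding a multiple of \<open>s b\<close> to \<open>s l\<close> would produce a positive value below \<open>e\<close>.\<close>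
  have dvd1: "int e dvd w (s a) (s l)"
    if s: "reduced k G m d s" "w (s a) (s b) = int e" and l: "l \<in> {2*m<..k}" for s l
  proof (cases "l = a \<or> l = b")
    case True
    then show ?thesis using s by (auto simp: alternating)
  next
    case False
    define q where "q = - (w (s a) (s l) div int e)"
    define s' where "s' = s(l := (\<lambda>i. s l i + q * s b i))"
    have s': "reduced k G m d s'" unfolding s'_def using s l False ab by (intro reduced_addmul) auto
    have "w (s' a) (s' l) = w (s a) (s l) + q * int e"
      using False s by (simp add: s'_def add_right)
    also have "\<dots> = w (s a) (s l) mod int e"
      by (simp add: q_def minus_div_mult_eq_mod[symmetric])
    finally have v: "w (s' a) (s' l) = w (s a) (s l) mod int e" .
    have bd: "0 \<le> w (s a) (s l) mod int e" "w (s a) (s l) mod int e < int e" using e0 by auto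
    have "w (s' a) (s' l) = 0"
    proof (rule ccontr)
      assume "w (s' a) (s' l) \<noteq> 0"
      from min[OF s' ab(1) l this] show False using v bd by linarith
    qed
    then show ?thesis using v by auto
  qed
  have dvd2: "int e dvd w (s l) (s b)"
    if s: "reduced k G m d s" "w (s a) (s b) = int e" and l: "l \<in> {2*m<..k}" for s l
  proof (cases "l = a \<or> l = b")
    case True
    then show ?thesis using s by (auto simp: alternating)
  next
    case False
    define q where "q = - (w (s l) (s b) div int e)"
    define s' where "s' = s(l := (\<lambda>i. s l i + q * s a i))"
    have s': "reduced k G m d s'" unfolding s'_def using s l False ab by (intro reduced_addmul) auto
    have "w (s' l) (s' b) = w (s l) (s b) + q * int e"
      using False s by (simp add: s'_def add_left)
    also have "\<dots> = w (s l) (s b) mod int e"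
      by (simp add: q_def minus_div_mult_eq_mod[symmetric])
    finally have v: "w (s' l) (s' b) = w (s l) (s b) mod int e" .
    have bd: "0 \<le> w (s l) (s b) mod int e" "w (s l) (s b) mod int e < int e" using e0 by auto
    have "w (s' l) (s' b) = 0"
    proof (rule ccontr)
      assume "w (s' l) (s' b) \<noteq> 0"
      from min[OF s' l ab(2) this] show False using v bd by linarith
    qed
    then show ?thesis using v by auto
  qed
  \<comment> \<open>The remaining vectors are made orthogonal to \<open>s a\<close> and \<open>s b\<close> one after the other.\<close>
  have "\<exists>s. reduced k G m d s \<and> w (s a) (s b) = int e \<and> (\<forall>l\<in>L. w (s a) (s l) = 0 \<and> w (s l) (s b) = 0)"
    if "finite L" "L \<subseteq> {2*m<..k} - {a, b}" for L
    using that
  proof (induction L rule: finite_induct)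
    case empty
    then show ?case using s5 by auto
  next
    case (insert l L)
    then obtain s where s: "reduced k G m d s" "w (s a) (s b) = int e"
      "\<forall>l\<in>L. w (s a) (s l) = 0 \<and> w (s l) (s b) = 0" by auto
    have l: "l \<in> {2*m<..k}" "l \<noteq> a" "l \<noteq> b" "l \<notin> L" using insert by auto
    obtain x where x: "w (s a) (s l) = int e * x" using dvd1[OF s(1,2) l(1)] by (auto elim: dvdE)
    obtain y where y: "w (s l) (s b) = int e * y" using dvd2[OF s(1,2) l(1)] by (auto elim: dvdE)
    define s' where "s' = s(l := (\<lambda>i. s l i + (- x) * s b i))"
    have s': "reduced k G m d s'" unfolding s'_def using s l ab by (intro reduced_addmul) auto
    define s'' where "s'' = s'(l := (\<lambda>i. s' l i + (- y) * s' a i))"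
    have s'': "reduced k G m d s''" unfolding s''_def using s' l ab by (intro reduced_addmul) auto
    have o: "s'' j = s j" if "j \<noteq> l" for j using that by (simp add: s'_def s''_def)
    have s''l: "s'' l = (\<lambda>i. (s l i + (- x) * s b i) + (- y) * s a i)"
      using l ab by (simp add: s''_def s'_def)
    have "w (s'' l) (s b) = w (s l) (s b) + (- x) * w (s b) (s b) + (- y) * w (s a) (s b)"
      unfolding s''l add_left by simp
    then have "w (s'' l) (s b) = 0" using y s(2) by (simp add: alternating)
    moreover have "w (s a) (s'' l) = w (s a) (s l) + (- x) * w (s a) (s b) + (- y) * w (s a) (s a)"
      unfolding s''l add_right by simp
    then have "w (s a) (s'' l) = 0" using x s(2) by (simp add: alternating)
    moreover have "\<forall>l'\<in>L. l' \<noteq> l" using l by auto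
    ultimately show ?case using s s'' l o by (intro exI[of _ s'']) auto
  qed
  from this[of "{2*m<..k} - {a, b}"] obtain s where s: "reduced k G m d s" "w (s a) (s b) = int e"
    "\<forall>l\<in>{2*m<..k} - {a, b}. w (s a) (s l) = 0 \<and> w (s l) (s b) = 0" by auto
  \<comment> \<open>Adding \<open>s i\<close> to \<open>s a\<close> keeps the value \<open>e\<close> on the pair \<open>a\<close>, \<open>b\<close>, and the new vector has the value
    \<open>w (s i) (s j)\<close> with \<open>s j\<close>; so the divisibility by \<open>e\<close> extends to this value.\<close>
  have dvd3: "int e dvd w (s i) (s j)" if i: "i \<in> {2*m<..k} - {a, b}" and j: "j \<in> {2*m<..k} - {a, b}" for i j
  proof -
    define s' where "s' = s(a := (\<lambda>l. s a l + 1 * s i l))"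
    have s': "reduced k G m d s'" unfolding s'_def using s i ab by (intro reduced_addmul) auto
    have "w (s' a) (s' b) = int e" using i s ab by (simp add: s'_def add_left[of _ 1, simplified])
    from dvd1[OF s' this, of j] show ?thesis
      using i j s ab by (simp add: s'_def add_left[of _ 1, simplified])
  qed
  define d' where "d' = d(Suc m := e)"
  have "reduced k G (Suc m) d' s"
    unfolding reduced_def
  proof (intro conjI ballI allI impI)
    show "Z_basis k s G" using s by (simp add: reduced_def)
    show "2 * Suc m \<le> k" using ab by (auto simp: b_def)
    show "0 < d' i" if "i \<in> {1..Suc m}" for i
      using that s(1) e0 by (auto simp: d'_def reduced_def)
    show "d' i dvd d' (Suc i)" if i: "i \<in> {1..<Suc m}" for i
    proof (cases "i = m")
      case True
      then have "m \<ge> 1" using i by auto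
      then have "int (d m) dvd w (s a) (s b)" using s(1) ab unfolding reduced_def by blast
      then show ?thesis using s(2) True i by (simp add: d'_def)
    next
      case False
      then show ?thesis using s(1) i by (auto simp: d'_def reduced_def)
    qed
    show "w (s i) (s j) = (if odd i \<and> j = Suc i then int (d' (Suc i div 2)) else 0)"
      if "1 \<le> i" "i < j" "j \<le> k" "i \<le> 2 * Suc m" for i j
    proof -
      have *: "i \<le> 2 * m \<or> i = Suc (2 * m) \<or> i = Suc (Suc (2 * m))" using that by arith
      consider "i \<le> 2 * m" | "i = a" "j = b" | "i = a" "j \<noteq> b" | "i = b"
        using * unfolding a_def b_def by blast
      then show ?thesis
      proof cases
        case 1
        then have "Suc i div 2 \<noteq> Suc m" by auto
        then show ?thesis using s(1) that 1 unfolding reduced_def d'_def by auto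
      next
        case 2
        then show ?thesis using s by (simp add: a_def b_def d'_def)
      next
        case 3
        then have "j \<in> {2*m<..k} - {a, b}" using that by (auto simp: a_def)
        then show ?thesis using s(3) 3 by (auto simp: a_def b_def)
      next
        case 4
        then have "j \<in> {2*m<..k} - {a, b}" using that by (auto simp: a_def b_def)
        then have "w (s b) (s j) = 0" using s(3) antisym[of "s b" "s j"] by auto
        then show ?thesis using 4 by (auto simp: b_def)
      qed
    qed
    show "int (d' (Suc m)) dvd w (s i) (s j)"
      if "i \<in> {2 * Suc m<..k}" "j \<in> {2 * Suc m<..k}" for i j
      using dvd3[of i j] that by (auto simp: d'_def a_def b_def)
  qed
  then show ?thesis by blast
qed

text \<open>Every alternating integral form on a lattice has a basis in block normal form with \<open>d 1 | d 2 | \<dots>\<close>.\<close>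

theorem normal_form:
  assumes "Z_basis k s G"
  shows "\<exists>s r d. Z_basis k s G \<and> 2 * r \<le> k \<and> (\<forall>i\<in>{1..r}. d i > (0::nat)) \<and>
    (\<forall>i\<in>{1..<r}. d i dvd d (Suc i)) \<and>
    (\<forall>i j. 1 \<le> i \<longrightarrow> i < j \<longrightarrow> j \<le> k \<longrightarrow>
      w (s i) (s j) = (if odd i \<and> j = Suc i \<and> j \<le> 2 * r then int (d (j div 2)) else 0))"
proof -
  define P where "P = (\<lambda>m. \<exists>d s. reduced k G m d s)"
  have P0: "P 0" unfolding P_def using assms by (intro exI[of _ s] exI) (auto simp: reduced_def)
  have bd: "m \<le> k" if "P m" for m using that by (auto simp: P_def reduced_def)
  define r where "r = (GREATEST m. P m)"
  have Pr: "P r" unfolding r_def using P0 bd by (rule GreatestI_nat)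
  have "\<not> P (Suc r)" 
  proof
    assume "P (Suc r)"
    then have "Suc r \<le> r" unfolding r_def using bd by (rule Greatest_le_nat)
    then show False by simp
  qed
  obtain d s where s: "reduced k G r d s" using Pr by (auto simp: P_def)
  have z: "w (s i) (s j) = 0" if "i \<in> {2*r<..k}" "j \<in> {2*r<..k}" for i j
    using reduced_step[OF s that] \<open>\<not> P (Suc r)\<close> unfolding P_def by blast
  have "w (s i) (s j) = (if odd i \<and> j = Suc i \<and> j \<le> 2 * r then int (d (j div 2)) else 0)"
    if ij: "1 \<le> i" "i < j" "j \<le> k" for i j
  proof (cases "i \<le> 2 * r")
    case True
    have "Suc i \<le> 2 * r" if "odd i"
      using True that by (metis Suc_leI dvd_triv_left le_neq_implies_less)
    then show ?thesis using s ij True unfolding reduced_def by auto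
  next
    case False
    then show ?thesis using z[of i j] ij by auto
  qed
  then show ?thesis using s unfolding reduced_def by (intro exI[of _ s] exI[of _ r] exI[of _ d]) simp
qed

end

section \<open>Graded algebras modulo a maximal ideal of the degree zero component\<close>

subsection \<open>Spans closed under multiplication\<close>

context kalg begin

lemma subalgebra:
  assumes H: "H \<subseteq> carrier A" "\<one>\<^bsub>A\<^esub> \<in> H"
    and add: "\<And>x y. x \<in> H \<Longrightarrow> y \<in> H \<Longrightarrow> x \<oplus>\<^bsub>A\<^esub> y \<in> H"
    and mult: "\<And>x y. x \<in> H \<Longrightarrow> y \<in> H \<Longrightarrow> x \<otimes>\<^bsub>A\<^esub> y \<in> H"
    and sm: "\<And>c x. c \<in> carrier K \<Longrightarrow> x \<in> H \<Longrightarrow> c \<odot>\<^bsub>A\<^esub> x \<in> H"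
  shows "kalg K (A\<lparr>carrier := H\<rparr>)"
proof -
  have "\<ominus>\<^bsub>A\<^esub> x \<in> H" if "x \<in> H" for x
    using sm[of "\<ominus> \<one>" x] that H(1) by (auto simp: smult_l_minus subset_iff)
  then have "subring H A" using H add mult by (intro A.subringI) auto
  then have r: "ring (A\<lparr>carrier := H\<rparr>)" by (rule A.subring_is_ring)
  note c = subsetD[OF H(1)]
  show ?thesis
    by (rule kalgI)
      (use r c sm in \<open>auto simp: K.field_axioms smult_l_distr smult_r_distr smult_assoc1
        smult_mult_left smult_mult_right\<close>)
qed

lemma generate_eq_kspan:
  assumes U: "U \<subseteq> carrier A" and sm: "\<And>c x. c \<in> carrier K \<Longrightarrow> x \<in> U \<Longrightarrow> c \<odot>\<^bsub>A\<^esub> x \<in> U"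
  shows "generate (add_monoid A) U = kspan K A U"
proof (intro equalityI subsetI)
  fix x assume "x \<in> generate (add_monoid A) U"
  then show "x \<in> kspan K A U"
  proof induction
    case one
    then show ?case by (simp add: kspan.kspan_zero)
  next
    case (incl h)
    then show ?case by (simp add: kspan_base[OF U])
  next
    case (inv h)
    then have "\<ominus>\<^bsub>A\<^esub> h = (\<ominus> \<one>) \<odot>\<^bsub>A\<^esub> h" using U by (auto simp: smult_l_minus)
    then have "\<ominus>\<^bsub>A\<^esub> h \<in> kspan K A U" using inv kspan_smult[OF U _ kspan_base[OF U inv]] by simp
    then show ?case by (simp add: a_inv_def)
  next
    case (eng h1 h2)
    then show ?case by (simp add: kspan_add[OF U])
  qed
next
  fix x assume "x \<in> kspan K A U"
  then show "x \<in> generate (add_monoid A) U"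
  proof induction
    case kspan_zero
    then show ?case using generate.intros(1)[of "add_monoid A"] by simp
  next
    case (kspan_step x c s)
    show ?case using generate.eng[OF kspan_step.IH generate.incl[OF sm[OF kspan_step.hyps(2,3)]]] by simp
  qed
qed

lemma kspan_mult_closed:
  assumes U: "U \<subseteq> carrier A" and m: "\<And>u v. u \<in> U \<Longrightarrow> v \<in> U \<Longrightarrow> u \<otimes>\<^bsub>A\<^esub> v \<in> U"
    and x: "x \<in> kspan K A U" and y: "y \<in> kspan K A U"
  shows "x \<otimes>\<^bsub>A\<^esub> y \<in> kspan K A U"
proof -
  have 1: "u \<otimes>\<^bsub>A\<^esub> y \<in> kspan K A U" if u: "u \<in> U" for u
    using y
  proof induction
    case kspan_zero
    then show ?case using u U by (auto simp: kspan.kspan_zero)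
  next
    case (kspan_step x c s)
    then have "u \<otimes>\<^bsub>A\<^esub> (x \<oplus>\<^bsub>A\<^esub> c \<odot>\<^bsub>A\<^esub> s) = u \<otimes>\<^bsub>A\<^esub> x \<oplus>\<^bsub>A\<^esub> c \<odot>\<^bsub>A\<^esub> (u \<otimes>\<^bsub>A\<^esub> s)"
      using u U kspan_carrier[OF U] by (auto simp: A.r_distr smult_mult_right subset_iff)
    then show ?case using kspan_step u m by (auto intro: kspan.kspan_step)
  qed
  have yc: "y \<in> carrier A" using y kspan_carrier[OF U] by blast
  show ?thesis
    using x
  proof induction
    case kspan_zero
    then show ?case using yc by (auto simp: kspan.kspan_zero)
  next
    case (kspan_step x c s)
    then have "(x \<oplus>\<^bsub>A\<^esub> c \<odot>\<^bsub>A\<^esub> s) \<otimes>\<^bsub>A\<^esub> y = x \<otimes>\<^bsub>A\<^esub> y \<oplus>\<^bsub>A\<^esub> c \<odot>\<^bsub>A\<^esub> (s \<otimes>\<^bsub>A\<^esub> y)"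
      using yc U kspan_carrier[OF U] by (auto simp: A.l_distr smult_mult_left subset_iff)
    then show ?case using kspan_step 1 by (auto intro!: kspan_add[OF U] kspan_smult[OF U])
  qed
qed

lemma lin_delta:
  assumes f: "f \<in> fs K S" and g: "g \<in> S" and a: "a \<in> carrier A"
  shows "lin K A (\<lambda>h. if h = g then a else \<zero>\<^bsub>A\<^esub>) f = f g \<odot>\<^bsub>A\<^esub> a"
  using f
proof (induction rule: fs_induct)
  case zero
  then show ?case using a by (simp add: lin_zero)
next
  case (add f x c)
  have s: "single K x c g = (if g = x then c else \<zero>)" by (simp add: single_def)
  from add show ?case using a fsD(1)[OF add.hyps(1), of g]
    by (auto simp: lin_add[where S = S] fs_single lin_single[where S = S] smult_l_distr s)
qed

end

text \<open>Sum, opposite and zero of degrees.\<close>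

abbreviation (input) dplus :: "(nat \<Rightarrow> int) \<Rightarrow> (nat \<Rightarrow> int) \<Rightarrow> nat \<Rightarrow> int" where
  "dplus g h \<equiv> (\<lambda>i. g i + h i)"
abbreviation (input) duminus :: "(nat \<Rightarrow> int) \<Rightarrow> nat \<Rightarrow> int" where
  "duminus g \<equiv> (\<lambda>i. - g i)"
abbreviation (input) dzero :: "nat \<Rightarrow> int" where "dzero \<equiv> (\<lambda>_. 0)"

text \<open>A \<open>K\<close>-algebra \<open>A\<close> with components \<open>comp g\<close>, indexed by integer functions, and projections \<open>prj g\<close> to
  them; a group \<open>S\<close> of degrees; and a maximal ideal \<open>M\<close> of the commutative ring \<open>comp 0\<close> whose residue field
  is \<open>K\<close>. An element of degree \<open>g \<in> S\<close> commutes with \<open>r \<in> comp 0\<close> after \<open>r\<close> is replaced by \<open>tw g r\<close>, and \<open>tw g\<close>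
  stabilizes \<open>M\<close>. For a twisted generalized Weyl construction, \<open>comp 0\<close> is \<open>R\<close>, \<open>M\<close> is the maximal ideal, \<open>S\<close>
  is its stabilizer and \<open>tw g\<close> is the action of \<open>g\<close>.\<close>

locale weight_setting = kalg K A
  for K :: "('k, 'x) ring_scheme" (structure) and A :: "('k, 'a, 'y) module_scheme" (structure) +
  fixes comp :: "(nat \<Rightarrow> int) \<Rightarrow> 'a set" and prj :: "(nat \<Rightarrow> int) \<Rightarrow> 'a \<Rightarrow> 'a"
    and S :: "(nat \<Rightarrow> int) set" and M :: "'a set" and tw :: "(nat \<Rightarrow> int) \<Rightarrow> 'a \<Rightarrow> 'a"
  assumes comp_closed: "x \<in> comp g \<Longrightarrow> x \<in> carrier A"
    and comp_smult: "c \<in> carrier K \<Longrightarrow> x \<in> comp g \<Longrightarrow> c \<odot>\<^bsub>A\<^esub> x \<in> comp g"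
    and comp_add: "x \<in> comp g \<Longrightarrow> y \<in> comp g \<Longrightarrow> x \<oplus>\<^bsub>A\<^esub> y \<in> comp g"
    and comp_mult: "x \<in> comp g \<Longrightarrow> y \<in> comp h \<Longrightarrow> x \<otimes>\<^bsub>A\<^esub> y \<in> comp (dplus g h)"
    and comp_one: "\<one>\<^bsub>A\<^esub> \<in> comp dzero"
    and prj_closed: "x \<in> carrier A \<Longrightarrow> prj g x \<in> comp g"
    and prj_add: "x \<in> carrier A \<Longrightarrow> y \<in> carrier A \<Longrightarrow> prj g (x \<oplus>\<^bsub>A\<^esub> y) = prj g x \<oplus>\<^bsub>A\<^esub> prj g y"
    and prj_smult: "c \<in> carrier K \<Longrightarrow> x \<in> carrier A \<Longrightarrow> prj g (c \<odot>\<^bsub>A\<^esub> x) = c \<odot>\<^bsub>A\<^esub> prj g x"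
    and prj_comp: "x \<in> comp h \<Longrightarrow> prj g x = (if g = h then x else \<zero>\<^bsub>A\<^esub>)"
    and S_zero: "dzero \<in> S" and S_add: "g \<in> S \<Longrightarrow> h \<in> S \<Longrightarrow> dplus g h \<in> S"
    and S_uminus: "g \<in> S \<Longrightarrow> duminus g \<in> S"
    and M_comp: "x \<in> M \<Longrightarrow> x \<in> comp dzero"
    and M_zero: "\<zero>\<^bsub>A\<^esub> \<in> M"
    and M_add: "x \<in> M \<Longrightarrow> y \<in> M \<Longrightarrow> x \<oplus>\<^bsub>A\<^esub> y \<in> M"
    and M_mult: "r \<in> comp dzero \<Longrightarrow> x \<in> M \<Longrightarrow> r \<otimes>\<^bsub>A\<^esub> x \<in> M"
    and M_prime: "x \<in> comp dzero \<Longrightarrow> y \<in> comp dzero \<Longrightarrow> x \<otimes>\<^bsub>A\<^esub> y \<in> M \<Longrightarrow> x \<in> M \<or> y \<in> M"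
    and M_inverse: "x \<in> comp dzero \<Longrightarrow> x \<notin> M \<Longrightarrow> \<exists>s \<in> comp dzero. s \<otimes>\<^bsub>A\<^esub> x \<ominus>\<^bsub>A\<^esub> \<one>\<^bsub>A\<^esub> \<in> M"
    and M_scalar: "x \<in> comp dzero \<Longrightarrow> \<exists>c \<in> carrier K. x \<ominus>\<^bsub>A\<^esub> c \<odot>\<^bsub>A\<^esub> \<one>\<^bsub>A\<^esub> \<in> M"
    and comp_zero_comm: "x \<in> comp dzero \<Longrightarrow> y \<in> comp dzero \<Longrightarrow> x \<otimes>\<^bsub>A\<^esub> y = y \<otimes>\<^bsub>A\<^esub> x"
    and tw: "g \<in> S \<Longrightarrow> r \<in> comp dzero \<Longrightarrow> tw g r \<in> comp dzero"
      "g \<in> S \<Longrightarrow> r \<in> comp dzero \<Longrightarrow> x \<in> comp g \<Longrightarrow> x \<otimes>\<^bsub>A\<^esub> r = tw g r \<otimes>\<^bsub>A\<^esub> x"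
      "g \<in> S \<Longrightarrow> r \<in> comp dzero \<Longrightarrow> tw g r \<in> M \<longleftrightarrow> r \<in> M"
begin

text \<open>\<open>U\<close> consists of the homogeneous elements with degree in \<open>S\<close>, \<open>B\<close> is the subalgebra that they span, \<open>I\<close>
  the ideal of \<open>B\<close> generated by \<open>M\<close>, and \<open>\<phi>\<close> the projection from \<open>B\<close> to the quotient \<open>Bq\<close>.\<close>

abbreviation "U \<equiv> (\<Union>g\<in>S. comp g)"
definition "B = A\<lparr>carrier := sum_of A S comp\<rparr>"
definition "I = genideal B M"
abbreviation "Bq \<equiv> quot_alg B I"
definition "\<phi> x = I +>\<^bsub>B\<^esub> x"

lemma U_closed: "U \<subseteq> carrier A" using comp_closed by auto

lemma carrier_B: "carrier B = kspan K A U"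
  unfolding B_def sum_of_def using generate_eq_kspan[OF U_closed] comp_smult by auto

lemma B_ops: "monoid.mult B = monoid.mult A" "one B = one A" "ring.zero B = ring.zero A"
  "ring.add B = ring.add A" "smult B = smult A"
  by (simp_all add: B_def)

lemma B_sub: "x \<in> carrier B \<Longrightarrow> x \<in> carrier A"
  unfolding carrier_B using kspan_carrier[OF U_closed] by auto

lemma comp_B: "g \<in> S \<Longrightarrow> x \<in> comp g \<Longrightarrow> x \<in> carrier B"
  unfolding carrier_B using kspan_base[OF U_closed] by auto

lemma U_mult:
  assumes "x \<in> U" "y \<in> U"
  shows "x \<otimes>\<^bsub>A\<^esub> y \<in> U"
proof -
  obtain g h where "g \<in> S" "x \<in> comp g" "h \<in> S" "y \<in> comp h" using assms by auto
  then show ?thesis using comp_mult[of x g y h] S_add[of g h] by blast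
qed

lemma B_kalg: "kalg K B"
proof -
  have "B = A\<lparr>carrier := kspan K A U\<rparr>" using carrier_B unfolding B_def by simp
  moreover have "kalg K (A\<lparr>carrier := kspan K A U\<rparr>)"
  proof (rule subalgebra)
    show "\<one>\<^bsub>A\<^esub> \<in> kspan K A U" using kspan_base[OF U_closed] comp_one S_zero by auto
    show "x \<otimes>\<^bsub>A\<^esub> y \<in> kspan K A U" if "x \<in> kspan K A U" "y \<in> kspan K A U" for x y
      by (rule kspan_mult_closed[OF U_closed _ that]) (rule U_mult)
  qed (use kspan_carrier[OF U_closed] kspan_add[OF U_closed] kspan_smult[OF U_closed] in auto)
  ultimately show ?thesis by simp
qed

sublocale B: kalg K B by (rule B_kalg)

lemma M_B: "M \<subseteq> carrier B" using M_comp comp_B[OF S_zero] by blast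

lemma I_ideal: "ideal I B" unfolding I_def by (rule B.A.genideal_ideal[OF M_B])

sublocale BI: kalg_ideal K B I by (intro kalg_ideal.intro B.kalg_axioms I_ideal)
sublocale Bq: kalg K Bq by (rule BI.quot_kalg)

lemma \<phi>_eq: "\<phi> = BI.cls" by (simp add: \<phi>_def fun_eq_iff)

lemma \<phi>_hom:
  "x \<in> carrier B \<Longrightarrow> \<phi> x \<in> carrier Bq"
  "x \<in> carrier B \<Longrightarrow> y \<in> carrier B \<Longrightarrow> \<phi> (x \<otimes>\<^bsub>A\<^esub> y) = \<phi> x \<otimes>\<^bsub>Bq\<^esub> \<phi> y"
  "x \<in> carrier B \<Longrightarrow> y \<in> carrier B \<Longrightarrow> \<phi> (x \<oplus>\<^bsub>A\<^esub> y) = \<phi> x \<oplus>\<^bsub>Bq\<^esub> \<phi> y"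
  "\<phi> \<one>\<^bsub>A\<^esub> = \<one>\<^bsub>Bq\<^esub>"
  "c \<in> carrier K \<Longrightarrow> x \<in> carrier B \<Longrightarrow> \<phi> (c \<odot>\<^bsub>A\<^esub> x) = c \<odot>\<^bsub>Bq\<^esub> \<phi> x"
  "x \<in> carrier B \<Longrightarrow> \<phi> x = \<zero>\<^bsub>Bq\<^esub> \<longleftrightarrow> x \<in> I"
  unfolding \<phi>_eq using BI.cls_closed BI.cls_mult BI.cls_add BI.cls_one BI.cls_smult BI.cls_zero_iff
  by (simp_all add: B_ops)

lemma prj_mult_left:
  assumes u: "u \<in> comp h" and x: "x \<in> carrier B"
  shows "prj g (u \<otimes>\<^bsub>A\<^esub> x) = u \<otimes>\<^bsub>A\<^esub> prj (\<lambda>i. g i - h i) x"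
  using x unfolding carrier_B
proof induction
  case kspan_zero
  have "prj g \<zero>\<^bsub>A\<^esub> = \<zero>\<^bsub>A\<^esub>" for g using prj_comp[OF M_comp[OF M_zero]] by simp
  then show ?case using comp_closed[OF u] by simp
next
  case (kspan_step x c s)
  then obtain g' where g': "g' \<in> S" "s \<in> comp g'" by auto
  have c: "u \<in> carrier A" "s \<in> carrier A" "x \<in> carrier A" "c \<in> carrier K"
    using u g' comp_closed kspan_step kspan_carrier[OF U_closed] by auto
  have p: "prj g x \<in> carrier A" if "x \<in> carrier A" for g x using comp_closed prj_closed that by blast
  have "prj g (u \<otimes>\<^bsub>A\<^esub> s) = u \<otimes>\<^bsub>A\<^esub> prj (\<lambda>i. g i - h i) s"
  proof -
    have "g = dplus h g' \<longleftrightarrow> (\<lambda>i. g i - h i) = g'" by (auto simp: fun_eq_iff algebra_simps)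
    then show ?thesis unfolding prj_comp[OF comp_mult[OF u g'(2)]] prj_comp[OF g'(2)] using c by simp
  qed
  then show ?case using kspan_step c
    by (simp add: A.r_distr smult_mult_right prj_add prj_smult p)
qed

lemma prj_mult_right:
  assumes u: "u \<in> comp h" and x: "x \<in> carrier B"
  shows "prj g (x \<otimes>\<^bsub>A\<^esub> u) = prj (\<lambda>i. g i - h i) x \<otimes>\<^bsub>A\<^esub> u"
  using x unfolding carrier_B
proof induction
  case kspan_zero
  have "prj g \<zero>\<^bsub>A\<^esub> = \<zero>\<^bsub>A\<^esub>" for g using prj_comp[OF M_comp[OF M_zero]] by simp
  then show ?case using comp_closed[OF u] by simp
next
  case (kspan_step x c s)
  then obtain g' where g': "g' \<in> S" "s \<in> comp g'" by auto
  have c: "u \<in> carrier A" "s \<in> carrier A" "x \<in> carrier A" "c \<in> carrier K"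
    using u g' comp_closed kspan_step kspan_carrier[OF U_closed] by auto
  have p: "prj g x \<in> carrier A" if "x \<in> carrier A" for g x using comp_closed prj_closed that by blast
  have "prj g (s \<otimes>\<^bsub>A\<^esub> u) = prj (\<lambda>i. g i - h i) s \<otimes>\<^bsub>A\<^esub> u"
  proof -
    have "g = dplus g' h \<longleftrightarrow> (\<lambda>i. g i - h i) = g'" by (auto simp: fun_eq_iff algebra_simps)
    then show ?thesis unfolding prj_comp[OF comp_mult[OF g'(2) u]] prj_comp[OF g'(2)] using c by simp
  qed
  then show ?case using kspan_step c
    by (simp add: A.l_distr smult_mult_left prj_add prj_smult p)
qed

lemma M_smult: "c \<in> carrier K \<Longrightarrow> x \<in> M \<Longrightarrow> c \<odot>\<^bsub>A\<^esub> x \<in> M"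
  using M_mult[OF comp_smult[OF _ comp_one], of c x] smult_mult_left[of c "\<one>\<^bsub>A\<^esub>" x]
    comp_closed[OF M_comp] by simp

text \<open>\<open>(x y)\<^sup>2 = x (y x) y\<close> lies in the prime ideal \<open>M\<close>, because \<open>y x \<in> M\<close> can be moved past \<open>x\<close>.\<close>

lemma M_swap:
  assumes g: "g \<in> S" and x: "x \<in> comp (duminus g)" and y: "y \<in> comp g" and m: "y \<otimes>\<^bsub>A\<^esub> x \<in> M"
  shows "x \<otimes>\<^bsub>A\<^esub> y \<in> M"
proof -
  have c: "x \<in> carrier A" "y \<in> carrier A" using x y comp_closed by auto
  have xy: "x \<otimes>\<^bsub>A\<^esub> y \<in> comp dzero" using comp_mult[OF x y] by simp
  have ym: "y \<otimes>\<^bsub>A\<^esub> x \<in> comp dzero" using M_comp[OF m] .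
  have "x \<otimes>\<^bsub>A\<^esub> y \<otimes>\<^bsub>A\<^esub> (x \<otimes>\<^bsub>A\<^esub> y) = (x \<otimes>\<^bsub>A\<^esub> (y \<otimes>\<^bsub>A\<^esub> x)) \<otimes>\<^bsub>A\<^esub> y"
    using c by (simp add: A.m_assoc)
  also have "\<dots> = tw (duminus g) (y \<otimes>\<^bsub>A\<^esub> x) \<otimes>\<^bsub>A\<^esub> x \<otimes>\<^bsub>A\<^esub> y"
    using tw(2)[OF S_uminus[OF g] ym x] by simp
  also have "\<dots> = (x \<otimes>\<^bsub>A\<^esub> y) \<otimes>\<^bsub>A\<^esub> tw (duminus g) (y \<otimes>\<^bsub>A\<^esub> x)"
    using c comp_zero_comm[OF xy tw(1)[OF S_uminus[OF g] ym]] comp_closed[OF tw(1)[OF S_uminus[OF g] ym]]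
    by (simp add: A.m_assoc)
  also have "\<dots> \<in> M" using M_mult[OF xy] tw(3)[OF S_uminus[OF g] ym] m by simp
  finally show ?thesis using M_prime[OF xy xy] by blast
qed

text \<open>
  The largest graded ideal of \<open>B\<close> whose degree zero part is contained in \<open>M\<close>. It contains \<open>I\<close>, and
  membership in \<open>J\<close> is an explicit condition on homogeneous components; so \<open>J\<close> serves to show that
  elements do not lie in \<open>I\<close>.
\<close>

definition "J = {x \<in> carrier B. \<forall>g\<in>S. \<forall>y\<in>comp (duminus g). y \<otimes>\<^bsub>A\<^esub> prj g x \<in> M}"

lemma J_mult:
  assumes x: "x \<in> J" and u: "u \<in> comp h" "h \<in> S"
  shows "u \<otimes>\<^bsub>A\<^esub> x \<in> J" "x \<otimes>\<^bsub>A\<^esub> u \<in> J"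
proof -
  have xB: "x \<in> carrier B" and xM: "\<And>g y. g \<in> S \<Longrightarrow> y \<in> comp (duminus g) \<Longrightarrow> y \<otimes>\<^bsub>A\<^esub> prj g x \<in> M"
    using x by (auto simp: J_def)
  have uB: "u \<in> carrier B" using u comp_B by auto
  have xA: "x \<in> carrier A" and uA: "u \<in> carrier A" using xB uB B_sub by auto
  have gh: "(\<lambda>i. g i - h i) \<in> S" if "g \<in> S" for g using S_add[OF that S_uminus[OF u(2)]] by simp
  have pc: "prj g x \<in> carrier A" for g using comp_closed[OF prj_closed[OF xA]] .
  have "y \<otimes>\<^bsub>A\<^esub> prj g (u \<otimes>\<^bsub>A\<^esub> x) \<in> M" if g: "g \<in> S" and y: "y \<in> comp (duminus g)" for g y
  proof -
    have "y \<otimes>\<^bsub>A\<^esub> u \<in> comp (duminus (\<lambda>i. g i - h i))"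
      using comp_mult[OF y u(1)] by (simp add: algebra_simps)
    from xM[OF gh[OF g] this] show ?thesis
      using uA y comp_closed[OF y] pc by (simp add: prj_mult_left[OF u(1) xB] A.m_assoc)
  qed
  then show "u \<otimes>\<^bsub>A\<^esub> x \<in> J" using B.A.m_closed[OF uB xB] by (simp add: J_def B_ops)
  have "y \<otimes>\<^bsub>A\<^esub> prj g (x \<otimes>\<^bsub>A\<^esub> u) \<in> M" if g: "g \<in> S" and y: "y \<in> comp (duminus g)" for g y
  proof -
    let ?x = "prj (\<lambda>i. g i - h i) x"
    have yc: "y \<in> carrier A" using y comp_closed by auto
    have "u \<otimes>\<^bsub>A\<^esub> y \<in> comp (duminus (\<lambda>i. g i - h i))"
      using comp_mult[OF u(1) y] by (simp add: algebra_simps)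
    from xM[OF gh[OF g] this] have m: "u \<otimes>\<^bsub>A\<^esub> (y \<otimes>\<^bsub>A\<^esub> ?x) \<in> M"
      using uA yc pc by (simp add: A.m_assoc)
    have "y \<otimes>\<^bsub>A\<^esub> ?x \<in> comp (duminus h)"
      using comp_mult[OF y prj_closed[OF xA, of "\<lambda>i. g i - h i"]] by (simp add: algebra_simps)
    from M_swap[OF u(2) this u(1) m] show ?thesis
      using uA yc pc by (simp add: prj_mult_right[OF u(1) xB] A.m_assoc)
  qed
  then show "x \<otimes>\<^bsub>A\<^esub> u \<in> J" using B.A.m_closed[OF xB uB] by (simp add: J_def B_ops)
qed

lemma J_zero: "\<zero>\<^bsub>A\<^esub> \<in> J"
proof -
  have "prj g \<zero>\<^bsub>A\<^esub> = \<zero>\<^bsub>A\<^esub>" for g using prj_comp[OF M_comp[OF M_zero]] by simp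
  then show ?thesis using M_zero comp_closed B.A.zero_closed by (auto simp: J_def B_ops)
qed

lemma J_add: "x \<in> J \<Longrightarrow> y \<in> J \<Longrightarrow> x \<oplus>\<^bsub>A\<^esub> y \<in> J"
proof -
  assume x: "x \<in> J" and y: "y \<in> J"
  then have B: "x \<in> carrier B" "y \<in> carrier B" by (auto simp: J_def)
  have p: "prj g x \<in> carrier A" if "x \<in> carrier B" for g x using comp_closed prj_closed that B_sub by blast
  show ?thesis using x y B B.A.a_closed[OF B] B_sub p comp_closed
    by (auto simp: J_def B_ops prj_add A.r_distr intro!: M_add)
qed

lemma J_smult: "c \<in> carrier K \<Longrightarrow> x \<in> J \<Longrightarrow> c \<odot>\<^bsub>A\<^esub> x \<in> J"
proof -
  assume c: "c \<in> carrier K" and x: "x \<in> J"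
  then have B: "x \<in> carrier B" by (auto simp: J_def)
  have p: "prj g x \<in> carrier A" if "x \<in> carrier B" for g x using comp_closed prj_closed that B_sub by blast
  show ?thesis using x c B B.smult_closed[OF c B] B_sub p comp_closed
    by (auto simp: J_def B_ops prj_smult smult_mult_right intro!: M_smult)
qed

lemma J_ideal: "ideal J B"
proof (rule idealI)
  show "ring B" by (rule B.A.ring_axioms)
  have JB: "J \<subseteq> carrier B" by (auto simp: J_def)
  show "subgroup J (add_monoid B)"
  proof (rule B.A.add.subgroupI)
    show "J \<subseteq> carrier B" by (rule JB)
    show "J \<noteq> {}" using J_zero by auto
    show "\<ominus>\<^bsub>B\<^esub> a \<in> J" if "a \<in> J" for a
      using J_smult[of "\<ominus> \<one>" a] that JB B.smult_l_minus[of "\<one>" a] B_sub[of a] by (auto simp: B_ops)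
    show "a \<oplus>\<^bsub>B\<^esub> b \<in> J" if "a \<in> J" "b \<in> J" for a b using J_add that by (simp add: B_ops)
  qed
  have "x \<otimes>\<^bsub>A\<^esub> a \<in> J \<and> a \<otimes>\<^bsub>A\<^esub> x \<in> J" if a: "a \<in> J" and x: "x \<in> kspan K A U" for a x
    using x
  proof induction
    case kspan_zero
    then show ?case using J_zero JB B_sub a by auto
  next
    case (kspan_step x c s)
    then obtain h where h: "h \<in> S" "s \<in> comp h" by auto
    have cl: "x \<in> carrier A" "s \<in> carrier A" "a \<in> carrier A"
      using kspan_step kspan_carrier[OF U_closed] h comp_closed a JB B_sub by auto
    show ?case using kspan_step J_mult[OF a h(2,1)] cl
      by (auto simp: A.l_distr A.r_distr smult_mult_left smult_mult_right intro!: J_add J_smult)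
  qed
  then show "x \<otimes>\<^bsub>B\<^esub> a \<in> J" "a \<otimes>\<^bsub>B\<^esub> x \<in> J" if "a \<in> J" "x \<in> carrier B" for a x
    using that by (auto simp: carrier_B B_ops)
qed

lemma I_sub_J: "I \<subseteq> J"
  unfolding I_def
proof (rule B.A.genideal_minimal[OF J_ideal])
  show "M \<subseteq> J"
  proof
    fix x assume x: "x \<in> M"
    have "y \<otimes>\<^bsub>A\<^esub> prj g x \<in> M" if "g \<in> S" "y \<in> comp (duminus g)" for g y
    proof (cases "g = dzero")
      case True
      then show ?thesis using that M_mult x prj_comp[OF M_comp[OF x]] by simp
    next
      case False
      then show ?thesis using that M_zero prj_comp[OF M_comp[OF x]] comp_closed by simp
    qed
    then show "x \<in> J" using M_B x by (auto simp: J_def)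
  qed
qed

lemma M_sub_I: "M \<subseteq> I"
  unfolding I_def by (rule B.A.genideal_self[OF M_B])

lemma \<phi>_nonzero:
  assumes "g \<in> S" "x \<in> comp g" "y \<in> comp (duminus g)" "y \<otimes>\<^bsub>A\<^esub> x \<notin> M"
  shows "\<phi> x \<noteq> \<zero>\<^bsub>Bq\<^esub>"
proof
  assume "\<phi> x = \<zero>\<^bsub>Bq\<^esub>"
  then have "x \<in> J" using \<phi>_hom(6)[OF comp_B[OF assms(1,2)]] I_sub_J by auto
  then have "y \<otimes>\<^bsub>A\<^esub> prj g x \<in> M" using assms by (auto simp: J_def)
  then show False using assms prj_comp[OF assms(2), of g] by simp
qed

text \<open>
  If \<open>v u \<notin> M\<close> for some \<open>v\<close> of degree \<open>- g\<close>, then \<open>u\<close> spans the component of degree \<open>g\<close> modulo \<open>I\<close>. In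
  \<open>(x v) u = x (v u)\<close> the factor \<open>x v\<close> is congruent to a scalar modulo \<open>M\<close>, and \<open>v u\<close>, moved to the left
  of \<open>x\<close>, stays outside \<open>M\<close> and is invertible modulo \<open>M\<close>.
\<close>

lemma \<phi>_comp_scalar:
  assumes g: "g \<in> S" and x: "x \<in> comp g" and u: "u \<in> comp g" and v: "v \<in> comp (duminus g)"
    and vu: "v \<otimes>\<^bsub>A\<^esub> u \<notin> M"
  shows "\<exists>c \<in> carrier K. \<phi> x = c \<odot>\<^bsub>Bq\<^esub> \<phi> u"
proof -
  define r where "r = x \<otimes>\<^bsub>A\<^esub> v"
  define t where "t = v \<otimes>\<^bsub>A\<^esub> u"
  have r: "r \<in> comp dzero" and t: "t \<in> comp dzero"
    using comp_mult[OF x v] comp_mult[OF v u] by (simp_all add: r_def t_def)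
  define t' where "t' = tw g t"
  have t': "t' \<in> comp dzero" "t' \<notin> M" using tw[OF g t] vu by (auto simp: t'_def t_def)
  obtain s where s: "s \<in> comp dzero" "s \<otimes>\<^bsub>A\<^esub> t' \<ominus>\<^bsub>A\<^esub> \<one>\<^bsub>A\<^esub> \<in> M" using M_inverse[OF t'] by blast
  define m where "m = s \<otimes>\<^bsub>A\<^esub> t' \<ominus>\<^bsub>A\<^esub> \<one>\<^bsub>A\<^esub>"
  have sr: "s \<otimes>\<^bsub>A\<^esub> r \<in> comp dzero" using comp_mult[OF s(1) r] by simp
  obtain c where c: "c \<in> carrier K" "s \<otimes>\<^bsub>A\<^esub> r \<ominus>\<^bsub>A\<^esub> c \<odot>\<^bsub>A\<^esub> \<one>\<^bsub>A\<^esub> \<in> M" using M_scalar[OF sr] by blast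
  define m' where "m' = s \<otimes>\<^bsub>A\<^esub> r \<ominus>\<^bsub>A\<^esub> c \<odot>\<^bsub>A\<^esub> \<one>\<^bsub>A\<^esub>"
  have cl: "x \<in> carrier A" "u \<in> carrier A" "v \<in> carrier A" "s \<in> carrier A" "t' \<in> carrier A" "r \<in> carrier A"
    "t \<in> carrier A"
    using x u v s r t t' comp_closed by auto
  have mc: "m \<in> carrier A" "m' \<in> carrier A" using cl c by (auto simp: m_def m'_def)
  have e1: "s \<otimes>\<^bsub>A\<^esub> t' = m \<oplus>\<^bsub>A\<^esub> \<one>\<^bsub>A\<^esub>" using cl by (simp add: m_def A.minus_eq A.a_assoc A.l_neg)
  have e2: "s \<otimes>\<^bsub>A\<^esub> r = m' \<oplus>\<^bsub>A\<^esub> c \<odot>\<^bsub>A\<^esub> \<one>\<^bsub>A\<^esub>" using cl c by (simp add: m'_def A.minus_eq A.a_assoc A.l_neg)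
  have "r \<otimes>\<^bsub>A\<^esub> u = x \<otimes>\<^bsub>A\<^esub> t" using cl by (simp add: r_def t_def A.m_assoc)
  also have "\<dots> = t' \<otimes>\<^bsub>A\<^esub> x" using tw(2)[OF g t x] by (simp add: t'_def)
  finally have "s \<otimes>\<^bsub>A\<^esub> r \<otimes>\<^bsub>A\<^esub> u = s \<otimes>\<^bsub>A\<^esub> t' \<otimes>\<^bsub>A\<^esub> x" using cl by (simp add: A.m_assoc)
  then have eq: "m' \<otimes>\<^bsub>A\<^esub> u \<oplus>\<^bsub>A\<^esub> c \<odot>\<^bsub>A\<^esub> u = m \<otimes>\<^bsub>A\<^esub> x \<oplus>\<^bsub>A\<^esub> x"
    unfolding e1 e2 using cl mc c by (simp add: A.l_distr smult_mult_left)
  have B: "m \<in> carrier B" "m' \<in> carrier B" "u \<in> carrier B" "x \<in> carrier B"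
    using s c M_B comp_B[OF g] u x by (auto simp: m_def m'_def)
  have I: "m \<otimes>\<^bsub>A\<^esub> x \<in> I" "m' \<otimes>\<^bsub>A\<^esub> u \<in> I"
    using BI.I_r_closed[of m x] BI.I_r_closed[of m' u] s c M_sub_I B by (auto simp: m_def m'_def B_ops)
  have z: "\<phi> (m \<otimes>\<^bsub>A\<^esub> x) = \<zero>\<^bsub>Bq\<^esub>" "\<phi> (m' \<otimes>\<^bsub>A\<^esub> u) = \<zero>\<^bsub>Bq\<^esub>"
    using I \<phi>_hom(6) BI.a_Hcarr by auto
  have Bc: "m \<otimes>\<^bsub>A\<^esub> x \<in> carrier B" "m' \<otimes>\<^bsub>A\<^esub> u \<in> carrier B" "c \<odot>\<^bsub>A\<^esub> u \<in> carrier B"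
    using I BI.a_Hcarr B.smult_closed[OF c(1) B(3)] by (auto simp: B_ops)
  have "\<phi> (m' \<otimes>\<^bsub>A\<^esub> u \<oplus>\<^bsub>A\<^esub> c \<odot>\<^bsub>A\<^esub> u) = \<phi> (m \<otimes>\<^bsub>A\<^esub> x \<oplus>\<^bsub>A\<^esub> x)" by (simp only: eq)
  then have "c \<odot>\<^bsub>Bq\<^esub> \<phi> u = \<phi> x" using Bc B c z \<phi>_hom(1,3,5) by simp
  with c show ?thesis by force
qed

end

text \<open>In addition a set \<open>G \<subseteq> S\<close> of degrees, closed under addition, with elements \<open>u g\<close> of degree \<open>g\<close> and \<open>v g\<close> of
  degree \<open>- g\<close> such that \<open>v g \<cdot> u g \<notin> M\<close>.\<close>

locale weight_basis = weight_setting K A comp prj S M tw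
  for K :: "('k, 'x) ring_scheme" (structure) and A :: "('k, 'a, 'y) module_scheme" (structure)
    and comp prj S M tw +
  fixes G :: "(nat \<Rightarrow> int) set" and u v :: "(nat \<Rightarrow> int) \<Rightarrow> 'a"
  assumes G_sub: "g \<in> G \<Longrightarrow> g \<in> S" and G_zero: "dzero \<in> G"
    and G_add: "g \<in> G \<Longrightarrow> h \<in> G \<Longrightarrow> dplus g h \<in> G"
    and u: "g \<in> G \<Longrightarrow> u g \<in> comp g" and v: "g \<in> G \<Longrightarrow> v g \<in> comp (duminus g)"
    and vu: "g \<in> G \<Longrightarrow> v g \<otimes>\<^bsub>A\<^esub> u g \<notin> M"
begin

text \<open>\<open>B1\<close> is the span of the images of the components with degree in \<open>G\<close>; the elements \<open>V g\<close> turn out to be a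
  basis of it.\<close>

abbreviation "W \<equiv> (\<Union>g\<in>G. \<phi> ` comp g)"
definition "B1 = Bq\<lparr>carrier := sum_of Bq G (\<lambda>g. \<phi> ` comp g)\<rparr>"
definition "V g = \<phi> (u g)"

lemma compB: "g \<in> G \<Longrightarrow> x \<in> comp g \<Longrightarrow> x \<in> carrier B"
  using G_sub comp_B by blast

lemma uB: "g \<in> G \<Longrightarrow> u g \<in> carrier B" using compB u by blast

lemma W_closed: "W \<subseteq> carrier Bq" using \<phi>_hom(1) compB by auto

lemma V_closed_Bq: "g \<in> G \<Longrightarrow> V g \<in> carrier Bq"
  unfolding V_def by (rule \<phi>_hom(1)[OF uB])

lemma carrier_B1: "carrier B1 = kspan K Bq W"
proof -
  have "c \<odot>\<^bsub>Bq\<^esub> x \<in> W" if c: "c \<in> carrier K" and x: "x \<in> W" for c x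
  proof -
    obtain g y where g: "g \<in> G" "y \<in> comp g" "x = \<phi> y" using x by auto
    then have "c \<odot>\<^bsub>Bq\<^esub> x = \<phi> (c \<odot>\<^bsub>A\<^esub> y)" using c compB by (simp add: \<phi>_hom)
    then show ?thesis using g c comp_smult by blast
  qed
  then show ?thesis unfolding B1_def sum_of_def using Bq.generate_eq_kspan[OF W_closed] by auto
qed

lemma B1_ops: "monoid.mult B1 = monoid.mult Bq" "one B1 = one Bq" "ring.zero B1 = ring.zero Bq"
  "ring.add B1 = ring.add Bq" "smult B1 = smult Bq"
  by (simp_all add: B1_def)

lemma B1_kalg: "kalg K B1"
proof -
  have "B1 = Bq\<lparr>carrier := kspan K Bq W\<rparr>" using carrier_B1 unfolding B1_def by simp
  moreover have "kalg K (Bq\<lparr>carrier := kspan K Bq W\<rparr>)"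
  proof (rule Bq.subalgebra)
    have "\<one>\<^bsub>Bq\<^esub> \<in> W" using \<phi>_hom(4) comp_one G_zero by (metis UN_iff imageI)
    then show "\<one>\<^bsub>Bq\<^esub> \<in> kspan K Bq W" using Bq.kspan_base[OF W_closed] by blast
    have "x \<otimes>\<^bsub>Bq\<^esub> y \<in> W" if "x \<in> W" "y \<in> W" for x y
    proof -
      from that(1) obtain g where g1: "g \<in> G" "x \<in> \<phi> ` comp g" by (rule UN_E)
      from g1(2) obtain x' where "x = \<phi> x'" "x' \<in> comp g" by (rule imageE)
      with g1 have g: "g \<in> G" "x' \<in> comp g" "x = \<phi> x'" by simp_all
      from that(2) obtain h where h1: "h \<in> G" "y \<in> \<phi> ` comp h" by (rule UN_E)
      from h1(2) obtain y' where "y = \<phi> y'" "y' \<in> comp h" by (rule imageE)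
      with h1 have h: "h \<in> G" "y' \<in> comp h" "y = \<phi> y'" by simp_all
      have "x \<otimes>\<^bsub>Bq\<^esub> y = \<phi> (x' \<otimes>\<^bsub>A\<^esub> y')"
        unfolding g(3) h(3) by (rule \<phi>_hom(2)[OF compB[OF g(1,2)] compB[OF h(1,2)], symmetric])
      then show ?thesis using comp_mult[OF g(2) h(2)] G_add[OF g(1) h(1)] by blast
    qed
    then show "x \<otimes>\<^bsub>Bq\<^esub> y \<in> kspan K Bq W" if "x \<in> kspan K Bq W" "y \<in> kspan K Bq W" for x y
      by (rule Bq.kspan_mult_closed[OF W_closed _ that])
  qed (use Bq.kspan_carrier[OF W_closed] Bq.kspan_add[OF W_closed] Bq.kspan_smult[OF W_closed] in auto)
  ultimately show ?thesis by simp
qed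

sublocale B1: kalg K B1 by (rule B1_kalg)

lemma V_closed: "g \<in> G \<Longrightarrow> V g \<in> carrier B1"
proof -
  assume "g \<in> G"
  then have "V g \<in> W" using u by (auto simp: V_def)
  then show ?thesis unfolding carrier_B1 by (rule Bq.kspan_base[OF W_closed])
qed

lemma V_one: "u dzero = \<one>\<^bsub>A\<^esub> \<Longrightarrow> V dzero = \<one>\<^bsub>B1\<^esub>"
  by (simp add: V_def \<phi>_hom B1_ops)

lemma kspan_V: "carrier B1 = kspan K B1 (V ` G)"
proof -
  have VB: "V ` G \<subseteq> carrier B1" using V_closed by auto
  have "x \<in> kspan K B1 (V ` G)" if "x \<in> kspan K Bq W" for x
    using that
  proof induction
    case kspan_zero
    then show ?case using kspan.kspan_zero[of B1] by (simp add: B1_ops)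
  next
    case (kspan_step x c s)
    then obtain g y where g: "g \<in> G" "y \<in> comp g" "s = \<phi> y" by auto
    obtain d where d: "d \<in> carrier K" "s = d \<odot>\<^bsub>Bq\<^esub> V g"
      using \<phi>_comp_scalar[OF G_sub[OF g(1)] g(2) u[OF g(1)] v[OF g(1)] vu[OF g(1)]] g(3) by (auto simp: V_def)
    have "c \<odot>\<^bsub>B1\<^esub> (d \<odot>\<^bsub>B1\<^esub> V g) \<in> kspan K B1 (V ` G)"
      using kspan_step g d by (intro B1.kspan_smult[OF VB] B1.kspan_base[OF VB]) auto
    then show ?case using B1.kspan_add[OF VB kspan_step.IH] d by (simp add: B1_ops)
  qed
  then show ?thesis using B1.kspan_carrier[OF VB] carrier_B1 by blast
qed

text \<open>The product is a multiple of \<open>V (g + h)\<close>. It is not zero because \<open>(v h \<cdot> v g) (u g \<cdot> u h)\<close> is, up to the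
  action, the product of \<open>v g \<cdot> u g\<close> and \<open>v h \<cdot> u h\<close>, both outside the prime ideal \<open>M\<close>.\<close>

lemma V_mult:
  assumes g: "g \<in> G" and h: "h \<in> G"
  shows "B1.prp (V g \<otimes>\<^bsub>B1\<^esub> V h) (V (dplus g h))"
proof -
  have gh: "dplus g h \<in> G" using G_add[OF g h] .
  have uu: "u g \<otimes>\<^bsub>A\<^esub> u h \<in> comp (dplus g h)" by (rule comp_mult[OF u[OF g] u[OF h]])
  have e: "V g \<otimes>\<^bsub>B1\<^esub> V h = \<phi> (u g \<otimes>\<^bsub>A\<^esub> u h)" using uB g h by (simp add: V_def \<phi>_hom B1_ops)
  obtain c where c: "c \<in> carrier K" "\<phi> (u g \<otimes>\<^bsub>A\<^esub> u h) = c \<odot>\<^bsub>Bq\<^esub> V (dplus g h)"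
    using \<phi>_comp_scalar[OF G_sub[OF gh] uu u[OF gh] v[OF gh] vu[OF gh]] by (auto simp: V_def)
  have vv: "v h \<otimes>\<^bsub>A\<^esub> v g \<in> comp (duminus (dplus g h))"
    using comp_mult[OF v[OF h] v[OF g]] by (simp add: algebra_simps)
  define t where "t = v g \<otimes>\<^bsub>A\<^esub> u g"
  have t: "t \<in> comp dzero" "t \<notin> M"
    using comp_mult[OF v[OF g] u[OF g]] vu[OF g] by (auto simp: t_def)
  have t': "v h \<otimes>\<^bsub>A\<^esub> u h \<in> comp dzero"
    using comp_mult[OF v[OF h] u[OF h]] by auto
  have cl: "u g \<in> carrier A" "u h \<in> carrier A" "v g \<in> carrier A" "v h \<in> carrier A"
    using u[OF g, THEN comp_closed] u[OF h, THEN comp_closed] v[OF g, THEN comp_closed]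
      v[OF h, THEN comp_closed] by auto
  have S: "duminus h \<in> S" using S_uminus G_sub h by auto
  have "v h \<otimes>\<^bsub>A\<^esub> v g \<otimes>\<^bsub>A\<^esub> (u g \<otimes>\<^bsub>A\<^esub> u h) = v h \<otimes>\<^bsub>A\<^esub> t \<otimes>\<^bsub>A\<^esub> u h"
    using cl by (simp add: t_def A.m_assoc)
  also have "\<dots> = tw (duminus h) t \<otimes>\<^bsub>A\<^esub> v h \<otimes>\<^bsub>A\<^esub> u h" using tw(2)[OF S t(1) v[OF h]] by simp
  also have "\<dots> = tw (duminus h) t \<otimes>\<^bsub>A\<^esub> (v h \<otimes>\<^bsub>A\<^esub> u h)"
    using cl comp_closed[OF tw(1)[OF S t(1)]] by (simp add: A.m_assoc)
  also have "\<dots> \<notin> M" using M_prime[OF tw(1)[OF S t(1)] t'] tw(3)[OF S t(1)] t(2) vu[OF h] by blast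
  finally have nz: "\<phi> (u g \<otimes>\<^bsub>A\<^esub> u h) \<noteq> \<zero>\<^bsub>Bq\<^esub>" using \<phi>_nonzero[OF G_sub[OF gh] uu vv] by blast
  have "c \<noteq> \<zero>"
  proof
    assume "c = \<zero>"
    then show False using nz Bq.smult_l_null[OF V_closed_Bq[OF gh]] unfolding c(2) by simp
  qed
  moreover have "V g \<otimes>\<^bsub>B1\<^esub> V h = c \<odot>\<^bsub>B1\<^esub> V (dplus g h)" 
  proof -
    have "c \<odot>\<^bsub>B1\<^esub> z = c \<odot>\<^bsub>Bq\<^esub> z" for z by (simp add: B1_ops)
    then show ?thesis using e c(2) by (simp only:)
  qed
  ultimately show ?thesis using c(1) unfolding B1.prp_def by blast
qed

text \<open>A linear combination of the \<open>u g\<close> in \<open>I\<close> lies in \<open>J\<close>, so \<open>f g \<cdot> (v g \<cdot> u g) \<in> M\<close> for its part \<open>f g \<cdot> u g\<close> of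
  degree \<open>g\<close>, which forces \<open>f g = 0\<close>.\<close>

lemma V_independent:
  assumes f: "f \<in> fs K G" and z: "lin K B1 V f = \<zero>\<^bsub>B1\<^esub>"
  shows "f = (\<lambda>_. \<zero>)"
proof -
  have "lin K B1 V f = lin K Bq V f"
    using linear_map_lin[OF B1_kalg Bq.kalg_axioms f V_closed, where g = "\<lambda>x. x"]
      Bq.kspan_carrier[OF W_closed] carrier_B1 by (auto simp: B1_ops comp_def)
  also have "\<dots> = \<phi> (lin K B u f)"
    using linear_map_lin[OF B_kalg Bq.kalg_axioms f uB, where g = \<phi>] \<phi>_hom
    by (simp add: B_ops comp_def V_def[abs_def])
  also have lB: "lin K B u f = lin K A u f"
    using linear_map_lin[OF B_kalg kalg_axioms f uB, where g = "\<lambda>x. x"] B_sub by (simp add: B_ops comp_def)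
  finally have "\<phi> (lin K A u f) = \<zero>\<^bsub>Bq\<^esub>" using z by (simp add: B1_ops)
  moreover have lB': "lin K A u f \<in> carrier B" unfolding lB[symmetric] by (rule B.lin_closed[OF f]) (rule uB)
  ultimately have J: "lin K A u f \<in> J" using \<phi>_hom(6) I_sub_J by blast
  have "f g = \<zero>" if g: "g \<in> G" for g
  proof (rule ccontr)
    assume fg: "f g \<noteq> \<zero>"
    have fgc: "f g \<in> carrier K" using fsD(1)[OF f] .
    have uc: "u h \<in> carrier A" if "h \<in> G" for h using u comp_closed that by blast
    have "prj g (lin K A u f) = lin K A (prj g \<circ> u) f"
      by (rule linear_map_lin[OF kalg_axioms kalg_axioms f uc])
        (use comp_closed[OF prj_closed] prj_add prj_smult in auto)
    also have "\<dots> = lin K A (\<lambda>h. if h = g then u g else \<zero>\<^bsub>A\<^esub>) f"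
      by (rule lin_cong[OF f]) (use prj_comp[OF u] uc g in auto)
    also have "\<dots> = f g \<odot>\<^bsub>A\<^esub> u g" by (rule lin_delta[OF f g uc[OF g]])
    finally have p: "prj g (lin K A u f) = f g \<odot>\<^bsub>A\<^esub> u g" .
    have vc: "v g \<in> carrier A" using v comp_closed g by blast
    have "v g \<otimes>\<^bsub>A\<^esub> prj g (lin K A u f) \<in> M" using J v[OF g] G_sub[OF g] by (auto simp: J_def)
    then have "f g \<odot>\<^bsub>A\<^esub> (v g \<otimes>\<^bsub>A\<^esub> u g) \<in> M" unfolding p using fgc uc[OF g] vc by (simp add: smult_mult_right)
    moreover have inv: "inv (f g) \<in> carrier K" "inv (f g) \<otimes> f g = \<one>" using fg fgc by (auto simp: K.field_Units)
    ultimately have "inv (f g) \<odot>\<^bsub>A\<^esub> (f g \<odot>\<^bsub>A\<^esub> (v g \<otimes>\<^bsub>A\<^esub> u g)) \<in> M" using M_smult by blast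
    then have "v g \<otimes>\<^bsub>A\<^esub> u g \<in> M" using inv fgc uc[OF g] vc by (simp flip: smult_assoc1)
    with vu[OF g] show False by blast
  qed
  moreover have "f g = \<zero>" if "g \<notin> G" for g using f that by (auto simp: fs_def)
  ultimately show ?thesis by auto
qed

end

section \<open>The grading of a twisted generalized Weyl construction\<close>

text \<open>The generators of the construction: the coefficients and the letters.\<close>

abbreviation (input) gens :: "('k, 'r) tgw_data \<Rightarrow> 'r tgw_gen set" where
  "gens D \<equiv> Coef ` carrier (base D) \<union> Letter ` letters (nvars D)"

text \<open>The homogeneous elements of degree \<open>g\<close> of the free algebra.\<close>

definition hom_free :: "('k, 'r) tgw_data \<Rightarrow> (nat \<Rightarrow> int) \<Rightarrow> ('r tgw_gen list \<Rightarrow> 'k) set"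
  where "hom_free D g = fs (ground D) {w \<in> lists (gens D). mon_degree w = g}"

text \<open>The projection of the free algebra to its homogeneous elements of degree \<open>g\<close>.\<close>

definition res :: "('k, 'r) tgw_data \<Rightarrow> (nat \<Rightarrow> int) \<Rightarrow> ('r tgw_gen list \<Rightarrow> 'k) \<Rightarrow> 'r tgw_gen list \<Rightarrow> 'k"
  where "res D g f = (\<lambda>w. if mon_degree w = g then f w else \<zero>\<^bsub>ground D\<^esub>)"

text \<open>The value of a monomial in the construction.\<close>

definition tgw_mon :: "('k, 'r) tgw_data \<Rightarrow> 'r tgw_gen list \<Rightarrow> ('r tgw_gen list \<Rightarrow> 'k) set"
  where "tgw_mon D w = tgw_class D (basis_elt (ground D) w)"

text \<open>The generators \<open>X\<^sub>i\<close> and \<open>Y\<^sub>i\<close>.\<close>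

definition tgw_letter :: "('k, 'r) tgw_data \<Rightarrow> letter \<Rightarrow> ('r tgw_gen list \<Rightarrow> 'k) set"
  where "tgw_letter D z = tgw_class D (basis_elt (ground D) [Letter z])"

text \<open>The projection to the component of degree \<open>g\<close>, computed on an arbitrary representative in the free
  algebra. It does not depend on the representative because the defining ideal is graded.\<close>

definition tgw_prj :: "('k, 'r) tgw_data \<Rightarrow> (nat \<Rightarrow> int) \<Rightarrow> ('r tgw_gen list \<Rightarrow> 'k) set \<Rightarrow>
    ('r tgw_gen list \<Rightarrow> 'k) set"
  where "tgw_prj D g x =
    tgw_class D (res D g (SOME f. f \<in> carrier (tgw_free D) \<and> tgw_class D f = x))"

lemma mon_degree_simps [simp]:
  "mon_degree [] = (\<lambda>_. 0)"
  "mon_degree (z # w) = (\<lambda>i. gen_degree z i + mon_degree w i)"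
  "mon_degree (v @ w) = (\<lambda>i. mon_degree v i + mon_degree w i)"
  by (auto simp: mon_degree_def)

text \<open>A twisted generalized Weyl construction, with names for its constituents.\<close>

locale tgw =
  fixes D :: "('k, 'r) tgw_data"
  assumes data: "is_tgw_data D"
begin

abbreviation "K \<equiv> ground D"
abbreviation "R \<equiv> base D"
abbreviation "n \<equiv> nvars D"
abbreviation "F \<equiv> tgw_free D"
abbreviation "A \<equiv> tgwc D"
abbreviation "Gs \<equiv> gens D"
abbreviation "\<sigma> i \<equiv> aut D i"
abbreviation "\<tau> i \<equiv> aut_inv D i"
abbreviation "cls \<equiv> tgw_class D"
abbreviation "cf \<equiv> coef_map D"
abbreviation "mn \<equiv> tgw_mon D"
abbreviation "xl \<equiv> tgw_letter D"

lemma K_field: "field K" and R_algebra: "algebra K R"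
  using data by (auto simp: is_tgw_data_def)

sublocale K: field K by (rule K_field)
sublocale R: algebra K R by (rule R_algebra)

lemma R_cring: "cring R" by (rule R.M_cring)
sublocale R: cring R by (rule R_cring)

sublocale FM: monoid_algebra K "free_monoid Gs" by (rule free_monoid_algebra) (rule K_field)

lemma F_eq: "F = free_alg K Gs" by (simp add: tgw_free_def)

sublocale F: kalg K F unfolding F_eq by (rule FM.monoid_alg_kalg)

lemma carrier_F: "carrier F = fs K (lists Gs)"
  by (simp add: F_eq carrier_monoid_alg)

lemma hom_free_sub: "hom_free D g \<subseteq> carrier F"
  unfolding hom_free_def carrier_F by (auto simp: fs_def)

lemma res_closed: "f \<in> carrier F \<Longrightarrow> res D g f \<in> hom_free D g"
proof -
  assume f: "f \<in> carrier F"
  have "{w. res D g f w \<noteq> \<zero>\<^bsub>K\<^esub>} \<subseteq> {w. f w \<noteq> \<zero>\<^bsub>K\<^esub>}" by (auto simp: res_def)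
  then have "finite {w. res D g f w \<noteq> \<zero>\<^bsub>K\<^esub>}"
    using f finite_subset by (auto simp: carrier_F fs_def)
  then show ?thesis using f unfolding hom_free_def carrier_F fs_def by (auto simp: res_def)
qed

lemma res_hom: "f \<in> hom_free D h \<Longrightarrow> res D g f = (if g = h then f else \<zero>\<^bsub>F\<^esub>)"
proof -
  assume f: "f \<in> hom_free D h"
  have "f w = \<zero>\<^bsub>K\<^esub>" if "mon_degree w \<noteq> h" for w using f that by (auto simp: hom_free_def fs_def)
  then show ?thesis by (auto simp: F_eq monoid_alg_simps res_def fun_eq_iff)
qed

lemma hom_freeI:
  assumes "f \<in> carrier F" "\<And>w. f w \<noteq> \<zero>\<^bsub>K\<^esub> \<Longrightarrow> mon_degree w = g"
  shows "f \<in> hom_free D g"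
  using assms unfolding hom_free_def carrier_F fs_def by auto

lemma hom_freeD: "f \<in> hom_free D g \<Longrightarrow> f w \<noteq> \<zero>\<^bsub>K\<^esub> \<Longrightarrow> mon_degree w = g"
  by (auto simp: hom_free_def fs_def)

lemma component_eq: "component D g = cls ` hom_free D g"
proof -
  have "{f \<in> carrier F. \<forall>w. f w \<noteq> \<zero>\<^bsub>K\<^esub> \<longrightarrow> mon_degree w = g} = hom_free D g"
    using hom_freeI hom_freeD hom_free_sub by blast
  then show ?thesis by (simp add: component_def)
qed

lemma hom_free_add: "f \<in> hom_free D g \<Longrightarrow> h \<in> hom_free D g \<Longrightarrow> f \<oplus>\<^bsub>F\<^esub> h \<in> hom_free D g"
  unfolding hom_free_def F_eq monoid_alg_simps by (rule K.fs_add)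

lemma hom_free_smult: "c \<in> carrier K \<Longrightarrow> f \<in> hom_free D g \<Longrightarrow> c \<odot>\<^bsub>F\<^esub> f \<in> hom_free D g"
  unfolding hom_free_def F_eq monoid_alg_simps by (rule K.fs_smult)

lemma hom_free_mult:
  assumes f: "f \<in> hom_free D g" and h: "h \<in> hom_free D g'" and k: "\<And>i. k i = g i + g' i"
  shows "f \<otimes>\<^bsub>F\<^esub> h \<in> hom_free D k"
proof (rule hom_freeI)
  show "f \<otimes>\<^bsub>F\<^esub> h \<in> carrier F" using f h hom_free_sub F.A.m_closed by blast
  fix w assume w: "(f \<otimes>\<^bsub>F\<^esub> h) w \<noteq> \<zero>\<^bsub>K\<^esub>"
  have "{(u, v). f u \<noteq> \<zero>\<^bsub>K\<^esub> \<and> h v \<noteq> \<zero>\<^bsub>K\<^esub> \<and> u @ v = w} \<noteq> {}"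
  proof
    assume "{(u, v). f u \<noteq> \<zero>\<^bsub>K\<^esub> \<and> h v \<noteq> \<zero>\<^bsub>K\<^esub> \<and> u @ v = w} = {}"
    note e = this
    have "(f \<otimes>\<^bsub>F\<^esub> h) w = finsum K (\<lambda>(u, v). f u \<otimes>\<^bsub>K\<^esub> h v) {(u, v). f u \<noteq> \<zero>\<^bsub>K\<^esub> \<and> h v \<noteq> \<zero>\<^bsub>K\<^esub> \<and> u @ v = w}"
      unfolding F_eq by (simp add: monoid_alg_def)
    also have "\<dots> = \<zero>\<^bsub>K\<^esub>" unfolding e by simp
    finally show False using w by simp
  qed
  then obtain u v where "f u \<noteq> \<zero>\<^bsub>K\<^esub>" "h v \<noteq> \<zero>\<^bsub>K\<^esub>" "w = u @ v" by auto
  then show "mon_degree w = k" using hom_freeD[OF f] hom_freeD[OF h] k by auto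
qed

lemma hom_free_basis: "w \<in> lists Gs \<Longrightarrow> mon_degree w = g \<Longrightarrow> basis_elt K w \<in> hom_free D g"
  unfolding hom_free_def basis_elt_single by (rule K.fs_single) auto

lemma hom_free_one: "\<one>\<^bsub>F\<^esub> \<in> hom_free D (\<lambda>_. 0)"
  using hom_free_basis[of "[]"] FM.basis_elt_one by (simp add: F_eq)

lemma res_add: "f \<in> carrier F \<Longrightarrow> h \<in> carrier F \<Longrightarrow> res D g (f \<oplus>\<^bsub>F\<^esub> h) = res D g f \<oplus>\<^bsub>F\<^esub> res D g h"
  by (auto simp: F_eq monoid_alg_simps res_def fun_eq_iff)

lemma res_smult: "c \<in> carrier K \<Longrightarrow> f \<in> carrier F \<Longrightarrow> res D g (c \<odot>\<^bsub>F\<^esub> f) = c \<odot>\<^bsub>F\<^esub> res D g f"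
  by (auto simp: F_eq monoid_alg_simps res_def fun_eq_iff)

lemma res_mult:
  assumes u: "u \<in> hom_free D h" and f: "f \<in> carrier F"
  shows "res D g (u \<otimes>\<^bsub>F\<^esub> f) = u \<otimes>\<^bsub>F\<^esub> res D (\<lambda>i. g i - h i) f"
    "res D g (f \<otimes>\<^bsub>F\<^esub> u) = res D (\<lambda>i. g i - h i) f \<otimes>\<^bsub>F\<^esub> u"
proof -
  have uF: "u \<in> carrier F" using u hom_free_sub by auto
  have r0: "res D g \<zero>\<^bsub>F\<^esub> = \<zero>\<^bsub>F\<^esub>" for g by (auto simp: F_eq monoid_alg_simps res_def)
  have rF: "res D g f \<in> carrier F" if "f \<in> carrier F" for f g using res_closed[OF that] hom_free_sub by blast
  have z: "(\<lambda>_. \<zero>\<^bsub>K\<^esub>) = \<zero>\<^bsub>F\<^esub>" by (simp add: F_eq monoid_alg_simps)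
  have "f \<in> fs K (lists Gs)" using f by (simp add: carrier_F)
  then have "res D g (u \<otimes>\<^bsub>F\<^esub> f) = u \<otimes>\<^bsub>F\<^esub> res D (\<lambda>i. g i - h i) f \<and>
    res D g (f \<otimes>\<^bsub>F\<^esub> u) = res D (\<lambda>i. g i - h i) f \<otimes>\<^bsub>F\<^esub> u"
  proof (induction rule: K.fs_induct)
    case zero
    then show ?case unfolding z using uF by (simp add: r0)
  next
    case (add f w c)
    define s where "s = single K w c"
    have s: "s \<in> hom_free D (mon_degree w)" unfolding s_def hom_free_def
      using add by (intro K.fs_single) auto
    have cl: "f \<in> carrier F" "s \<in> carrier F" using add s hom_free_sub by (auto simp: carrier_F)
    have e: "(\<lambda>y. f y \<oplus>\<^bsub>K\<^esub> single K w c y) = f \<oplus>\<^bsub>F\<^esub> s" by (simp add: F_eq monoid_alg_simps s_def)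
    have us: "u \<otimes>\<^bsub>F\<^esub> s \<in> hom_free D (\<lambda>i. h i + mon_degree w i)"
      "s \<otimes>\<^bsub>F\<^esub> u \<in> hom_free D (\<lambda>i. h i + mon_degree w i)"
      using hom_free_mult[OF u s] hom_free_mult[OF s u] by auto
    have eq: "g = (\<lambda>i. h i + mon_degree w i) \<longleftrightarrow> (\<lambda>i. g i - h i) = mon_degree w"
      by (auto simp: fun_eq_iff algebra_simps)
    have "res D g (u \<otimes>\<^bsub>F\<^esub> s) = u \<otimes>\<^bsub>F\<^esub> res D (\<lambda>i. g i - h i) s"
      "res D g (s \<otimes>\<^bsub>F\<^esub> u) = res D (\<lambda>i. g i - h i) s \<otimes>\<^bsub>F\<^esub> u"
      unfolding res_hom[OF us(1)] res_hom[OF us(2)] res_hom[OF s] eq using uF by auto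
    then show ?case
      unfolding e using add.IH cl uF rF by (simp add: F.A.r_distr F.A.l_distr res_add)
  qed
  then show "res D g (u \<otimes>\<^bsub>F\<^esub> f) = u \<otimes>\<^bsub>F\<^esub> res D (\<lambda>i. g i - h i) f"
    "res D g (f \<otimes>\<^bsub>F\<^esub> u) = res D (\<lambda>i. g i - h i) f \<otimes>\<^bsub>F\<^esub> u" by auto
qed

lemma aut_iso: "i \<in> {1..n} \<Longrightarrow> \<sigma> i \<in> alg_iso K R R"
  using data by (auto simp: is_tgw_data_def)

lemma \<sigma>_facts:
  assumes "i \<in> {1..n}"
  shows "r \<in> carrier R \<Longrightarrow> \<sigma> i r \<in> carrier R" "r \<in> carrier R \<Longrightarrow> \<tau> i r \<in> carrier R"
    "r \<in> carrier R \<Longrightarrow> \<sigma> i (\<tau> i r) = r" "r \<in> carrier R \<Longrightarrow> \<tau> i (\<sigma> i r) = r"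
proof -
  have b: "bij_betw (\<sigma> i) (carrier R) (carrier R)"
    using aut_iso[OF assms] by (auto simp: alg_iso_def ring_iso_def)
  then show "r \<in> carrier R \<Longrightarrow> \<sigma> i r \<in> carrier R" by (rule bij_betwE[THEN bspec])
  show "r \<in> carrier R \<Longrightarrow> \<tau> i r \<in> carrier R" using b by (metis bij_betw_def inv_into_into)
  show "r \<in> carrier R \<Longrightarrow> \<sigma> i (\<tau> i r) = r" using b by (simp add: bij_betw_inv_into_right)
  show "r \<in> carrier R \<Longrightarrow> \<tau> i (\<sigma> i r) = r" using b by (simp add: bij_betw_inv_into_left)
qed

lemma \<sigma>_comm: "i \<in> {1..n} \<Longrightarrow> j \<in> {1..n} \<Longrightarrow> r \<in> carrier R \<Longrightarrow> \<sigma> i (\<sigma> j r) = \<sigma> j (\<sigma> i r)"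
  using data by (auto simp: is_tgw_data_def)

lemma elt_closed: "i \<in> {1..n} \<Longrightarrow> elt D i \<in> carrier R"
  and par_closed: "i \<in> {1..n} \<Longrightarrow> j \<in> {1..n} \<Longrightarrow> par D i j \<in> carrier K - {\<zero>\<^bsub>K\<^esub>}"
  using data by (auto simp: is_tgw_data_def)

lemma letter_mem: "i \<in> {1..n} \<Longrightarrow> LX i \<in> letters n" "i \<in> {1..n} \<Longrightarrow> LY i \<in> letters n"
  by (auto simp: letters_def)

lemma var_hom: "z \<in> Gs \<Longrightarrow> g = gen_degree z \<Longrightarrow> var K z \<in> hom_free D g"
  by (rule hom_free_basis) auto

lemma tgw_rels_homogeneous:
  assumes "(u, v) \<in> tgw_rels D"
  shows "\<exists>g. u \<in> hom_free D g \<and> v \<in> hom_free D g"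
proof -
  note h = hom_free_mult hom_free_add hom_free_smult var_hom hom_free_one
  have C: "var K (Coef r) \<in> hom_free D (\<lambda>_. 0)" if "r \<in> carrier R" for r
    using that by (intro var_hom) auto
  have X: "var K (Letter (LX i)) \<in> hom_free D (\<lambda>j. if j = i then 1 else 0)" if "i \<in> {1..n}" for i
    using that letter_mem by (intro var_hom) auto
  have Y: "var K (Letter (LY i)) \<in> hom_free D (\<lambda>j. if j = i then -1 else 0)" if "i \<in> {1..n}" for i
    using that letter_mem by (intro var_hom) auto
  show ?thesis
    using assms unfolding tgw_rels_def Let_def
  proof (elim UnE CollectE exE conjE singletonE)
    fix r r' assume "r \<in> carrier R" "r' \<in> carrier R" "(u, v) = (var K (Coef (r \<oplus>\<^bsub>R\<^esub> r')), var K (Coef r) \<oplus>\<^bsub>F\<^esub> var K (Coef r'))"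
    then show ?thesis using C[of r] C[of r'] C[of "r \<oplus>\<^bsub>R\<^esub> r'"] hom_free_add by blast
  next
    fix r r' assume "r \<in> carrier R" "r' \<in> carrier R" "(u, v) = (var K (Coef (r \<otimes>\<^bsub>R\<^esub> r')), var K (Coef r) \<otimes>\<^bsub>F\<^esub> var K (Coef r'))"
    then show ?thesis using C[of "r \<otimes>\<^bsub>R\<^esub> r'"] hom_free_mult[OF C[of r] C[of r'], of "\<lambda>_. 0"] by auto
  next
    fix a r assume "a \<in> carrier K" "r \<in> carrier R" "(u, v) = (var K (Coef (a \<odot>\<^bsub>R\<^esub> r)), a \<odot>\<^bsub>F\<^esub> var K (Coef r))"
    then show ?thesis using C[of r] C[of "a \<odot>\<^bsub>R\<^esub> r"] hom_free_smult by blast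
  next
    assume "(u, v) = (var K (Coef \<one>\<^bsub>R\<^esub>), \<one>\<^bsub>F\<^esub>)"
    then show ?thesis using C[of "\<one>\<^bsub>R\<^esub>"] hom_free_one by auto
  next
    fix i r assume i: "i \<in> {1..n}" "r \<in> carrier R" and e: "(u, v) = (var K (Letter (LX i)) \<otimes>\<^bsub>F\<^esub> var K (Coef r), var K (Coef (\<sigma> i r)) \<otimes>\<^bsub>F\<^esub> var K (Letter (LX i)))"
    show ?thesis using e
        hom_free_mult[OF X[OF i(1)] C[OF i(2)], of "\<lambda>j. if j = i then 1 else 0"]
        hom_free_mult[OF C[OF \<sigma>_facts(1)[OF i]] X[OF i(1)], of "\<lambda>j. if j = i then 1 else 0"] by auto
  next
    fix i r assume i: "i \<in> {1..n}" "r \<in> carrier R" and e: "(u, v) = (var K (Letter (LY i)) \<otimes>\<^bsub>F\<^esub> var K (Coef r), var K (Coef (\<tau> i r)) \<otimes>\<^bsub>F\<^esub> var K (Letter (LY i)))"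
    show ?thesis using e
        hom_free_mult[OF Y[OF i(1)] C[OF i(2)], of "\<lambda>j. if j = i then -1 else 0"]
        hom_free_mult[OF C[OF \<sigma>_facts(2)[OF i]] Y[OF i(1)], of "\<lambda>j. if j = i then -1 else 0"] by auto
  next
    fix i assume i: "i \<in> {1..n}" and e: "(u, v) = (var K (Letter (LY i)) \<otimes>\<^bsub>F\<^esub> var K (Letter (LX i)), var K (Coef (elt D i)))"
    have "var K (Letter (LY i)) \<otimes>\<^bsub>F\<^esub> var K (Letter (LX i)) \<in> hom_free D (\<lambda>_. 0)"
      by (rule hom_free_mult[OF Y[OF i] X[OF i]]) simp
    then show ?thesis using e C[OF elt_closed[OF i]] by blast
  next
    fix i assume i: "i \<in> {1..n}" and e: "(u, v) = (var K (Letter (LX i)) \<otimes>\<^bsub>F\<^esub> var K (Letter (LY i)), var K (Coef (\<sigma> i (elt D i))))"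
    have "var K (Letter (LX i)) \<otimes>\<^bsub>F\<^esub> var K (Letter (LY i)) \<in> hom_free D (\<lambda>_. 0)"
      by (rule hom_free_mult[OF X[OF i] Y[OF i]]) simp
    then show ?thesis using e C[OF \<sigma>_facts(1)[OF i elt_closed[OF i]]] by blast
  next
    fix i j assume i: "i \<in> {1..n}" "j \<in> {1..n}" and e: "(u, v) = (var K (Letter (LX i)) \<otimes>\<^bsub>F\<^esub> var K (Letter (LY j)), par D i j \<odot>\<^bsub>F\<^esub> (var K (Letter (LY j)) \<otimes>\<^bsub>F\<^esub> var K (Letter (LX i))))"
    let ?g = "\<lambda>l. (if l = i then 1 else 0) + (if l = j then -1 else 0)"
    have "var K (Letter (LX i)) \<otimes>\<^bsub>F\<^esub> var K (Letter (LY j)) \<in> hom_free D ?g"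
      by (rule hom_free_mult[OF X[OF i(1)] Y[OF i(2)]]) simp
    moreover have "par D i j \<odot>\<^bsub>F\<^esub> (var K (Letter (LY j)) \<otimes>\<^bsub>F\<^esub> var K (Letter (LX i))) \<in> hom_free D ?g"
      using par_closed[OF i] by (intro hom_free_smult hom_free_mult[OF Y[OF i(2)] X[OF i(1)]]) auto
    moreover have "u = var K (Letter (LX i)) \<otimes>\<^bsub>F\<^esub> var K (Letter (LY j))"
      "v = par D i j \<odot>\<^bsub>F\<^esub> (var K (Letter (LY j)) \<otimes>\<^bsub>F\<^esub> var K (Letter (LX i)))" using e by blast+
    ultimately show ?thesis by blast
  qed
qed

lemma tgw_rels_closed: "tgw_rels D \<subseteq> carrier F \<times> carrier F"
proof clarify
  fix u v assume "(u, v) \<in> tgw_rels D"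
  then obtain g where "u \<in> hom_free D g" "v \<in> hom_free D g" using tgw_rels_homogeneous by blast
  then show "u \<in> carrier F \<and> v \<in> carrier F" using hom_free_sub by blast
qed

lemma tgw_ideal: "ideal (tgw_ideal D) F"
  unfolding tgw_ideal_def by (rule rel_ideal_ideal[OF F.A.ring_axioms tgw_rels_closed])

sublocale Q: kalg_ideal K F "tgw_ideal D"
  by (intro kalg_ideal.intro F.kalg_axioms tgw_ideal)

lemma A_eq: "A = quot_alg F (tgw_ideal D)" by (simp add: tgwc_def)
lemma cls_eq: "cls = Q.cls" by (simp add: tgw_class_def fun_eq_iff)

sublocale A: kalg K A unfolding A_eq by (rule Q.quot_kalg)

lemma cls_hom:
  "f \<in> carrier F \<Longrightarrow> cls f \<in> carrier A"
  "f \<in> carrier F \<Longrightarrow> h \<in> carrier F \<Longrightarrow> cls (f \<otimes>\<^bsub>F\<^esub> h) = cls f \<otimes>\<^bsub>A\<^esub> cls h"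
  "f \<in> carrier F \<Longrightarrow> h \<in> carrier F \<Longrightarrow> cls (f \<oplus>\<^bsub>F\<^esub> h) = cls f \<oplus>\<^bsub>A\<^esub> cls h"
  "cls \<one>\<^bsub>F\<^esub> = \<one>\<^bsub>A\<^esub>" "cls \<zero>\<^bsub>F\<^esub> = \<zero>\<^bsub>A\<^esub>"
  "c \<in> carrier K \<Longrightarrow> f \<in> carrier F \<Longrightarrow> cls (c \<odot>\<^bsub>F\<^esub> f) = c \<odot>\<^bsub>A\<^esub> cls f"
  "f \<in> carrier F \<Longrightarrow> h \<in> carrier F \<Longrightarrow> cls f = cls h \<longleftrightarrow> f \<ominus>\<^bsub>F\<^esub> h \<in> tgw_ideal D"
  unfolding A_eq cls_eq
  using Q.cls_closed Q.cls_mult Q.cls_add Q.cls_one Q.cls_zero Q.cls_smult Q.cls_eq_iff by auto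

lemma carrier_A: "carrier A = cls ` carrier F"
  unfolding A_eq cls_eq by (rule Q.cls_carrier)

lemma cls_rel: "(u, v) \<in> tgw_rels D \<Longrightarrow> cls u = cls v"
  using tgw_rels_closed rel_ideal_rel[OF F.A.ring_axioms tgw_rels_closed, of u v]
  by (subst cls_hom(7)) (auto simp: tgw_ideal_def)

text \<open>
  The elements all of whose homogeneous parts lie in the defining ideal form an ideal, which contains
  the differences of both sides of the homogeneous relations.
\<close>

lemma tgw_ideal_graded:
  assumes "x \<in> tgw_ideal D"
  shows "res D g x \<in> tgw_ideal D"
proof -
  define J where "J = {x \<in> carrier F. \<forall>g. res D g x \<in> tgw_ideal D}"
  have rF: "res D g f \<in> carrier F" if "f \<in> carrier F" for f g using res_closed[OF that] hom_free_sub by blast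
  have r0: "res D g \<zero>\<^bsub>F\<^esub> = \<zero>\<^bsub>F\<^esub>" for g by (auto simp: F_eq monoid_alg_simps res_def)
  have J0: "\<zero>\<^bsub>F\<^esub> \<in> J" by (simp add: J_def r0)
  have Jadd: "x \<oplus>\<^bsub>F\<^esub> y \<in> J" if "x \<in> J" "y \<in> J" for x y using that by (simp add: J_def res_add)
  have Jsm: "c \<odot>\<^bsub>F\<^esub> x \<in> J" if "x \<in> J" "c \<in> carrier K" for x c
    using that by (simp add: J_def res_smult Q.ideal_smult)
  have Jm: "x \<otimes>\<^bsub>F\<^esub> y \<in> J \<and> y \<otimes>\<^bsub>F\<^esub> x \<in> J" if x: "x \<in> J" and y: "y \<in> fs K (lists Gs)" for x y
    using y
  proof (induction rule: K.fs_induct)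
    case zero
    have "(\<lambda>_. \<zero>\<^bsub>K\<^esub>) = \<zero>\<^bsub>F\<^esub>" by (simp add: F_eq monoid_alg_simps)
    then show ?case using x J0 by (simp add: J_def)
  next
    case (add f w c)
    define s where "s = single K w c"
    have s: "s \<in> hom_free D (mon_degree w)" unfolding s_def hom_free_def
      using add by (intro K.fs_single) auto
    have cl: "f \<in> carrier F" "s \<in> carrier F" "x \<in> carrier F"
      using add s hom_free_sub x by (auto simp: carrier_F J_def)
    have e: "(\<lambda>y. f y \<oplus>\<^bsub>K\<^esub> single K w c y) = f \<oplus>\<^bsub>F\<^esub> s" by (simp add: F_eq monoid_alg_simps s_def)
    have "x \<otimes>\<^bsub>F\<^esub> s \<in> J" "s \<otimes>\<^bsub>F\<^esub> x \<in> J"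
      using x cl by (auto simp: J_def res_mult[OF s cl(3)] intro: Q.I_l_closed Q.I_r_closed)
    then show ?case unfolding e using add.IH cl Jadd by (simp add: F.A.l_distr F.A.r_distr)
  qed
  have "ideal J F"
  proof (rule idealI)
    show "ring F" by (rule F.A.ring_axioms)
    show "subgroup J (add_monoid F)"
    proof (rule F.A.add.subgroupI)
      show "\<ominus>\<^bsub>F\<^esub> a \<in> J" if "a \<in> J" for a
        using Jsm[OF that, of "\<ominus>\<^bsub>K\<^esub> \<one>\<^bsub>K\<^esub>"] that F.smult_l_minus[of "\<one>\<^bsub>K\<^esub>" a] by (auto simp: J_def)
    qed (use J0 Jadd in \<open>auto simp: J_def\<close>)
  qed (use Jm in \<open>auto simp: carrier_F\<close>)
  moreover have "{u \<ominus>\<^bsub>F\<^esub> v |u v. (u, v) \<in> tgw_rels D} \<subseteq> J"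
  proof clarify
    fix u v assume uv: "(u, v) \<in> tgw_rels D"
    then obtain g where g: "u \<in> hom_free D g" "v \<in> hom_free D g" using tgw_rels_homogeneous by blast
    have c: "u \<in> carrier F" "v \<in> carrier F" using g hom_free_sub by auto
    have i: "u \<ominus>\<^bsub>F\<^esub> v \<in> tgw_ideal D"
      unfolding tgw_ideal_def by (rule rel_ideal_rel[OF F.A.ring_axioms tgw_rels_closed uv])
    have "u \<ominus>\<^bsub>F\<^esub> v = u \<oplus>\<^bsub>F\<^esub> (\<ominus>\<^bsub>K\<^esub> \<one>\<^bsub>K\<^esub>) \<odot>\<^bsub>F\<^esub> v" using c by (simp add: F.A.minus_eq F.smult_l_minus)
    also have "\<dots> \<in> hom_free D g" using g by (intro hom_free_add hom_free_smult) auto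
    finally have "res D h (u \<ominus>\<^bsub>F\<^esub> v) = (if h = g then u \<ominus>\<^bsub>F\<^esub> v else \<zero>\<^bsub>F\<^esub>)" for h by (rule res_hom)
    then show "u \<ominus>\<^bsub>F\<^esub> v \<in> J" using i c by (auto simp: J_def)
  qed
  ultimately have "tgw_ideal D \<subseteq> J"
    unfolding tgw_ideal_def rel_ideal_def by (intro F.A.genideal_minimal)
  then show ?thesis using assms by (auto simp: J_def)
qed

lemma res_F: "f \<in> carrier F \<Longrightarrow> res D g f \<in> carrier F"
  using res_closed hom_free_sub by blast

lemma prj_cls:
  assumes f: "f \<in> carrier F"
  shows "tgw_prj D g (cls f) = cls (res D g f)"
proof -
  define h where "h = (SOME h. h \<in> carrier F \<and> cls h = cls f)"
  have "h \<in> carrier F \<and> cls h = cls f" unfolding h_def by (rule someI[of _ f]) (use f in simp)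
  then have h: "h \<in> carrier F" "h \<ominus>\<^bsub>F\<^esub> f \<in> tgw_ideal D" using f by (auto simp: cls_hom(7))
  have "h \<ominus>\<^bsub>F\<^esub> f = h \<oplus>\<^bsub>F\<^esub> (\<ominus>\<^bsub>K\<^esub> \<one>\<^bsub>K\<^esub>) \<odot>\<^bsub>F\<^esub> f" using f h by (simp add: F.A.minus_eq F.smult_l_minus)
  then have "res D g (h \<ominus>\<^bsub>F\<^esub> f) = res D g h \<oplus>\<^bsub>F\<^esub> (\<ominus>\<^bsub>K\<^esub> \<one>\<^bsub>K\<^esub>) \<odot>\<^bsub>F\<^esub> res D g f"
    using f h by (simp add: res_add res_smult)
  also have "\<dots> = res D g h \<ominus>\<^bsub>F\<^esub> res D g f"
    using f h res_F by (simp add: F.A.minus_eq F.smult_l_minus)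
  finally have "res D g h \<ominus>\<^bsub>F\<^esub> res D g f \<in> tgw_ideal D" using tgw_ideal_graded[OF h(2), of g] by simp
  then have "cls (res D g h) = cls (res D g f)" using f h res_F by (simp add: cls_hom(7))
  then show ?thesis by (simp add: tgw_prj_def h_def)
qed

subsection \<open>Relations\<close>

lemma cf_eq: "cf r = cls (var K (Coef r))" by (simp add: coef_map_def)

lemma var_closed: "z \<in> Gs \<Longrightarrow> var K z \<in> carrier F"
  using var_hom hom_free_sub by blast

lemma cf_var: "r \<in> carrier R \<Longrightarrow> var K (Coef r) \<in> carrier F"
  and xl_var: "z \<in> letters n \<Longrightarrow> var K (Letter z) \<in> carrier F"
  by (rule var_closed; simp)+

lemma cf_closed: "r \<in> carrier R \<Longrightarrow> cf r \<in> carrier A"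
  and xl_closed: "z \<in> letters n \<Longrightarrow> xl z \<in> carrier A"
  by (simp_all add: cf_eq tgw_letter_def cls_hom cf_var xl_var)

lemma cf_hom:
  "r \<in> carrier R \<Longrightarrow> r' \<in> carrier R \<Longrightarrow> cf (r \<oplus>\<^bsub>R\<^esub> r') = cf r \<oplus>\<^bsub>A\<^esub> cf r'"
  "r \<in> carrier R \<Longrightarrow> r' \<in> carrier R \<Longrightarrow> cf (r \<otimes>\<^bsub>R\<^esub> r') = cf r \<otimes>\<^bsub>A\<^esub> cf r'"
  "c \<in> carrier K \<Longrightarrow> r \<in> carrier R \<Longrightarrow> cf (c \<odot>\<^bsub>R\<^esub> r) = c \<odot>\<^bsub>A\<^esub> cf r"
  "cf \<one>\<^bsub>R\<^esub> = \<one>\<^bsub>A\<^esub>"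
proof -
  assume r: "r \<in> carrier R"
  show "cf (r \<oplus>\<^bsub>R\<^esub> r') = cf r \<oplus>\<^bsub>A\<^esub> cf r'" if r': "r' \<in> carrier R"
  proof -
    have "(var K (Coef (r \<oplus>\<^bsub>R\<^esub> r')), var K (Coef r) \<oplus>\<^bsub>F\<^esub> var K (Coef r')) \<in> tgw_rels D"
      unfolding tgw_rels_def Let_def using r r' by blast
    from cls_rel[OF this] show ?thesis using r r' by (simp add: cf_eq cls_hom cf_var)
  qed
  show "cf (r \<otimes>\<^bsub>R\<^esub> r') = cf r \<otimes>\<^bsub>A\<^esub> cf r'" if r': "r' \<in> carrier R"
  proof -
    have "(var K (Coef (r \<otimes>\<^bsub>R\<^esub> r')), var K (Coef r) \<otimes>\<^bsub>F\<^esub> var K (Coef r')) \<in> tgw_rels D"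
      unfolding tgw_rels_def Let_def using r r' by blast
    from cls_rel[OF this] show ?thesis using r r' by (simp add: cf_eq cls_hom cf_var)
  qed
  show "cf (c \<odot>\<^bsub>R\<^esub> r) = c \<odot>\<^bsub>A\<^esub> cf r" if c: "c \<in> carrier K"
  proof -
    have "(var K (Coef (c \<odot>\<^bsub>R\<^esub> r)), c \<odot>\<^bsub>F\<^esub> var K (Coef r)) \<in> tgw_rels D"
      unfolding tgw_rels_def Let_def using r c by blast
    from cls_rel[OF this] show ?thesis using r c by (simp add: cf_eq cls_hom cf_var)
  qed
next
  have "(var K (Coef \<one>\<^bsub>R\<^esub>), \<one>\<^bsub>F\<^esub>) \<in> tgw_rels D"
    unfolding tgw_rels_def Let_def by blast
  from cls_rel[OF this] show "cf \<one>\<^bsub>R\<^esub> = \<one>\<^bsub>A\<^esub>" by (simp add: cf_eq cls_hom)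
qed

lemma cf_zero: "cf \<zero>\<^bsub>R\<^esub> = \<zero>\<^bsub>A\<^esub>"
  using cf_hom(3)[of "\<zero>\<^bsub>K\<^esub>" "\<zero>\<^bsub>R\<^esub>"] cf_closed[of "\<zero>\<^bsub>R\<^esub>"] by simp

lemma xl_rel:
  assumes i: "i \<in> {1..n}"
  shows "r \<in> carrier R \<Longrightarrow> xl (LX i) \<otimes>\<^bsub>A\<^esub> cf r = cf (\<sigma> i r) \<otimes>\<^bsub>A\<^esub> xl (LX i)"
    "r \<in> carrier R \<Longrightarrow> xl (LY i) \<otimes>\<^bsub>A\<^esub> cf r = cf (\<tau> i r) \<otimes>\<^bsub>A\<^esub> xl (LY i)"
    "xl (LY i) \<otimes>\<^bsub>A\<^esub> xl (LX i) = cf (elt D i)"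
    "xl (LX i) \<otimes>\<^bsub>A\<^esub> xl (LY i) = cf (\<sigma> i (elt D i))"
    "j \<in> {1..n} \<Longrightarrow> i \<noteq> j \<Longrightarrow> xl (LX i) \<otimes>\<^bsub>A\<^esub> xl (LY j) = par D i j \<odot>\<^bsub>A\<^esub> (xl (LY j) \<otimes>\<^bsub>A\<^esub> xl (LX i))"
proof -
  note l = letter_mem[OF i]
  show "xl (LX i) \<otimes>\<^bsub>A\<^esub> cf r = cf (\<sigma> i r) \<otimes>\<^bsub>A\<^esub> xl (LX i)" if r: "r \<in> carrier R"
  proof -
    have "(var K (Letter (LX i)) \<otimes>\<^bsub>F\<^esub> var K (Coef r), var K (Coef (\<sigma> i r)) \<otimes>\<^bsub>F\<^esub> var K (Letter (LX i))) \<in> tgw_rels D"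
      unfolding tgw_rels_def Let_def using r i by blast
    from cls_rel[OF this] show ?thesis
      using r i l by (simp add: cf_eq tgw_letter_def cls_hom cf_var xl_var \<sigma>_facts)
  qed
  show "xl (LY i) \<otimes>\<^bsub>A\<^esub> cf r = cf (\<tau> i r) \<otimes>\<^bsub>A\<^esub> xl (LY i)" if r: "r \<in> carrier R"
  proof -
    have "(var K (Letter (LY i)) \<otimes>\<^bsub>F\<^esub> var K (Coef r), var K (Coef (\<tau> i r)) \<otimes>\<^bsub>F\<^esub> var K (Letter (LY i))) \<in> tgw_rels D"
      unfolding tgw_rels_def Let_def using r i by blast
    from cls_rel[OF this] show ?thesis
      using r i l by (simp add: cf_eq tgw_letter_def cls_hom cf_var xl_var \<sigma>_facts)
  qed
  have "(var K (Letter (LY i)) \<otimes>\<^bsub>F\<^esub> var K (Letter (LX i)), var K (Coef (elt D i))) \<in> tgw_rels D"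
    unfolding tgw_rels_def Let_def using i by blast
  from cls_rel[OF this] show "xl (LY i) \<otimes>\<^bsub>A\<^esub> xl (LX i) = cf (elt D i)"
    using l by (simp add: cf_eq tgw_letter_def cls_hom xl_var)
  have "(var K (Letter (LX i)) \<otimes>\<^bsub>F\<^esub> var K (Letter (LY i)), var K (Coef (\<sigma> i (elt D i)))) \<in> tgw_rels D"
    unfolding tgw_rels_def Let_def using i by blast
  from cls_rel[OF this] show "xl (LX i) \<otimes>\<^bsub>A\<^esub> xl (LY i) = cf (\<sigma> i (elt D i))"
    using l by (simp add: cf_eq tgw_letter_def cls_hom xl_var)
  show "xl (LX i) \<otimes>\<^bsub>A\<^esub> xl (LY j) = par D i j \<odot>\<^bsub>A\<^esub> (xl (LY j) \<otimes>\<^bsub>A\<^esub> xl (LX i))"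
    if j: "j \<in> {1..n}" "i \<noteq> j"
  proof -
    have "(var K (Letter (LX i)) \<otimes>\<^bsub>F\<^esub> var K (Letter (LY j)),
       par D i j \<odot>\<^bsub>F\<^esub> (var K (Letter (LY j)) \<otimes>\<^bsub>F\<^esub> var K (Letter (LX i)))) \<in> tgw_rels D"
      unfolding tgw_rels_def Let_def by (rule UnI2) (use i j in blast)
    from cls_rel[OF this] show ?thesis
      using l letter_mem[OF j(1)] par_closed[OF i j(1)] by (simp add: tgw_letter_def cls_hom xl_var)
  qed
qed

subsection \<open>Monomials\<close>

lemma basis_F: "w \<in> lists Gs \<Longrightarrow> basis_elt K w \<in> carrier F"
  using hom_free_basis hom_free_sub by blast

lemma mon_closed: "w \<in> lists Gs \<Longrightarrow> mn w \<in> carrier A"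
  unfolding tgw_mon_def by (rule cls_hom(1)[OF basis_F])

lemma mon_Nil: "mn [] = \<one>\<^bsub>A\<^esub>"
  unfolding tgw_mon_def using FM.basis_elt_one cls_hom(4) by (simp add: F_eq)

lemma mon_append: "v \<in> lists Gs \<Longrightarrow> w \<in> lists Gs \<Longrightarrow> mn (v @ w) = mn v \<otimes>\<^bsub>A\<^esub> mn w"
  unfolding tgw_mon_def using FM.basis_elt_mult[of v w] cls_hom(2)[OF basis_F basis_F, of v w] by (simp add: F_eq)

lemma mon_single: "mn [Coef r] = cf r" "mn [Letter z] = xl z"
  by (simp_all add: tgw_mon_def cf_eq tgw_letter_def)

lemma mon_Cons:
  "r \<in> carrier R \<Longrightarrow> w \<in> lists Gs \<Longrightarrow> mn (Coef r # w) = cf r \<otimes>\<^bsub>A\<^esub> mn w"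
  "z \<in> letters n \<Longrightarrow> w \<in> lists Gs \<Longrightarrow> mn (Letter z # w) = xl z \<otimes>\<^bsub>A\<^esub> mn w"
  using mon_append[of "[Coef r]" w] mon_append[of "[Letter z]" w] by (simp_all add: mon_single)

lemma word_elt_mon: "w \<in> words D \<Longrightarrow> word_elt D w = mn (map Letter w)"
proof (induction w)
  case Nil
  then show ?case by (simp add: word_elt_def mon_Nil)
next
  case (Cons z w)
  then have "map Letter w \<in> lists Gs" by (auto simp: words_def)
  then show ?case using Cons by (simp add: word_elt_def words_def mon_Cons tgw_letter_def)
qed

lemma component_kspan:
  "component D g = kspan K A (mn ` {w \<in> lists Gs. mon_degree w = g})"
proof -
  let ?S = "{w \<in> lists Gs. mon_degree w = g}"
  have "cls f = lin K A mn f" if "f \<in> fs K ?S" for f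
    using that
  proof (induction rule: K.fs_induct)
    case zero
    then show ?case using cls_hom(5) by (simp add: A.lin_zero F_eq monoid_alg_simps)
  next
    case (add f w c)
    have m: "\<And>x. x \<in> ?S \<Longrightarrow> mn x \<in> carrier A" using mon_closed by blast
    have cl: "f \<in> carrier F" using add hom_free_sub by (auto simp: hom_free_def)
    have e: "(\<lambda>y. f y \<oplus>\<^bsub>K\<^esub> single K w c y) = f \<oplus>\<^bsub>F\<^esub> c \<odot>\<^bsub>F\<^esub> basis_elt K w"
      using add by (auto simp: F_eq monoid_alg_simps basis_elt_single single_def)
    have "cls (f \<oplus>\<^bsub>F\<^esub> c \<odot>\<^bsub>F\<^esub> basis_elt K w) = cls f \<oplus>\<^bsub>A\<^esub> c \<odot>\<^bsub>A\<^esub> mn w"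
      using add cl basis_F[of w] by (simp add: cls_hom tgw_mon_def)
    also have "\<dots> = lin K A mn (\<lambda>y. f y \<oplus>\<^bsub>K\<^esub> single K w c y)"
      using add A.lin_add[OF add.hyps(1) K.fs_single[OF add.hyps(2,3)] m] A.lin_single[OF add.hyps(2,3) m] by simp
    finally show ?case unfolding e .
  qed
  then have "cls ` fs K ?S = lin K A mn ` fs K ?S" by auto
  also have "\<dots> = kspan K A (mn ` ?S)" by (rule A.lin_image_kspan) (use mon_closed in auto)
  finally show ?thesis by (simp add: component_eq hom_free_def)
qed

lemma mon_component: "w \<in> lists Gs \<Longrightarrow> mn w \<in> component D (mon_degree w)"
  unfolding component_kspan by (rule A.kspan_base) (use mon_closed in auto)

subsection \<open>Normal ordering\<close>

text \<open>Products of letters \<open>Y\<close>, and of letters \<open>X\<close>, whose indices are given by a list.\<close>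

abbreviation "yw ys \<equiv> wprod A (\<lambda>i. xl (LY i)) ys"
abbreviation "xw xs \<equiv> wprod A (\<lambda>i. xl (LX i)) xs"

lemma xy_closed: "i \<in> {1..n} \<Longrightarrow> xl (LX i) \<in> carrier A" "i \<in> {1..n} \<Longrightarrow> xl (LY i) \<in> carrier A"
  by (simp_all add: xl_closed letter_mem)

lemma yw_closed: "set ys \<subseteq> {1..n} \<Longrightarrow> yw ys \<in> carrier A"
  by (rule A.A.wprod_closed[where S = "{1..n}"]) (auto simp: xy_closed)

lemma xw_closed: "set xs \<subseteq> {1..n} \<Longrightarrow> xw xs \<in> carrier A"
  by (rule A.A.wprod_closed[where S = "{1..n}"]) (auto simp: xy_closed)

lemma x_yw_commute:
  assumes i: "i \<in> {1..n}"
  shows "set ys \<subseteq> {1..n} \<Longrightarrow> i \<notin> set ys \<Longrightarrow> A.prp (xl (LX i) \<otimes>\<^bsub>A\<^esub> yw ys) (yw ys \<otimes>\<^bsub>A\<^esub> xl (LX i))"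
proof (induction ys)
  case Nil
  then show ?case using xy_closed[OF i] by (simp add: A.prp_refl)
next
  case (Cons j ys)
  then have j: "j \<in> {1..n}" "i \<noteq> j" "set ys \<subseteq> {1..n}" by auto
  have c: "xl (LX i) \<in> carrier A" "xl (LY j) \<in> carrier A" "yw ys \<in> carrier A"
    using xy_closed i j yw_closed by auto
  have "A.prp (xl (LX i) \<otimes>\<^bsub>A\<^esub> xl (LY j)) (xl (LY j) \<otimes>\<^bsub>A\<^esub> xl (LX i))"
    unfolding A.prp_def using xl_rel(5)[OF i j(1,2)] par_closed[OF i j(1)] by blast
  then have "A.prp ((xl (LX i) \<otimes>\<^bsub>A\<^esub> xl (LY j)) \<otimes>\<^bsub>A\<^esub> yw ys) ((xl (LY j) \<otimes>\<^bsub>A\<^esub> xl (LX i)) \<otimes>\<^bsub>A\<^esub> yw ys)"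
    using c by (intro A.prp_mult_right) auto
  moreover have "A.prp (xl (LY j) \<otimes>\<^bsub>A\<^esub> (xl (LX i) \<otimes>\<^bsub>A\<^esub> yw ys)) (xl (LY j) \<otimes>\<^bsub>A\<^esub> (yw ys \<otimes>\<^bsub>A\<^esub> xl (LX i)))"
    using c Cons by (intro A.prp_mult_left) auto
  ultimately show ?case using c A.prp_trans by (simp add: A.A.m_assoc)
qed

lemma x_yw_cancel:
  assumes i: "i \<in> {1..n}"
  shows "set ys \<subseteq> {1..n} \<Longrightarrow> i \<in> set ys \<Longrightarrow>
    \<exists>r \<in> carrier R. xl (LX i) \<otimes>\<^bsub>A\<^esub> yw ys = cf r \<otimes>\<^bsub>A\<^esub> yw (remove1 i ys)"
proof (induction ys)
  case (Cons j ys)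
  then have j: "j \<in> {1..n}" "set ys \<subseteq> {1..n}" by auto
  have c: "xl (LX i) \<in> carrier A" "xl (LY j) \<in> carrier A" "yw ys \<in> carrier A"
    using xy_closed i j yw_closed by auto
  show ?case
  proof (cases "j = i")
    case True
    have "xl (LX i) \<otimes>\<^bsub>A\<^esub> yw (j # ys) = (xl (LX i) \<otimes>\<^bsub>A\<^esub> xl (LY j)) \<otimes>\<^bsub>A\<^esub> yw ys"
      using c by (simp add: A.A.m_assoc)
    then show ?thesis using xl_rel(4)[OF i] True \<sigma>_facts(1)[OF i elt_closed[OF i]] by auto
  next
    case False
    then have "i \<in> set ys" using Cons by auto
    then obtain r where r: "r \<in> carrier R" "xl (LX i) \<otimes>\<^bsub>A\<^esub> yw ys = cf r \<otimes>\<^bsub>A\<^esub> yw (remove1 i ys)"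
      using Cons j by auto
    let ?W = "yw (remove1 i ys)" and ?m = "par D i j"
    have W: "?W \<in> carrier A" using j set_remove1_subset[of i ys] by (intro yw_closed) auto
    have m: "?m \<in> carrier K" using par_closed[OF i j(1)] by simp
    have t: "\<tau> j r \<in> carrier R" using \<sigma>_facts[OF j(1)] r by auto
    have "xl (LX i) \<otimes>\<^bsub>A\<^esub> yw (j # ys) = (xl (LX i) \<otimes>\<^bsub>A\<^esub> xl (LY j)) \<otimes>\<^bsub>A\<^esub> yw ys"
      using c by (simp add: A.A.m_assoc)
    also have "\<dots> = ?m \<odot>\<^bsub>A\<^esub> (xl (LY j) \<otimes>\<^bsub>A\<^esub> (xl (LX i) \<otimes>\<^bsub>A\<^esub> yw ys))"
      using c m False xl_rel(5)[OF i j(1)] by (simp add: A.A.m_assoc A.smult_mult_left)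
    also have "\<dots> = ?m \<odot>\<^bsub>A\<^esub> ((xl (LY j) \<otimes>\<^bsub>A\<^esub> cf r) \<otimes>\<^bsub>A\<^esub> ?W)"
      using c W r cf_closed[OF r(1)] by (simp add: A.A.m_assoc)
    also have "\<dots> = cf (?m \<odot>\<^bsub>R\<^esub> \<tau> j r) \<otimes>\<^bsub>A\<^esub> (xl (LY j) \<otimes>\<^bsub>A\<^esub> ?W)"
      using c W m t cf_closed[OF t] xl_rel(2)[OF j(1) r(1)]
      by (simp add: A.A.m_assoc A.smult_mult_left cf_hom)
    also have "xl (LY j) \<otimes>\<^bsub>A\<^esub> ?W = yw (remove1 i (j # ys))" using False by simp
    finally show ?thesis using m t by blast
  qed
qed simp

lemma yw_x_cancel:
  assumes i: "i \<in> {1..n}"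
  shows "set ys \<subseteq> {1..n} \<Longrightarrow> i \<in> set ys \<Longrightarrow>
    \<exists>r \<in> carrier R. \<exists>ys'. yw ys \<otimes>\<^bsub>A\<^esub> xl (LX i) = cf r \<otimes>\<^bsub>A\<^esub> yw ys' \<and> set ys' \<subseteq> {1..n} \<and>
      (\<forall>j. count_list ys j = count_list ys' j + (if j = i then 1 else 0))"
proof (induction ys)
  case (Cons j ys)
  then have j: "j \<in> {1..n}" "set ys \<subseteq> {1..n}" by auto
  have c: "xl (LX i) \<in> carrier A" "xl (LY j) \<in> carrier A" "yw ys \<in> carrier A"
    using xy_closed i j yw_closed by auto
  show ?case
  proof (cases "i \<in> set ys")
    case True
    then obtain r ys' where r: "r \<in> carrier R" "yw ys \<otimes>\<^bsub>A\<^esub> xl (LX i) = cf r \<otimes>\<^bsub>A\<^esub> yw ys'"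
      "set ys' \<subseteq> {1..n}" "\<forall>j. count_list ys j = count_list ys' j + (if j = i then 1 else 0)"
      using Cons j by blast
    have W: "yw ys' \<in> carrier A" using r by (intro yw_closed)
    have t: "\<tau> j r \<in> carrier R" using \<sigma>_facts[OF j(1)] r by auto
    have "yw (j # ys) \<otimes>\<^bsub>A\<^esub> xl (LX i) = xl (LY j) \<otimes>\<^bsub>A\<^esub> (yw ys \<otimes>\<^bsub>A\<^esub> xl (LX i))"
      using c by (simp add: A.A.m_assoc)
    also have "\<dots> = (xl (LY j) \<otimes>\<^bsub>A\<^esub> cf r) \<otimes>\<^bsub>A\<^esub> yw ys'"
      using c W r cf_closed[OF r(1)] by (simp add: A.A.m_assoc)
    also have "\<dots> = cf (\<tau> j r) \<otimes>\<^bsub>A\<^esub> yw (j # ys')"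
      using c W cf_closed[OF t] xl_rel(2)[OF j(1) r(1)] by (simp add: A.A.m_assoc)
    finally show ?thesis using t r j by (intro bexI[of _ "\<tau> j r"] exI[of _ "j # ys'"]) auto
  next
    case False
    then have ji: "j = i" using Cons by auto
    obtain m where m: "m \<in> carrier K" "yw ys \<otimes>\<^bsub>A\<^esub> xl (LX i) = m \<odot>\<^bsub>A\<^esub> (xl (LX i) \<otimes>\<^bsub>A\<^esub> yw ys)"
      using A.prp_sym[OF x_yw_commute[OF i j(2) False]] c by (auto simp: A.prp_def)
    have t: "elt D i \<in> carrier R" using elt_closed[OF i] .
    have "yw (j # ys) \<otimes>\<^bsub>A\<^esub> xl (LX i) = xl (LY j) \<otimes>\<^bsub>A\<^esub> (yw ys \<otimes>\<^bsub>A\<^esub> xl (LX i))"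
      using c by (simp add: A.A.m_assoc)
    also have "\<dots> = m \<odot>\<^bsub>A\<^esub> ((xl (LY j) \<otimes>\<^bsub>A\<^esub> xl (LX i)) \<otimes>\<^bsub>A\<^esub> yw ys)"
      using c m by (simp add: A.A.m_assoc A.smult_mult_right)
    also have "\<dots> = cf (m \<odot>\<^bsub>R\<^esub> elt D i) \<otimes>\<^bsub>A\<^esub> yw ys"
      using c m t cf_closed[OF t] xl_rel(3)[OF i] ji by (simp add: A.smult_mult_left cf_hom)
    finally show ?thesis using t m j ji
      by (intro bexI[of _ "m \<odot>\<^bsub>R\<^esub> elt D i"] exI[of _ ys]) auto
  qed
qed simp

text \<open>
  A letter \<open>X\<^sub>i\<close> passes every \<open>Y\<^sub>j\<close> with \<open>j \<noteq> i\<close> up to a scalar and cancels against \<open>Y\<^sub>i\<close>, leaving an element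
  of \<open>R\<close>. So the letters \<open>Y\<close> can be collected to the left of the letters \<open>X\<close>, although neither two letters
  \<open>X\<close> nor two letters \<open>Y\<close> satisfy a relation.
\<close>

lemma normal_order:
  "w \<in> lists Gs \<Longrightarrow> \<exists>r \<in> carrier R. \<exists>ys xs. set ys \<subseteq> {1..n} \<and> set xs \<subseteq> {1..n} \<and>
     mn w = cf r \<otimes>\<^bsub>A\<^esub> (yw ys \<otimes>\<^bsub>A\<^esub> xw xs) \<and>
     (\<forall>i. mon_degree w i = int (count_list xs i) - int (count_list ys i))"
proof (induction w)
  case Nil
  then show ?case using cf_closed cf_hom(4)
    by (intro bexI[of _ "\<one>\<^bsub>R\<^esub>"] exI[of _ "[]"]) (auto simp: mon_Nil)
next
  case (Cons z w)
  then obtain r ys xs where r: "r \<in> carrier R" "set ys \<subseteq> {1..n}" "set xs \<subseteq> {1..n}"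
     "mn w = cf r \<otimes>\<^bsub>A\<^esub> (yw ys \<otimes>\<^bsub>A\<^esub> xw xs)"
     "\<forall>i. mon_degree w i = int (count_list xs i) - int (count_list ys i)" by auto
  have w: "w \<in> lists Gs" using Cons by auto
  have c: "cf r \<in> carrier A" "yw ys \<in> carrier A" "xw xs \<in> carrier A"
    using r cf_closed yw_closed xw_closed by auto
  consider r' where "z = Coef r'" "r' \<in> carrier R" | i where "z = Letter (LY i)" "i \<in> {1..n}"
    | i where "z = Letter (LX i)" "i \<in> {1..n}" using Cons.prems by (auto simp: letters_def)
  then show ?case
  proof cases
    case 1
    have "mn (z # w) = cf (r' \<otimes>\<^bsub>R\<^esub> r) \<otimes>\<^bsub>A\<^esub> (yw ys \<otimes>\<^bsub>A\<^esub> xw xs)"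
      using 1 w r c cf_closed[OF 1(2)] by (simp add: mon_Cons cf_hom A.A.m_assoc)
    then show ?thesis using r 1
      by (intro bexI[of _ "r' \<otimes>\<^bsub>R\<^esub> r"] exI[of _ ys] exI[of _ xs]) auto
  next
    case 2
    have y: "xl (LY i) \<in> carrier A" "LY i \<in> letters n" using xy_closed letter_mem 2 by auto
    have t: "\<tau> i r \<in> carrier R" using \<sigma>_facts[OF 2(2)] r by auto
    have "mn (z # w) = (xl (LY i) \<otimes>\<^bsub>A\<^esub> cf r) \<otimes>\<^bsub>A\<^esub> (yw ys \<otimes>\<^bsub>A\<^esub> xw xs)"
      using 2 w r c y by (simp add: mon_Cons A.A.m_assoc)
    also have "\<dots> = cf (\<tau> i r) \<otimes>\<^bsub>A\<^esub> (yw (i # ys) \<otimes>\<^bsub>A\<^esub> xw xs)"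
      using c y cf_closed[OF t] xl_rel(2)[OF 2(2) r(1)] by (simp add: A.A.m_assoc)
    finally show ?thesis using r t 2
      by (intro bexI[of _ "\<tau> i r"] exI[of _ "i # ys"] exI[of _ xs]) auto
  next
    case 3
    have x: "xl (LX i) \<in> carrier A" "LX i \<in> letters n" using xy_closed letter_mem 3 by auto
    have t: "\<sigma> i r \<in> carrier R" using \<sigma>_facts[OF 3(2)] r by auto
    have "mn (z # w) = (xl (LX i) \<otimes>\<^bsub>A\<^esub> cf r) \<otimes>\<^bsub>A\<^esub> (yw ys \<otimes>\<^bsub>A\<^esub> xw xs)"
      using 3 w r c x by (simp add: mon_Cons A.A.m_assoc)
    also have "\<dots> = cf (\<sigma> i r) \<otimes>\<^bsub>A\<^esub> ((xl (LX i) \<otimes>\<^bsub>A\<^esub> yw ys) \<otimes>\<^bsub>A\<^esub> xw xs)"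
      using c x cf_closed[OF t] xl_rel(1)[OF 3(2) r(1)] by (simp add: A.A.m_assoc)
    finally have e: "mn (z # w) = cf (\<sigma> i r) \<otimes>\<^bsub>A\<^esub> ((xl (LX i) \<otimes>\<^bsub>A\<^esub> yw ys) \<otimes>\<^bsub>A\<^esub> xw xs)" .
    show ?thesis
    proof (cases "i \<in> set ys")
      case True
      then obtain r' where r': "r' \<in> carrier R" "xl (LX i) \<otimes>\<^bsub>A\<^esub> yw ys = cf r' \<otimes>\<^bsub>A\<^esub> yw (remove1 i ys)"
        using x_yw_cancel[OF 3(2) r(2)] by blast
      have s: "set (remove1 i ys) \<subseteq> {1..n}" using r(2) set_remove1_subset[of i ys] by blast
      have "mn (z # w) = cf (\<sigma> i r \<otimes>\<^bsub>R\<^esub> r') \<otimes>\<^bsub>A\<^esub> (yw (remove1 i ys) \<otimes>\<^bsub>A\<^esub> xw xs)"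
        unfolding e r'(2) using c t r' cf_closed yw_closed[OF s] by (simp add: cf_hom A.A.m_assoc)
      moreover have "count_list (remove1 i ys) j = count_list ys j - (if i = j then 1 else 0)" for j
        by (induction ys) auto
      moreover have "count_list ys i > 0" using True by (simp add: count_list_0_iff neq0_conv[symmetric])
      ultimately show ?thesis using r 3 t r' s
        by (intro bexI[of _ "\<sigma> i r \<otimes>\<^bsub>R\<^esub> r'"] exI[of _ "remove1 i ys"] exI[of _ xs]) auto
    next
      case False
      obtain m where m: "m \<in> carrier K" "xl (LX i) \<otimes>\<^bsub>A\<^esub> yw ys = m \<odot>\<^bsub>A\<^esub> (yw ys \<otimes>\<^bsub>A\<^esub> xl (LX i))"
        using x_yw_commute[OF 3(2) r(2) False] by (auto simp: A.prp_def)
      have "mn (z # w) = cf (m \<odot>\<^bsub>R\<^esub> \<sigma> i r) \<otimes>\<^bsub>A\<^esub> (yw ys \<otimes>\<^bsub>A\<^esub> xw (i # xs))"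
        unfolding e m(2) using c x t m cf_closed[OF t]
        by (simp add: cf_hom A.A.m_assoc A.smult_mult_left A.smult_mult_right)
      then show ?thesis using r 3 t m
        by (intro bexI[of _ "m \<odot>\<^bsub>R\<^esub> \<sigma> i r"] exI[of _ ys] exI[of _ "i # xs"]) auto
    qed
  qed
qed

text \<open>If the same indices occur on both sides, every \<open>X\<^sub>i\<close> cancels against some \<open>Y\<^sub>i\<close>.\<close>

lemma balanced_coefficient:
  "set xs \<subseteq> {1..n} \<Longrightarrow> set ys \<subseteq> {1..n} \<Longrightarrow> (\<forall>i. count_list xs i = count_list ys i) \<Longrightarrow>
   \<exists>r \<in> carrier R. yw ys \<otimes>\<^bsub>A\<^esub> xw xs = cf r"
proof (induction xs arbitrary: ys)
  case Nil
  then have "\<forall>i. i \<notin> set ys" by (simp add: count_list_0_iff[symmetric])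
  then have "ys = []" by auto
  then show ?case using cf_hom(4) by (intro bexI[of _ "\<one>\<^bsub>R\<^esub>"]) auto
next
  case (Cons i xs)
  then have i: "i \<in> {1..n}" "set xs \<subseteq> {1..n}" by auto
  have "count_list ys i \<noteq> 0" using Cons.prems(3)[rule_format, of i] by simp
  then have "i \<in> set ys" by (simp add: count_list_0_iff)
  then obtain r ys' where r: "r \<in> carrier R" "yw ys \<otimes>\<^bsub>A\<^esub> xl (LX i) = cf r \<otimes>\<^bsub>A\<^esub> yw ys'" "set ys' \<subseteq> {1..n}"
      "\<forall>j. count_list ys j = count_list ys' j + (if j = i then 1 else 0)"
    using yw_x_cancel[OF i(1) Cons.prems(2)] by blast
  have "count_list xs j = count_list ys' j" for j
    using Cons.prems(3)[rule_format, of j] r(4)[rule_format, of j] by (auto split: if_splits)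
  then obtain r' where r': "r' \<in> carrier R" "yw ys' \<otimes>\<^bsub>A\<^esub> xw xs = cf r'"
    using Cons.IH[OF i(2) r(3)] by blast
  have "yw ys \<otimes>\<^bsub>A\<^esub> xw (i # xs) = (yw ys \<otimes>\<^bsub>A\<^esub> xl (LX i)) \<otimes>\<^bsub>A\<^esub> xw xs"
    using xy_closed[OF i(1)] xw_closed[OF i(2)] yw_closed[OF Cons.prems(2)] by (simp add: A.A.m_assoc)
  also have "\<dots> = cf (r \<otimes>\<^bsub>R\<^esub> r')"
    unfolding r(2) using cf_closed[OF r(1)] xw_closed[OF i(2)] yw_closed[OF r(3)] r'
    by (simp add: A.A.m_assoc cf_hom r(1))
  finally show ?case using r r' by blast
qed

text \<open>The identification of \<open>R\<close> with \<open>A\<^sub>0\<close>: a normally ordered monomial of degree zero has as many letters \<open>X\<^sub>i\<close>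
  as letters \<open>Y\<^sub>i\<close>, for every \<open>i\<close>.\<close>

lemma component_zero: "component D (\<lambda>_. 0) = cf ` carrier R"
proof
  show "cf ` carrier R \<subseteq> component D (\<lambda>_. 0)"
  proof clarify
    fix r assume "r \<in> carrier R"
    then have "mn [Coef r] \<in> component D (mon_degree [Coef r])" by (intro mon_component) auto
    then show "cf r \<in> component D (\<lambda>_. 0)" by (simp add: mon_single)
  qed
  have m: "mn w \<in> cf ` carrier R" if w: "w \<in> lists Gs" "mon_degree w = (\<lambda>_. 0)" for w
  proof -
    obtain r ys xs where r: "r \<in> carrier R" "set ys \<subseteq> {1..n}" "set xs \<subseteq> {1..n}"
     "mn w = cf r \<otimes>\<^bsub>A\<^esub> (yw ys \<otimes>\<^bsub>A\<^esub> xw xs)"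
     "\<forall>i. mon_degree w i = int (count_list xs i) - int (count_list ys i)"
      using normal_order[OF w(1)] by blast
    then have "\<forall>i. count_list xs i = count_list ys i" using w(2) by simp
    then obtain r' where r': "r' \<in> carrier R" "yw ys \<otimes>\<^bsub>A\<^esub> xw xs = cf r'"
      using balanced_coefficient[OF r(3,2)] by blast
    then have "mn w = cf (r \<otimes>\<^bsub>R\<^esub> r')" using r by (simp add: cf_hom)
    then show ?thesis using r r' by blast
  qed
  show "component D (\<lambda>_. 0) \<subseteq> cf ` carrier R"
    unfolding component_kspan
  proof
    fix x assume "x \<in> kspan K A (mn ` {w \<in> lists Gs. mon_degree w = (\<lambda>_. 0)})"
    then show "x \<in> cf ` carrier R"
    proof induction
      case kspan_zero
      then show ?case using cf_zero by (intro image_eqI[of _ _ "\<zero>\<^bsub>R\<^esub>"]) auto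
    next
      case (kspan_step x c s)
      then obtain r r' where "r \<in> carrier R" "x = cf r" "r' \<in> carrier R" "s = cf r'" using m by blast
      then have "x \<oplus>\<^bsub>A\<^esub> c \<odot>\<^bsub>A\<^esub> s = cf (r \<oplus>\<^bsub>R\<^esub> c \<odot>\<^bsub>R\<^esub> r')" "r \<oplus>\<^bsub>R\<^esub> c \<odot>\<^bsub>R\<^esub> r' \<in> carrier R"
        using kspan_step by (simp_all add: cf_hom)
      then show ?case by blast
    qed
  qed
qed

subsection \<open>The action of the degrees on \<open>R\<close>\<close>

lemma aut_pow_closed: "i \<in> {1..n} \<Longrightarrow> r \<in> carrier R \<Longrightarrow> aut_pow D i z r \<in> carrier R"
proof -
  assume i: "i \<in> {1..n}" and r: "r \<in> carrier R"
  have "(\<sigma> i ^^ k) r \<in> carrier R" "(\<tau> i ^^ k) r \<in> carrier R" for k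
    by (induction k) (use \<sigma>_facts[OF i] r in auto)
  then show ?thesis by (simp add: aut_pow_def)
qed

lemma aut_pow_succ: "i \<in> {1..n} \<Longrightarrow> r \<in> carrier R \<Longrightarrow> aut_pow D i (z + 1) r = \<sigma> i (aut_pow D i z r)"
proof (cases "z \<ge> 0")
  case True
  then have "nat (z + 1) = Suc (nat z)" by simp
  then show ?thesis using True by (simp add: aut_pow_def)
next
  case False
  assume i: "i \<in> {1..n}" and r: "r \<in> carrier R"
  define k where "k = nat (- (z + 1))"
  have k: "nat (- z) = Suc k" "aut_pow D i (z + 1) = \<tau> i ^^ k"
    using False by (auto simp: k_def aut_pow_def)
  have "(\<tau> i ^^ k) r \<in> carrier R" by (induction k) (use \<sigma>_facts[OF i] r in auto)
  then show ?thesis using False k \<sigma>_facts(3)[OF i] by (simp add: aut_pow_def)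
qed

lemma \<sigma>_\<tau>_comm:
  assumes "i \<in> {1..n}" "j \<in> {1..n}" "r \<in> carrier R"
  shows "\<sigma> i (\<tau> j r) = \<tau> j (\<sigma> i r)"
proof -
  have c: "\<tau> j r \<in> carrier R" using \<sigma>_facts[OF assms(2)] assms(3) by auto
  have "\<sigma> i r = \<sigma> j (\<sigma> i (\<tau> j r))"
    using \<sigma>_comm[OF assms(2,1) c] \<sigma>_facts(3)[OF assms(2,3)] by simp
  then show ?thesis using \<sigma>_facts(4)[OF assms(2) \<sigma>_facts(1)[OF assms(1) c]] by simp
qed

lemma aut_pow_comm:
  assumes "i \<in> {1..n}" "j \<in> {1..n}" "r \<in> carrier R"
  shows "\<sigma> i (aut_pow D j z r) = aut_pow D j z (\<sigma> i r)"
proof -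
  have 1: "(\<sigma> j ^^ k) r \<in> carrier R \<and> \<sigma> i ((\<sigma> j ^^ k) r) = (\<sigma> j ^^ k) (\<sigma> i r)" for k
    by (induction k) (use \<sigma>_comm[OF assms(1,2)] \<sigma>_facts[OF assms(2)] assms(3) in auto)
  have 2: "(\<tau> j ^^ k) r \<in> carrier R \<and> \<sigma> i ((\<tau> j ^^ k) r) = (\<tau> j ^^ k) (\<sigma> i r)" for k
    by (induction k) (use \<sigma>_\<tau>_comm[OF assms(1,2)] \<sigma>_facts[OF assms(2)] assms(3) in auto)
  show ?thesis using 1 2 by (simp add: aut_pow_def)
qed

lemma act_fold_closed: "set L \<subseteq> {1..n} \<Longrightarrow> r \<in> carrier R \<Longrightarrow> foldr (\<lambda>i. aut_pow D i (g i)) L r \<in> carrier R"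
  by (induction L) (auto simp: aut_pow_closed)

lemma act_closed: "r \<in> carrier R \<Longrightarrow> act D g r \<in> carrier R"
  unfolding act_def by (rule act_fold_closed) auto

lemma act_fold_succ:
  assumes "i \<in> {1..n}" "r \<in> carrier R"
  shows "distinct L \<Longrightarrow> set L \<subseteq> {1..n} \<Longrightarrow> i \<in> set L \<Longrightarrow>
    foldr (\<lambda>j. aut_pow D j (g j + (if j = i then 1 else 0))) L r = \<sigma> i (foldr (\<lambda>j. aut_pow D j (g j)) L r)"
proof (induction L)
  case (Cons j L)
  have c: "foldr (\<lambda>j. aut_pow D j (g j)) L r \<in> carrier R" using Cons assms by (intro act_fold_closed) auto
  show ?case
  proof (cases "j = i")
    case True
    have "foldr (\<lambda>j. aut_pow D j (g j + (if j = i then 1 else 0))) L r = foldr (\<lambda>j. aut_pow D j (g j)) L r"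
      by (rule foldr_cong) (use Cons.prems True in auto)
    then show ?thesis using True c assms by (simp add: aut_pow_succ)
  next
    case False
    then show ?thesis using Cons c assms aut_pow_comm[OF assms(1) _ c] by simp
  qed
qed simp

lemma act_succ: "i \<in> {1..n} \<Longrightarrow> r \<in> carrier R \<Longrightarrow>
   act D (\<lambda>j. (if j = i then 1 else 0) + g j) r = \<sigma> i (act D g r)"
  using act_fold_succ[of i r "[1..<Suc n]" g] by (simp add: act_def add.commute atLeastLessThanSuc_atLeastAtMost del: upt_Suc)

lemma act_pred:
  assumes i: "i \<in> {1..n}" and r: "r \<in> carrier R"
  shows "act D (\<lambda>j. (if j = i then -1 else 0) + g j) r = \<tau> i (act D g r)"
proof -
  let ?g = "\<lambda>j. (if j = i then -1 else 0) + g j"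
  have "(\<lambda>j. (if j = i then 1 else 0) + ?g j) = g" by auto
  then have "act D g r = \<sigma> i (act D ?g r)" using act_succ[OF i r, of ?g] by simp
  then show ?thesis using \<sigma>_facts(4)[OF i act_closed[OF r]] by simp
qed

text \<open>The map \<open>\<alpha>\<close> with \<open>z x = \<alpha>(x) z\<close> for a generator \<open>z\<close> and a coefficient \<open>x\<close>.\<close>

fun gen_act :: "'r tgw_gen \<Rightarrow> 'r \<Rightarrow> 'r" where
  "gen_act (Coef r) x = x"
| "gen_act (Letter (LX i)) x = \<sigma> i x"
| "gen_act (Letter (LY i)) x = \<tau> i x"

lemma act_zero: "act D (\<lambda>_. 0) r = r"
proof -
  have "foldr (\<lambda>i. aut_pow D i 0) L r = r" for L by (induction L) (auto simp: aut_pow_def)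
  then show ?thesis by (simp add: act_def del: upt_Suc)
qed

lemma act_word: "w \<in> lists Gs \<Longrightarrow> r \<in> carrier R \<Longrightarrow> foldr gen_act w r = act D (mon_degree w) r"
proof (induction w)
  case Nil
  then show ?case by (simp add: act_zero)
next
  case (Cons z w)
  consider r' where "z = Coef r'" | i where "z = Letter (LY i)" "i \<in> {1..n}"
    | i where "z = Letter (LX i)" "i \<in> {1..n}" using Cons.prems by (auto simp: letters_def)
  then show ?case
  proof cases
    case 1
    then show ?thesis using Cons by simp
  next
    case 2
    have "(\<lambda>j. gen_degree z j + mon_degree w j) = (\<lambda>j. (if j = i then -1 else 0) + mon_degree w j)"
      unfolding 2 by auto
    then show ?thesis using Cons act_pred[OF 2(2) Cons.prems(2), of "mon_degree w"] 2 by simp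
  next
    case 3
    have "(\<lambda>j. gen_degree z j + mon_degree w j) = (\<lambda>j. (if j = i then 1 else 0) + mon_degree w j)"
      unfolding 3 by auto
    then show ?thesis using Cons act_succ[OF 3(2) Cons.prems(2), of "mon_degree w"] 3 by simp
  qed
qed

lemma mon_coef_commute:
  "w \<in> lists Gs \<Longrightarrow> r \<in> carrier R \<Longrightarrow> mn w \<otimes>\<^bsub>A\<^esub> cf r = cf (foldr gen_act w r) \<otimes>\<^bsub>A\<^esub> mn w"
proof (induction w)
  case Nil
  then show ?case using cf_closed by (simp add: mon_Nil)
next
  case (Cons z w)
  have w: "w \<in> lists Gs" using Cons by auto
  let ?r = "foldr gen_act w r"
  have rc: "?r \<in> carrier R" using act_word[OF w Cons.prems(2)] act_closed Cons.prems by simp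
  have c: "mn w \<in> carrier A" "cf r \<in> carrier A" "cf ?r \<in> carrier A"
    using w Cons.prems rc mon_closed cf_closed by auto
  have IH: "mn w \<otimes>\<^bsub>A\<^esub> cf r = cf ?r \<otimes>\<^bsub>A\<^esub> mn w" using Cons w by blast
  consider r' where "z = Coef r'" "r' \<in> carrier R" | i where "z = Letter (LY i)" "i \<in> {1..n}"
    | i where "z = Letter (LX i)" "i \<in> {1..n}" using Cons.prems by (auto simp: letters_def)
  then show ?case
  proof cases
    case 1
    have "cf r' \<otimes>\<^bsub>A\<^esub> cf ?r = cf ?r \<otimes>\<^bsub>A\<^esub> cf r'"
      using 1 rc by (simp add: R.m_comm flip: cf_hom(2))
    then show ?thesis using 1 w c cf_closed[OF 1(2)] IH
      by (simp add: mon_Cons A.A.m_assoc) (simp flip: A.A.m_assoc)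
  next
    case 2
    have y: "xl (LY i) \<in> carrier A" "LY i \<in> letters n" using xy_closed letter_mem 2 by auto
    have t: "cf (\<tau> i ?r) \<in> carrier A" using \<sigma>_facts[OF 2(2)] rc cf_closed by auto
    have "mn (z # w) \<otimes>\<^bsub>A\<^esub> cf r = (xl (LY i) \<otimes>\<^bsub>A\<^esub> cf ?r) \<otimes>\<^bsub>A\<^esub> mn w"
      using 2 w c y IH by (simp add: mon_Cons A.A.m_assoc)
    also have "\<dots> = cf (\<tau> i ?r) \<otimes>\<^bsub>A\<^esub> mn (z # w)"
      using xl_rel(2)[OF 2(2) rc] 2 w c y t by (simp add: mon_Cons A.A.m_assoc)
    finally show ?thesis using 2 by simp
  next
    case 3
    have y: "xl (LX i) \<in> carrier A" "LX i \<in> letters n" using xy_closed letter_mem 3 by auto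
    have t: "cf (\<sigma> i ?r) \<in> carrier A" using \<sigma>_facts[OF 3(2)] rc cf_closed by auto
    have "mn (z # w) \<otimes>\<^bsub>A\<^esub> cf r = (xl (LX i) \<otimes>\<^bsub>A\<^esub> cf ?r) \<otimes>\<^bsub>A\<^esub> mn w"
      using 3 w c y IH by (simp add: mon_Cons A.A.m_assoc)
    also have "\<dots> = cf (\<sigma> i ?r) \<otimes>\<^bsub>A\<^esub> mn (z # w)"
      using xl_rel(1)[OF 3(2) rc] 3 w c y t by (simp add: mon_Cons A.A.m_assoc)
    finally show ?thesis using 3 by simp
  qed
qed

lemma component_coef_commute:
  assumes x: "x \<in> component D g" and r: "r \<in> carrier R"
  shows "x \<otimes>\<^bsub>A\<^esub> cf r = cf (act D g r) \<otimes>\<^bsub>A\<^esub> x"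
proof -
  let ?S = "mn ` {w \<in> lists Gs. mon_degree w = g}"
  have S: "?S \<subseteq> carrier A" using mon_closed by auto
  have c: "cf r \<in> carrier A" "cf (act D g r) \<in> carrier A" using r act_closed cf_closed by auto
  show ?thesis using x unfolding component_kspan
  proof induction
    case kspan_zero
    then show ?case using c by simp
  next
    case (kspan_step x k s)
    then obtain w where w: "w \<in> lists Gs" "mon_degree w = g" "s = mn w" by auto
    have "s \<otimes>\<^bsub>A\<^esub> cf r = cf (act D g r) \<otimes>\<^bsub>A\<^esub> s"
      using mon_coef_commute[OF w(1) r] act_word[OF w(1) r] w by simp
    moreover have "x \<in> carrier A" "s \<in> carrier A" using kspan_step A.kspan_carrier[OF S] S by auto
    ultimately show ?case using kspan_step c
      by (simp add: A.A.l_distr A.A.r_distr A.smult_mult_left A.smult_mult_right)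
  qed
qed

lemma word_of_mon_degree:
  assumes "g \<in> Zn n"
  shows "\<exists>w \<in> lists Gs. mon_degree w = g"
proof -
  obtain w where w: "w \<in> lists (tletters n)" "\<forall>i. wdeg w i = g i" using word_of_degree[OF assms] by blast
  define f :: "torus_gen \<Rightarrow> 'r tgw_gen" where
    "f = (\<lambda>z. case z of Pos i \<Rightarrow> Letter (LX i) | Neg i \<Rightarrow> Letter (LY i))"
  have "gen_degree (f z) i = tdeg z i" for z i by (cases z) (auto simp: f_def)
  then have "mon_degree (map f w) i = wdeg w i" for i by (induction w) auto
  moreover have fz: "f z \<in> Gs" if "z \<in> tletters n" for z
    using that by (cases z) (auto simp: f_def tletters_def letter_mem)
  have "map f w \<in> lists Gs" using w(1) by (induction w) (simp_all add: fz del: Un_iff)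
  ultimately show ?thesis using w(2) by (intro bexI[of _ "map f w"]) auto
qed

text \<open>Both sides are compositions of the automorphisms that belong to the letters of monomials of degree \<open>g\<close> and \<open>h\<close>.\<close>

lemma act_add:
  assumes "g \<in> Zn n" "h \<in> Zn n" "r \<in> carrier R"
  shows "act D (\<lambda>i. g i + h i) r = act D g (act D h r)"
proof -
  obtain v w where v: "v \<in> lists Gs" "mon_degree v = g" and w: "w \<in> lists Gs" "mon_degree w = h"
    using word_of_mon_degree assms by metis
  have "v @ w \<in> lists Gs" using v w by auto
  then have "act D (mon_degree (v @ w)) r = foldr gen_act v (foldr gen_act w r)"
    using act_word[of "v @ w" r] assms(3) by simp
  also have "\<dots> = act D g (act D h r)"
    using act_word[OF w(1) assms(3)] act_word[OF v(1) act_closed[OF assms(3)]] v w by simp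
  finally show ?thesis using v w by simp
qed

end

section \<open>Algebras with one basis vector in each degree\<close>

subsection \<open>The commutation factor\<close>

text \<open>A \<open>K\<close>-algebra with a basis \<open>V g\<close>, indexed by a group \<open>G\<close> of integer functions, such that \<open>V g \<cdot> V h\<close> is a nonzero
  multiple of \<open>V (g + h)\<close>: a group algebra of \<open>G\<close>, twisted by a cocycle.\<close>

locale pointed_grading = kalg K B
  for K :: "('k, 'x) ring_scheme" (structure) and B :: "('k, 'b, 'y) module_scheme" (structure) +
  fixes G :: "(nat \<Rightarrow> int) set" and V :: "(nat \<Rightarrow> int) \<Rightarrow> 'b"
  assumes G_zero: "dzero \<in> G" and G_add: "g \<in> G \<Longrightarrow> h \<in> G \<Longrightarrow> dplus g h \<in> G"
    and G_uminus: "g \<in> G \<Longrightarrow> duminus g \<in> G"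
    and V_closed: "g \<in> G \<Longrightarrow> V g \<in> carrier B" and V_one: "V dzero = \<one>\<^bsub>B\<^esub>"
    and V_mult: "g \<in> G \<Longrightarrow> h \<in> G \<Longrightarrow> prp (V g \<otimes>\<^bsub>B\<^esub> V h) (V (dplus g h))"
    and V_span: "carrier B = kspan K B (V ` G)"
    and V_independent: "f \<in> fs K G \<Longrightarrow> lin K B V f = \<zero>\<^bsub>B\<^esub> \<Longrightarrow> f = (\<lambda>_. \<zero>)"
begin

lemma V_nonzero: "g \<in> G \<Longrightarrow> V g \<noteq> \<zero>\<^bsub>B\<^esub>"
proof
  assume g: "g \<in> G" and z: "V g = \<zero>\<^bsub>B\<^esub>"
  have "single K g \<one> \<in> fs K G" using g by (simp add: fs_single)
  moreover have "lin K B V (single K g \<one>) = \<zero>\<^bsub>B\<^esub>"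
    using lin_single[of g G \<one> V] g V_closed z by simp
  ultimately have "single K g \<one> = (\<lambda>_. \<zero>)" by (rule V_independent)
  then have "\<one> = \<zero>" by (metis single_def)
  then show False by simp
qed

lemma smult_nonzero:
  assumes "c \<in> carrier K" "c \<noteq> \<zero>" "x \<in> carrier B" "c \<odot>\<^bsub>B\<^esub> x = \<zero>\<^bsub>B\<^esub>"
  shows "x = \<zero>\<^bsub>B\<^esub>"
proof -
  have "inv c \<in> carrier K" "inv c \<otimes> c = \<one>" using assms(1,2) by (auto simp: K.field_Units)
  then have "x = inv c \<odot>\<^bsub>B\<^esub> (c \<odot>\<^bsub>B\<^esub> x)" using assms(1,3) by (simp flip: smult_assoc1)
  also have "\<dots> = \<zero>\<^bsub>B\<^esub>" using \<open>inv c \<in> carrier K\<close> by (simp add: assms(4))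
  finally show ?thesis .
qed

lemma smult_cancel:
  assumes c: "c \<in> carrier K" "d \<in> carrier K" and x: "x \<in> carrier B" "x \<noteq> \<zero>\<^bsub>B\<^esub>"
    and e: "c \<odot>\<^bsub>B\<^esub> x = d \<odot>\<^bsub>B\<^esub> x"
  shows "c = d"
proof (rule ccontr)
  assume "c \<noteq> d"
  then have "c \<ominus> d \<noteq> \<zero>" using c by simp
  moreover have "(c \<ominus> d) \<odot>\<^bsub>B\<^esub> x = \<zero>\<^bsub>B\<^esub>"
    using c x e by (simp add: K.minus_eq smult_l_distr smult_l_minus A.r_neg)
  ultimately show False using smult_nonzero[of "c \<ominus> d" x] c x by auto
qed

lemma prp_nonzero: "prp x y \<Longrightarrow> y \<in> carrier B \<Longrightarrow> y \<noteq> \<zero>\<^bsub>B\<^esub> \<Longrightarrow> x \<noteq> \<zero>\<^bsub>B\<^esub>"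
proof -
  assume p: "prp x y" and y: "y \<in> carrier B" "y \<noteq> \<zero>\<^bsub>B\<^esub>"
  from p obtain c where c: "c \<in> carrier K" "c \<noteq> \<zero>" "x = c \<odot>\<^bsub>B\<^esub> y" unfolding prp_def by blast
  show "x \<noteq> \<zero>\<^bsub>B\<^esub>"
    using smult_nonzero[OF c(1,2) y(1)] y(2) c(3) by metis
qed

lemma VV_nonzero: "g \<in> G \<Longrightarrow> h \<in> G \<Longrightarrow> V g \<otimes>\<^bsub>B\<^esub> V h \<noteq> \<zero>\<^bsub>B\<^esub>"
  by (rule prp_nonzero[OF V_mult V_closed[OF G_add] V_nonzero[OF G_add]])

lemma comm_ex:
  assumes g: "g \<in> G" and h: "h \<in> G"
  shows "\<exists>c. c \<in> carrier K - {\<zero>} \<and> V g \<otimes>\<^bsub>B\<^esub> V h = c \<odot>\<^bsub>B\<^esub> (V h \<otimes>\<^bsub>B\<^esub> V g)"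
proof -
  have e: "dplus h g = dplus g h" by auto
  have c: "V h \<otimes>\<^bsub>B\<^esub> V g \<in> carrier B" "V (dplus g h) \<in> carrier B"
    using V_closed[OF g] V_closed[OF h] V_closed[OF G_add[OF g h]] by auto
  have "prp (V h \<otimes>\<^bsub>B\<^esub> V g) (V (dplus g h))" by (subst e[symmetric]) (rule V_mult[OF h g])
  then have "prp (V (dplus g h)) (V h \<otimes>\<^bsub>B\<^esub> V g)" using c(2) by (rule prp_sym)
  then have "prp (V g \<otimes>\<^bsub>B\<^esub> V h) (V h \<otimes>\<^bsub>B\<^esub> V g)" using prp_trans[OF V_mult[OF g h] _ c(1)] by blast
  then show ?thesis by (auto simp: prp_def)
qed

text \<open>
  The commutation factor of \<open>V g\<close> and \<open>V h\<close>. It is unique because \<open>V h \<cdot> V g\<close> is not zero.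
\<close>

definition \<kappa> where
  "\<kappa> g h = (SOME c. c \<in> carrier K - {\<zero>} \<and> V g \<otimes>\<^bsub>B\<^esub> V h = c \<odot>\<^bsub>B\<^esub> (V h \<otimes>\<^bsub>B\<^esub> V g))"

lemma \<kappa>:
  assumes "g \<in> G" "h \<in> G"
  shows "\<kappa> g h \<in> carrier K - {\<zero>}" "V g \<otimes>\<^bsub>B\<^esub> V h = \<kappa> g h \<odot>\<^bsub>B\<^esub> (V h \<otimes>\<^bsub>B\<^esub> V g)"
  using someI_ex[OF comm_ex[OF assms]] unfolding \<kappa>_def by blast+

lemma \<kappa>_unique:
  assumes "g \<in> G" "h \<in> G" "c \<in> carrier K" "V g \<otimes>\<^bsub>B\<^esub> V h = c \<odot>\<^bsub>B\<^esub> (V h \<otimes>\<^bsub>B\<^esub> V g)"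
  shows "\<kappa> g h = c"
  by (rule smult_cancel[of _ _ "V h \<otimes>\<^bsub>B\<^esub> V g"])
    (use \<kappa>[OF assms(1,2)] assms VV_nonzero V_closed in auto)

lemma \<kappa>_self: "g \<in> G \<Longrightarrow> \<kappa> g g = \<one>"
  by (rule \<kappa>_unique) (use V_closed in auto)

lemma \<kappa>_swap: "g \<in> G \<Longrightarrow> h \<in> G \<Longrightarrow> \<kappa> g h \<otimes> \<kappa> h g = \<one>"
proof -
  assume g: "g \<in> G" and h: "h \<in> G"
  have c: "V g \<otimes>\<^bsub>B\<^esub> V h \<in> carrier B" using V_closed g h by auto
  have k: "\<kappa> g h \<in> carrier K" "\<kappa> h g \<in> carrier K" using \<kappa> g h by auto
  have "\<kappa> g h \<odot>\<^bsub>B\<^esub> (\<kappa> h g \<odot>\<^bsub>B\<^esub> (V g \<otimes>\<^bsub>B\<^esub> V h)) = \<one> \<odot>\<^bsub>B\<^esub> (V g \<otimes>\<^bsub>B\<^esub> V h)"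
    using \<kappa>(2)[OF g h] \<kappa>(2)[OF h g] c by simp
  then have "(\<kappa> g h \<otimes> \<kappa> h g) \<odot>\<^bsub>B\<^esub> (V g \<otimes>\<^bsub>B\<^esub> V h) = \<one> \<odot>\<^bsub>B\<^esub> (V g \<otimes>\<^bsub>B\<^esub> V h)"
    using k c by (simp add: smult_assoc1)
  then show ?thesis using smult_cancel[of "\<kappa> g h \<otimes> \<kappa> h g" \<one>] k c VV_nonzero[OF g h] by simp
qed

lemma \<kappa>_add_left:
  assumes g: "g \<in> G" "g' \<in> G" and h: "h \<in> G"
  shows "\<kappa> (dplus g g') h = \<kappa> g h \<otimes> \<kappa> g' h"
proof (rule \<kappa>_unique)
  show "dplus g g' \<in> G" "h \<in> G" using G_add[OF g] h by auto
  have k: "\<kappa> g h \<in> carrier K" "\<kappa> g' h \<in> carrier K" using \<kappa> g h by auto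
  then show "\<kappa> g h \<otimes> \<kappa> g' h \<in> carrier K" by simp
  have c: "V g \<in> carrier B" "V g' \<in> carrier B" "V h \<in> carrier B" "V (dplus g g') \<in> carrier B"
    using V_closed[OF g(1)] V_closed[OF g(2)] V_closed[OF h] V_closed[OF G_add[OF g]] by auto
  obtain e where e: "e \<in> carrier K" "V (dplus g g') = e \<odot>\<^bsub>B\<^esub> (V g \<otimes>\<^bsub>B\<^esub> V g')"
    using prp_sym[OF V_mult[OF g] c(4)] by (auto simp: prp_def)
  have "V g \<otimes>\<^bsub>B\<^esub> V g' \<otimes>\<^bsub>B\<^esub> V h = V g \<otimes>\<^bsub>B\<^esub> (\<kappa> g' h \<odot>\<^bsub>B\<^esub> (V h \<otimes>\<^bsub>B\<^esub> V g'))"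
    using c \<kappa>(2)[OF g(2) h] by (simp add: A.m_assoc)
  also have "\<dots> = \<kappa> g' h \<odot>\<^bsub>B\<^esub> ((V g \<otimes>\<^bsub>B\<^esub> V h) \<otimes>\<^bsub>B\<^esub> V g')"
    using c k by (simp add: A.m_assoc smult_mult_right)
  also have "\<dots> = \<kappa> g' h \<odot>\<^bsub>B\<^esub> ((\<kappa> g h \<odot>\<^bsub>B\<^esub> (V h \<otimes>\<^bsub>B\<^esub> V g)) \<otimes>\<^bsub>B\<^esub> V g')"
    by (simp only: \<kappa>(2)[OF g(1) h])
  also have "\<dots> = (\<kappa> g h \<otimes> \<kappa> g' h) \<odot>\<^bsub>B\<^esub> (V h \<otimes>\<^bsub>B\<^esub> (V g \<otimes>\<^bsub>B\<^esub> V g'))"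
    using c k smult_comm[of "\<kappa> g' h" "\<kappa> g h"] by (simp add: A.m_assoc smult_mult_left smult_assoc1)
  finally have "V g \<otimes>\<^bsub>B\<^esub> V g' \<otimes>\<^bsub>B\<^esub> V h = (\<kappa> g h \<otimes> \<kappa> g' h) \<odot>\<^bsub>B\<^esub> (V h \<otimes>\<^bsub>B\<^esub> (V g \<otimes>\<^bsub>B\<^esub> V g'))" .
  then show "V (dplus g g') \<otimes>\<^bsub>B\<^esub> V h = (\<kappa> g h \<otimes> \<kappa> g' h) \<odot>\<^bsub>B\<^esub> (V h \<otimes>\<^bsub>B\<^esub> V (dplus g g'))"
    unfolding e(2) using c k e smult_comm[of e "\<kappa> g h \<otimes> \<kappa> g' h"]
    by (simp add: smult_mult_left smult_mult_right)
qed

lemma V_inverse: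
  assumes g: "g \<in> G"
  shows "\<exists>x. x \<in> carrier B \<and> prp x (V (duminus g)) \<and> V g \<otimes>\<^bsub>B\<^esub> x = \<one>\<^bsub>B\<^esub> \<and> x \<otimes>\<^bsub>B\<^esub> V g = \<one>\<^bsub>B\<^esub>"
proof -
  note ng = G_uminus[OF g]
  have z: "dplus g (duminus g) = dzero" "dplus (duminus g) g = dzero" by auto
  have c: "V g \<in> carrier B" "V (duminus g) \<in> carrier B" using V_closed g ng by auto
  have "prp (V g \<otimes>\<^bsub>B\<^esub> V (duminus g)) \<one>\<^bsub>B\<^esub>" "prp (V (duminus g) \<otimes>\<^bsub>B\<^esub> V g) \<one>\<^bsub>B\<^esub>"
    using V_mult[OF g ng] V_mult[OF ng g] V_one by (simp_all add: z)
  from this[THEN prp_sym] have p: "prp \<one>\<^bsub>B\<^esub> (V g \<otimes>\<^bsub>B\<^esub> V (duminus g))" "prp \<one>\<^bsub>B\<^esub> (V (duminus g) \<otimes>\<^bsub>B\<^esub> V g)"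
    by simp_all
  from p(1) obtain a where a: "a \<in> carrier K" "a \<noteq> \<zero>" "\<one>\<^bsub>B\<^esub> = a \<odot>\<^bsub>B\<^esub> (V g \<otimes>\<^bsub>B\<^esub> V (duminus g))"
    unfolding prp_def by blast
  from p(2) obtain b where b: "b \<in> carrier K" "b \<noteq> \<zero>" "\<one>\<^bsub>B\<^esub> = b \<odot>\<^bsub>B\<^esub> (V (duminus g) \<otimes>\<^bsub>B\<^esub> V g)"
    unfolding prp_def by blast
  define x y where "x = a \<odot>\<^bsub>B\<^esub> V (duminus g)" and "y = b \<odot>\<^bsub>B\<^esub> V (duminus g)"
  have xy: "x \<in> carrier B" "y \<in> carrier B" "V g \<otimes>\<^bsub>B\<^esub> x = \<one>\<^bsub>B\<^esub>" "y \<otimes>\<^bsub>B\<^esub> V g = \<one>\<^bsub>B\<^esub>"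
    using a b c by (simp_all add: x_def y_def smult_mult_left smult_mult_right)
  have "y = y \<otimes>\<^bsub>B\<^esub> (V g \<otimes>\<^bsub>B\<^esub> x)" using xy by simp
  also have "\<dots> = x" using xy(1,2,4) c by (simp flip: A.m_assoc)
  finally have "x = y" by simp
  moreover have "prp x (V (duminus g))" using a by (auto simp: x_def prp_def)
  ultimately show ?thesis using xy by auto
qed

text \<open>Linear independence survives reindexing and multiplication by nonzero scalars.\<close>

lemma independent_rescale:
  assumes P: "bij_betw P S G" and y: "\<And>c. c \<in> S \<Longrightarrow> y c \<in> carrier B"
    and p: "\<And>c. c \<in> S \<Longrightarrow> prp (y c) (V (P c))" and f: "f \<in> fs K S" and z: "lin K B y f = \<zero>\<^bsub>B\<^esub>"
  shows "f = (\<lambda>_. \<zero>)"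
proof -
  have "\<exists>b. \<forall>c\<in>S. b c \<in> carrier K - {\<zero>} \<and> y c = b c \<odot>\<^bsub>B\<^esub> V (P c)"
    using p unfolding prp_def by (intro bchoice) blast
  then obtain b where b: "\<And>c. c \<in> S \<Longrightarrow> b c \<in> carrier K" "\<And>c. c \<in> S \<Longrightarrow> b c \<noteq> \<zero>"
    "\<And>c. c \<in> S \<Longrightarrow> y c = b c \<odot>\<^bsub>B\<^esub> V (P c)" by auto
  define Q where "Q = inv_into S P"
  have Q: "g \<in> G \<Longrightarrow> Q g \<in> S" "g \<in> G \<Longrightarrow> P (Q g) = g" "c \<in> S \<Longrightarrow> Q (P c) = c" "c \<in> S \<Longrightarrow> P c \<in> G" for g c
    using P bij_betw_inv_into_right[OF P] bij_betw_inv_into_left[OF P]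
      bij_betw_apply[OF bij_betw_inv_into[OF P]] bij_betw_apply[OF P] by (auto simp: Q_def)
  define tr where "tr f = (\<lambda>g. if g \<in> G then f (Q g) \<otimes> b (Q g) else \<zero>)" for f
  have "tr f \<in> fs K G \<and> lin K B V (tr f) = lin K B y f"
    using f
  proof (induction rule: fs_induct)
    case zero
    have "tr (\<lambda>_. \<zero>) = (\<lambda>_. \<zero>)" using Q b by (auto simp: tr_def)
    then show ?case by (simp add: fs_zero lin_zero)
  next
    case (add f x c)
    have e: "tr (\<lambda>y. f y \<oplus> single K x c y) = (\<lambda>g. tr f g \<oplus> single K (P x) (c \<otimes> b x) g)"
    proof
      fix g
      show "tr (\<lambda>y. f y \<oplus> single K x c y) g = tr f g \<oplus> single K (P x) (c \<otimes> b x) g"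
      proof (cases "g \<in> G")
        case True
        have "Q g = x \<longleftrightarrow> g = P x" using Q True add by auto
        then show ?thesis using True Q b add fsD(1)[OF add.hyps(1)]
          by (auto simp: tr_def single_def K.l_distr)
      next
        case False
        then have "g \<noteq> P x" using Q add by auto
        then show ?thesis using False by (simp add: tr_def single_def)
      qed
    qed
    have cb: "c \<otimes> b x \<in> carrier K" using add b by simp
    have Px: "P x \<in> G" using Q add by simp
    have s: "single K (P x) (c \<otimes> b x) \<in> fs K G" using cb Px by (rule fs_single[rotated])
    have "lin K B V (\<lambda>g. tr f g \<oplus> single K (P x) (c \<otimes> b x) g) = lin K B V (tr f) \<oplus>\<^bsub>B\<^esub> (c \<otimes> b x) \<odot>\<^bsub>B\<^esub> V (P x)"
      using lin_add[of "tr f" G "single K (P x) (c \<otimes> b x)" V] lin_single[of "P x" G _ V] add s V_closed Px cb by simp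
    also have "\<dots> = lin K B y f \<oplus>\<^bsub>B\<^esub> c \<odot>\<^bsub>B\<^esub> y x"
      using add b V_closed[OF Px] by (simp add: smult_assoc1)
    also have "\<dots> = lin K B y (\<lambda>y. f y \<oplus> single K x c y)"
      using lin_add[OF add.hyps(1) fs_single[OF add.hyps(2,3)] y] lin_single[OF add.hyps(2,3) y] by simp
    finally show ?case unfolding e using add s by (simp add: fs_add)
  qed
  then have t: "tr f = (\<lambda>_. \<zero>)" using V_independent z by auto
  show ?thesis
  proof
    fix c
    show "f c = \<zero>"
    proof (cases "c \<in> S")
      case True
      then have "tr f (P c) = f c \<otimes> b c" using Q by (simp add: tr_def)
      then show ?thesis using t K.integral[of "f c" "b c"] b True fsD(1)[OF f] by auto
    next
      case False
      then show ?thesis using f by (auto simp: fs_def)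
    qed
  qed
qed

end

text \<open>Homomorphisms on \<open>\<int>\<^sup>k\<close> are determined by their values on the unit vectors.\<close>

lemma Zn_hom_ext:
  assumes H: "group H"
    and f: "\<And>c. c \<in> Zn k \<Longrightarrow> f c \<in> carrier H" "\<And>c d. c \<in> Zn k \<Longrightarrow> d \<in> Zn k \<Longrightarrow> f (dplus c d) = f c \<otimes>\<^bsub>H\<^esub> f d"
    and g: "\<And>c. c \<in> Zn k \<Longrightarrow> g c \<in> carrier H" "\<And>c d. c \<in> Zn k \<Longrightarrow> d \<in> Zn k \<Longrightarrow> g (dplus c d) = g c \<otimes>\<^bsub>H\<^esub> g d"
    and e: "\<And>j. j \<in> {1..k} \<Longrightarrow> f (\<lambda>i. if i = j then 1 else 0) = g (\<lambda>i. if i = j then 1 else 0)"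
    and c: "c \<in> Zn k"
  shows "f c = g c"
proof -
  interpret group H by fact
  have z: "dzero \<in> Zn k" by (simp add: Zn_def)
  have one: "h dzero = \<one>\<^bsub>H\<^esub>" if "\<And>c. c \<in> Zn k \<Longrightarrow> h c \<in> carrier H"
     "\<And>c d. c \<in> Zn k \<Longrightarrow> d \<in> Zn k \<Longrightarrow> h (dplus c d) = h c \<otimes>\<^bsub>H\<^esub> h d" for h
    using that(2)[OF z z] that(1)[OF z] by (simp add: l_cancel_one')
  have one_f: "f dzero = \<one>\<^bsub>H\<^esub>" by (rule one) (fact f)+
  have one_g: "g dzero = \<one>\<^bsub>H\<^esub>" by (rule one) (fact g)+
  have neg: "h (duminus c) = inv\<^bsub>H\<^esub> h c" if h: "\<And>c. c \<in> Zn k \<Longrightarrow> h c \<in> carrier H"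
     "\<And>c d. c \<in> Zn k \<Longrightarrow> d \<in> Zn k \<Longrightarrow> h (dplus c d) = h c \<otimes>\<^bsub>H\<^esub> h d" and c: "c \<in> Zn k" for h c
  proof -
    have nc: "duminus c \<in> Zn k" using c by (simp add: Zn_def)
    have "h (duminus c) \<otimes>\<^bsub>H\<^esub> h c = \<one>\<^bsub>H\<^esub>" using h(2)[OF nc c] one[of h] h by simp
    then show ?thesis using h(1)[OF c] h(1)[OF nc] inv_equality by simp
  qed
  have neg_f: "f (duminus c) = inv\<^bsub>H\<^esub> f c" if "c \<in> Zn k" for c by (rule neg) (fact f that)+
  have neg_g: "g (duminus c) = inv\<^bsub>H\<^esub> g c" if "c \<in> Zn k" for c by (rule neg) (fact g that)+
  have u: "(\<lambda>i. if i = j then 1 else 0) \<in> Zn k" if "j \<in> {1..k}" for j using that by (auto simp: Zn_def)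
  have td: "f (tdeg z) = g (tdeg z) \<and> tdeg z \<in> Zn k" if zl: "z \<in> tletters k" for z
  proof -
    consider j where "j \<in> {1..k}" "z = Pos j" | j where "j \<in> {1..k}" "z = Neg j"
      using zl by (auto simp: tletters_def)
    then show ?thesis
    proof cases
      case 1
      then have "tdeg z = (\<lambda>i. if i = j then 1 else 0)" by auto
      then show ?thesis using e[OF 1(1)] u[OF 1(1)] by simp
    next
      case 2
      then have "tdeg z = duminus (\<lambda>i. if i = j then 1 else 0)" by auto
      then show ?thesis using e[OF 2(1)] u[OF 2(1)] neg_f[OF u[OF 2(1)]] neg_g[OF u[OF 2(1)]]
        by (simp add: Zn_def)
    qed
  qed
  have "f (wdeg w) = g (wdeg w) \<and> wdeg w \<in> Zn k" if "w \<in> lists (tletters k)" for w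
    using that
  proof (induction w)
    case Nil
    have "wdeg [] = dzero" by auto
    then show ?case using one_f one_g z by simp
  next
    case (Cons a w)
    have "wdeg (a # w) = dplus (tdeg a) (wdeg w)" by auto
    then show ?case using Cons td[of a] f(2)[of "tdeg a" "wdeg w"] g(2)[of "tdeg a" "wdeg w"]
      by (simp add: Zn_def)
  qed
  moreover obtain w where "w \<in> lists (tletters k)" "wdeg w = c" using word_of_degree[OF c] by auto
  ultimately show ?thesis by auto
qed

subsection \<open>A basis adapted to the commutation factor\<close>

lemma lcomb_unit: "j \<in> {1..k} \<Longrightarrow> lcomb k s (\<lambda>i. if i = j then 1 else 0) = s j"
  by (auto simp: lcomb_def fun_eq_iff if_distrib[of "\<lambda>x. x * _"] cong: if_cong)

lemma lcomb_add: "lcomb k s (dplus c d) = dplus (lcomb k s c) (lcomb k s d)"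
  by (auto simp: lcomb_def fun_eq_iff distrib_right sum.distrib)

lemma unit_Zn: "j \<in> {1..k} \<Longrightarrow> (\<lambda>i. if i = j then 1 else 0) \<in> Zn k"
  by (auto simp: Zn_def)

lemma Z_basis_mem: "Z_basis k s G \<Longrightarrow> j \<in> {1..k} \<Longrightarrow> s j \<in> G"
  using lcomb_unit[of j k s] unit_Zn[of j k] bij_betw_apply[of "lcomb k s" "Zn k" G]
  by (metis Z_basis_lcomb)

lemma Z_basis_lcomb_mem: "Z_basis k s G \<Longrightarrow> c \<in> Zn k \<Longrightarrow> lcomb k s c \<in> G"
  using bij_betw_apply[of "lcomb k s" "Zn k" G] by (simp add: Z_basis_lcomb)

lemma Z_basis_standard: "Z_basis k (\<lambda>j i. if i = j then 1 else 0) (Zn k)"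
proof -
  have "lcomb k (\<lambda>j i. if i = j then 1 else 0) c = c" if "c \<in> Zn k" for c
    using that by (auto simp: lcomb_def Zn_def fun_eq_iff if_distrib[of "\<lambda>x. _ * x"] cong: if_cong)
  then have "bij_betw (lcomb k (\<lambda>j i. if i = j then 1 else 0)) (Zn k) (Zn k) \<longleftrightarrow> bij_betw (\<lambda>c. c) (Zn k) (Zn k)"
    by (intro bij_betw_cong)
  then show ?thesis by (simp add: Z_basis_lcomb bij_betw_def)
qed

lemma Z_basis_trans:
  assumes s: "Z_basis k s G" and t: "Z_basis k t (Zn k)"
  shows "Z_basis k (\<lambda>j. lcomb k s (t j)) G"
proof -
  have "lcomb k (\<lambda>j. lcomb k s (t j)) c i = lcomb k s (lcomb k t c) i" for c i
  proof -
    have "lcomb k (\<lambda>j. lcomb k s (t j)) c i = (\<Sum>j=1..k. \<Sum>l=1..k. c j * t j l * s l i)"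
      by (simp add: lcomb_def sum_distrib_left mult.assoc)
    also have "\<dots> = (\<Sum>l=1..k. \<Sum>j=1..k. c j * t j l * s l i)" by (rule sum.swap)
    also have "\<dots> = lcomb k s (lcomb k t c) i" by (simp add: lcomb_def sum_distrib_right)
    finally show ?thesis .
  qed
  then have "lcomb k (\<lambda>j. lcomb k s (t j)) = lcomb k s \<circ> lcomb k t" by (auto simp: fun_eq_iff)
  then show ?thesis using bij_betw_trans s t by (simp add: Z_basis_lcomb) 
qed

context pointed_grading begin

text \<open>In exponents of a root of unity \<open>z\<close> of which all commutation factors of basis vectors are powers, the
  commutation factor is an alternating integral form \<open>w\<close> on \<open>\<int>\<^sup>k\<close>, and a basis in normal form for \<open>w\<close> is a
  normalized basis for the commutation factor.\<close>

lemma normalized_basis: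
  assumes Z: "Z_basis k s G"
    and ru: "\<And>i j. i \<in> {1..k} \<Longrightarrow> j \<in> {1..k} \<Longrightarrow> root_of_unity K (\<kappa> (s i) (s j))"
  shows "\<exists>s r d z. root_of_unity K z \<and> Z_basis k s G \<and> 2 * r \<le> k \<and> (\<forall>i\<in>{1..r}. d i > (0::nat)) \<and>
    (\<forall>i\<in>{1..<r}. d i dvd d (Suc i)) \<and>
    (\<forall>i j. 1 \<le> i \<longrightarrow> i < j \<longrightarrow> j \<le> k \<longrightarrow>
      \<kappa> (s i) (s j) = (if odd i \<and> j = Suc i \<and> j \<le> 2 * r then z [^] d (j div 2) else \<one>))"
proof -
  let ?U = "(\<lambda>(i, j). \<kappa> (s i) (s j)) ` ({1..k} \<times> {1..k})"
  have "\<exists>z. root_of_unity K z \<and> (\<forall>x \<in> ?U. \<exists>m::nat. x = z [^] m)"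
    by (rule root_of_unity_common) (use ru in auto)
  then obtain z where z: "root_of_unity K z" "\<forall>x \<in> ?U. \<exists>m::nat. x = z [^] m" by blast
  then have "\<forall>i \<in> {1..k}. \<forall>j \<in> {1..k}. \<exists>m::nat. \<kappa> (s i) (s j) = z [^] m" by force
  then obtain mm :: "nat \<Rightarrow> nat \<Rightarrow> nat" where mm: "\<forall>i \<in> {1..k}. \<forall>j \<in> {1..k}. \<kappa> (s i) (s j) = z [^] mm i j"
    by metis
  define H where "H = Multiplicative_Group.mult_of K"
  have Hs: "carrier H = carrier K - {\<zero>}" "monoid.mult H = monoid.mult K" "one H = \<one>"
    by (simp_all add: H_def)
  interpret H: comm_group H
    unfolding H_def by (rule group.group_comm_groupI[OF field_mult_group]) (auto simp: K.m_comm)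
  have Hpow: "x [^]\<^bsub>H\<^esub> (m::nat) = x [^] m" for x m
    by (simp add: H_def Multiplicative_Group.nat_pow_mult_of)
  have zH: "z \<in> carrier H"
  proof -
    obtain N :: nat where "N > 0" "z [^] N = \<one>" "z \<in> carrier K" using z(1) by (auto simp: root_of_unity_def)
    then show ?thesis by (auto simp: Hs K.nat_pow_zero)
  qed
  \<comment> \<open>The exponents are unique only modulo the order of \<open>z\<close>; those with \<open>i < j\<close> are kept and extended
    to an antisymmetric matrix, so that the resulting form is alternating.\<close>
  define th :: "nat \<Rightarrow> nat \<Rightarrow> int" where
    "th i j = (if i < j then int (mm i j) else if j < i then - int (mm j i) else 0)" for i j
  have sG: "s j \<in> G" if "j \<in> {1..k}" for j using Z_basis_mem[OF Z that] .
  have kH: "\<kappa> g h \<in> carrier H" if "g \<in> G" "h \<in> G" for g h using \<kappa>(1)[OF that] by (simp add: Hs)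
  have swapH: "\<kappa> g h = inv\<^bsub>H\<^esub> \<kappa> h g" if "g \<in> G" "h \<in> G" for g h
    using \<kappa>_swap[OF that] H.inv_equality[of "\<kappa> g h" "\<kappa> h g"] kH that by (simp add: Hs)
  have kth: "\<kappa> (s i) (s j) = z [^]\<^bsub>H\<^esub> th i j" if ij: "i \<in> {1..k}" "j \<in> {1..k}" for i j
  proof -
    consider "i < j" | "j < i" | "i = j" by linarith
    then show ?thesis
    proof cases
      case 1
      then show ?thesis using mm ij by (simp add: th_def int_pow_int Hpow)
    next
      case 2
      have "\<kappa> (s j) (s i) = z [^]\<^bsub>H\<^esub> mm j i" using mm ij by (simp add: Hpow)
      then show ?thesis using 2 swapH[OF sG[OF ij(1)] sG[OF ij(2)]] zH
        by (simp add: th_def H.int_pow_neg int_pow_int)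
    next
      case 3
      then show ?thesis using \<kappa>_self[OF sG[OF ij(1)]] by (simp add: th_def Hs)
    qed
  qed
  define w where "w c d = (\<Sum>i=1..k. \<Sum>j=1..k. th i j * c i * d j)" for c d :: "nat \<Rightarrow> int"
  have w_left: "w (\<lambda>i. x i + q * y i) v = w x v + q * w y v" for x y v q
    by (simp add: w_def algebra_simps sum.distrib sum_distrib_left)
  have w_right: "w v (\<lambda>i. x i + q * y i) = w v x + q * w v y" for x y v q
    by (simp add: w_def algebra_simps sum.distrib sum_distrib_left)
  have w_alt: "w x x = 0" for x
  proof -
    have "w x x = (\<Sum>j=1..k. \<Sum>i=1..k. th i j * x i * x j)" unfolding w_def by (rule sum.swap)
    also have "\<dots> = (\<Sum>j=1..k. \<Sum>i=1..k. - (th j i * x j * x i))"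
      by (intro sum.cong refl) (auto simp: th_def)
    also have "\<dots> = - w x x" by (simp add: w_def sum_negf)
    finally show ?thesis by simp
  qed
  interpret alternating_form w by unfold_locales (fact w_left w_right w_alt)+
  let ?e = "\<lambda>j i. if i = j then 1 else (0::int)"
  have w_unit: "w (?e i) (?e j) = th i j" if "i \<in> {1..k}" "j \<in> {1..k}" for i j
  proof -
    have 1: "(\<Sum>j'=1..k. th i' j' * ?e i i' * ?e j j') = (if i' = i then th i' j else 0)" for i'
    proof -
      have "(\<Sum>j'=1..k. th i' j' * ?e i i' * ?e j j') = (\<Sum>j'=1..k. if j' = j then (if i' = i then th i' j' else 0) else 0)"
        by (intro sum.cong refl) auto
      then show ?thesis using that by simp
    qed
    show ?thesis unfolding w_def 1 using that by simp
  qed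
  have w_dplus: "w (dplus c d) v = w c v + w d v" "w v (dplus c d) = w v c + w v d" for c d v
    using add_left[of c 1 d v] add_right[of v c 1 d] by simp_all
  let ?P = "lcomb k s"
  have PG: "?P c \<in> G" if "c \<in> Zn k" for c using Z_basis_lcomb_mem[OF Z that] .
  have kadd1: "\<kappa> (?P (dplus c d)) h = \<kappa> (?P c) h \<otimes>\<^bsub>H\<^esub> \<kappa> (?P d) h"
    if "c \<in> Zn k" "d \<in> Zn k" "h \<in> G" for c d h
    unfolding lcomb_add Hs by (rule \<kappa>_add_left[OF PG[OF that(1)] PG[OF that(2)] that(3)])
  have kadd2: "\<kappa> h (?P (dplus c d)) = \<kappa> h (?P c) \<otimes>\<^bsub>H\<^esub> \<kappa> h (?P d)"
    if "c \<in> Zn k" "d \<in> Zn k" "h \<in> G" for c d h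
  proof -
    have cd: "dplus c d \<in> Zn k" using that by (simp add: Zn_def)
    have "\<kappa> h (?P (dplus c d)) = inv\<^bsub>H\<^esub> (\<kappa> (?P c) h \<otimes>\<^bsub>H\<^esub> \<kappa> (?P d) h)"
      using swapH[OF that(3) PG[OF cd]] kadd1[OF that] by simp
    also have "\<dots> = inv\<^bsub>H\<^esub> \<kappa> (?P c) h \<otimes>\<^bsub>H\<^esub> inv\<^bsub>H\<^esub> \<kappa> (?P d) h"
      using kH PG that by (intro H.inv_mult) auto
    finally show ?thesis using swapH[OF that(3) PG[OF that(1)]] swapH[OF that(3) PG[OF that(2)]] by simp
  qed
  have k1: "\<kappa> (?P c) (s j) = z [^]\<^bsub>H\<^esub> w c (?e j)" if c: "c \<in> Zn k" and j: "j \<in> {1..k}" for c j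
  proof (rule Zn_hom_ext[OF H.group_axioms, where k = k and f = "\<lambda>c. \<kappa> (?P c) (s j)"
        and g = "\<lambda>c. z [^]\<^bsub>H\<^esub> w c (?e j)"])
    show "\<kappa> (?P (?e i)) (s j) = z [^]\<^bsub>H\<^esub> w (?e i) (?e j)" if "i \<in> {1..k}" for i
      using kth that j by (simp only: lcomb_unit w_unit)
  qed (use kH PG sG[OF j] c zH kadd1 in \<open>auto simp: w_dplus H.int_pow_mult\<close>)
  have kw: "\<kappa> (?P c) (?P d) = z [^]\<^bsub>H\<^esub> w c d" if c: "c \<in> Zn k" and d: "d \<in> Zn k" for c d
  proof (rule Zn_hom_ext[OF H.group_axioms, where k = k and f = "\<lambda>d. \<kappa> (?P c) (?P d)"
        and g = "\<lambda>d. z [^]\<^bsub>H\<^esub> w c d"])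
    show "\<kappa> (?P c) (?P (?e j)) = z [^]\<^bsub>H\<^esub> w c (?e j)" if "j \<in> {1..k}" for j
      using k1[OF c that] that by (simp only: lcomb_unit)
  qed (use kH PG c d zH kadd2 in \<open>auto simp: w_dplus H.int_pow_mult\<close>)
  obtain t r d where t: "Z_basis k t (Zn k)" "2 * r \<le> k" "\<forall>i\<in>{1..r}. d i > (0::nat)"
    "\<forall>i\<in>{1..<r}. d i dvd d (Suc i)"
    "\<And>i j. 1 \<le> i \<Longrightarrow> i < j \<Longrightarrow> j \<le> k \<Longrightarrow>
      w (t i) (t j) = (if odd i \<and> j = Suc i \<and> j \<le> 2 * r then int (d (j div 2)) else 0)"
    using normal_form[OF Z_basis_standard] by blast
  define s' where "s' j = lcomb k s (t j)" for j
  have "\<kappa> (s' i) (s' j) = (if odd i \<and> j = Suc i \<and> j \<le> 2 * r then z [^] d (j div 2) else \<one>)"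
    if "1 \<le> i" "i < j" "j \<le> k" for i j
  proof -
    have "\<kappa> (s' i) (s' j) = z [^]\<^bsub>H\<^esub> w (t i) (t j)"
      unfolding s'_def using that Z_basis_mem[OF t(1)] by (intro kw) auto
    then show ?thesis unfolding t(5)[OF that] by (simp add: int_pow_int Hpow Hs)
  qed
  moreover have "Z_basis k s' G" unfolding s'_def by (rule Z_basis_trans[OF Z t(1)])
  ultimately show ?thesis using z(1) t(2-4)
    by (intro exI[of _ s'] exI[of _ r] exI[of _ d] exI[of _ z]) simp
qed

end

subsection \<open>Comparison with a tensor product of tori\<close>

lemma alg_isomorphic_of_bij:
  assumes K: "kalg K T" "kalg K B" and g: "g \<in> alg_hom K T B" and b: "bij_betw g (carrier T) (carrier B)"
  shows "alg_isomorphic K B T"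
proof -
  interpret T: kalg K T by fact
  have gr: "g \<in> ring_iso T B" using g b by (auto simp: ring_iso_def alg_hom_def)
  let ?h = "inv_into (carrier T) g"
  have h: "?h \<in> ring_iso B T" by (rule ring_iso_set_sym[OF T.A.ring_axioms gr])
  have "?h (c \<odot>\<^bsub>B\<^esub> x) = c \<odot>\<^bsub>T\<^esub> ?h x" if c: "c \<in> carrier K" and x: "x \<in> carrier B" for c x
  proof -
    have hx: "?h x \<in> carrier T" "g (?h x) = x"
      using b x bij_betw_inv_into_right[OF b x] bij_betw_apply[OF bij_betw_inv_into[OF b] x] by auto
    have "c \<odot>\<^bsub>B\<^esub> x = g (c \<odot>\<^bsub>T\<^esub> ?h x)" using alg_homD(5)[OF g c hx(1)] hx(2) by simp
    then show ?thesis using bij_betw_inv_into_left[OF b T.smult_closed[OF c hx(1)]] by simp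
  qed
  then have "?h \<in> alg_iso K B T" using h by (simp add: alg_iso_def)
  then show ?thesis by (auto simp: alg_isomorphic_def)
qed

lemma sum_split_nat: "(\<Sum>l=1..a + m. f l) = (\<Sum>l=1..a. f l) + (\<Sum>j=1..m. f (a + j :: nat) :: int)"
  by (induction m) auto

lemma (in torus) torus_kalg: "kalg K Tm" by (rule T.kalg_axioms)

context pointed_grading begin

lemma kspan_centralizer:
  assumes C: "kalg K C" and f: "f \<in> alg_hom K C B" and S: "S \<subseteq> carrier C" and x: "x \<in> carrier B"
    and c: "\<And>s. s \<in> S \<Longrightarrow> f s \<otimes>\<^bsub>B\<^esub> x = x \<otimes>\<^bsub>B\<^esub> f s" and u: "u \<in> kspan K C S"
  shows "f u \<otimes>\<^bsub>B\<^esub> x = x \<otimes>\<^bsub>B\<^esub> f u"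
proof -
  interpret C: kalg K C by fact
  note fD = alg_homD[OF f]
  from u show ?thesis
  proof induction
    case kspan_zero
    then show ?case using alg_hom_zero[OF f C.A.ring_axioms A.ring_axioms] x by simp
  next
    case (kspan_step u a s)
    have cl: "u \<in> carrier C" "s \<in> carrier C" using kspan_step C.kspan_carrier[OF S] S by auto
    show ?case using kspan_step cl c x
      by (simp add: fD A.l_distr A.r_distr smult_mult_left smult_mult_right)
  qed
qed

lemma commute_inverse:
  assumes "x \<in> carrier B" "y \<in> carrier B" "y' \<in> carrier B" "y \<otimes>\<^bsub>B\<^esub> y' = \<one>\<^bsub>B\<^esub>" "y' \<otimes>\<^bsub>B\<^esub> y = \<one>\<^bsub>B\<^esub>"
    "x \<otimes>\<^bsub>B\<^esub> y = y \<otimes>\<^bsub>B\<^esub> x"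
  shows "x \<otimes>\<^bsub>B\<^esub> y' = y' \<otimes>\<^bsub>B\<^esub> x"
proof -
  have "x \<otimes>\<^bsub>B\<^esub> y' = (y' \<otimes>\<^bsub>B\<^esub> y) \<otimes>\<^bsub>B\<^esub> x \<otimes>\<^bsub>B\<^esub> y'" using assms by simp
  also have "\<dots> = y' \<otimes>\<^bsub>B\<^esub> (x \<otimes>\<^bsub>B\<^esub> y) \<otimes>\<^bsub>B\<^esub> y'" using assms(1-3,6) by (simp add: A.m_assoc)
  also have "\<dots> = y' \<otimes>\<^bsub>B\<^esub> x" using assms(1-4) by (simp add: A.m_assoc)
  finally show ?thesis .
qed

text \<open>If the commutation factors of a basis are in block form, the universal properties of the tori and of
  the tensor product give a homomorphism \<open>g\<close> to \<open>B\<close>. The tensor product is spanned by one monomial for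
  each exponent vector, and \<open>g\<close> maps these monomials to nonzero multiples of the distinct basis elements
  of \<open>B\<close>; so \<open>g\<close> is bijective.\<close>

theorem torus_tensor_iso:
  assumes Z: "Z_basis k s G" and rk: "2 * r \<le> k" and q: "\<And>i. i \<in> {1..r} \<Longrightarrow> q i \<in> carrier K - {\<zero>}"
    and kap: "\<And>i j. 1 \<le> i \<Longrightarrow> i < j \<Longrightarrow> j \<le> k \<Longrightarrow>
      \<kappa> (s i) (s j) = (if odd i \<and> j = Suc i \<and> j \<le> 2 * r then q (j div 2) else \<one>)"
  shows "alg_isomorphic K B (tensor_alg K {1..Suc r}
     (\<lambda>i. if i \<le> r then T_alg K (q i) else laurent_alg K (k - 2 * r)))"
proof -
  \<comment> \<open>\<open>m i\<close> is the size of block \<open>i\<close>, and \<open>off i\<close> is the number of basis vectors that precede it.\<close>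
  define m where "m i = (if i \<le> r then 2 else k - 2 * r)" for i
  define qq where "qq i = (if i \<le> r then q i else \<one>)" for i
  define off where "off i = 2 * (i - 1)" for i :: nat
  define I where "I = {1..Suc r}"
  define F where "F = (\<lambda>i. if i \<le> r then T_alg K (q i) else laurent_alg K (k - 2 * r))"
  have FI: "F i = torus_alg K (m i) (qq i)" for i
    by (simp add: F_def m_def qq_def T_alg_def laurent_alg_def)
  have tor: "torus K (qq i)" if "i \<in> I" for i
    by (intro torus.intro torus_axioms.intro field_axioms) (use that q in \<open>auto simp: qq_def I_def\<close>)
  have Fk: "kalg K (F i)" if "i \<in> I" for i
    unfolding FI by (rule torus.torus_kalg[OF tor[OF that]])
  have ten: "tensor K I F"
    by (intro tensor.intro tensor_axioms.intro field_axioms Fk) (auto simp: I_def)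
  interpret T: tensor K I F by (rule ten)
  have offm: "off i + j \<in> {1..k}" if "i \<in> I" "j \<in> {1..m i}" for i j
    using that rk by (auto simp: off_def m_def I_def split: if_splits)
  have sG: "s j \<in> G" if "j \<in> {1..k}" for j using Z_basis_mem[OF Z that] .
  have "\<exists>Vi. \<forall>g\<in>G. Vi g \<in> carrier B \<and> prp (Vi g) (V (duminus g)) \<and> V g \<otimes>\<^bsub>B\<^esub> Vi g = \<one>\<^bsub>B\<^esub> \<and> Vi g \<otimes>\<^bsub>B\<^esub> V g = \<one>\<^bsub>B\<^esub>"
    by (rule bchoice) (use V_inverse in blast)
  then obtain Vi where Vi: "\<And>g. g \<in> G \<Longrightarrow> Vi g \<in> carrier B" "\<And>g. g \<in> G \<Longrightarrow> prp (Vi g) (V (duminus g))"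
    "\<And>g. g \<in> G \<Longrightarrow> V g \<otimes>\<^bsub>B\<^esub> Vi g = \<one>\<^bsub>B\<^esub>" "\<And>g. g \<in> G \<Longrightarrow> Vi g \<otimes>\<^bsub>B\<^esub> V g = \<one>\<^bsub>B\<^esub>" by blast
  define y where "y i z = (case z of Pos j \<Rightarrow> V (s (off i + j)) | Neg j \<Rightarrow> Vi (s (off i + j)))" for i z
  have tl: "(\<exists>j\<in>{1..m i}. z = Pos j) \<or> (\<exists>j\<in>{1..m i}. z = Neg j)" if "z \<in> tletters (m i)" for z i
    using that by (auto simp: tletters_def)
  have ycl: "y i z \<in> carrier B" if i: "i \<in> I" and z: "z \<in> tletters (m i)" for i z
    using tl[OF z] sG[OF offm[OF i]] V_closed Vi(1) by (auto simp: y_def)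
  have yinv: "y i z \<otimes>\<^bsub>B\<^esub> y i (tinv z) = \<one>\<^bsub>B\<^esub>" if i: "i \<in> I" and z: "z \<in> tletters (m i)" for i z
    using tl[OF z] sG[OF offm[OF i]] Vi(3,4) by (auto simp: y_def)
  have ycomm: "y i (Pos a) \<otimes>\<^bsub>B\<^esub> y i (Pos b) = qq i \<odot>\<^bsub>B\<^esub> (y i (Pos b) \<otimes>\<^bsub>B\<^esub> y i (Pos a))"
    if i: "i \<in> I" and ab: "a \<in> {1..m i}" "b \<in> {1..m i}" "a < b" for i a b
  proof -
    have oa: "off i + a \<in> {1..k}" "off i + b \<in> {1..k}" using offm[OF i] ab by auto
    have e: "\<kappa> (s (off i + a)) (s (off i + b)) = qq i"
    proof (cases "i \<le> r")
      case True
      then have "a = 1" "b = 2" using ab by (auto simp: m_def)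
      moreover have "odd (off i + 1)" "off i + 2 = Suc (off i + 1)" "off i + 2 \<le> 2 * r" "(off i + 2) div 2 = i"
        using True i by (auto simp: off_def I_def)
      ultimately show ?thesis using kap[of "off i + 1" "off i + 2"] oa True by (simp add: qq_def)
    next
      case False
      then have "off i = 2 * r" using i by (auto simp: off_def I_def)
      then have "\<not> off i + b \<le> 2 * r" using ab by simp
      then show ?thesis using kap[of "off i + a" "off i + b"] oa ab False by (simp add: qq_def)
    qed
    show ?thesis using \<kappa>(2)[OF sG[OF oa(1)] sG[OF oa(2)]] unfolding e y_def by simp
  qed
  have "\<forall>i\<in>I. \<exists>f. f \<in> alg_hom K (F i) B \<and> (\<forall>w \<in> lists (tletters (m i)). f (tword K (m i) (qq i) w) = wprod B (y i) w)"
  proof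
    fix i assume i: "i \<in> I"
    show "\<exists>f. f \<in> alg_hom K (F i) B \<and> (\<forall>w \<in> lists (tletters (m i)). f (tword K (m i) (qq i) w) = wprod B (y i) w)"
      using torus.torus_hom_ex[OF tor[OF i] kalg_axioms ycl[OF i] yinv[OF i] ycomm[OF i]]
      unfolding FI by blast
  qed
  then obtain f where f: "\<And>i. i \<in> I \<Longrightarrow> f i \<in> alg_hom K (F i) B"
    "\<And>i w. i \<in> I \<Longrightarrow> w \<in> lists (tletters (m i)) \<Longrightarrow> f i (tword K (m i) (qq i) w) = wprod B (y i) w"
    by (metis (no_types, lifting) bchoice)
  note torS = torus.tword_closed[OF tor]
  have Fspan: "carrier (F i) = kspan K (F i) (tword K (m i) (qq i) ` lists (tletters (m i)))" if "i \<in> I" for i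
    unfolding FI by (rule torus.torus_kspan[OF tor[OF that]])
  have Fsub: "tword K (m i) (qq i) ` lists (tletters (m i)) \<subseteq> carrier (F i)" if "i \<in> I" for i
    unfolding FI using torS[OF that] by auto

  have com1: "y i (Pos a) \<otimes>\<^bsub>B\<^esub> y i' (Pos b) = y i' (Pos b) \<otimes>\<^bsub>B\<^esub> y i (Pos a)"
    if i: "i \<in> I" "i' \<in> I" "i < i'" and ab: "a \<in> {1..m i}" "b \<in> {1..m i'}" for i i' a b
  proof -
    have o: "off i + a \<in> {1..k}" "off i' + b \<in> {1..k}" using offm i ab by auto
    have "off i + a \<le> 2 * i" "2 * i \<le> off i'"
      using i ab by (auto simp: off_def m_def I_def split: if_splits)
    then have lt: "off i + a < off i' + b" using ab by auto
    have "\<not> (odd (off i + a) \<and> off i' + b = Suc (off i + a))"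
    proof
      assume h: "odd (off i + a) \<and> off i' + b = Suc (off i + a)"
      then have "off i + a = 2 * i" using \<open>off i + a \<le> 2 * i\<close> \<open>2 * i \<le> off i'\<close> ab by auto
      then show False using h by simp
    qed
    then have "\<kappa> (s (off i + a)) (s (off i' + b)) = \<one>" using kap[OF _ lt] o by auto
    then show ?thesis using \<kappa>(2)[OF sG[OF o(1)] sG[OF o(2)]] V_closed[OF sG[OF o(1)]] V_closed[OF sG[OF o(2)]]
      by (simp add: y_def)
  qed
  have com2: "y i z \<otimes>\<^bsub>B\<^esub> x = x \<otimes>\<^bsub>B\<^esub> y i z"
    if i: "i \<in> I" and z: "z \<in> tletters (m i)" and x: "x \<in> carrier B"
      and h: "\<And>a. a \<in> {1..m i} \<Longrightarrow> y i (Pos a) \<otimes>\<^bsub>B\<^esub> x = x \<otimes>\<^bsub>B\<^esub> y i (Pos a)" for i z x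
    using tl[OF z]
  proof
    assume "\<exists>j\<in>{1..m i}. z = Pos j"
    then show ?thesis using h by auto
  next
    assume "\<exists>j\<in>{1..m i}. z = Neg j"
    then obtain j where j: "j \<in> {1..m i}" "z = Neg j" by auto
    have l: "Pos j \<in> tletters (m i)" "Neg j \<in> tletters (m i)" using j by (auto simp: tletters_def)
    show ?thesis unfolding j(2)
      by (rule commute_inverse[symmetric, OF x ycl[OF i l(1)] ycl[OF i l(2)]])
        (use yinv[OF i l(1)] yinv[OF i l(2)] h[OF j(1)] in simp_all)
  qed
  have com3: "y i z \<otimes>\<^bsub>B\<^esub> y i' z' = y i' z' \<otimes>\<^bsub>B\<^esub> y i z"
    if i: "i \<in> I" "i' \<in> I" "i < i'" and z: "z \<in> tletters (m i)" "z' \<in> tletters (m i')" for i i' z z'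
  proof (rule com2[OF i(1) z(1) ycl[OF i(2) z(2)]])
    fix a assume a: "a \<in> {1..m i}"
    have l: "Pos a \<in> tletters (m i)" using a by (auto simp: tletters_def)
    show "y i (Pos a) \<otimes>\<^bsub>B\<^esub> y i' z' = y i' z' \<otimes>\<^bsub>B\<^esub> y i (Pos a)"
      by (rule com2[symmetric, OF i(2) z(2) ycl[OF i(1) l]]) (rule com1[symmetric, OF i a])
  qed
  have com4: "y i z \<otimes>\<^bsub>B\<^esub> y i' z' = y i' z' \<otimes>\<^bsub>B\<^esub> y i z"
    if i: "i \<in> I" "i' \<in> I" "i \<noteq> i'" and z: "z \<in> tletters (m i)" "z' \<in> tletters (m i')" for i i' z z'
    using com3[OF i(1,2) _ z] com3[OF i(2,1) _ z(2,1)] i(3) by (metis linorder_neqE_nat)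
  have fcom: "f i u \<otimes>\<^bsub>B\<^esub> x = x \<otimes>\<^bsub>B\<^esub> f i u"
    if i: "i \<in> I" and u: "u \<in> carrier (F i)" and x: "x \<in> carrier B"
      and h: "\<And>z. z \<in> tletters (m i) \<Longrightarrow> y i z \<otimes>\<^bsub>B\<^esub> x = x \<otimes>\<^bsub>B\<^esub> y i z" for i u x
  proof (rule kspan_centralizer[OF Fk[OF i] f(1)[OF i] Fsub[OF i] x])
    show "u \<in> kspan K (F i) (tword K (m i) (qq i) ` lists (tletters (m i)))" using u Fspan[OF i] by simp
    fix t assume "t \<in> tword K (m i) (qq i) ` lists (tletters (m i))"
    then obtain w where w: "w \<in> lists (tletters (m i))" "t = tword K (m i) (qq i) w" by auto
    then have l: "z \<in> tletters (m i)" if "z \<in> set w" for z using that by auto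
    show "f i t \<otimes>\<^bsub>B\<^esub> x = x \<otimes>\<^bsub>B\<^esub> f i t"
      unfolding w(2) f(2)[OF i w(1)] by (rule A.wprod_commute[OF x]) (use ycl[OF i l] h[OF l] in auto)
  qed
  have fcl: "f i u \<in> carrier B" if "i \<in> I" "u \<in> carrier (F i)" for i u using alg_homD(1)[OF f(1)] that by blast
  have fcomm: "f i u \<otimes>\<^bsub>B\<^esub> f j v = f j v \<otimes>\<^bsub>B\<^esub> f i u"
    if ij: "i \<in> I" "j \<in> I" "i \<noteq> j" and u: "u \<in> carrier (F i)" and v: "v \<in> carrier (F j)" for i j u v
  proof (rule fcom[OF ij(1) u fcl[OF ij(2) v]])
    fix z assume z: "z \<in> tletters (m i)"
    show "y i z \<otimes>\<^bsub>B\<^esub> f j v = f j v \<otimes>\<^bsub>B\<^esub> y i z"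
      by (rule fcom[symmetric, OF ij(2) v ycl[OF ij(1) z]]) (rule com4[symmetric, OF ij z])
  qed
  obtain g where g: "g \<in> alg_hom K T.T B"
    "\<And>x. x \<in> T.C \<Longrightarrow> g (tpure K I F x) = wprod B (\<lambda>i. f i (x i)) [1..<Suc (Suc r)]"
    using T.tensor_hom_ex[OF kalg_axioms f(1) fcomm, of "[1..<Suc (Suc r)]"]
    by (auto simp: I_def atLeastLessThanSuc_atLeastAtMost simp del: upt_Suc)

  \<comment> \<open>The degree of the value in \<open>B\<close> of a word \<open>w\<close> in the generators of block \<open>i\<close>.\<close>
  define blk where "blk i w = (\<lambda>l. \<Sum>j=1..m i. wdeg w j * s (off i + j) l)" for i w
  have blk: "blk i w \<in> G \<and> prp (wprod B (y i) w) (V (blk i w))"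
    if i: "i \<in> I" and w: "w \<in> lists (tletters (m i))" for i w
    using w
  proof (induction w)
    case Nil
    have "blk i [] = dzero" by (simp add: blk_def)
    then show ?case using G_zero by (simp add: V_one prp_refl)
  next
    case (Cons z w)
    then have z: "z \<in> tletters (m i)" and w: "w \<in> lists (tletters (m i))" by auto
    define gz where "gz = (\<lambda>l. \<Sum>j=1..m i. tdeg z j * s (off i + j) l)"
    have e: "blk i (z # w) = dplus gz (blk i w)"
      by (simp add: blk_def gz_def distrib_right sum.distrib fun_eq_iff)
    have gz: "gz \<in> G \<and> prp (y i z) (V gz)"
      using tl[OF z]
    proof
      assume "\<exists>j\<in>{1..m i}. z = Pos j"
      then obtain j where j: "j \<in> {1..m i}" "z = Pos j" by auto
      have "gz = s (off i + j)"
      proof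
        fix l
        have "gz l = (\<Sum>j'=1..m i. if j' = j then s (off i + j) l else 0)"
          unfolding gz_def j(2) by (intro sum.cong refl) auto
        then show "gz l = s (off i + j) l" using j by simp
      qed
      then show ?thesis using sG[OF offm[OF i j(1)]] V_closed prp_refl by (simp add: y_def j(2))
    next
      assume "\<exists>j\<in>{1..m i}. z = Neg j"
      then obtain j where j: "j \<in> {1..m i}" "z = Neg j" by auto
      have "gz = duminus (s (off i + j))"
      proof
        fix l
        have "gz l = (\<Sum>j'=1..m i. if j' = j then - s (off i + j) l else 0)"
          unfolding gz_def j(2) by (intro sum.cong refl) auto
        then show "gz l = - s (off i + j) l" using j by simp
      qed
      then show ?thesis using sG[OF offm[OF i j(1)]] Vi(2) G_uminus by (simp add: y_def j(2))
    qed
    have IH: "blk i w \<in> G" "prp (wprod B (y i) w) (V (blk i w))" using Cons w by auto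
    have "prp (y i z \<otimes>\<^bsub>B\<^esub> wprod B (y i) w) (V gz \<otimes>\<^bsub>B\<^esub> V (blk i w))"
      using gz IH V_closed by (intro prp_mult) auto
    then have "prp (y i z \<otimes>\<^bsub>B\<^esub> wprod B (y i) w) (V (dplus gz (blk i w)))"
      using prp_trans V_mult[of gz "blk i w"] gz IH V_closed[OF G_add] by blast
    then show ?case unfolding e using G_add gz IH by simp
  qed

  \<comment> \<open>Every exponent vector \<open>c\<close> of length \<open>k\<close> is cut into blocks; \<open>Y c\<close> is the pure tensor of words with these
    exponents, and \<open>g\<close> maps it to the line of degree \<open>lcomb k s c\<close>.\<close>
  define W where "W i c = (SOME w. w \<in> lists (tletters (m i)) \<and>
      (\<forall>j. wdeg w j = (if j \<in> {1..m i} then c (off i + j) else 0)))" for i c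
  have W: "W i c \<in> lists (tletters (m i))" "wdeg (W i c) j = (if j \<in> {1..m i} then c (off i + j) else 0)" for i c j
  proof -
    have "(\<lambda>j. if j \<in> {1..m i} then c (off i + j) else 0) \<in> Zn (m i)" by (auto simp: Zn_def)
    then have "\<exists>w. w \<in> lists (tletters (m i)) \<and> (\<forall>j. wdeg w j = (if j \<in> {1..m i} then c (off i + j) else 0))"
      using word_of_degree by blast
    from someI_ex[OF this] show "W i c \<in> lists (tletters (m i))"
      "wdeg (W i c) j = (if j \<in> {1..m i} then c (off i + j) else 0)" unfolding W_def by blast+
  qed
  define Y where "Y c = tpure K I F (\<lambda>i\<in>I. tword K (m i) (qq i) (W i c))" for c
  have YC: "(\<lambda>i\<in>I. tword K (m i) (qq i) (W i c)) \<in> T.C" for c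
    using torS W(1) unfolding FI by auto
  have Ycl: "Y c \<in> carrier T.T" for c unfolding Y_def by (rule T.tpure_closed[OF YC])
  define ps where "ps a c = (\<lambda>l. \<Sum>j=1..a. c j * s j l)" for a :: nat and c
  have blkW: "blk i (W i c) = (\<lambda>l. \<Sum>j=1..m i. c (off i + j) * s (off i + j) l)" for i c
    unfolding blk_def by (intro ext sum.cong refl) (simp add: W(2))
  have step: "ps (off i + m i) c \<in> G \<and> prp (x \<otimes>\<^bsub>B\<^esub> wprod B (y i) (W i c)) (V (ps (off i + m i) c))"
    if i: "i \<in> I" and p: "ps (off i) c \<in> G" "prp x (V (ps (off i) c))" for i x c
  proof -
    have e: "ps (off i + m i) c = dplus (ps (off i) c) (blk i (W i c))"
      unfolding ps_def blkW by (intro ext sum_split_nat)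
    note b = blk[OF i W(1), of c]
    have "prp (x \<otimes>\<^bsub>B\<^esub> wprod B (y i) (W i c)) (V (ps (off i) c) \<otimes>\<^bsub>B\<^esub> V (blk i (W i c)))"
      using p b V_closed by (intro prp_mult) auto
    then show ?thesis unfolding e
      using prp_trans V_mult[OF p(1) conjunct1[OF b]] V_closed[OF G_add] G_add p b by blast
  qed
  define h where "h c i = wprod B (y i) (W i c)" for c i
  have hcl: "h c i \<in> carrier B" if "i \<in> I" for c i
    unfolding h_def by (rule A.wprod_closed[OF ycl[OF that] W(1)])
  have happ: "wprod B (h c) ([1..<Suc N] @ [Suc N]) = wprod B (h c) [1..<Suc N] \<otimes>\<^bsub>B\<^esub> h c (Suc N)"
    if "N \<le> r" for N c
  proof -
    have "[1..<Suc N] \<in> lists I" "[Suc N] \<in> lists I" using that by (auto simp: I_def simp del: upt_Suc)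
    then have "wprod B (h c) ([1..<Suc N] @ [Suc N]) = wprod B (h c) [1..<Suc N] \<otimes>\<^bsub>B\<^esub> wprod B (h c) [Suc N]"
      by (rule A.wprod_append[where S = I, rotated]) (rule hcl)
    then show ?thesis using hcl[of "Suc N" c] that by (simp add: I_def del: upt_Suc)
  qed
  have part: "ps (2 * N) c \<in> G \<and> prp (wprod B (h c) [1..<Suc N]) (V (ps (2 * N) c))" if "N \<le> r" for N c
    using that
  proof (induction N)
    case 0
    have "ps 0 c = dzero" by (simp add: ps_def)
    then show ?case using G_zero by (simp add: V_one prp_refl)
  next
    case (Suc N)
    then have o: "off (Suc N) + m (Suc N) = 2 * Suc N" "off (Suc N) = 2 * N" "Suc N \<in> I"
      by (auto simp: off_def m_def I_def)
    have IH: "ps (2 * N) c \<in> G" "prp (wprod B (h c) [1..<Suc N]) (V (ps (2 * N) c))" using Suc by auto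
    have u: "[1..<Suc (Suc N)] = [1..<Suc N] @ [Suc N]" by simp
    have e: "wprod B (h c) [1..<Suc (Suc N)] = wprod B (h c) [1..<Suc N] \<otimes>\<^bsub>B\<^esub> wprod B (y (Suc N)) (W (Suc N) c)"
      unfolding u using happ[of N c] Suc.prems by (simp only: h_def)
    have o': "2 * N + m (Suc N) = 2 * Suc N" using o(1,2) by simp
    show ?case unfolding e using step[OF o(3), of c "wprod B (h c) [1..<Suc N]"] IH unfolding o(2) o' by blast
  qed
  have gY: "prp (g (Y c)) (V (lcomb k s c))" for c
  proof -
    have "g (Y c) = wprod B (\<lambda>i. f i ((\<lambda>i\<in>I. tword K (m i) (qq i) (W i c)) i)) [1..<Suc (Suc r)]"
      unfolding Y_def by (rule g(2)[OF YC])
    also have "\<dots> = wprod B (h c) [1..<Suc (Suc r)]"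
      by (rule A.wprod_cong) (auto simp: h_def f(2)[OF _ W(1)] I_def simp del: upt_Suc)
    also have "[1..<Suc (Suc r)] = [1..<Suc r] @ [Suc r]" by simp
    finally have e: "g (Y c) = wprod B (h c) [1..<Suc r] \<otimes>\<^bsub>B\<^esub> h c (Suc r)" using happ[of r c] by simp
    have o: "off (Suc r) + m (Suc r) = k" "off (Suc r) = 2 * r" "Suc r \<in> I"
      using rk by (auto simp: off_def m_def I_def)
    have o': "2 * r + m (Suc r) = k" using o(1,2) by simp
    have "lcomb k s c = ps k c" by (simp add: lcomb_def ps_def)
    moreover have "wprod B (y (Suc r)) (W (Suc r) c) = h c (Suc r)" by (simp only: h_def)
    ultimately show ?thesis using step[OF o(3), of c "wprod B (h c) [1..<Suc r]"] part[of r c] unfolding e o(2) o' by simp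
  qed

  \<comment> \<open>Words with the same exponents are proportional, so one word for every exponent vector suffices.\<close>
  have Yspan: "carrier T.T = kspan K T.T (Y ` Zn k)"
  proof -
    let ?S = "tpure K I F ` (\<Pi>\<^sub>E i\<in>I. tword K (m i) (qq i) ` lists (tletters (m i)))"
    have YT: "Y ` Zn k \<subseteq> carrier T.T" using Ycl by auto
    have "?S \<subseteq> kspan K T.T (Y ` Zn k)"
    proof
      fix t assume "t \<in> ?S"
      then obtain x where x: "x \<in> (\<Pi>\<^sub>E i\<in>I. tword K (m i) (qq i) ` lists (tletters (m i)))" "t = tpure K I F x" by auto
      have "\<forall>i\<in>I. \<exists>w. w \<in> lists (tletters (m i)) \<and> x i = tword K (m i) (qq i) w"
      proof
        fix i assume "i \<in> I"
        then have "x i \<in> tword K (m i) (qq i) ` lists (tletters (m i))" by (rule PiE_mem[OF x(1)])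
        then show "\<exists>w. w \<in> lists (tletters (m i)) \<and> x i = tword K (m i) (qq i) w" by blast
      qed
      then obtain w where w: "\<And>i. i \<in> I \<Longrightarrow> w i \<in> lists (tletters (m i))"
        "\<And>i. i \<in> I \<Longrightarrow> x i = tword K (m i) (qq i) (w i)" by metis
      define bk where "bk l = (if l \<le> 2 * r then (l + 1) div 2 else Suc r)" for l
      define c where "c l = (if l \<in> {1..k} then wdeg (w (bk l)) (l - off (bk l)) else 0)" for l
      have c: "c \<in> Zn k" by (auto simp: c_def Zn_def)
      have co: "c (off i + j) = wdeg (w i) j" if i: "i \<in> I" and j: "j \<in> {1..m i}" for i j
      proof -
        have "bk (off i + j) = i"
          using i j by (auto simp: bk_def off_def m_def I_def split: if_splits)
        then show ?thesis using offm[OF i j] by (simp add: c_def)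
      qed
      have d0: "wdeg v j = 0" if "v \<in> lists (tletters a)" "j \<notin> {1..a}" for v j a
        using that(1)
      proof (induction v)
        case (Cons z v)
        then show ?case using that(2) by (auto simp: tletters_def)
      qed simp
      have "wdeg (w i) j = wdeg (W i c) j" if i: "i \<in> I" for i j
        using co[OF i, of j] d0[OF w(1)[OF i], of j] by (auto simp: W(2))
      then have "kalg.prp K (F i) (x i) (tword K (m i) (qq i) (W i c))" if i: "i \<in> I" for i
        unfolding FI w(2)[OF i] using torus.tword_proportional[OF tor[OF i] w(1)[OF i] W(1)[of i c]] i by blast
      note xprp = this
      have xC: "x \<in> T.C" by (rule subsetD[OF PiE_mono x(1)]) (rule Fsub)
      have "T.T.prp (tpure K I F x) (Y c)"
        unfolding Y_def by (rule T.tpure_prp[OF xC YC]) (simp only: restrict_apply' xprp)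
      then obtain a where a: "a \<in> carrier K" "t = a \<odot>\<^bsub>T.T\<^esub> Y c" using x(2) by (auto simp: T.T.prp_def)
      show "t \<in> kspan K T.T (Y ` Zn k)"
        unfolding a(2) using a(1) c by (intro T.T.kspan_smult[OF YT] T.T.kspan_base[OF YT]) auto
    qed
    then have "kspan K T.T ?S \<subseteq> kspan K T.T (Y ` Zn k)" by (rule T.T.kspan_subset[OF YT])
    then show ?thesis using T.tensor_kspan[OF Fsub Fspan] T.T.kspan_carrier[OF YT] by blast
  qed

  note gD = alg_homD[OF g(1)]
  have gl: "g (lin K T.T Y a) = lin K B (g \<circ> Y) a" if "a \<in> fs K (Zn k)" for a
    by (rule linear_map_lin[OF T.T.kalg_axioms kalg_axioms that]) (use Ycl gD in auto)
  have linT: "carrier T.T = lin K T.T Y ` fs K (Zn k)"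
    unfolding Yspan by (rule T.T.lin_image_kspan[symmetric]) (rule Ycl)
  have bij: "bij_betw (lcomb k s) (Zn k) G" using Z by (simp add: Z_basis_lcomb)
  have ker: "t = \<zero>\<^bsub>T.T\<^esub>" if t: "t \<in> carrier T.T" "g t = \<zero>\<^bsub>B\<^esub>" for t
  proof -
    obtain a where a: "a \<in> fs K (Zn k)" "t = lin K T.T Y a" using t(1) unfolding linT by blast
    have "lin K B (g \<circ> Y) a = \<zero>\<^bsub>B\<^esub>" using gl[OF a(1)] t(2) a(2) by simp
    then have "a = (\<lambda>_. \<zero>)"
      by (rule independent_rescale[OF bij _ _ a(1), rotated 2]) (use gY gD(1)[OF Ycl] in auto)
    then show ?thesis using a(2) by (simp add: T.T.lin_zero)
  qed
  have "inj_on g (carrier T.T)"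
  proof (rule inj_onI)
    fix t t' assume t: "t \<in> carrier T.T" "t' \<in> carrier T.T" "g t = g t'"
    let ?d = "t \<oplus>\<^bsub>T.T\<^esub> (\<ominus> \<one>) \<odot>\<^bsub>T.T\<^esub> t'"
    have gt: "g t' \<in> carrier B" using gD(1) t by blast
    have "g ?d = g t' \<oplus>\<^bsub>B\<^esub> (\<ominus> \<one>) \<odot>\<^bsub>B\<^esub> g t'" using t by (simp add: gD)
    also have "\<dots> = \<zero>\<^bsub>B\<^esub>" using gt by (simp add: smult_l_minus A.r_neg)
    finally have "?d = \<zero>\<^bsub>T.T\<^esub>" using ker[of ?d] t by simp
    then have "t \<ominus>\<^bsub>T.T\<^esub> t' = \<zero>\<^bsub>T.T\<^esub>" using t by (simp add: T.T.smult_l_minus T.T.A.minus_eq)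
    then show "t = t'" using t by simp
  qed
  moreover have "g ` carrier T.T = carrier B"
  proof
    show "g ` carrier T.T \<subseteq> carrier B" using gD(1) by auto
    have gYB: "(g \<circ> Y) ` Zn k \<subseteq> carrier B" using gD(1)[OF Ycl] by auto
    have "V ` G \<subseteq> kspan K B ((g \<circ> Y) ` Zn k)"
    proof clarify
      fix x assume x: "x \<in> G"
      then obtain c where c: "c \<in> Zn k" "x = lcomb k s c" using bij by (auto simp: bij_betw_def)
      have "prp (V x) (g (Y c))" unfolding c(2)
        by (rule prp_sym[OF gY]) (use x c V_closed in auto)
      then obtain a where a: "a \<in> carrier K" "V x = a \<odot>\<^bsub>B\<^esub> g (Y c)" by (auto simp: prp_def)
      show "V x \<in> kspan K B ((g \<circ> Y) ` Zn k)"
        unfolding a(2) using a(1) c by (intro kspan_smult[OF gYB] kspan_base[OF gYB]) auto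
    qed
    then have "carrier B \<subseteq> kspan K B ((g \<circ> Y) ` Zn k)" unfolding V_span by (rule kspan_subset[OF gYB])
    also have "\<dots> = lin K B (g \<circ> Y) ` fs K (Zn k)"
      by (rule lin_image_kspan[symmetric]) (use gD(1)[OF Ycl] in auto)
    also have "\<dots> = g ` (lin K T.T Y ` fs K (Zn k))" using gl by (force simp: image_image)
    finally show "carrier B \<subseteq> g ` carrier T.T" unfolding linT .
  qed
  ultimately have "bij_betw g (carrier T.T) (carrier B)" by (simp add: bij_betw_def)
  then have "alg_isomorphic K B T.T"
    by (rule alg_isomorphic_of_bij[OF T.T.kalg_axioms kalg_axioms g(1)])
  then show ?thesis unfolding I_def F_def .
qed

end

section \<open>The weight algebra of a maximal ideal\<close>

lemma star_words: "w \<in> words D \<Longrightarrow> star w \<in> words D"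
proof -
  have l: "star_letter z \<in> letters k" if "z \<in> letters k" for z k
    using that by (cases z) (auto simp: letters_def)
  assume "w \<in> words D"
  then show ?thesis unfolding words_def star_def by (induction w) (simp_all add: l)
qed

lemma mon_degree_star:
  "mon_degree (map Letter (star w) :: 'r tgw_gen list) = duminus (mon_degree (map Letter w :: 'r tgw_gen list))"
proof (induction w)
  case (Cons z w)
  have "gen_degree (Letter (star_letter z) :: 'r tgw_gen) i = - gen_degree (Letter z :: 'r tgw_gen) i" for i by (cases z) auto
  then show ?case using Cons by (auto simp: star_def fun_eq_iff)
qed (simp add: star_def)

text \<open>A maximal ideal of \<open>R\<close> with residue field \<open>K\<close>.\<close>

locale tgw_point = tgw D for D :: "('k, 'r) tgw_data" +
  fixes m :: "'r set"
  assumes cf_inj: "inj_on (coef_map D) (carrier (base D))"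
    and m_max: "maximalideal m (base D)"
    and m_scalars: "(\<lambda>c. m +>\<^bsub>base D\<^esub> (c \<odot>\<^bsub>base D\<^esub> \<one>\<^bsub>base D\<^esub>)) ` carrier (ground D) = carrier (base D Quot m)"
begin

sublocale m: maximalideal m R by (rule m_max)

text \<open>The inverse of the identification of \<open>R\<close> with \<open>A\<^sub>0\<close>.\<close>

definition ci where "ci x = inv_into (carrier R) cf x"

lemma ci: "r \<in> carrier R \<Longrightarrow> ci (cf r) = r" "x \<in> component D dzero \<Longrightarrow> ci x \<in> carrier R"
  "x \<in> component D dzero \<Longrightarrow> cf (ci x) = x"
  unfolding ci_def component_zero using cf_inj
  by (auto simp: inv_into_f_f inv_into_into f_inv_into_f)

lemma m_sub: "r \<in> m \<Longrightarrow> r \<in> carrier R" using m.a_Hcarr by auto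

lemma cf_mem_iff: "r \<in> carrier R \<Longrightarrow> cf r \<in> cf ` m \<longleftrightarrow> r \<in> m"
  using inj_on_image_mem_iff[OF cf_inj _ m.a_subset] by blast

lemma m_scalar_ex: "r \<in> carrier R \<Longrightarrow> \<exists>c \<in> carrier K. r \<ominus>\<^bsub>R\<^esub> c \<odot>\<^bsub>R\<^esub> \<one>\<^bsub>R\<^esub> \<in> m"
proof -
  assume r: "r \<in> carrier R"
  then have "m +>\<^bsub>R\<^esub> r \<in> carrier (R Quot m)" by (auto simp: FactRing_def A_RCOSETS_def')
  then obtain c where c: "c \<in> carrier K" "m +>\<^bsub>R\<^esub> r = m +>\<^bsub>R\<^esub> (c \<odot>\<^bsub>R\<^esub> \<one>\<^bsub>R\<^esub>)"
    unfolding m_scalars[symmetric] by blast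
  have "c \<odot>\<^bsub>R\<^esub> \<one>\<^bsub>R\<^esub> \<in> carrier R" using c by simp
  then have "r \<ominus>\<^bsub>R\<^esub> c \<odot>\<^bsub>R\<^esub> \<one>\<^bsub>R\<^esub> \<in> m"
    using R.quotient_eq_iff_same_a_r_cos[OF m.is_ideal r] c(2) by blast
  with c(1) show ?thesis by blast
qed

lemma cf_minus: "r \<in> carrier R \<Longrightarrow> r' \<in> carrier R \<Longrightarrow> cf (r \<ominus>\<^bsub>R\<^esub> r') = cf r \<ominus>\<^bsub>A\<^esub> cf r'"
proof -
  assume r: "r \<in> carrier R" "r' \<in> carrier R"
  have "r \<ominus>\<^bsub>R\<^esub> r' = r \<oplus>\<^bsub>R\<^esub> (\<ominus>\<^bsub>K\<^esub> \<one>\<^bsub>K\<^esub>) \<odot>\<^bsub>R\<^esub> r'" using r by (simp add: R.minus_eq R.smult_l_minus)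
  then have "cf (r \<ominus>\<^bsub>R\<^esub> r') = cf r \<oplus>\<^bsub>A\<^esub> (\<ominus>\<^bsub>K\<^esub> \<one>\<^bsub>K\<^esub>) \<odot>\<^bsub>A\<^esub> cf r'" using r by (simp add: cf_hom)
  then show ?thesis using r cf_closed by (simp add: A.A.minus_eq A.smult_l_minus)
qed

lemma m_inverse_ex:
  assumes r: "r \<in> carrier R" "r \<notin> m"
  shows "\<exists>s \<in> carrier R. s \<otimes>\<^bsub>R\<^esub> r \<ominus>\<^bsub>R\<^esub> \<one>\<^bsub>R\<^esub> \<in> m"
proof -
  obtain c where c: "c \<in> carrier K" "r \<ominus>\<^bsub>R\<^esub> c \<odot>\<^bsub>R\<^esub> \<one>\<^bsub>R\<^esub> \<in> m" using m_scalar_ex[OF r(1)] by blast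
  have "c \<noteq> \<zero>\<^bsub>K\<^esub>"
  proof
    assume "c = \<zero>\<^bsub>K\<^esub>"
    then show False using c(2) r by (simp add: R.minus_eq)
  qed
  then have d: "inv\<^bsub>K\<^esub> c \<in> carrier K" "inv\<^bsub>K\<^esub> c \<otimes>\<^bsub>K\<^esub> c = \<one>\<^bsub>K\<^esub>" using c by (auto simp: K.field_Units)
  define s where "s = inv\<^bsub>K\<^esub> c \<odot>\<^bsub>R\<^esub> \<one>\<^bsub>R\<^esub>"
  have s: "s \<in> carrier R" using d by (simp add: s_def)
  have "s \<otimes>\<^bsub>R\<^esub> (r \<ominus>\<^bsub>R\<^esub> c \<odot>\<^bsub>R\<^esub> \<one>\<^bsub>R\<^esub>) = s \<otimes>\<^bsub>R\<^esub> r \<ominus>\<^bsub>R\<^esub> s \<otimes>\<^bsub>R\<^esub> (c \<odot>\<^bsub>R\<^esub> \<one>\<^bsub>R\<^esub>)"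
    using s r c by (simp add: R.minus_eq R.r_distr R.r_minus)
  also have "s \<otimes>\<^bsub>R\<^esub> (c \<odot>\<^bsub>R\<^esub> \<one>\<^bsub>R\<^esub>) = \<one>\<^bsub>R\<^esub>"
    using d c by (simp add: s_def R.smult_assoc2 flip: R.smult_assoc1)
  finally show ?thesis using m.I_l_closed[OF c(2) s] s by auto
qed

lemma stab_Zn: "g \<in> stab D m \<Longrightarrow> g \<in> Zn n" by (simp add: stab_def)

lemma stab_act: "g \<in> stab D m \<Longrightarrow> act D g ` m = m" by (simp add: stab_def)

lemma stab_add:
  assumes "g \<in> stab D m" "h \<in> stab D m"
  shows "dplus g h \<in> stab D m"
proof -
  have "act D (dplus g h) ` m = act D g ` (act D h ` m)"
    using act_add[OF stab_Zn[OF assms(1)] stab_Zn[OF assms(2)]] m_sub by (force simp: image_image)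
  then show ?thesis using assms by (auto simp: stab_def Zn_def)
qed

lemma act_uminus: "g \<in> Zn n \<Longrightarrow> r \<in> carrier R \<Longrightarrow> act D (duminus g) (act D g r) = r"
  using act_add[of "duminus g" g r] act_zero[of r] by (simp add: Zn_def)

lemma stab_uminus:
  assumes g: "g \<in> stab D m"
  shows "duminus g \<in> stab D m"
proof -
  have "act D (duminus g) ` m = act D (duminus g) ` (act D g ` m)" using stab_act[OF g] by simp
  also have "\<dots> = (\<lambda>r. r) ` m"
    unfolding image_image by (rule image_cong[OF refl]) (rule act_uminus[OF stab_Zn[OF g] m_sub])
  finally show ?thesis using g by (auto simp: stab_def Zn_def)
qed

lemma stab_mem: "g \<in> stab D m \<Longrightarrow> r \<in> carrier R \<Longrightarrow> act D g r \<in> m \<longleftrightarrow> r \<in> m"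
proof
  assume g: "g \<in> stab D m" and r: "r \<in> carrier R"
  show "act D g r \<in> m" if "r \<in> m" using stab_act[OF g] that by blast
  assume "act D g r \<in> m"
  then have "act D (duminus g) (act D g r) \<in> m" using stab_act[OF stab_uminus[OF g]] by blast
  then show "r \<in> m" using act_uminus[OF stab_Zn[OF g] r] by simp
qed

lemma component_elem: "x \<in> component D g \<Longrightarrow> \<exists>f \<in> hom_free D g. f \<in> carrier F \<and> x = cls f"
  using hom_free_sub by (auto simp: component_eq)

lemma component_carrier: "x \<in> component D g \<Longrightarrow> x \<in> carrier A"
  using component_elem hom_free_sub cls_hom(1) by blast

sublocale W: weight_setting K A "component D" "tgw_prj D" "stab D m" "cf ` m" "\<lambda>g x. cf (act D g (ci x))"
proof (intro weight_setting.intro A.kalg_axioms weight_setting_axioms.intro)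
  fix g h x y
  show "x \<in> component D g \<Longrightarrow> x \<in> carrier A" by (rule component_carrier)
  show "c \<odot>\<^bsub>A\<^esub> x \<in> component D g" if c: "c \<in> carrier K" and x: "x \<in> component D g" for c
  proof -
    obtain f where f: "f \<in> hom_free D g" "x = cls f" "f \<in> carrier F" using component_elem[OF x] by blast
    then have "c \<odot>\<^bsub>A\<^esub> x = cls (c \<odot>\<^bsub>F\<^esub> f)" using c by (simp add: cls_hom)
    then show ?thesis using hom_free_smult[OF c f(1)] by (simp add: component_eq)
  qed
  show "x \<oplus>\<^bsub>A\<^esub> y \<in> component D g" if x: "x \<in> component D g" and y: "y \<in> component D g"
  proof -
    obtain f where f: "f \<in> hom_free D g" "x = cls f" "f \<in> carrier F" using component_elem[OF x] by blast
    obtain f' where f': "f' \<in> hom_free D g" "y = cls f'" "f' \<in> carrier F" using component_elem[OF y] by blast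
    have "x \<oplus>\<^bsub>A\<^esub> y = cls (f \<oplus>\<^bsub>F\<^esub> f')" using f f' by (simp add: cls_hom)
    then show ?thesis using hom_free_add[OF f(1) f'(1)] by (simp add: component_eq)
  qed
  show "x \<otimes>\<^bsub>A\<^esub> y \<in> component D (dplus g h)" if x: "x \<in> component D g" and y: "y \<in> component D h"
  proof -
    obtain f where f: "f \<in> hom_free D g" "x = cls f" "f \<in> carrier F" using component_elem[OF x] by blast
    obtain f' where f': "f' \<in> hom_free D h" "y = cls f'" "f' \<in> carrier F" using component_elem[OF y] by blast
    have "x \<otimes>\<^bsub>A\<^esub> y = cls (f \<otimes>\<^bsub>F\<^esub> f')" using f f' by (simp add: cls_hom)
    then show ?thesis using hom_free_mult[OF f(1) f'(1), of "dplus g h"] by (simp add: component_eq)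
  qed
  show "\<one>\<^bsub>A\<^esub> \<in> component D dzero"
    using hom_free_one cls_hom(4) unfolding component_eq by (metis imageI)
  show "tgw_prj D g x \<in> component D g" if x: "x \<in> carrier A"
  proof -
    obtain f where f: "f \<in> carrier F" "x = cls f" using x carrier_A by blast
    then show ?thesis using prj_cls[OF f(1)] res_closed[OF f(1)] by (simp add: component_eq)
  qed
  show "tgw_prj D g (x \<oplus>\<^bsub>A\<^esub> y) = tgw_prj D g x \<oplus>\<^bsub>A\<^esub> tgw_prj D g y" if x: "x \<in> carrier A" and y: "y \<in> carrier A"
  proof -
    obtain f where f: "f \<in> carrier F" "x = cls f" using x carrier_A by blast
    obtain f' where f': "f' \<in> carrier F" "y = cls f'" using y carrier_A by blast
    have "x \<oplus>\<^bsub>A\<^esub> y = cls (f \<oplus>\<^bsub>F\<^esub> f')" using f f' by (simp add: cls_hom)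
    then show ?thesis using f f' prj_cls[of "f \<oplus>\<^bsub>F\<^esub> f'" g] by (simp add: prj_cls res_add cls_hom res_F)
  qed
  show "tgw_prj D g (c \<odot>\<^bsub>A\<^esub> x) = c \<odot>\<^bsub>A\<^esub> tgw_prj D g x" if c: "c \<in> carrier K" and x: "x \<in> carrier A" for c
  proof -
    obtain f where f: "f \<in> carrier F" "x = cls f" using x carrier_A by blast
    have "c \<odot>\<^bsub>A\<^esub> x = cls (c \<odot>\<^bsub>F\<^esub> f)" using f c by (simp add: cls_hom)
    then show ?thesis using f c prj_cls[of "c \<odot>\<^bsub>F\<^esub> f" g] by (simp add: prj_cls res_smult cls_hom res_F)
  qed
  show "tgw_prj D g x = (if g = h then x else \<zero>\<^bsub>A\<^esub>)" if x: "x \<in> component D h"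
  proof -
    obtain f where f: "f \<in> hom_free D h" "x = cls f" "f \<in> carrier F" using component_elem[OF x] by blast
    then show ?thesis using f prj_cls[of f g] res_hom[OF f(1), of g] by (simp add: cls_hom)
  qed
  show "dzero \<in> stab D m"
  proof -
    have "act D dzero ` m = m" using act_zero by simp
    then show ?thesis by (simp add: stab_def Zn_def)
  qed
  show "dplus g h \<in> stab D m" if "g \<in> stab D m" "h \<in> stab D m" using stab_add that .
  show "duminus g \<in> stab D m" if "g \<in> stab D m" using stab_uminus that .
  show "x \<in> component D dzero" if "x \<in> cf ` m" using that m_sub component_zero by auto
  show "\<zero>\<^bsub>A\<^esub> \<in> cf ` m" using m.zero_closed cf_zero by (metis imageI)
  show "x \<oplus>\<^bsub>A\<^esub> y \<in> cf ` m" if xy: "x \<in> cf ` m" "y \<in> cf ` m"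
  proof -
    obtain a where a: "a \<in> m" "x = cf a" using xy(1) by (rule imageE)
    obtain b where b: "b \<in> m" "y = cf b" using xy(2) by (rule imageE)
    note ab = a(1) b(1) a(2) b(2)
    then have "x \<oplus>\<^bsub>A\<^esub> y = cf (a \<oplus>\<^bsub>R\<^esub> b)" using m_sub by (simp add: cf_hom)
    then show ?thesis using ab m.a_closed by blast
  qed
  show "r \<otimes>\<^bsub>A\<^esub> x \<in> cf ` m" if rx: "r \<in> component D dzero" "x \<in> cf ` m" for r
  proof -
    obtain a where a: "r = cf a" "a \<in> carrier R" using rx(1) unfolding component_zero by (rule imageE)
    obtain b where b: "x = cf b" "b \<in> m" using rx(2) by (rule imageE)
    note ab = a(2) b(2) a(1) b(1)
    then have "r \<otimes>\<^bsub>A\<^esub> x = cf (a \<otimes>\<^bsub>R\<^esub> b)" using m_sub by (simp add: cf_hom)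
    then show ?thesis using ab m.I_l_closed by blast
  qed
  show "x \<in> cf ` m \<or> y \<in> cf ` m"
    if xc: "x \<in> component D dzero" and yc: "y \<in> component D dzero" and xy: "x \<otimes>\<^bsub>A\<^esub> y \<in> cf ` m"
  proof -
    obtain a where a: "x = cf a" "a \<in> carrier R" using xc unfolding component_zero by (rule imageE)
    obtain b where b: "y = cf b" "b \<in> carrier R" using yc unfolding component_zero by (rule imageE)
    note ab = a(2) b(2) a(1) b(1)
    have "cf (a \<otimes>\<^bsub>R\<^esub> b) \<in> cf ` m" using xy unfolding ab(3,4) cf_hom(2)[OF ab(1,2)] .
    then have abm: "a \<otimes>\<^bsub>R\<^esub> b \<in> m" using cf_mem_iff[OF R.m_closed[OF ab(1,2)]] by blast
    have "primeideal m R" by (rule R.maximalideal_prime[OF m_max])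
    from primeideal.I_prime[OF this ab(1,2) abm] show ?thesis unfolding ab(3,4) by blast
  qed
  show "\<exists>s\<in>component D dzero. s \<otimes>\<^bsub>A\<^esub> x \<ominus>\<^bsub>A\<^esub> \<one>\<^bsub>A\<^esub> \<in> cf ` m" if x: "x \<in> component D dzero" "x \<notin> cf ` m"
  proof -
    obtain a where a: "x = cf a" "a \<in> carrier R" using x(1) unfolding component_zero by (rule imageE)
    note a = a(2,1)
    have "a \<notin> m" using x(2) unfolding a(2) by blast
    then obtain s where s: "s \<in> carrier R" "s \<otimes>\<^bsub>R\<^esub> a \<ominus>\<^bsub>R\<^esub> \<one>\<^bsub>R\<^esub> \<in> m" using m_inverse_ex[OF a(1)] by blast
    have "cf s \<otimes>\<^bsub>A\<^esub> x \<ominus>\<^bsub>A\<^esub> \<one>\<^bsub>A\<^esub> = cf (s \<otimes>\<^bsub>R\<^esub> a \<ominus>\<^bsub>R\<^esub> \<one>\<^bsub>R\<^esub>)"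
      using a s by (simp add: cf_minus cf_hom)
    moreover have "cf s \<in> component D dzero" unfolding component_zero using s(1) by blast
    ultimately show ?thesis using s(2) by blast
  qed
  show "\<exists>c\<in>carrier K. x \<ominus>\<^bsub>A\<^esub> c \<odot>\<^bsub>A\<^esub> \<one>\<^bsub>A\<^esub> \<in> cf ` m" if x: "x \<in> component D dzero"
  proof -
    obtain a where a: "x = cf a" "a \<in> carrier R" using x unfolding component_zero by (rule imageE)
    note a = a(2,1)
    obtain c where c: "c \<in> carrier K" "a \<ominus>\<^bsub>R\<^esub> c \<odot>\<^bsub>R\<^esub> \<one>\<^bsub>R\<^esub> \<in> m" using m_scalar_ex[OF a(1)] by blast
    have "x \<ominus>\<^bsub>A\<^esub> c \<odot>\<^bsub>A\<^esub> \<one>\<^bsub>A\<^esub> = cf (a \<ominus>\<^bsub>R\<^esub> c \<odot>\<^bsub>R\<^esub> \<one>\<^bsub>R\<^esub>)"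
      using a c by (simp add: cf_minus cf_hom)
    then show ?thesis using c by blast
  qed
  show "x \<otimes>\<^bsub>A\<^esub> y = y \<otimes>\<^bsub>A\<^esub> x" if xc: "x \<in> component D dzero" and yc: "y \<in> component D dzero"
  proof -
    obtain a where a: "x = cf a" "a \<in> carrier R" using xc unfolding component_zero by (rule imageE)
    obtain b where b: "y = cf b" "b \<in> carrier R" using yc unfolding component_zero by (rule imageE)
    note ab = a(2) b(2) a(1) b(1)
    then have "cf (a \<otimes>\<^bsub>R\<^esub> b) = cf (b \<otimes>\<^bsub>R\<^esub> a)" by (simp add: R.m_comm)
    then show ?thesis using ab by (simp add: cf_hom)
  qed
  fix r assume r: "r \<in> component D dzero"
  show "cf (act D g (ci r)) \<in> component D dzero"
    unfolding component_zero using act_closed[OF ci(2)[OF r]] by blast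
  show "x \<otimes>\<^bsub>A\<^esub> r = cf (act D g (ci r)) \<otimes>\<^bsub>A\<^esub> x" if "x \<in> component D g"
    using component_coef_commute[OF that ci(2)[OF r]] ci(3)[OF r] by simp
  show "cf (act D g (ci r)) \<in> cf ` m \<longleftrightarrow> r \<in> cf ` m" if g: "g \<in> stab D m"
    using stab_mem[OF g ci(2)[OF r]] cf_mem_iff[OF ci(2)[OF r]] cf_mem_iff[OF act_closed[OF ci(2)[OF r]]]
      ci(3)[OF r] by simp
qed

text \<open>
  The value of \<open>w\<close> is not zero and lies both in the component of degree \<open>g\<close> and in that of the degree of
  the word \<open>w\<close>. So \<open>g\<close> is the degree of \<open>w\<close>, and \<open>star w\<close> has degree \<open>- g\<close>.
\<close>

lemma nonvanishing_word:
  assumes w: "w \<in> words D" and g: "word_elt D w \<in> component D g" and nv: "nonvanishing D m w"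
  shows "word_elt D (star w) \<in> component D (duminus g)"
    "word_elt D (star w) \<otimes>\<^bsub>A\<^esub> word_elt D w \<notin> cf ` m"
proof -
  show 1: "word_elt D (star w) \<otimes>\<^bsub>A\<^esub> word_elt D w \<notin> cf ` m" using nv by (simp add: nonvanishing_def)
  have sw: "star w \<in> words D" using star_words[OF w] .
  have l: "map Letter w \<in> lists Gs" "map Letter (star w) \<in> lists Gs"
    using w sw by (auto simp: words_def)
  let ?d = "mon_degree (map Letter w :: 'r tgw_gen list)"
  have e: "word_elt D w = mn (map Letter w)" "word_elt D (star w) = mn (map Letter (star w))"
    using word_elt_mon w sw by auto
  have d: "word_elt D w \<in> component D ?d" unfolding e by (rule mon_component[OF l(1)])
  have "g = ?d"
  proof (rule ccontr)
    assume "g \<noteq> ?d"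
    then have "word_elt D w = \<zero>\<^bsub>A\<^esub>" using W.prj_comp[OF g, of g] W.prj_comp[OF d, of g] by simp
    then have "word_elt D (star w) \<otimes>\<^bsub>A\<^esub> word_elt D w = \<zero>\<^bsub>A\<^esub>" using mon_closed[OF l(2)] e by simp
    then show False using 1 W.M_zero by simp
  qed
  then show "word_elt D (star w) \<in> component D (duminus g)"
    using mon_component[OF l(2)] e by (simp add: mon_degree_star)
qed

end

lemma Z_basis_subgroup:
  assumes Z: "Z_basis k s G"
  shows "dzero \<in> G" "g \<in> G \<Longrightarrow> h \<in> G \<Longrightarrow> dplus g h \<in> G" "g \<in> G \<Longrightarrow> duminus g \<in> G"
proof -
  have G: "G = lcomb k s ` Zn k" using Z by (simp add: Z_basis_lcomb bij_betw_def)
  have "dzero = lcomb k s dzero" "dzero \<in> Zn k" by (simp_all add: lcomb_def Zn_def)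
  then show "dzero \<in> G" unfolding G by (rule image_eqI)
  show "dplus g h \<in> G" if "g \<in> G" "h \<in> G"
  proof -
    obtain c d where c: "c \<in> Zn k" "g = lcomb k s c" and d: "d \<in> Zn k" "h = lcomb k s d"
      using \<open>g \<in> G\<close> \<open>h \<in> G\<close> unfolding G by blast
    have "dplus g h = lcomb k s (dplus c d)" unfolding c d lcomb_add ..
    moreover have "dplus c d \<in> Zn k" using c d by (simp add: Zn_def)
    ultimately show ?thesis unfolding G by (rule image_eqI)
  qed
  show "duminus g \<in> G" if "g \<in> G"
  proof -
    obtain c where c: "c \<in> Zn k" "g = lcomb k s c" using \<open>g \<in> G\<close> unfolding G by blast
    have "duminus g = lcomb k s (duminus c)" unfolding c by (simp add: lcomb_def sum_negf)
    moreover have "duminus c \<in> Zn k" using c by (simp add: Zn_def)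
    ultimately show ?thesis unfolding G by (rule image_eqI)
  qed
qed

theorem theorem4p8:
  fixes D :: "('k, 'r) tgw_data" and \<mm> :: "'r set"
    and a :: "(nat \<Rightarrow> int) \<Rightarrow> letter list"
    and k :: nat and s :: "nat \<Rightarrow> nat \<Rightarrow> int"
    and b :: "nat \<Rightarrow> ('r tgw_gen list \<Rightarrow> 'k) set set"
    and lam :: "nat \<Rightarrow> nat \<Rightarrow> 'k"
  assumes "is_tgw_data D"
    and "inj_on (coef_map D) (carrier (base D))"
    and "algebraically_closed (ground D)"
    and "maximalideal \<mm> (base D)"
    and "(\<lambda>c. \<mm> +>\<^bsub>base D\<^esub> (c \<odot>\<^bsub>base D\<^esub> \<one>\<^bsub>base D\<^esub>)) ` carrier (ground D) = carrier (base D Quot \<mm>)"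
    and "\<And>g. g \<in> G_tilde D \<mm> \<Longrightarrow>
           a g \<in> words D \<and> word_elt D (a g) \<in> component D g \<and> nonvanishing D \<mm> (a g)"
    and "a (\<lambda>_. 0) = []"
    and "Z_basis k s (G_grp D \<mm>)"
    and "\<And>i. i \<in> {1..k} \<Longrightarrow> b i = B_proj D \<mm> (word_elt D (a (s i)))"
    and "\<And>i j. i \<in> {1..k} \<Longrightarrow> j \<in> {1..k} \<Longrightarrow>
           lam i j \<in> carrier (ground D) - {\<zero>\<^bsub>ground D\<^esub>} \<and>
           b i \<otimes>\<^bsub>B1_alg D \<mm>\<^esub> b j = lam i j \<odot>\<^bsub>B1_alg D \<mm>\<^esub> (b j \<otimes>\<^bsub>B1_alg D \<mm>\<^esub> b i)"
    and "\<And>i j. i \<in> {1..k} \<Longrightarrow> j \<in> {1..k} \<Longrightarrow> root_of_unity (ground D) (lam i j)"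
  shows "\<exists>l r p. root_of_unity (ground D) l \<and> r \<le> k div 2 \<and>
           (\<forall>i \<in> {1..r}. p i > (0::nat)) \<and> (r \<ge> 1 \<longrightarrow> p 1 = 1) \<and>
           (\<forall>i \<in> {1..<r}. p i dvd p (Suc i)) \<and>
           alg_isomorphic (ground D) (B1_alg D \<mm>)
             (tensor_alg (ground D) {1..Suc r}
               (\<lambda>i. if i \<le> r then T_alg (ground D) (l [^]\<^bsub>ground D\<^esub> p i)
                     else laurent_alg (ground D) (k - 2 * r)))"
proof -
  interpret tgw_point D \<mm>
    by (intro tgw_point.intro tgw.intro tgw_point_axioms.intro assms(1,2,4,5))
  let ?G = "G_grp D \<mm>"
  note Z = assms(8)
  have GS: "g \<in> stab D \<mm>" "g \<in> G_tilde D \<mm>" if "g \<in> ?G" for g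
    using that by (auto simp: G_grp_def)
  interpret WB: weight_basis K A "component D" "tgw_prj D" "stab D \<mm>" "cf ` \<mm>"
    "\<lambda>g x. cf (act D g (ci x))" ?G "\<lambda>g. word_elt D (a g)" "\<lambda>g. word_elt D (star (a g))"
  proof (intro weight_basis.intro W.weight_setting_axioms weight_basis_axioms.intro)
    fix g h assume g: "g \<in> ?G"
    show "g \<in> stab D \<mm>" using GS g by blast
    show "dplus g h \<in> ?G" if "h \<in> ?G" using Z_basis_subgroup(2)[OF Z g that] .
    have w: "a g \<in> words D" "word_elt D (a g) \<in> component D g" "nonvanishing D \<mm> (a g)"
      using assms(6)[OF GS(2)[OF g]] by auto
    show "word_elt D (a g) \<in> component D g" by (rule w(2))
    show "word_elt D (star (a g)) \<in> component D (duminus g)"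
      "word_elt D (star (a g)) \<otimes>\<^bsub>A\<^esub> word_elt D (a g) \<notin> cf ` \<mm>"
      by (rule nonvanishing_word[OF w])+
  qed (rule Z_basis_subgroup(1)[OF Z])
  have B_eq: "W.B = B_omega D \<mm>" by (simp add: W.B_def B_omega_def)
  have I_eq: "W.I = B_ideal D \<mm>" by (simp add: W.I_def B_ideal_def B_eq)
  have phi: "W.\<phi> = B_proj D \<mm>" by (simp add: fun_eq_iff W.\<phi>_def B_proj_def B_eq I_eq)
  have B1: "WB.B1 = B1_alg D \<mm>" by (simp add: WB.B1_def B1_alg_def B_alg_def B_eq I_eq phi)
  have V: "WB.V g = B_proj D \<mm> (word_elt D (a g))" for g by (simp add: WB.V_def phi)
  interpret P: pointed_grading K WB.B1 ?G WB.V
  proof (intro pointed_grading.intro WB.B1_kalg pointed_grading_axioms.intro)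
    show "WB.V dzero = \<one>\<^bsub>WB.B1\<^esub>" by (rule WB.V_one) (simp add: assms(7) word_elt_def)
  qed (fact Z_basis_subgroup[OF Z] WB.V_closed WB.V_mult WB.kspan_V WB.V_independent)+
  have sG: "s i \<in> ?G" if "i \<in> {1..k}" for i using Z_basis_mem[OF Z that] .
  have kap: "P.\<kappa> (s i) (s j) = lam i j" if ij: "i \<in> {1..k}" "j \<in> {1..k}" for i j
  proof (rule P.\<kappa>_unique[OF sG[OF ij(1)] sG[OF ij(2)]])
    show "lam i j \<in> carrier K" using assms(10)[OF ij] by blast
    show "WB.V (s i) \<otimes>\<^bsub>WB.B1\<^esub> WB.V (s j) = lam i j \<odot>\<^bsub>WB.B1\<^esub> (WB.V (s j) \<otimes>\<^bsub>WB.B1\<^esub> WB.V (s i))"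
      using assms(10)[OF ij] assms(9)[OF ij(1)] assms(9)[OF ij(2)] unfolding B1 V by simp
  qed
  have ru: "root_of_unity K (P.\<kappa> (s i) (s j))" if ij: "i \<in> {1..k}" "j \<in> {1..k}" for i j
    using kap[OF ij] assms(11) ij by simp
  obtain s' r d z where z: "root_of_unity K z" and Z': "Z_basis k s' ?G" and r: "2 * r \<le> k"
    and d: "\<forall>i\<in>{1..r}. d i > (0::nat)" "\<forall>i\<in>{1..<r}. d i dvd d (Suc i)"
    and nf: "\<And>i j. 1 \<le> i \<Longrightarrow> i < j \<Longrightarrow> j \<le> k \<Longrightarrow>
      P.\<kappa> (s' i) (s' j) = (if odd i \<and> j = Suc i \<and> j \<le> 2 * r then z [^]\<^bsub>K\<^esub> d (j div 2) else \<one>\<^bsub>K\<^esub>)"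
    using P.normalized_basis[OF Z ru] by blast
  obtain N :: nat where N: "N > 0" "z [^]\<^bsub>K\<^esub> N = \<one>\<^bsub>K\<^esub>" "z \<in> carrier K"
    using z by (auto simp: root_of_unity_def)
  have z0: "z \<noteq> \<zero>\<^bsub>K\<^esub>" using N by (auto simp: K.nat_pow_zero)
  have K_pow: "x [^]\<^bsub>K\<^esub> (n::nat) \<noteq> \<zero>\<^bsub>K\<^esub>" if "x \<in> carrier K" "x \<noteq> \<zero>\<^bsub>K\<^esub>" for x n
    using that by (induction n) (auto simp: K.integral_iff)
  \<comment> \<open>If \<open>r = 0\<close>, there are no factors \<open>T\<close>, and any root of unity will do.\<close>
  define l where "l = (if r \<ge> 1 then z [^]\<^bsub>K\<^esub> d 1 else \<one>\<^bsub>K\<^esub>)"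
  define p where "p i = d i div d 1" for i
  have d1: "d 1 dvd d i" if "i \<in> {1..r}" for i
    using that
  proof (induction i)
    case (Suc i)
    then show ?case using d(2) by (cases "i = 0") (auto intro: dvd_trans)
  qed simp
  have lK: "l \<in> carrier K" "l \<noteq> \<zero>\<^bsub>K\<^esub>" using N z0 by (auto simp: l_def K_pow)
  have lp: "l [^]\<^bsub>K\<^esub> p i = z [^]\<^bsub>K\<^esub> d i" if i: "i \<in> {1..r}" for i
  proof -
    have "l [^]\<^bsub>K\<^esub> p i = z [^]\<^bsub>K\<^esub> (d 1 * (d i div d 1))"
      using i N by (simp add: l_def p_def K.nat_pow_pow)
    then show ?thesis using d1[OF i] by simp
  qed
  have "root_of_unity K l"
  proof -
    have "l [^]\<^bsub>K\<^esub> N = \<one>\<^bsub>K\<^esub>"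
    proof (cases "r \<ge> 1")
      case True
      have "l [^]\<^bsub>K\<^esub> N = (z [^]\<^bsub>K\<^esub> N) [^]\<^bsub>K\<^esub> d 1"
        using True N(3) by (simp add: l_def K.nat_pow_pow mult.commute)
      then show ?thesis using N by simp
    qed (simp add: l_def)
    then show ?thesis using lK N(1) by (auto simp: root_of_unity_def)
  qed
  moreover have "r \<le> k div 2" using r by simp
  moreover have "\<forall>i\<in>{1..r}. p i > 0"
  proof
    fix i assume i: "i \<in> {1..r}"
    then have "1 \<in> {1..r}" by auto
    then have "d 1 > 0" "d i > 0" using d(1) i by blast+
    then show "p i > 0" unfolding p_def using d1[OF i] by (simp add: div_greater_zero_iff dvd_imp_le)
  qed
  moreover have "r \<ge> 1 \<longrightarrow> p 1 = 1" using d(1) by (auto simp: p_def)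
  moreover have "\<forall>i\<in>{1..<r}. p i dvd p (Suc i)"
    using d d1 by (auto simp: p_def intro!: div_dvd_div[THEN iffD2])
  moreover have "alg_isomorphic K WB.B1 (tensor_alg K {1..Suc r}
     (\<lambda>i. if i \<le> r then T_alg K (l [^]\<^bsub>K\<^esub> p i) else laurent_alg K (k - 2 * r)))"
  proof (rule P.torus_tensor_iso[OF Z' r])
    show "l [^]\<^bsub>K\<^esub> p i \<in> carrier K - {\<zero>\<^bsub>K\<^esub>}" for i using lK by (auto simp: K_pow)
    fix i j assume ij: "1 \<le> i" "i < j" "j \<le> k"
    show "P.\<kappa> (s' i) (s' j) = (if odd i \<and> j = Suc i \<and> j \<le> 2 * r then l [^]\<^bsub>K\<^esub> p (j div 2) else \<one>\<^bsub>K\<^esub>)"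
    proof (cases "odd i \<and> j = Suc i \<and> j \<le> 2 * r")
      case True
      then have "j div 2 \<in> {1..r}" using ij by auto
      then show ?thesis using nf[OF ij] lp True by simp
    next
      case False
      show ?thesis unfolding nf[OF ij] if_not_P[OF False] ..
    qed
  qed
  ultimately show ?thesis unfolding B1 by blast
qed

end
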